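(* Let $X$ be a complex Fano variety, and let $\overline{X}$ be the underlying topological space of the spectrum of the Cox ring of $X$. Then $\overline{X}$ is simply connected.
   Context: A Fano variety is a normal projective variety over $\mathbb{C}$ with log terminal singularities whose anticanonical divisor $-K_X$ is ($\mathbb{Q}$-Cartier and) ample. Such a variety has finitely generated divisor class group $\mathrm{Cl}(X)$, and its Cox ring $\mathrm{Cox}(X)=\bigoplus_{[D]\in \mathrm{Cl}(X)}H^0(X,\mathcal{O}_X(D))$, with the usual multiplication (defined as in the book "Cox Rings" of Arzhantsev, Derenthal, Hausen and Laface), is a finitely generated $\mathbb{C}$-algebra. The spectrum $\mathrm{Spec}\,\mathrm{Cox}(X)$ is considered with its analytic (Euclidean) topology. *)

theory Defs
  imports
    "HOL-Analysis.Analysis"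
    "HOL-Algebra.QuotRing"
    "HOL-Algebra.Algebraic_Closure_Type"
    "HOL-Library.Poly_Mapping"
    "HOL-Computational_Algebra.Polynomial"
    "HOL-Combinatorics.Permutations"
begin

text \<open>
  A complex projective variety is presented by its function field and a generic point.  The
  function field is a field type 'k with a ring homomorphism \<iota> from the complex numbers into it.
  The variety is a nonempty list V of elements of 'k, not all zero, read as the homogeneous
  coordinates in the function field of the generic point: the homogeneous prime ideal of the
  variety consists of the forms vanishing at V.  Every embedded (integral) complex projective
  variety arises in this way, from the restrictions of the coordinate functions to it, divided by
  a nonzero one.  A complex point is represented by its coordinate vectors, and a subset of the
  variety by the set of all coordinate vectors of its points.
\<close>

type_synonym mpoly = "(nat \<Rightarrow>\<^sub>0 nat) \<Rightarrow>\<^sub>0 complex"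

definition eval_mpoly :: "(complex \<Rightarrow> 'a::comm_ring_1) \<Rightarrow> mpoly \<Rightarrow> 'a list \<Rightarrow> 'a" where
  "eval_mpoly \<iota> F x =
     (\<Sum>m\<in>Poly_Mapping.keys F. \<iota> (Poly_Mapping.lookup F m) *
        (\<Prod>i\<in>Poly_Mapping.keys m. (x ! i) ^ Poly_Mapping.lookup m i))"

definition mpolys :: "nat \<Rightarrow> mpoly set" where
  "mpolys r = {F. \<forall>m\<in>Poly_Mapping.keys F. Poly_Mapping.keys m \<subseteq> {..<r}}"

definition forms :: "nat \<Rightarrow> nat \<Rightarrow> mpoly set" where
  "forms r d = {F \<in> mpolys r. \<forall>m\<in>Poly_Mapping.keys F.
                  (\<Sum>i\<in>Poly_Mapping.keys m. Poly_Mapping.lookup m i) = d}"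

definition complex_algebra_map :: "(complex \<Rightarrow> 'a::comm_ring_1) \<Rightarrow> bool" where
  "complex_algebra_map \<iota> \<longleftrightarrow> \<iota> 1 = 1 \<and>
     (\<forall>c d. \<iota> (c + d) = \<iota> c + \<iota> d) \<and> (\<forall>c d. \<iota> (c * d) = \<iota> c * \<iota> d)"

text \<open>The last condition says that 'k is the function field of the variety.\<close>

definition projective_variety :: "(complex \<Rightarrow> 'k::field) \<Rightarrow> 'k list \<Rightarrow> bool" where
  "projective_variety \<iota> V \<longleftrightarrow> complex_algebra_map \<iota> \<and> (\<exists>x\<in>set V. x \<noteq> 0) \<and>
     (\<forall>f. \<exists>d. \<exists>F\<in>forms (length V) d. \<exists>G\<in>forms (length V) d.
        eval_mpoly \<iota> G V \<noteq> 0 \<and> f = eval_mpoly \<iota> F V / eval_mpoly \<iota> G V)"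

definition points :: "(complex \<Rightarrow> 'k::field) \<Rightarrow> 'k list \<Rightarrow> complex list set" where
  "points \<iota> V = {a. length a = length V \<and> (\<exists>c\<in>set a. c \<noteq> 0) \<and>
     (\<forall>d. \<forall>F\<in>forms (length V) d. eval_mpoly \<iota> F V = 0 \<longrightarrow> eval_mpoly id F a = 0)}"

definition zariski_closed :: "(complex \<Rightarrow> 'k::field) \<Rightarrow> 'k list \<Rightarrow> complex list set \<Rightarrow> bool" where
  "zariski_closed \<iota> V Y \<longleftrightarrow> (\<exists>T \<subseteq> (\<Union>d. forms (length V) d).
     Y = {a \<in> points \<iota> V. \<forall>F\<in>T. eval_mpoly id F a = 0})"

definition irreducible_closed :: "(complex \<Rightarrow> 'k::field) \<Rightarrow> 'k list \<Rightarrow> complex list set \<Rightarrow> bool" where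
  "irreducible_closed \<iota> V Y \<longleftrightarrow> zariski_closed \<iota> V Y \<and> Y \<noteq> {} \<and>
     (\<forall>Y1 Y2. zariski_closed \<iota> V Y1 \<and> zariski_closed \<iota> V Y2 \<and> Y = Y1 \<union> Y2 \<longrightarrow>
        Y = Y1 \<or> Y = Y2)"

text \<open>Prime divisors: irreducible closed subsets of codimension one.\<close>

definition prime_divisors :: "(complex \<Rightarrow> 'k::field) \<Rightarrow> 'k list \<Rightarrow> complex list set set" where
  "prime_divisors \<iota> V = {Y. irreducible_closed \<iota> V Y \<and> Y \<noteq> points \<iota> V \<and>
     \<not> (\<exists>Z. irreducible_closed \<iota> V Z \<and> Y \<subset> Z \<and> Z \<subset> points \<iota> V)}"

text \<open>
  The local ring of V along an irreducible closed subset Y, as a subring of the function field.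
  The local ring at a point a is the one along \<open>{a}\<close>; it makes no difference that \<open>{a}\<close> contains
  only one of the coordinate vectors of the point, since G is homogeneous.
\<close>

definition local_ring :: "(complex \<Rightarrow> 'k::field) \<Rightarrow> 'k list \<Rightarrow> complex list set \<Rightarrow> 'k set" where
  "local_ring \<iota> V Y = {eval_mpoly \<iota> F V / eval_mpoly \<iota> G V | d F G.
     F \<in> forms (length V) d \<and> G \<in> forms (length V) d \<and> (\<exists>a\<in>Y. eval_mpoly id G a \<noteq> 0)}"

definition normal_variety :: "(complex \<Rightarrow> 'k::field) \<Rightarrow> 'k list \<Rightarrow> bool" where
  "normal_variety \<iota> V \<longleftrightarrow> (\<forall>a\<in>points \<iota> V. \<forall>f.
     (\<exists>p :: 'k poly. Polynomial.lead_coeff p = 1 \<and>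
        (\<forall>i. Polynomial.coeff p i \<in> local_ring \<iota> V {a}) \<and> Polynomial.poly p f = 0)
     \<longrightarrow> f \<in> local_ring \<iota> V {a})"

definition local_units :: "'k::field set \<Rightarrow> 'k set" where
  "local_units R = {u \<in> R. u \<noteq> 0 \<and> inverse u \<in> R}"

definition uniformizer :: "'k::field set \<Rightarrow> 'k \<Rightarrow> bool" where
  "uniformizer R t \<longleftrightarrow> t \<in> R \<and> t \<noteq> 0 \<and> t \<notin> local_units R \<and>
     (\<forall>f. f \<noteq> 0 \<longrightarrow> (\<exists>k::int. \<exists>u\<in>local_units R. f = u * t powi k))"

text \<open>The normalized valuation of a discrete valuation ring R with fraction field 'k; only used
  for nonzero f.\<close>

definition valuation :: "'k::field set \<Rightarrow> 'k \<Rightarrow> int" where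
  "valuation R f = (THE k. \<exists>t u. uniformizer R t \<and> u \<in> local_units R \<and> f = u * t powi k)"

definition ord_along :: "(complex \<Rightarrow> 'k::field) \<Rightarrow> 'k list \<Rightarrow> complex list set \<Rightarrow> 'k \<Rightarrow> int" where
  "ord_along \<iota> V Y f = valuation (local_ring \<iota> V Y) f"

type_synonym weil_divisor = "complex list set \<Rightarrow>\<^sub>0 int"

definition weil_divisors :: "(complex \<Rightarrow> 'k::field) \<Rightarrow> 'k list \<Rightarrow> weil_divisor set" where
  "weil_divisors \<iota> V = {D. Poly_Mapping.keys D \<subseteq> prime_divisors \<iota> V}"

definition is_divisor_of :: "(complex \<Rightarrow> 'k::field) \<Rightarrow> 'k list \<Rightarrow> 'k \<Rightarrow> weil_divisor \<Rightarrow> bool" where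
  "is_divisor_of \<iota> V f D \<longleftrightarrow> f \<noteq> 0 \<and> D \<in> weil_divisors \<iota> V \<and>
     (\<forall>Y\<in>prime_divisors \<iota> V. Poly_Mapping.lookup D Y = ord_along \<iota> V Y f)"

definition principal_divisor :: "(complex \<Rightarrow> 'k::field) \<Rightarrow> 'k list \<Rightarrow> weil_divisor \<Rightarrow> bool" where
  "principal_divisor \<iota> V D \<longleftrightarrow> (\<exists>f. is_divisor_of \<iota> V f D)"

text \<open>The space of global sections of the sheaf attached to D.\<close>

definition global_sections :: "(complex \<Rightarrow> 'k::field) \<Rightarrow> 'k list \<Rightarrow> weil_divisor \<Rightarrow> 'k set" where
  "global_sections \<iota> V D = {f. f = 0 \<or>
     (\<forall>Y\<in>prime_divisors \<iota> V. 0 \<le> ord_along \<iota> V Y f + Poly_Mapping.lookup D Y)}"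

text \<open>D is the divisor of f on a neighbourhood of a.\<close>

definition local_equation ::
    "(complex \<Rightarrow> 'k::field) \<Rightarrow> 'k list \<Rightarrow> weil_divisor \<Rightarrow> complex list \<Rightarrow> 'k \<Rightarrow> bool" where
  "local_equation \<iota> V D a f \<longleftrightarrow> f \<noteq> 0 \<and>
     (\<forall>Y\<in>prime_divisors \<iota> V. a \<in> Y \<longrightarrow> Poly_Mapping.lookup D Y = ord_along \<iota> V Y f)"

definition cartier :: "(complex \<Rightarrow> 'k::field) \<Rightarrow> 'k list \<Rightarrow> weil_divisor \<Rightarrow> bool" where
  "cartier \<iota> V D \<longleftrightarrow> D \<in> weil_divisors \<iota> V \<and> (\<forall>a\<in>points \<iota> V. \<exists>f. local_equation \<iota> V D a f)"

definition q_cartier :: "(complex \<Rightarrow> 'k::field) \<Rightarrow> 'k list \<Rightarrow> weil_divisor \<Rightarrow> bool" where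
  "q_cartier \<iota> V D \<longleftrightarrow> (\<exists>m::nat. m > 0 \<and> cartier \<iota> V (frag_cmul (int m) D))"

text \<open>
  The sections in the list S generate the sheaf of D at every point, so that
  the morphism from V to projective space given by S pulls O(1) back to the sheaf of D.  The image of
  that morphism is the variety with generic point S.  It is a closed embedding if and only if it is
  an isomorphism onto its image, that is, if and only if V and the variety S have the same
  function field and the same local rings at their points.
\<close>

definition very_ample :: "(complex \<Rightarrow> 'k::field) \<Rightarrow> 'k list \<Rightarrow> weil_divisor \<Rightarrow> bool" where
  "very_ample \<iota> V D \<longleftrightarrow> D \<in> weil_divisors \<iota> V \<and>
     (\<exists>S. set S \<subseteq> global_sections \<iota> V D \<and>
        (\<forall>a\<in>points \<iota> V. \<exists>s\<in>set S. local_equation \<iota> V (- D) a s) \<and>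
        projective_variety \<iota> S \<and>
        (\<lambda>b. local_ring \<iota> S {b}) ` points \<iota> S = (\<lambda>a. local_ring \<iota> V {a}) ` points \<iota> V)"

definition ample :: "(complex \<Rightarrow> 'k::field) \<Rightarrow> 'k list \<Rightarrow> weil_divisor \<Rightarrow> bool" where
  "ample \<iota> V D \<longleftrightarrow> (\<exists>m::nat. m > 0 \<and> very_ample \<iota> V (frag_cmul (int m) D))"

definition algebraically_independent :: "(complex \<Rightarrow> 'k::field) \<Rightarrow> 'k list \<Rightarrow> bool" where
  "algebraically_independent \<iota> s \<longleftrightarrow> (\<forall>F\<in>mpolys (length s). eval_mpoly \<iota> F s = 0 \<longrightarrow> F = 0)"

definition transcendence_basis :: "(complex \<Rightarrow> 'k::field) \<Rightarrow> 'k list \<Rightarrow> bool" where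
  "transcendence_basis \<iota> s \<longleftrightarrow> algebraically_independent \<iota> s \<and>
     (\<forall>f. \<not> algebraically_independent \<iota> (f # s))"

definition derivation :: "(complex \<Rightarrow> 'k::field) \<Rightarrow> ('k \<Rightarrow> 'k) \<Rightarrow> bool" where
  "derivation \<iota> \<delta> \<longleftrightarrow> (\<forall>f g. \<delta> (f + g) = \<delta> f + \<delta> g) \<and>
     (\<forall>f g. \<delta> (f * g) = f * \<delta> g + g * \<delta> f) \<and> (\<forall>c. \<delta> (\<iota> c) = 0)"

text \<open>
  Rational differential forms of top degree.  A form is represented by its values on tuples of
  derivations of the function field: \<open>top_form g s\<close> is \<open>g ds\<^sub>1 \<and> \<dots> \<and> ds\<^sub>n\<close>.  The nonzero forms are those with g
  nonzero and s a transcendence basis, because the differentials of a transcendence basis form a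
  basis of the Kaehler differentials in characteristic zero.
\<close>

definition top_form :: "'k::field \<Rightarrow> 'k list \<Rightarrow> ('k \<Rightarrow> 'k) list \<Rightarrow> 'k" where
  "top_form g s \<delta>s = g * (\<Sum>p | p permutes {..<length s}.
     of_int (sign p) * (\<Prod>i<length s. (\<delta>s ! p i) (s ! i)))"

text \<open>
  \<open>\<delta>s\<close> is the frame dual to the differentials of local coordinates u of the regular local ring R:
  the derivations preserve R, so the differentials of u are linearly independent and, there being as
  many of them as the dimension of the variety, form a basis of the differentials of R.
\<close>

definition coordinate_frame :: "(complex \<Rightarrow> 'k::field) \<Rightarrow> 'k set \<Rightarrow> ('k \<Rightarrow> 'k) list \<Rightarrow> bool" where
  "coordinate_frame \<iota> R \<delta>s \<longleftrightarrow>
     (\<exists>s. transcendence_basis \<iota> s \<and> length \<delta>s = length s) \<and>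
     (\<forall>\<delta>\<in>set \<delta>s. derivation \<iota> \<delta> \<and> \<delta> ` R \<subseteq> R) \<and>
     (\<exists>u. length u = length \<delta>s \<and> set u \<subseteq> R \<and>
        (\<forall>i<length \<delta>s. \<forall>j<length \<delta>s. (\<delta>s ! j) (u ! i) = (if i = j then 1 else 0)))"

text \<open>Evaluating a form at the frame gives its coefficient with respect to
  \<open>du\<^sub>1 \<and> \<dots> \<and> du\<^sub>n\<close>, whose valuation does not depend on the coordinates.\<close>

definition ord_form :: "(complex \<Rightarrow> 'k::field) \<Rightarrow> 'k set \<Rightarrow> (('k \<Rightarrow> 'k) list \<Rightarrow> 'k) \<Rightarrow> int" where
  "ord_form \<iota> R \<omega> = (THE k. \<exists>\<delta>s. coordinate_frame \<iota> R \<delta>s \<and> k = valuation R (\<omega> \<delta>s))"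

definition is_divisor_of_form ::
    "(complex \<Rightarrow> 'k::field) \<Rightarrow> 'k list \<Rightarrow> (('k \<Rightarrow> 'k) list \<Rightarrow> 'k) \<Rightarrow> weil_divisor \<Rightarrow> bool" where
  "is_divisor_of_form \<iota> V \<omega> D \<longleftrightarrow>
     (\<exists>g s. g \<noteq> 0 \<and> transcendence_basis \<iota> s \<and> \<omega> = top_form g s) \<and> D \<in> weil_divisors \<iota> V \<and>
     (\<forall>Y\<in>prime_divisors \<iota> V. Poly_Mapping.lookup D Y = ord_form \<iota> (local_ring \<iota> V Y) \<omega>)"

definition canonical_divisor :: "(complex \<Rightarrow> 'k::field) \<Rightarrow> 'k list \<Rightarrow> weil_divisor \<Rightarrow> bool" where
  "canonical_divisor \<iota> V D \<longleftrightarrow> (\<exists>\<omega>. is_divisor_of_form \<iota> V \<omega> D)"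

text \<open>The local ring R dominates the local ring S: S is a subring of R and the maximal ideal of S
  is contained in that of R.\<close>

definition dominates :: "'k::field set \<Rightarrow> 'k set \<Rightarrow> bool" where
  "dominates R S \<longleftrightarrow> S \<subseteq> R \<and> S \<inter> local_units R \<subseteq> local_units S"

text \<open>The identity of the function field is induced by a (birational) morphism from Z to V.
  The image of z is the point a with dominated local ring.\<close>

definition birational_morphism :: "(complex \<Rightarrow> 'k::field) \<Rightarrow> 'k list \<Rightarrow> 'k list \<Rightarrow> bool" where
  "birational_morphism \<iota> Z V \<longleftrightarrow>
     (\<forall>z\<in>points \<iota> Z. \<exists>a\<in>points \<iota> V. dominates (local_ring \<iota> Z {z}) (local_ring \<iota> V {a}))"

text \<open>The multiplicity along the prime divisor E of Z of the pullback of a Cartier divisor D on V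
  under the birational morphism from Z to V.\<close>

definition pullback_mult ::
    "(complex \<Rightarrow> 'k::field) \<Rightarrow> 'k list \<Rightarrow> weil_divisor \<Rightarrow> 'k list \<Rightarrow> complex list set \<Rightarrow> int" where
  "pullback_mult \<iota> V D Z E = (THE k. \<exists>z\<in>E. \<exists>a\<in>points \<iota> V. \<exists>f.
     dominates (local_ring \<iota> Z {z}) (local_ring \<iota> V {a}) \<and> local_equation \<iota> V D a f \<and>
     k = ord_along \<iota> Z E f)"

text \<open>
  The prime divisor E of Z is exceptional over V if it is not the strict transform of a prime
  divisor of V, that is, if its valuation is not that of a prime divisor of V.
\<close>

definition exceptional ::
    "(complex \<Rightarrow> 'k::field) \<Rightarrow> 'k list \<Rightarrow> 'k list \<Rightarrow> complex list set \<Rightarrow> bool" where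
  "exceptional \<iota> V Z E \<longleftrightarrow> E \<in> prime_divisors \<iota> Z \<and>
     (\<forall>Y\<in>prime_divisors \<iota> V. local_ring \<iota> Z E \<noteq> local_ring \<iota> V Y)"

text \<open>
  The canonical divisors of V and Z are taken to be the divisors of the same form \<open>\<omega>\<close>.  If \<open>m K\<^sub>V\<close> is
  Cartier, the discrepancy of E is the multiplicity along E of \<open>K\<^sub>Z\<close> minus \<open>1/m\<close> times the
  multiplicity along E of the pullback of \<open>m K\<^sub>V\<close>.
\<close>

definition log_terminal :: "(complex \<Rightarrow> 'k::field) \<Rightarrow> 'k list \<Rightarrow> bool" where
  "log_terminal \<iota> V \<longleftrightarrow> (\<exists>\<omega> K. is_divisor_of_form \<iota> V \<omega> K \<and>
     (\<exists>m::nat. m > 0 \<and> cartier \<iota> V (frag_cmul (int m) K) \<and>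
       (\<forall>Z E. projective_variety \<iota> Z \<and> normal_variety \<iota> Z \<and> birational_morphism \<iota> Z V \<and>
          exceptional \<iota> V Z E \<longrightarrow>
          - 1 < (of_int (ord_form \<iota> (local_ring \<iota> Z E) \<omega>) -
                 of_int (pullback_mult \<iota> V (frag_cmul (int m) K) Z E) / of_nat m :: rat))))"

definition fano_variety :: "(complex \<Rightarrow> 'k::field) \<Rightarrow> 'k list \<Rightarrow> bool" where
  "fano_variety \<iota> V \<longleftrightarrow> projective_variety \<iota> V \<and> normal_variety \<iota> V \<and> log_terminal \<iota> V \<and>
     (\<exists>K. canonical_divisor \<iota> V K \<and> q_cartier \<iota> V (- K) \<and> ample \<iota> V (- K))"

text \<open>
  The choices entering the construction of the Cox ring (Arzhantsev, Derenthal, Hausen, Laface):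
  a group W of Weil divisors mapping onto the class group and a homomorphism \<open>\<psi>\<close> from the
  subgroup of principal divisors in W to the nonzero rational functions such that the divisor of
  \<open>\<psi> E\<close> is E.
\<close>

definition cox_data ::
    "(complex \<Rightarrow> 'k::field) \<Rightarrow> 'k list \<Rightarrow> weil_divisor set \<Rightarrow> (weil_divisor \<Rightarrow> 'k) \<Rightarrow> bool" where
  "cox_data \<iota> V W \<psi> \<longleftrightarrow>
     W \<subseteq> weil_divisors \<iota> V \<and> 0 \<in> W \<and> (\<forall>D\<in>W. \<forall>E\<in>W. D - E \<in> W) \<and>
     (\<forall>D\<in>weil_divisors \<iota> V. \<exists>E\<in>W. principal_divisor \<iota> V (D - E)) \<and>
     (\<forall>E\<in>W. principal_divisor \<iota> V E \<longrightarrow> is_divisor_of \<iota> V (\<psi> E) E) \<and>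
     (\<forall>E\<in>W. \<forall>E'\<in>W. principal_divisor \<iota> V E \<and> principal_divisor \<iota> V E' \<longrightarrow>
        \<psi> (E + E') = \<psi> E * \<psi> E')"

text \<open>
  The direct sum over D in W of the global sections of D.  Its elements are the finitely supported
  families \<open>(f\<^sub>D)\<close>, multiplied as in the group algebra of the Weil divisors over the function field:
  the product of \<open>f\<close> in degree D and \<open>g\<close> in degree E is \<open>f * g\<close> in degree \<open>D + E\<close>.
\<close>

definition section_ring ::
    "(complex \<Rightarrow> 'k::field) \<Rightarrow> 'k list \<Rightarrow> weil_divisor set \<Rightarrow> (weil_divisor \<Rightarrow>\<^sub>0 'k) ring" where
  "section_ring \<iota> V W = ring_of_type_algebra
     \<lparr>carrier := {s. Poly_Mapping.keys s \<subseteq> W \<and>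
        (\<forall>D\<in>W. Poly_Mapping.lookup s D \<in> global_sections \<iota> V D)}\<rparr>"

text \<open>
  The relations identify \<open>f\<close> in degree D with \<open>f * \<psi> E\<close> in degree \<open>D - E\<close> for principal E in W, so
  that one copy of the global sections of D remains for each divisor class.
\<close>

definition cox_ideal ::
    "(complex \<Rightarrow> 'k::field) \<Rightarrow> 'k list \<Rightarrow> weil_divisor set \<Rightarrow> (weil_divisor \<Rightarrow> 'k) \<Rightarrow>
     (weil_divisor \<Rightarrow>\<^sub>0 'k) set" where
  "cox_ideal \<iota> V W \<psi> = genideal (section_ring \<iota> V W)
     {1 - Poly_Mapping.single (- E) (\<psi> E) | E. E \<in> W \<and> principal_divisor \<iota> V E}"

definition cox_ring ::
    "(complex \<Rightarrow> 'k::field) \<Rightarrow> 'k list \<Rightarrow> weil_divisor set \<Rightarrow> (weil_divisor \<Rightarrow> 'k) \<Rightarrow>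
     (weil_divisor \<Rightarrow>\<^sub>0 'k) set ring" where
  "cox_ring \<iota> V W \<psi> = section_ring \<iota> V W Quot cox_ideal \<iota> V W \<psi>"

text \<open>The structure map of the Cox ring as a complex algebra.\<close>

definition cox_scalar ::
    "(complex \<Rightarrow> 'k::field) \<Rightarrow> 'k list \<Rightarrow> weil_divisor set \<Rightarrow> (weil_divisor \<Rightarrow> 'k) \<Rightarrow>
     complex \<Rightarrow> (weil_divisor \<Rightarrow>\<^sub>0 'k) set" where
  "cox_scalar \<iota> V W \<psi> c =
     cox_ideal \<iota> V W \<psi> +>\<^bsub>section_ring \<iota> V W\<^esub> Poly_Mapping.single 0 (\<iota> c)"

text \<open>
  The complex points of the spectrum of a complex algebra R with structure map \<open>\<sigma>\<close>, that is,
  the algebra homomorphisms from R to the complex numbers.  As a set of functions (all with the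
  same value outside the carrier of R), it carries the topology of pointwise convergence, the
  coarsest one for which all elements of R are continuous functions.  If R is generated by
  \<open>r\<^sub>1, \<dots>, r\<^sub>N\<close>, this is the Euclidean topology of the closed subset of \<open>\<complex>\<^sup>N\<close> formed by the points
  \<open>(\<phi> r\<^sub>1, \<dots>, \<phi> r\<^sub>N)\<close>, i.e. the analytic topology.
\<close>

definition analytic_spec :: "'r ring \<Rightarrow> (complex \<Rightarrow> 'r) \<Rightarrow> ('r \<Rightarrow> complex) set" where
  "analytic_spec R \<sigma> =
     {\<phi> \<in> ring_hom R ring_of_type_algebra. \<phi> \<in> extensional (carrier R) \<and> (\<forall>c. \<phi> (\<sigma> c) = c)}"

end

theory Submission
  imports Defs "HOL-Real_Asymp.Real_Asymp"
begin

text \<open>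
  The Cox ring is graded by divisors, so a function w on Weil divisors that is additive, vanishes on
  principal divisors and is nonnegative on effective ones gives a family of maps of the spectrum
  into itself: \<open>(H t \<phi>) f\<close> is the sum of \<open>t\<close> to the power \<open>w D\<close> times \<open>\<phi> f\<^sub>D\<close> over the components \<open>f\<^sub>D\<close> of \<open>f\<close>.
  If w is positive on nonzero effective divisors, only the components with principal D survive at
  \<open>t = 0\<close>; their sections are constants, because regular functions on V are constant.  So the
  spectrum is contracted to one point.

  Such a w comes from a Bezout inequality: the sum of the orders of a nonzero form of degree d along
  the prime divisors is at most C d.  It makes the infimum of C d minus the sum of the
  multiplicities of E, over the effective E with \<open>D + E\<close> linearly equivalent to d hyperplane sections,
  a finite subadditive function of D, and as in the Hahn-Banach theorem there is an additive w
  below it.  The Bezout inequality itself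
  follows by comparing Hilbert functions after a Noether normalization.  Normality enters through
  the discrete valuation rings of the prime divisors and the extension of functions without poles.
\<close>

section \<open>Forms and their values\<close>

text \<open>The homogeneous coordinates are elements of the function field, where values of forms of
  different degrees can coincide. Degrees are therefore carried along as indices, no graded ring is
  formed, and the order of a form along a divisor is normalized by a coordinate that does not vanish
  identically on the divisor. The weight need not be an intersection number; a one-sided estimate
  suffices. The function \<open>w\<close> dominates the sum of the multiplicities of every effective
  divisor, and this sum is a positive integer unless the divisor is zero, so nonzero effective
  divisors have weight at least 1. A nonzero section of \<open>D\<close> makes \<open>D\<close>
  linearly equivalent to an effective divisor of the same weight. Real weights do no harm, because
  \<open>t powr w D\<close> makes sense for all real exponents. The constant for forms comes out as
  \<open>2 * dim (hom V q)\<close>: the dimension bounds the number of generators over the Noether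
  normalization, and 2 is the price for comparing a Hilbert function at \<open>L\<close> and
  \<open>L + s\<close>. It holds for forms first; sections of a twist, which need not be forms, are
  reached by passing to high powers.\<close>

lemma sum_keys_mono:
  assumes "finite A" "Poly_Mapping.keys F \<subseteq> A" "\<And>m. h m 0 = 0"
  shows "(\<Sum>m\<in>Poly_Mapping.keys F. h m (Poly_Mapping.lookup F m)) = (\<Sum>m\<in>A. h m (Poly_Mapping.lookup F m))"
  using assms by (intro sum.mono_neutral_left) (auto simp: in_keys_iff)

lemma forms_single:
  assumes "Poly_Mapping.keys m \<subseteq> {..<r}" "(\<Sum>i\<in>Poly_Mapping.keys m. Poly_Mapping.lookup m i) = d"
  shows "Poly_Mapping.single m c \<in> forms r d"
  using assms by (auto simp: forms_def mpolys_def split: if_splits)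

lemma forms_zero: "0 \<in> forms r d"
  by (auto simp: forms_def mpolys_def)

lemma forms_add:
  assumes "F \<in> forms r d" "G \<in> forms r d" shows "F + G \<in> forms r d"
proof -
  have "Poly_Mapping.keys (F + G) \<subseteq> Poly_Mapping.keys F \<union> Poly_Mapping.keys G" by (rule Poly_Mapping.keys_add)
  with assms show ?thesis unfolding forms_def mpolys_def by blast
qed

lemma forms_sum:
  assumes "finite A" "\<And>i. i \<in> A \<Longrightarrow> F i \<in> forms r d" shows "(\<Sum>i\<in>A. F i) \<in> forms r d"
  using assms by (induction A rule: finite_induct) (auto intro: forms_zero forms_add)

locale embedded_complex =
  fixes \<iota> :: "complex \<Rightarrow> 'k::field"
  assumes cam: "complex_algebra_map \<iota>"
begin

lemma iota_1 [simp]: "\<iota> 1 = 1"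
  and iota_add: "\<iota> (c + d) = \<iota> c + \<iota> d"
  and iota_mult: "\<iota> (c * d) = \<iota> c * \<iota> d"
  using cam by (auto simp: complex_algebra_map_def)

lemma iota_0 [simp]: "\<iota> 0 = 0"
proof -
  have "\<iota> 0 + \<iota> 0 = \<iota> 0 + 0" by (simp flip: iota_add)
  then show ?thesis by (simp only: add_left_cancel)
qed

lemma iota_uminus: "\<iota> (- c) = - \<iota> c"
  using iota_add[of c "-c"] by (simp add: eq_neg_iff_add_eq_0 add.commute)

lemma iota_diff: "\<iota> (c - d) = \<iota> c - \<iota> d"
  using iota_add[of c "-d"] iota_uminus[of d] by simp

lemma iota_eq_0 [simp]: "\<iota> c = 0 \<longleftrightarrow> c = 0"
proof
  assume "\<iota> c = 0"
  show "c = 0"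
  proof (rule ccontr)
    assume "c \<noteq> 0"
    then have "\<iota> 1 = \<iota> c * \<iota> (inverse c)" by (simp flip: iota_mult)
    with \<open>\<iota> c = 0\<close> show False by simp
  qed
qed auto

lemma iota_eq_iff [simp]: "\<iota> c = \<iota> d \<longleftrightarrow> c = d"
  using iota_diff[of c d] by (metis iota_eq_0 right_minus_eq)

lemma iota_sum: "\<iota> (\<Sum>i\<in>A. f i) = (\<Sum>i\<in>A. \<iota> (f i))"
  by (induction A rule: infinite_finite_induct) (auto simp: iota_add)

lemma iota_power: "\<iota> (c ^ n) = \<iota> c ^ n"
  by (induction n) (auto simp: iota_mult)

sublocale kv: vector_space "\<lambda>c f. \<iota> c * f"
  by unfold_locales (auto simp: algebra_simps iota_add iota_mult)

text \<open>\<open>hf ys d g f\<close>: some form of degree \<open>d\<close> takes the value \<open>g\<close> at \<open>ys\<close> and is the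
  function \<open>f\<close> on complex vectors.\<close>

inductive hf :: "'k list \<Rightarrow> nat \<Rightarrow> 'k \<Rightarrow> (complex list \<Rightarrow> complex) \<Rightarrow> bool" for ys where
  hf_const: "hf ys 0 (\<iota> c) (\<lambda>_. c)"
| hf_zero: "hf ys d 0 (\<lambda>_. 0)"
| hf_add: "hf ys d g f \<Longrightarrow> hf ys d g' f' \<Longrightarrow> hf ys d (g + g') (\<lambda>x. f x + f' x)"
| hf_mul: "i < length ys \<Longrightarrow> hf ys d g f \<Longrightarrow> hf ys (Suc d) (ys ! i * g) (\<lambda>x. x ! i * f x)"

lemma hf_one: "hf ys 0 1 (\<lambda>_. 1)"
  using hf_const[of ys 1] by simp

lemma hf_scale: "hf ys d g f \<Longrightarrow> hf ys d (\<iota> c * g) (\<lambda>x. c * f x)"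
proof (induction rule: hf.induct)
  case (hf_const c')
  show ?case using hf.hf_const[of ys "c * c'"] by (simp add: iota_mult)
next
  case (hf_zero d) show ?case using hf.hf_zero by simp
next
  case (hf_add d g f g' f')
  from hf.hf_add[OF hf_add.IH] show ?case by (simp add: algebra_simps)
next
  case (hf_mul i d g f)
  from hf.hf_mul[OF hf_mul.hyps(1) hf_mul.IH] show ?case by (simp add: algebra_simps)
qed

lemma hf_mult: "hf ys d g f \<Longrightarrow> hf ys e g' f' \<Longrightarrow> hf ys (d + e) (g * g') (\<lambda>x. f x * f' x)"
proof (induction rule: hf.induct)
  case (hf_const c) then show ?case using hf_scale by simp
next
  case (hf_zero d) show ?case using hf.hf_zero by simp
next
  case (hf_add d g f g' f')
  from hf.hf_add[OF hf_add.IH] hf_add.prems show ?case by (simp add: algebra_simps)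
next
  case (hf_mul i d g f)
  from hf.hf_mul[OF hf_mul.hyps(1) hf_mul.IH[OF hf_mul.prems]] show ?case by (simp add: algebra_simps)
qed

lemma hf_uminus: "hf ys d g f \<Longrightarrow> hf ys d (- g) (\<lambda>x. - f x)"
  using hf_scale[of ys d g f "-1"] by (simp add: iota_uminus)

lemma hf_diff: "hf ys d g f \<Longrightarrow> hf ys d g' f' \<Longrightarrow> hf ys d (g - g') (\<lambda>x. f x - f' x)"
  using hf_add[of ys d g f "-g'" "\<lambda>x. - f' x"] hf_uminus by simp

lemma hf_power: "hf ys d g f \<Longrightarrow> hf ys (d * n) (g ^ n) (\<lambda>x. f x ^ n)"
  by (induction n) (auto simp: hf_one intro: hf_mult)

lemma hf_sum:
  assumes "\<And>i. i \<in> A \<Longrightarrow> hf ys d (g i) (f i)"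
  shows "hf ys d (\<Sum>i\<in>A. g i) (\<lambda>x. \<Sum>i\<in>A. f i x)"
  using assms by (induction A rule: infinite_finite_induct) (auto intro: hf_zero hf_add)

lemma hf_var: "i < length ys \<Longrightarrow> hf ys 1 (ys ! i) (\<lambda>x. x ! i)"
  using hf_mul[OF _ hf_one, of i ys] by simp

lemma hf_0D: "hf ys d g f \<Longrightarrow> d = 0 \<Longrightarrow> \<exists>c. g = \<iota> c \<and> f = (\<lambda>_. c)"
proof (induction rule: hf.induct)
  case (hf_add d g f g' f')
  then obtain c c' where "g = \<iota> c" "f = (\<lambda>_. c)" "g' = \<iota> c'" "f' = (\<lambda>_. c')" by auto
  then show ?case by (auto simp: iota_add intro!: exI[of _ "c + c'"])
qed (auto intro: exI[of _ 0])

text \<open>The basis of all inductions on the degree: a form of positive degree lies in the ideal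
  of the variables, and value and function split in the same way.\<close>

lemma hf_SucD:
  "hf ys e g f \<Longrightarrow> e = Suc d \<Longrightarrow> \<exists>G F. (\<forall>i<length ys. hf ys d (G i) (F i)) \<and>
     g = (\<Sum>i<length ys. ys ! i * G i) \<and> f = (\<lambda>x. \<Sum>i<length ys. x ! i * F i x)"
proof (induction rule: hf.induct)
  case (hf_zero e)
  show ?case by (rule exI[of _ "\<lambda>_. 0"], rule exI[of _ "\<lambda>_ _. 0"]) (auto intro: hf.hf_zero)
next
  case (hf_add e g f g' f')
  then obtain G F G' F' where *: "\<forall>i<length ys. hf ys d (G i) (F i)"
     "g = (\<Sum>i<length ys. ys ! i * G i)" "f = (\<lambda>x. \<Sum>i<length ys. x ! i * F i x)"
     "\<forall>i<length ys. hf ys d (G' i) (F' i)"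
     "g' = (\<Sum>i<length ys. ys ! i * G' i)" "f' = (\<lambda>x. \<Sum>i<length ys. x ! i * F' i x)"
    by blast
  show ?case
    by (rule exI[of _ "\<lambda>i. G i + G' i"], rule exI[of _ "\<lambda>i x. F i x + F' i x"])
      (use * in \<open>auto simp: algebra_simps sum.distrib intro: hf.hf_add\<close>)
next
  case (hf_mul j e g f)
  have *: "(\<Sum>i<length ys. ys ! i * (if i = j then g else 0)) = ys ! j * g"
    "(\<Sum>i<length ys. x ! i * (if i = j then f x else 0)) = x ! j * f x" for x
    using hf_mul.hyps(1) by (auto simp: if_distrib sum.delta cong: if_cong)
  show ?case
    by (rule exI[of _ "\<lambda>i. if i = j then g else 0"], rule exI[of _ "\<lambda>i x. if i = j then f x else 0"])
      (use hf_mul * in \<open>auto simp: hf.hf_zero\<close>)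
qed auto

lemma hf_homogeneous:
  "hf ys d g f \<Longrightarrow> length a = length ys \<Longrightarrow> f (map ((*) c) a) = c ^ d * f a"
  by (induction rule: hf.induct) (auto simp: algebra_simps)

text \<open>The part of degree \<open>d\<close> of the homogeneous coordinate ring generated by
  \<open>ys\<close>, realized inside the function field. Parts of different degrees may overlap
  there (some coordinate can be 1), so membership always comes with a degree.\<close>

definition hom :: "'k list \<Rightarrow> nat \<Rightarrow> 'k set" where
  "hom ys d = {g. \<exists>f. hf ys d g f}"

lemma homI: "hf ys d g f \<Longrightarrow> g \<in> hom ys d"
  by (auto simp: hom_def)

lemma subspace_hom: "kv.subspace (hom ys d)"
  unfolding kv.subspace_def hom_def using hf_zero hf_add hf_scale by blast

lemma hom_0 [simp]: "0 \<in> hom ys d" using hf_zero homI by blast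
lemma hom_add: "g \<in> hom ys d \<Longrightarrow> h \<in> hom ys d \<Longrightarrow> g + h \<in> hom ys d"
  using subspace_hom kv.subspace_add by blast
lemma hom_diff: "g \<in> hom ys d \<Longrightarrow> h \<in> hom ys d \<Longrightarrow> g - h \<in> hom ys d"
  using subspace_hom kv.subspace_diff by blast
lemma hom_uminus: "g \<in> hom ys d \<Longrightarrow> - g \<in> hom ys d"
  using subspace_hom kv.subspace_neg by blast
lemma hom_sum: "(\<And>i. i \<in> A \<Longrightarrow> g i \<in> hom ys d) \<Longrightarrow> (\<Sum>i\<in>A. g i) \<in> hom ys d"
  using subspace_hom kv.subspace_sum by blast
lemma hom_scale: "g \<in> hom ys d \<Longrightarrow> \<iota> c * g \<in> hom ys d"
  using hf_scale unfolding hom_def by blast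
lemma hom_mult: "g \<in> hom ys d \<Longrightarrow> h \<in> hom ys e \<Longrightarrow> g * h \<in> hom ys (d + e)"
  using hf_mult unfolding hom_def by blast
lemma hom_power: "g \<in> hom ys d \<Longrightarrow> g ^ n \<in> hom ys (d * n)"
  using hf_power unfolding hom_def by blast
lemma hom_const: "\<iota> c \<in> hom ys 0" using hf_const homI by blast
lemma hom_one: "1 \<in> hom ys 0" using hf_one homI by blast
lemma hom_var: "i < length ys \<Longrightarrow> ys ! i \<in> hom ys 1" using hf_var homI by blast
lemma hom_0D: "g \<in> hom ys 0 \<Longrightarrow> \<exists>c. g = \<iota> c" using hf_0D unfolding hom_def by blast

lemma hom_SucD:
  assumes "g \<in> hom ys (Suc d)"
  shows "\<exists>G. (\<forall>i<length ys. G i \<in> hom ys d) \<and> g = (\<Sum>i<length ys. ys ! i * G i)"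
proof -
  from assms obtain f where "hf ys (Suc d) g f" by (auto simp: hom_def)
  from hf_SucD[OF this refl] show ?thesis unfolding hom_def by blast
qed

lemma hf_eval_power:
  assumes "finite A" "A \<subseteq> {..<length V}"
  shows "hf V (\<Sum>i\<in>A. e i) (\<Prod>i\<in>A. V ! i ^ e i) (\<lambda>x. \<Prod>i\<in>A. x ! i ^ e i)"
  using assms
proof (induction A rule: finite_induct)
  case empty show ?case using hf_one by simp
next
  case (insert i A)
  then have "hf V (1 * e i) (V ! i ^ e i) (\<lambda>x. x ! i ^ e i)" by (intro hf_power hf_var) auto
  with insert show ?case using hf_mult[of V "e i"] by simp
qed

lemma hf_eval_mpoly:
  assumes "F \<in> forms (length V) d"
  shows "hf V d (eval_mpoly \<iota> F V) (eval_mpoly id F)"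
proof -
  have "hf V d (\<iota> (Poly_Mapping.lookup F m) * (\<Prod>i\<in>Poly_Mapping.keys m. V ! i ^ Poly_Mapping.lookup m i))
      (\<lambda>x. Poly_Mapping.lookup F m * (\<Prod>i\<in>Poly_Mapping.keys m. x ! i ^ Poly_Mapping.lookup m i))"
    if "m \<in> Poly_Mapping.keys F" for m
  proof (rule hf_scale)
    from assms that have "Poly_Mapping.keys m \<subseteq> {..<length V}"
      "(\<Sum>i\<in>Poly_Mapping.keys m. Poly_Mapping.lookup m i) = d" by (auto simp: forms_def mpolys_def)
    with hf_eval_power[of "Poly_Mapping.keys m" V "Poly_Mapping.lookup m"]
    show "hf V d (\<Prod>i\<in>Poly_Mapping.keys m. V ! i ^ Poly_Mapping.lookup m i)
      (\<lambda>x. \<Prod>i\<in>Poly_Mapping.keys m. x ! i ^ Poly_Mapping.lookup m i)" by simp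
  qed
  from hf_sum[OF this, of "Poly_Mapping.keys F"] show ?thesis
    unfolding eval_mpoly_def by (simp add: eval_mpoly_def[abs_def])
qed

end

definition mon_val :: "'a::comm_ring_1 list \<Rightarrow> (nat \<Rightarrow>\<^sub>0 nat) \<Rightarrow> 'a" where
  "mon_val x m = (\<Prod>i\<in>Poly_Mapping.keys m. x ! i ^ Poly_Mapping.lookup m i)"

lemma mon_val_superset:
  assumes "finite A" "Poly_Mapping.keys m \<subseteq> A"
  shows "mon_val x m = (\<Prod>i\<in>A. x ! i ^ Poly_Mapping.lookup m i)"
  unfolding mon_val_def using assms by (intro prod.mono_neutral_left) (auto simp: in_keys_iff)

lemma mon_val_add: "mon_val x (m + n) = mon_val x m * mon_val x n"
proof -
  let ?A = "Poly_Mapping.keys m \<union> Poly_Mapping.keys n"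
  have "Poly_Mapping.keys (m + n) \<subseteq> ?A" by (rule Poly_Mapping.keys_add)
  then show ?thesis
    by (subst (1 2 3) mon_val_superset[of ?A]) (auto simp: lookup_add power_add prod.distrib)
qed

lemma eval_mpoly_alt: "eval_mpoly h F x = (\<Sum>m\<in>Poly_Mapping.keys F. h (Poly_Mapping.lookup F m) * mon_val x m)"
  by (simp add: eval_mpoly_def mon_val_def)

lemma eval_mpoly_add:
  assumes "\<And>c d. h (c + d) = h c + h d"
  shows "eval_mpoly h (F + G) x = eval_mpoly h F x + eval_mpoly h G x"
proof -
  let ?A = "Poly_Mapping.keys F \<union> Poly_Mapping.keys G"
  have h0: "h 0 = 0" using assms[of 0 0] by simp
  have "Poly_Mapping.keys (F + G) \<subseteq> ?A" by (rule Poly_Mapping.keys_add)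
  then show ?thesis unfolding eval_mpoly_alt
    by (subst (1 2 3) sum_keys_mono[where A = ?A and h = "\<lambda>m c. h c * mon_val x m"])
      (auto simp: lookup_add assms algebra_simps sum.distrib h0)
qed

lemma eval_mpoly_sum:
  assumes "\<And>c d. h (c + d) = h c + h d"
  shows "eval_mpoly h (\<Sum>i\<in>A. F i) x = (\<Sum>i\<in>A. eval_mpoly h (F i) x)"
  by (induction A rule: infinite_finite_induct)
    (auto simp: eval_mpoly_add[of h, OF assms], auto simp: eval_mpoly_def)

lemma eval_mpoly_single:
  assumes "h 0 = 0"
  shows "eval_mpoly h (Poly_Mapping.single m c) x = h c * mon_val x m"
  using assms by (auto simp: eval_mpoly_alt)

context embedded_complex
begin

text \<open>Together with \<open>hf_eval_mpoly\<close> this identifies \<open>hf\<close> with the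
  evaluation of the homogeneous polynomials of the definitions, so that rule induction on
  \<open>hf\<close> can replace calculations with exponent vectors.\<close>

lemma hf_imp_form:
  "hf V d g f \<Longrightarrow> \<exists>F\<in>forms (length V) d. eval_mpoly \<iota> F V = g \<and> eval_mpoly id F = f"
proof (induction rule: hf.induct)
  case (hf_const c)
  show ?case
    by (rule bexI[of _ "Poly_Mapping.single 0 c"])
      (auto intro!: forms_single simp: eval_mpoly_single fun_eq_iff mon_val_def)
next
  case (hf_zero d)
  show ?case by (rule bexI[OF _ forms_zero]) (auto simp: eval_mpoly_def fun_eq_iff)
next
  case (hf_add d g f g' f')
  then obtain F G where "F\<in>forms (length V) d" "eval_mpoly \<iota> F V = g" "eval_mpoly id F = f"
    "G\<in>forms (length V) d" "eval_mpoly \<iota> G V = g'" "eval_mpoly id G = f'" by blast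
  moreover have "eval_mpoly id (F + G) x = eval_mpoly id F x + eval_mpoly id G x" for x
    by (rule eval_mpoly_add) simp
  ultimately show ?case
    by (intro bexI[of _ "F + G"]) (auto simp: eval_mpoly_add iota_add forms_add simp del: id_apply intro!: ext)
next
  case (hf_mul i d g f)
  then obtain F where F: "F\<in>forms (length V) d" "eval_mpoly \<iota> F V = g" "eval_mpoly id F = f" by blast
  let ?e = "Poly_Mapping.single i (1::nat)"
  \<comment> \<open>Written as a sum of monomials, so that evaluation and membership in
    \<open>forms\<close> are checked termwise and the keys of \<open>G\<close> need not be
    determined.\<close>
  define G where "G = (\<Sum>m\<in>Poly_Mapping.keys F. Poly_Mapping.single (m + ?e) (Poly_Mapping.lookup F m))"
  have mv: "mon_val x (m + ?e) = x ! i * mon_val x m" for x :: "'a::comm_ring_1 list" and m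
    by (simp add: mon_val_add) (simp add: mon_val_def)
  have *: "Poly_Mapping.keys (m + ?e) \<subseteq> {..<length V}"
    "(\<Sum>j\<in>Poly_Mapping.keys (m + ?e). Poly_Mapping.lookup (m + ?e) j) = Suc d"
    if "m \<in> Poly_Mapping.keys F" for m
  proof -
    from F(1) that have m: "Poly_Mapping.keys m \<subseteq> {..<length V}"
      "(\<Sum>i\<in>Poly_Mapping.keys m. Poly_Mapping.lookup m i) = d" by (auto simp: forms_def mpolys_def)
    show k: "Poly_Mapping.keys (m + ?e) \<subseteq> {..<length V}"
      using Poly_Mapping.keys_add[of m ?e] m(1) hf_mul.hyps(1) by (auto split: if_splits)
    have "(\<Sum>j\<in>Poly_Mapping.keys (m + ?e). Poly_Mapping.lookup (m + ?e) j) = (\<Sum>j<length V. Poly_Mapping.lookup (m + ?e) j)"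
      using k sum_keys_mono[of "{..<length V}" "m + ?e" "\<lambda>_ c. c"] by simp
    also have "\<dots> = (\<Sum>j<length V. Poly_Mapping.lookup m j) + (\<Sum>j<length V. if j = i then 1 else 0)"
      unfolding lookup_add sum.distrib by (simp add: lookup_single when_def eq_commute)
    also have "(\<Sum>j<length V. Poly_Mapping.lookup m j) = d"
      using m sum_keys_mono[of "{..<length V}" m "\<lambda>_ c. c"] by simp
    finally show "(\<Sum>j\<in>Poly_Mapping.keys (m + ?e). Poly_Mapping.lookup (m + ?e) j) = Suc d"
      using hf_mul.hyps(1) by simp
  qed
  have ev: "eval_mpoly h G x = x ! i * eval_mpoly h F x" if "\<And>c d. h (c + d) = h c + h d" for h and x :: "'a::comm_ring_1 list"
  proof -
    have "h 0 = 0" using that[of 0 0] by simp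
    then have "eval_mpoly h G x = (\<Sum>m\<in>Poly_Mapping.keys F. h (Poly_Mapping.lookup F m) * (x ! i * mon_val x m))"
      unfolding G_def eval_mpoly_sum[of h, OF that] by (simp only: eval_mpoly_single mv)
    then show ?thesis by (simp add: eval_mpoly_alt sum_distrib_left algebra_simps)
  qed
  show ?case
  proof (rule bexI[of _ G], intro conjI)
    show "eval_mpoly \<iota> G V = V ! i * g" using ev[of \<iota>] F iota_add by simp
    show "eval_mpoly id G = (\<lambda>x. x ! i * f x)" using ev[of id] F(3) by (auto simp: fun_eq_iff)
    show "G \<in> forms (length V) (Suc d)" unfolding G_def by (intro forms_sum forms_single * ) auto
  qed
qed

section \<open>Noether normalization and Hilbert functions\<close>

text \<open>Indexed families are needed because the products counted later may coincide for
  different indices; a repeated value already gives a relation, with coefficients 1 and -1.\<close>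

lemma family_dependent:
  assumes "finite I" "finite T" "card T < card I" "\<And>i. i \<in> I \<Longrightarrow> g i \<in> kv.span T"
  shows "\<exists>l. (\<exists>i\<in>I. l i \<noteq> 0) \<and> (\<Sum>i\<in>I. \<iota> (l i) * g i) = 0"
proof (cases "inj_on g I")
  case True
  have "kv.dependent (g ` I)"
  proof (rule ccontr)
    assume "\<not> kv.dependent (g ` I)"
    with kv.independent_span_bound[of T "g ` I"] assms have "card (g ` I) \<le> card T" by auto
    with True assms show False by (simp add: card_image)
  qed
  then obtain u where u: "\<exists>x\<in>g ` I. u x \<noteq> 0" "(\<Sum>x\<in>g ` I. \<iota> (u x) * x) = 0"
    using kv.dependent_finite[of "g ` I"] assms(1) by auto
  then show ?thesis using True by (intro exI[of _ "u \<circ> g"]) (auto simp: sum.reindex)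
next
  case False
  then obtain i j where ij: "i \<in> I" "j \<in> I" "i \<noteq> j" "g i = g j" by (auto simp: inj_on_def)
  define l where "l k = (if k = i then 1 else if k = j then -1 else (0::complex))" for k
  have "(\<Sum>k\<in>I. \<iota> (l k) * g k) = (\<Sum>k\<in>{i, j}. \<iota> (l k) * g k)"
    using ij assms(1) by (intro sum.mono_neutral_right) (auto simp: l_def)
  also have "\<dots> = 0" using ij by (simp add: l_def iota_uminus)
  finally show ?thesis using ij by (intro exI[of _ l]) (auto simp: l_def)
qed

section \<open>Ideals generated by linear forms, one degree at a time\<close>

lemma span_mult_right:
  assumes "x \<in> kv.span T" shows "x * w \<in> kv.span ((\<lambda>t. t * w) ` T)"
  using assms
proof (induction rule: kv.span_induct_alt)
  case base show ?case by (simp add: kv.span_zero)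
next
  case (step c t y)
  have "\<iota> c * (t * w) \<in> kv.span ((\<lambda>t. t * w) ` T)"
    by (rule kv.span_scale, rule kv.span_base) (use step in auto)
  from kv.span_add[OF this step.IH] have "\<iota> c * (t * w) + y * w \<in> kv.span ((\<lambda>t. t * w) ` T)" .
  then show ?case by (simp add: algebra_simps)
qed

text \<open>For linear forms \<open>ys\<close>, \<open>M = set ys\<close> and
  \<open>A = hom V q\<close>, this is the part of degree \<open>q + 1\<close> of the ideal that
  \<open>ys\<close> generates in the coordinate ring of \<open>V\<close>.\<close>

definition lincomb :: "'k set \<Rightarrow> 'k set \<Rightarrow> 'k set" where
  "lincomb M A = kv.span {x * h | x h. x \<in> M \<and> h \<in> A}"

lemma lincomb_base: "x \<in> M \<Longrightarrow> h \<in> A \<Longrightarrow> x * h \<in> lincomb M A"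
  unfolding lincomb_def by (rule kv.span_base) blast

lemma lincomb_add: "a \<in> lincomb M A \<Longrightarrow> b \<in> lincomb M A \<Longrightarrow> a + b \<in> lincomb M A"
  unfolding lincomb_def by (rule kv.span_add)
lemma lincomb_scale: "a \<in> lincomb M A \<Longrightarrow> \<iota> c * a \<in> lincomb M A"
  unfolding lincomb_def by (rule kv.span_scale)
lemma lincomb_zero: "0 \<in> lincomb M A"
  unfolding lincomb_def by (rule kv.span_zero)
lemma lincomb_sum: "(\<And>i. i \<in> I \<Longrightarrow> a i \<in> lincomb M A) \<Longrightarrow> (\<Sum>i\<in>I. a i) \<in> lincomb M A"
  unfolding lincomb_def by (rule kv.span_sum)

lemma lincomb_subset:
  assumes "\<And>x h. x \<in> M \<Longrightarrow> h \<in> A \<Longrightarrow> x * h \<in> U" "kv.subspace U"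
  shows "lincomb M A \<subseteq> U"
  unfolding lincomb_def using assms by (intro kv.span_minimal) auto

lemma lincomb_mult:
  assumes "a \<in> lincomb M (hom Z d)" "y \<in> hom Z e" shows "a * y \<in> lincomb M (hom Z (d + e))"
  using assms(1) unfolding lincomb_def
proof (induction rule: kv.span_induct_alt)
  case base show ?case by (simp add: kv.span_zero)
next
  case (step c t z)
  then obtain x h where t: "t = x * h" "x \<in> M" "h \<in> hom Z d" by blast
  have "\<iota> c * (x * (h * y)) \<in> kv.span {x * h |x h. x \<in> M \<and> h \<in> hom Z (d + e)}"
    by (rule kv.span_scale, rule kv.span_base) (use t assms(2) hom_mult in blast)
  from kv.span_add[OF this step.IH]
  have "\<iota> c * (x * (h * y)) + z * y \<in> kv.span {x * h |x h. x \<in> M \<and> h \<in> hom Z (d + e)}" .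
  then show ?case by (simp add: t algebra_simps)
qed

lemma lincomb_mono:
  assumes "M \<subseteq> Y" "A \<subseteq> B" shows "lincomb M A \<subseteq> lincomb Y B"
  unfolding lincomb_def using assms by (intro kv.span_mono) blast

lemma lincomb_insert:
  assumes "kv.subspace A" "g \<in> lincomb (insert u M) A"
  shows "\<exists>a\<in>lincomb M A. \<exists>b\<in>A. g = a + u * b"
  using assms(2) unfolding lincomb_def
proof (induction rule: kv.span_induct_alt)
  case base show ?case using kv.subspace_0[OF assms(1)] kv.span_zero by force
next
  case (step c t z)
  then obtain a b where ab: "a \<in> kv.span {x * h |x h. x \<in> M \<and> h \<in> A}" "b \<in> A" "z = a + u * b" by blast
  from step obtain x h where t: "t = x * h" "x \<in> insert u M" "h \<in> A" by blast
  show ?case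
  proof (cases "x \<in> M")
    case True
    have "\<iota> c * (x * h) \<in> kv.span {x * h |x h. x \<in> M \<and> h \<in> A}"
      by (rule kv.span_scale, rule kv.span_base) (use True t in blast)
    from kv.span_add[OF this ab(1)] have "\<iota> c * (x * h) + a \<in> kv.span {x * h |x h. x \<in> M \<and> h \<in> A}" .
    with ab t show ?thesis by (intro bexI[of _ "\<iota> c * (x * h) + a"] bexI[of _ b]) auto
  next
    case False
    with t have "x = u" by auto
    with ab t have "\<iota> c * t + z = a + u * (\<iota> c * h + b)" by (simp add: algebra_simps)
    moreover have "\<iota> c * h + b \<in> A"
      using ab t by (intro kv.subspace_add[OF assms(1)] kv.subspace_scale[OF assms(1)])
    ultimately show ?thesis using ab(1) by blast
  qed
qed

lemma subspace_lc: "kv.subspace (lincomb M A)"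
  unfolding lincomb_def by (rule kv.subspace_span)

lemma hom_Suc_lc: "hom ys (Suc d) \<subseteq> lincomb (set ys) (hom ys d)"
proof
  fix g assume "g \<in> hom ys (Suc d)"
  from hom_SucD[OF this] obtain G where "\<forall>i<length ys. G i \<in> hom ys d" "g = (\<Sum>i<length ys. ys ! i * G i)" by blast
  then show "g \<in> lincomb (set ys) (hom ys d)" by (auto intro!: lincomb_sum lincomb_base)
qed

lemma hom_subset:
  assumes "set ys \<subseteq> hom Z 1" shows "hom ys d \<subseteq> hom Z d"
proof (induction d)
  case 0 show ?case using hom_0D hom_const by blast
next
  case (Suc d)
  show ?case
  proof (rule order_trans[OF hom_Suc_lc], rule lincomb_subset)
    fix x h assume "x \<in> set ys" "h \<in> hom ys d"
    with assms Suc have "x * h \<in> hom Z (1 + d)" by (intro hom_mult) auto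
    then show "x * h \<in> hom Z (Suc d)" by simp
  qed (rule subspace_hom)
qed

section \<open>Expansion in the last variable\<close>

lemma hf_cong_point:
  "hf ys d g f \<Longrightarrow> (\<And>i. i < length ys \<Longrightarrow> x ! i = y ! i) \<Longrightarrow> f x = f y"
  by (induction rule: hf.induct) auto

lemma hf_append: "hf ys d g f \<Longrightarrow> hf (ys @ zs) d g f"
proof (induction rule: hf.induct)
  case (hf_mul i d g f)
  from hf.hf_mul[OF _ hf_mul.IH, of i] hf_mul.hyps(1) show ?case by (simp add: nth_append)
qed (auto intro: hf.intros)

text \<open>Value and function are expanded in powers of the last variable with matching
  coefficients; this makes induction on the number of variables possible.\<close>

lemma hf_snocD:
  "hf (ys @ [z]) d g f \<Longrightarrow> \<exists>G F. (\<forall>i\<le>d. hf ys (d - i) (G i) (F i)) \<and> g = (\<Sum>i\<le>d. G i * z ^ i) \<and>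
     (\<forall>cs c. length cs = length ys \<longrightarrow> f (cs @ [c]) = (\<Sum>i\<le>d. F i cs * c ^ i))"
proof (induction rule: hf.induct)
  case (hf_const c)
  show ?case by (rule exI[of _ "\<lambda>_. \<iota> c"], rule exI[of _ "\<lambda>_ _. c"]) (auto intro: hf.hf_const)
next
  case (hf_zero d)
  show ?case by (rule exI[of _ "\<lambda>_. 0"], rule exI[of _ "\<lambda>_ _. 0"]) (auto intro: hf.hf_zero)
next
  case (hf_add d g f g' f')
  then obtain G F G' F' where *:
    "\<forall>i\<le>d. hf ys (d - i) (G i) (F i)" "g = (\<Sum>i\<le>d. G i * z ^ i)"
     "\<forall>cs c. length cs = length ys \<longrightarrow> f (cs @ [c]) = (\<Sum>i\<le>d. F i cs * c ^ i)"
    "\<forall>i\<le>d. hf ys (d - i) (G' i) (F' i)" "g' = (\<Sum>i\<le>d. G' i * z ^ i)"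
     "\<forall>cs c. length cs = length ys \<longrightarrow> f' (cs @ [c]) = (\<Sum>i\<le>d. F' i cs * c ^ i)"
    by blast
  show ?case
    by (rule exI[of _ "\<lambda>i. G i + G' i"], rule exI[of _ "\<lambda>i x. F i x + F' i x"])
      (use * in \<open>auto simp: algebra_simps sum.distrib intro: hf.hf_add\<close>)
next
  case (hf_mul j d g f)
  then obtain G F where *: "\<forall>i\<le>d. hf ys (d - i) (G i) (F i)" "g = (\<Sum>i\<le>d. G i * z ^ i)"
     "\<forall>cs c. length cs = length ys \<longrightarrow> f (cs @ [c]) = (\<Sum>i\<le>d. F i cs * c ^ i)" by blast
  show ?case
  proof (cases "j < length ys")
    case True
    have "hf ys (Suc d - i) (ys ! j * G i) (\<lambda>x. x ! j * F i x)" if "i \<le> d" for i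
      using hf.hf_mul[OF True, of "d - i"] * that by (simp add: Suc_diff_le)
    then show ?thesis using * True
      by (intro exI[of _ "\<lambda>i. if i \<le> d then ys ! j * G i else 0"]
          exI[of _ "\<lambda>i x. if i \<le> d then x ! j * F i x else 0"])
        (auto simp: nth_append sum_distrib_left mult.assoc intro: hf.hf_zero)
  next
    case False
    with hf_mul.hyps have j: "j = length ys" by auto
    show ?thesis
      using * j
      by (intro exI[of _ "\<lambda>i. case i of 0 \<Rightarrow> 0 | Suc i \<Rightarrow> G i"]
          exI[of _ "\<lambda>i x. case i of 0 \<Rightarrow> 0 | Suc i \<Rightarrow> F i x"])
        (auto simp del: sum.atMost_Suc simp: sum.atMost_Suc_shift nth_append sum_distrib_left algebra_simps
          intro: hf.hf_zero split: nat.splits)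
  qed
qed

lemma hf_Nil: "hf [] d g f \<Longrightarrow> \<exists>c. g = \<iota> c \<and> f = (\<lambda>_. c)"
proof (cases d)
  case 0 then show "hf [] d g f \<Longrightarrow> ?thesis" using hf_0D by blast
next
  case (Suc n)
  show ?thesis if "hf [] d g f"
    using hf_SucD[OF that Suc] by (auto intro: exI[of _ 0])
qed

text \<open>For fixed first coordinates the expansion is a polynomial function of the last one, zero
  on the infinite field \<open>\<complex>\<close>, so its coefficients vanish as functions and the
  induction hypothesis applies to them.\<close>

lemma hf_vanish:
  "hf ys d g f \<Longrightarrow> (\<And>cs. length cs = length ys \<Longrightarrow> f cs = 0) \<Longrightarrow> g = 0"
proof (induction ys arbitrary: d g f rule: rev_induct)
  case Nil
  then obtain c where "g = \<iota> c" "f = (\<lambda>_. c)" using hf_Nil by blast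
  with Nil(2)[of "[]"] show ?case by auto
next
  case (snoc z ys)
  from hf_snocD[OF snoc.prems(1)] obtain G F where *: "\<forall>i\<le>d. hf ys (d - i) (G i) (F i)" "g = (\<Sum>i\<le>d. G i * z ^ i)"
     "\<And>cs c. length cs = length ys \<Longrightarrow> f (cs @ [c]) = (\<Sum>i\<le>d. F i cs * c ^ i)" by blast
  have "F i cs = 0" if "length cs = length ys" "i \<le> d" for i cs
  proof -
    from *(3)[OF that(1)] snoc.prems(2) that(1) have "\<forall>c. (\<Sum>i\<le>d. F i cs * c ^ i) = 0" by simp
    then show ?thesis using polyfun_eq_0[where n = d and c = "\<lambda>i. F i cs"] that(2) by blast
  qed
  then have "G i = 0" if "i \<le> d" for i using snoc.IH *(1) that by blast
  then show ?case using *(2) by simp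
qed

text \<open>A crude count of the monomials of degree \<open>d\<close>. What matters later is that
  the bound is polynomial in \<open>d\<close> for a fixed list.\<close>

lemma hom_span_bound: "\<exists>T. finite T \<and> card T \<le> (d + 1) ^ length ys \<and> hom ys d \<subseteq> kv.span T"
proof (induction ys arbitrary: d rule: rev_induct)
  case Nil
  show ?case
  proof (intro exI[of _ "{1}"] conjI subsetI)
    fix g assume "g \<in> hom [] d"
    then obtain c where "g = \<iota> c" unfolding hom_def using hf_Nil by blast
    then show "g \<in> kv.span {1}" using kv.span_scale[OF kv.span_base[of 1 "{1}"], of c] by simp
  qed auto
next
  case (snoc z ys)
  then obtain T where T: "\<And>d. finite (T d)" "\<And>d. card (T d) \<le> (d + 1) ^ length ys" "\<And>d. hom ys d \<subseteq> kv.span (T d)"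
    by metis
  let ?T = "\<Union>i\<le>d. (\<lambda>t. t * z ^ i) ` T (d - i)"
  have "card ?T \<le> (\<Sum>i\<le>d. card ((\<lambda>t. t * z ^ i) ` T (d - i)))" by (rule card_UN_le) auto
  also have "\<dots> \<le> (\<Sum>i\<le>d. (d + 1) ^ length ys)"
  proof (rule sum_mono)
    fix i assume "i \<in> {..d}"
    have "card ((\<lambda>t. t * z ^ i) ` T (d - i)) \<le> card (T (d - i))" by (rule card_image_le) (rule T)
    also have "\<dots> \<le> (d - i + 1) ^ length ys" by (rule T)
    also have "\<dots> \<le> (d + 1) ^ length ys" by (rule power_mono) auto
    finally show "card ((\<lambda>t. t * z ^ i) ` T (d - i)) \<le> (d + 1) ^ length ys" .
  qed
  also have "\<dots> = (d + 1) ^ length (ys @ [z])" by simp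
  finally have c: "card ?T \<le> (d + 1) ^ length (ys @ [z])" .
  have "hom (ys @ [z]) d \<subseteq> kv.span ?T"
  proof
    fix g assume "g \<in> hom (ys @ [z]) d"
    then obtain f where "hf (ys @ [z]) d g f" by (auto simp: hom_def)
    from hf_snocD[OF this] obtain G F where *: "\<forall>i\<le>d. hf ys (d - i) (G i) (F i)" "g = (\<Sum>i\<le>d. G i * z ^ i)"
      by blast
    have "G i * z ^ i \<in> kv.span ?T" if "i \<le> d" for i
    proof -
      have "G i \<in> kv.span (T (d - i))" using * that homI T(3) by blast
      from span_mult_right[OF this] have "G i * z ^ i \<in> kv.span ((\<lambda>t. t * z ^ i) ` T (d - i))" .
      then show ?thesis using kv.span_mono[of "(\<lambda>t. t * z ^ i) ` T (d - i)" ?T] that by blast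
    qed
    then show "g \<in> kv.span ?T" unfolding *(2) by (intro kv.span_sum) auto
  qed
  with c T(1) show ?case by (intro exI[of _ ?T]) auto
qed

lemma hom_basis:
  obtains B where "B \<subseteq> hom ys d" "finite B" "kv.independent B" "hom ys d \<subseteq> kv.span B" "card B = kv.dim (hom ys d)"
proof -
  obtain B where B: "B \<subseteq> hom ys d" "kv.independent B" "hom ys d \<subseteq> kv.span B" "card B = kv.dim (hom ys d)"
    using kv.basis_exists[of "hom ys d"] by blast
  obtain T where T: "finite T" "hom ys d \<subseteq> kv.span T" using hom_span_bound by blast
  have "finite B" using kv.independent_span_bound[OF T(1) B(2)] B(1) T(2) by blast
  with B that show thesis by blast
qed

lemma dim_hom_le: "kv.dim (hom ys d) \<le> (d + 1) ^ length ys"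
  using hom_span_bound[of d ys] kv.dim_le_card[of "hom ys d"] by (meson le_trans)

text \<open>Says that the coordinate ring modulo the linear forms \<open>ys\<close> vanishes in
  degree \<open>q + 1\<close>, hence in all higher degrees. Above degree \<open>q\<close> the ring
  is thus generated by \<open>hom V q\<close> as a module over the forms in \<open>ys\<close>; a
  shortest such list is a Noether normalization.\<close>

definition reduces :: "'k list \<Rightarrow> nat \<Rightarrow> 'k list \<Rightarrow> bool" where
  "reduces V q ys \<longleftrightarrow> set ys \<subseteq> hom V 1 \<and> hom V (Suc q) \<subseteq> lincomb (set ys) (hom V q)"

lemma reduces_up:
  assumes "reduces V q ys" shows "hom V (Suc (q + j)) \<subseteq> lincomb (set ys) (hom V (q + j))"
proof (induction j)
  case 0 then show ?case using assms by (simp add: reduces_def)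
next
  case (Suc j)
  show ?case
  proof
    fix g assume "g \<in> hom V (Suc (q + Suc j))"
    then have "g \<in> lincomb (set V) (hom V (Suc (q + j)))" using hom_Suc_lc by force
    moreover have "lincomb (set V) (hom V (Suc (q + j))) \<subseteq> lincomb (set ys) (hom V (q + Suc j))"
    proof (rule lincomb_subset)
      fix x h assume "x \<in> set V" "h \<in> hom V (Suc (q + j))"
      with Suc have "h \<in> lincomb (set ys) (hom V (q + j))" by blast
      moreover have "x \<in> hom V 1" using \<open>x \<in> set V\<close> hom_var by (metis in_set_conv_nth)
      ultimately have "h * x \<in> lincomb (set ys) (hom V (q + j + 1))" by (rule lincomb_mult)
      then show "x * h \<in> lincomb (set ys) (hom V (q + Suc j))" by (simp add: mult.commute)
    qed (rule subspace_lc)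
    ultimately show "g \<in> lincomb (set ys) (hom V (q + Suc j))" by blast
  qed
qed

text \<open>Passing to linear coordinates in which \<open>p\<close> is the point where all but the last one vanish.\<close>

lemma coordinate_change:
  assumes "length p = length ys" "k < length ys" "p ! k \<noteq> (0::complex)"
  obtains zs u where "Suc (length zs) = length ys" "set (zs @ [u]) \<subseteq> hom ys 1" "set ys \<subseteq> hom (zs @ [u]) 1"
    "\<And>d g f. hf ys (Suc d) g f \<Longrightarrow> g - \<iota> (f p) * u ^ Suc d \<in> lincomb (set zs) (hom ys d)"
    "\<And>A. kv.subspace A \<Longrightarrow> lincomb (set ys) A \<subseteq> lincomb (set (zs @ [u])) A"
proof -
  \<comment> \<open>As linear functions, \<open>u\<close> takes the value 1 at \<open>p\<close> and
    each \<open>z i\<close> the value 0. Since \<open>z k\<close> vanishes identically, it is left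
    out of the new list.\<close>
  define u where "u = \<iota> (1 / p ! k) * ys ! k"
  define z where "z i = ys ! i - \<iota> (p ! i) * u" for i
  define zs where "zs = map z ([0..<k] @ [Suc k..<length ys])"
  have zk: "z k = 0" using assms(3) by (simp add: z_def u_def flip: mult.assoc iota_mult)
  have "{..<length ys} - {k} = {0..<k} \<union> {Suc k..<length ys}" using assms(2) by auto
  then have zs_set: "set zs = z ` ({..<length ys} - {k})" by (simp add: zs_def image_Un)
  have ysi: "ys ! i = z i + \<iota> (p ! i) * u" for i by (simp add: z_def)
  have u1: "u \<in> hom ys 1" unfolding u_def using assms(2) by (intro hom_scale hom_var)
  have len: "Suc (length zs) = length ys" using assms(2) by (simp add: zs_def)
  have z1: "set (zs @ [u]) \<subseteq> hom ys 1"
    using u1 by (auto simp: zs_set z_def simp del: One_nat_def intro!: hom_diff hom_scale hom_var)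
  have zin: "x \<in> hom (zs @ [u]) 1" if "x \<in> set (zs @ [u])" for x using that hom_var by (metis in_set_conv_nth)
  have ys1: "set ys \<subseteq> hom (zs @ [u]) 1"
  proof
    fix y assume "y \<in> set ys"
    then obtain i where i: "i < length ys" "y = ys ! i" by (auto simp: in_set_conv_nth)
    have "z i \<in> hom (zs @ [u]) 1" using zin i zs_set zk by (cases "i = k") auto
    then show "y \<in> hom (zs @ [u]) 1" unfolding i(2) ysi using zin by (intro hom_add hom_scale) auto
  qed
  have zlc: "z i * h \<in> lincomb (set zs) A" if "i < length ys" "h \<in> A" for i h A
    using that zs_set zk lincomb_zero by (cases "i = k") (auto intro: lincomb_base)
  \<comment> \<open>Modulo the \<open>z i\<close> each coordinate \<open>ys ! i\<close> is
    \<open>p ! i\<close> times \<open>u\<close>, so a form becomes its value at \<open>p\<close>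
    times a power of \<open>u\<close>.\<close>
  have "g - \<iota> (f p) * u ^ Suc d \<in> lincomb (set zs) (hom ys d)" if "hf ys (Suc d) g f" for d g f
    using that
  proof (induction d arbitrary: g f)
    case 0
    from hf_SucD[OF this refl] obtain G F where *: "\<forall>i<length ys. hf ys 0 (G i) (F i)"
     "g = (\<Sum>i<length ys. ys ! i * G i)" "f = (\<lambda>x. \<Sum>i<length ys. x ! i * F i x)" by blast
    have "G i = \<iota> (F i p)" if "i < length ys" for i using * that hf_0D by fastforce
    then have "g - \<iota> (f p) * u ^ 1 = (\<Sum>i<length ys. z i * G i)"
      unfolding *(2,3) ysi by (simp add: iota_sum iota_mult algebra_simps sum.distrib sum_distrib_left)
    then show ?case using * homI by (auto intro!: lincomb_sum zlc)
  next
    case (Suc d)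
    from hf_SucD[OF Suc.prems refl] obtain G F where *: "\<forall>i<length ys. hf ys (Suc d) (G i) (F i)"
     "g = (\<Sum>i<length ys. ys ! i * G i)" "f = (\<lambda>x. \<Sum>i<length ys. x ! i * F i x)" by blast
    have "g - \<iota> (f p) * u ^ Suc (Suc d) = (\<Sum>i<length ys. z i * G i + \<iota> (p ! i) * (u * (G i - \<iota> (F i p) * u ^ Suc d)))"
      unfolding *(2,3) ysi by (simp add: iota_sum iota_mult algebra_simps sum.distrib sum_distrib_left sum_subtractf)
    also have "\<dots> \<in> lincomb (set zs) (hom ys (Suc d))"
    proof (intro lincomb_sum lincomb_add lincomb_scale zlc)
      fix i assume "i \<in> {..<length ys}"
      then have "G i - \<iota> (F i p) * u ^ Suc d \<in> lincomb (set zs) (hom ys d)" using Suc.IH * by blast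
      from lincomb_mult[OF this u1] show "u * (G i - \<iota> (F i p) * u ^ Suc d) \<in> lincomb (set zs) (hom ys (Suc d))"
        by (simp add: mult.commute)
    qed (use * homI in auto)
    finally show ?case .
  qed
  moreover have "lincomb (set ys) A \<subseteq> lincomb (set (zs @ [u])) A" if A: "kv.subspace A" for A
  proof (rule lincomb_subset)
    fix y h assume "y \<in> set ys" "h \<in> A"
    then obtain i where i: "i < length ys" "y = ys ! i" by (auto simp: in_set_conv_nth)
    have "z i * h + u * (\<iota> (p ! i) * h) \<in> lincomb (set (zs @ [u])) A"
      using zlc[OF i(1) \<open>h \<in> A\<close>] lincomb_mono[of "set zs" "set (zs @ [u])" A A] A \<open>h \<in> A\<close>
      by (intro lincomb_add) (auto intro: lincomb_base kv.subspace_scale)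
    then show "y * h \<in> lincomb (set (zs @ [u])) A" unfolding i(2) ysi by (simp add: algebra_simps)
  qed (rule subspace_lc)
  ultimately show thesis using that[of zs u] len z1 ys1 by blast
qed

text \<open>This is the Krull dimension of the coordinate ring. Defining it by minimality gives
  independence of the list at once, with no theory of transcendence degree.\<close>

definition noether_number :: "'k list \<Rightarrow> nat" where
  "noether_number V = (LEAST n. \<exists>q ys. length ys = n \<and> reduces V q ys)"

lemma reduces_self: "reduces V 0 V"
  unfolding reduces_def using hom_Suc_lc hom_var by (metis in_set_conv_nth subsetI)

lemma reduces_noether_number: "\<exists>q ys. length ys = noether_number V \<and> reduces V q ys"
  unfolding noether_number_def by (rule LeastI_ex) (use reduces_self in blast)

lemma reduces_nn_le: "reduces V q ys \<Longrightarrow> noether_number V \<le> length ys"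
  unfolding noether_number_def by (rule Least_le) blast

text \<open>A relation that does not vanish at \<open>p\<close> becomes monic in \<open>u\<close> in
  the coordinates adapted to \<open>p\<close>. So a power of \<open>u\<close> lies in the ideal of
  the remaining \<open>zs\<close>, and these alone reduce \<open>V\<close>, with a larger
  \<open>q\<close>; this contradicts the minimal length.\<close>

lemma reduces_indep:
  assumes "reduces V q ys" "length ys = noether_number V" "hf ys d 0 f" "length p = length ys"
  shows "f p = 0"
proof (rule ccontr)
  assume fp: "f p \<noteq> 0"
  obtain d' where d: "d = Suc d'" using fp assms(3) hf_0D[of ys d 0 f] by (cases d) auto
  have "\<exists>k<length ys. p ! k \<noteq> 0"
  proof (rule ccontr)
    assume "\<not> ?thesis"
    then have "map ((*) 0) p = p" using assms(4) by (intro nth_equalityI) auto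
    with hf_homogeneous[OF assms(3,4), of 0] fp d show False by simp
  qed
  then obtain k where k: "k < length ys" "p ! k \<noteq> 0" by blast
  obtain zs u where zu: "Suc (length zs) = length ys" "set (zs @ [u]) \<subseteq> hom ys 1"
    "\<And>d g f. hf ys (Suc d) g f \<Longrightarrow> g - \<iota> (f p) * u ^ Suc d \<in> lincomb (set zs) (hom ys d)"
    "\<And>A. kv.subspace A \<Longrightarrow> lincomb (set ys) A \<subseteq> lincomb (set (zs @ [u])) A"
    by (rule coordinate_change[OF assms(4) k]) blast
  have ysV: "set ys \<subseteq> hom V 1" using assms(1) by (simp add: reduces_def)
  have "0 - \<iota> (f p) * u ^ Suc d' \<in> lincomb (set zs) (hom ys d')" using zu(3) assms(3) d by blast
  from lincomb_scale[OF this, of "- 1 / f p"] fp have "u ^ Suc d' \<in> lincomb (set zs) (hom ys d')"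
    by (simp add: iota_uminus flip: mult.assoc iota_mult)
  then have ud: "u ^ Suc d' \<in> lincomb (set zs) (hom V d')"
    using lincomb_mono[of "set zs" "set zs" "hom ys d'" "hom V d'"] hom_subset[OF ysV] by blast
  \<comment> \<open>Splitting off \<open>u\<close> repeatedly: modulo the ideal of
    \<open>zs\<close>, an element of degree \<open>q + j + 1\<close> is \<open>u ^ (j + 1)\<close>
    times an element of degree \<open>q\<close>.\<close>
  have J: "\<exists>a\<in>lincomb (set zs) (hom V (q + j)). \<exists>b\<in>hom V q. g = a + u ^ Suc j * b" if "g \<in> hom V (Suc (q + j))" for j g
    using that
  proof (induction j arbitrary: g)
    case 0
    then have "g \<in> lincomb (set ys) (hom V q)" using assms(1) by (auto simp: reduces_def)
    then have "g \<in> lincomb (insert u (set zs)) (hom V q)" using zu(4)[OF subspace_hom] by auto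
    from lincomb_insert[OF subspace_hom this] show ?case by simp
  next
    case (Suc j)
    then have "g \<in> lincomb (insert u (set zs)) (hom V (q + Suc j))"
      using reduces_up[OF assms(1), of "Suc j"] zu(4)[OF subspace_hom] by fastforce
    from lincomb_insert[OF subspace_hom this] obtain a b where ab: "a\<in>lincomb (set zs) (hom V (q + Suc j))" "b \<in> hom V (q + Suc j)"
      "g = a + u * b" by blast
    from Suc.IH[of b] ab obtain a' b' where ab': "a' \<in> lincomb (set zs) (hom V (q + j))" "b' \<in> hom V q"
      "b = a' + u ^ Suc j * b'" by auto
    have "u \<in> hom V 1" using zu(2) hom_subset[OF ysV] by auto
    from lincomb_mult[OF ab'(1) this] ab(1) have "a + a' * u \<in> lincomb (set zs) (hom V (q + Suc j))" by (auto intro: lincomb_add)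
    then show ?case by (intro bexI[of _ "a + a' * u"] bexI[of _ b']) (auto simp: ab ab' algebra_simps)
  qed
  \<comment> \<open>In degree \<open>q + d' + 1\<close> the power of \<open>u\<close> that remains
    is exactly the one that lies in the ideal of \<open>zs\<close>.\<close>
  have "reduces V (q + d') zs"
    unfolding reduces_def
  proof (intro conjI subsetI)
    fix z assume "z \<in> set zs" then show "z \<in> hom V 1" using zu(2) hom_subset[OF ysV] by auto
  next
    fix g assume "g \<in> hom V (Suc (q + d'))"
    from J[OF this] obtain a b where ab: "a\<in>lincomb (set zs) (hom V (q + d'))" "b\<in>hom V q" "g = a + u ^ Suc d' * b" by blast
    from lincomb_mult[OF ud ab(2)] ab(1) show "g \<in> lincomb (set zs) (hom V (q + d'))"
      unfolding ab(3) by (intro lincomb_add) (auto simp: add.commute)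
  qed
  from reduces_nn_le[OF this] zu(1) assms(2) show False by linarith
qed

section \<open>Division by a monic form\<close>

lemma poly_altdef_le:
  fixes p :: "'k poly"
  assumes "Polynomial.degree p \<le> d"
  shows "poly p x = (\<Sum>i\<le>d. Polynomial.coeff p i * x ^ i)"
  unfolding poly_altdef[of p x] using assms by (intro sum.mono_neutral_left) (auto simp: coeff_eq_0)

text \<open>Homogeneity of total degree \<open>d\<close>, the polynomial variable counting as a
  variable of degree 1. In this shape forms can be divided by a form that is monic in
  \<open>u\<close>.\<close>

definition hpoly :: "'k list \<Rightarrow> nat \<Rightarrow> 'k poly \<Rightarrow> bool" where
  "hpoly zs d p \<longleftrightarrow> (\<forall>i\<le>d. Polynomial.coeff p i \<in> hom zs (d - i)) \<and> (\<forall>i>d. Polynomial.coeff p i = 0)"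

lemma hpoly_coeff: "hpoly zs d p \<Longrightarrow> i \<le> d \<Longrightarrow> Polynomial.coeff p i \<in> hom zs (d - i)"
  by (auto simp: hpoly_def)

lemma hpoly_0 [simp]: "hpoly zs d 0" by (auto simp: hpoly_def)
lemma hpoly_diff: "hpoly zs d p \<Longrightarrow> hpoly zs d q \<Longrightarrow> hpoly zs d (p - q)" by (auto simp: hpoly_def intro: hom_diff)
lemma hpoly_add: "hpoly zs d p \<Longrightarrow> hpoly zs d q \<Longrightarrow> hpoly zs d (p + q)" by (auto simp: hpoly_def intro: hom_add)
lemma hpoly_mult:
  assumes "hpoly zs d p" "hpoly zs e q" shows "hpoly zs (d + e) (p * q)"
  unfolding hpoly_def
proof (intro conjI allI impI)
  fix i assume i: "i \<le> d + e"
  show "Polynomial.coeff (p * q) i \<in> hom zs (d + e - i)"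
    unfolding coeff_mult
  proof (rule hom_sum)
    fix j assume "j \<in> {..i}"
    show "Polynomial.coeff p j * Polynomial.coeff q (i - j) \<in> hom zs (d + e - i)"
    proof (cases "j \<le> d \<and> i - j \<le> e")
      case True
      with assms have "Polynomial.coeff p j * Polynomial.coeff q (i - j) \<in> hom zs ((d - j) + (e - (i - j)))"
        by (intro hom_mult hpoly_coeff) auto
      moreover have "(d - j) + (e - (i - j)) = d + e - i" using True \<open>j \<in> {..i}\<close> by auto
      ultimately show ?thesis by simp
    next
      case False
      with assms show ?thesis by (auto simp: hpoly_def)
    qed
  qed
next
  fix i assume i: "i > d + e"
  show "Polynomial.coeff (p * q) i = 0" unfolding coeff_mult
  proof (rule sum.neutral, rule)
    fix j assume "j \<in> {..i}"
    with i have "j > d \<or> i - j > e" by auto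
    with assms show "Polynomial.coeff p j * Polynomial.coeff q (i - j) = 0" by (auto simp: hpoly_def)
  qed
qed

lemma hpoly_monom: "a \<in> hom zs (d - n) \<Longrightarrow> n \<le> d \<Longrightarrow> hpoly zs d (Polynomial.monom a n)"
  by (auto simp: hpoly_def)

lemma hpoly_power: "hpoly zs d p \<Longrightarrow> hpoly zs (d * n) (p ^ n)"
proof (induction n)
  case 0 show ?case using hpoly_monom[of 1 zs 0 0] hom_one by (simp add: monom_eq_1)
next
  case (Suc n) then show ?case using hpoly_mult[of zs d p "d * n"] by simp
qed

lemma hpoly_smult: "a \<in> hom zs e \<Longrightarrow> hpoly zs d p \<Longrightarrow> hpoly zs (e + d) (Polynomial.smult a p)"
  using hpoly_mult[OF hpoly_monom[of a zs e 0], of d p] by (simp add: monom_0)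

lemma hom_snocE:
  assumes "g \<in> hom (zs @ [u]) d" obtains p where "hpoly zs d p" "poly p u = g"
proof -
  from assms obtain f where "hf (zs @ [u]) d g f" by (auto simp: hom_def)
  from hf_snocD[OF this] obtain G F where *: "\<forall>i\<le>d. hf zs (d - i) (G i) (F i)" "g = (\<Sum>i\<le>d. G i * u ^ i)" by blast
  define p where "p = (\<Sum>i\<le>d. Polynomial.monom (G i) i)"
  have "hpoly zs d p" unfolding p_def hpoly_def using * homI
    by (auto simp: coeff_sum if_distrib cong: if_cong)
  moreover have "poly p u = g" by (simp add: p_def poly_sum poly_monom *)
  ultimately show thesis by (rule that)
qed

lemma hpoly_poly: "hpoly zs d p \<Longrightarrow> poly p u \<in> hom (zs @ [u]) d"
proof -
  assume p: "hpoly zs d p"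
  then have "Polynomial.degree p \<le> d" by (intro degree_le) (auto simp: hpoly_def)
  then have e: "poly p u = (\<Sum>i\<le>d. Polynomial.coeff p i * u ^ i)" by (rule poly_altdef_le)
  show ?thesis unfolding e
  proof (rule hom_sum)
    fix i assume "i \<in> {..d}"
    then have "Polynomial.coeff p i \<in> hom (zs @ [u]) (d - i)" using p hpoly_coeff hf_append unfolding hom_def by blast
    moreover have "u ^ i \<in> hom (zs @ [u]) (1 * i)"
      using hom_var[of "length zs" "zs @ [u]"] by (intro hom_power) (simp add: nth_append)
    ultimately have "Polynomial.coeff p i * u ^ i \<in> hom (zs @ [u]) (d - i + 1 * i)" by (rule hom_mult)
    with \<open>i \<in> {..d}\<close> show "Polynomial.coeff p i * u ^ i \<in> hom (zs @ [u]) d" by simp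
  qed
qed

text \<open>Algebraic independence, tested on homogeneous relations. Triviality of the relation is
  expressed through its function, since \<open>hf\<close> does not record a polynomial.\<close>

definition indep :: "'k list \<Rightarrow> bool" where
  "indep ys \<longleftrightarrow> (\<forall>d f cs. hf ys d 0 f \<longrightarrow> length cs = length ys \<longrightarrow> f cs = 0)"

text \<open>The function of the relation vanishes at every \<open>cs @ [c]\<close>. Varying
  \<open>c\<close> shows that the coefficient functions vanish, and \<open>hf_vanish\<close> carries
  this over to the coefficients. So the expansion of a form in powers of \<open>u\<close> is
  unique.\<close>

lemma hpoly_inj:
  assumes "indep (zs @ [u])" "hpoly zs d p" "poly p u = 0" shows "p = 0"
proof -
  have "\<forall>i\<le>d. \<exists>f. hf zs (d - i) (Polynomial.coeff p i) f" using assms(2) by (auto simp: hpoly_def hom_def)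
  then obtain F where F: "\<And>i. i \<le> d \<Longrightarrow> hf zs (d - i) (Polynomial.coeff p i) (F i)" by metis
  have "hf (zs @ [u]) d (Polynomial.coeff p i * u ^ i) (\<lambda>x. F i x * (x ! length zs) ^ i)" if "i \<le> d" for i
  proof -
    have "hf (zs @ [u]) 1 u (\<lambda>x. x ! length zs)" using hf_var[of "length zs" "zs @ [u]"] by (simp add: nth_append)
    from hf_mult[OF hf_append[OF F[OF that]] hf_power[OF this, of i]] that show ?thesis by simp
  qed
  then have "hf (zs @ [u]) d (\<Sum>i\<le>d. Polynomial.coeff p i * u ^ i) (\<lambda>x. \<Sum>i\<le>d. F i x * (x ! length zs) ^ i)"
    by (intro hf_sum) auto
  moreover have "Polynomial.degree p \<le> d" using assms(2) by (intro degree_le) (auto simp: hpoly_def)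
  then have "(\<Sum>i\<le>d. Polynomial.coeff p i * u ^ i) = 0" using assms(3) poly_altdef_le[of p d u] by simp
  ultimately have "hf (zs @ [u]) d 0 (\<lambda>x. \<Sum>i\<le>d. F i x * (x ! length zs) ^ i)" by simp
  then have *: "(\<Sum>i\<le>d. F i cs * (cs ! length zs) ^ i) = 0" if "length cs = Suc (length zs)" for cs
    using assms(1) that unfolding indep_def by fastforce
  have "F i cs = 0" if "i \<le> d" "length cs = length zs" for i cs
  proof -
    have "(\<Sum>i\<le>d. F i cs * c ^ i) = 0" for c
    proof -
      have "F i (cs @ [c]) = F i cs" if "i \<le> d" for i
        using hf_cong_point[OF F[OF that], of "cs @ [c]" cs] \<open>length cs = length zs\<close> by (simp add: nth_append)
      then show ?thesis using *[of "cs @ [c]"] that(2) by (simp add: nth_append)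
    qed
    then show ?thesis using polyfun_eq_0[where n = d and c = "\<lambda>i. F i cs"] that(1) by blast
  qed
  then have "Polynomial.coeff p i = 0" if "i \<le> d" for i using hf_vanish[OF F[OF that]] that by blast
  then show ?thesis using assms(2) by (intro poly_eqI) (auto simp: hpoly_def not_le[symmetric])
qed

text \<open>Long division, by induction on a bound \<open>n\<close> for the degree of
  \<open>p\<close>. The top coefficient of \<open>P\<close> is a nonzero constant, so that dividing
  by it preserves forms and their degrees.\<close>

lemma hpoly_division:
  assumes "hpoly zs m P" "Polynomial.coeff P m = \<iota> l" "l \<noteq> 0"
  shows "hpoly zs d p \<Longrightarrow> (\<And>i. i \<ge> n \<Longrightarrow> Polynomial.coeff p i = 0) \<Longrightarrow>
     \<exists>Q R. hpoly zs (d - m) Q \<and> (\<forall>i\<ge>m. Polynomial.coeff R i = 0) \<and> p = P * Q + R"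
proof (induction n arbitrary: p)
  case 0
  then have "p = 0" by (intro poly_eqI) auto
  then show ?case by (intro exI[of _ 0]) auto
next
  case (Suc n)
  show ?case
  proof (cases "n < m \<or> Polynomial.coeff p n = 0")
    case True
    then show ?thesis
    proof
      assume "n < m"
      with Suc.prems show ?thesis by (intro exI[of _ 0] exI[of _ p]) auto
    next
      assume "Polynomial.coeff p n = 0"
      with Suc.prems have "\<And>i. i \<ge> n \<Longrightarrow> Polynomial.coeff p i = 0" by (metis Suc_leI le_neq_implies_less)
      with Suc show ?thesis by blast
    qed
  next
    case False
    then have nm: "m \<le> n" and nz: "Polynomial.coeff p n \<noteq> 0" by auto
    then have nd: "n \<le> d" using Suc.prems(1) by (auto simp: hpoly_def not_less[symmetric])
    define t where "t = Polynomial.monom (\<iota> (1 / l) * Polynomial.coeff p n) (n - m)"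
    have t: "hpoly zs (d - m) t" unfolding t_def
      using Suc.prems(1) nd nm by (intro hpoly_monom hom_scale) (auto dest: hpoly_coeff[of _ _ _ n])
    have Pt: "hpoly zs d (P * t)" using hpoly_mult[OF assms(1) t] nm nd by simp
    have "Polynomial.coeff (p - P * t) i = 0" if "i \<ge> n" for i
    proof (cases "i = n")
      case True
      have "Polynomial.coeff (t * P) n = \<iota> (1 / l) * Polynomial.coeff p n * \<iota> l"
        unfolding t_def coeff_monom_mult using nm assms(2) by simp
      also have "\<dots> = \<iota> (1 / l * l) * Polynomial.coeff p n" by (simp only: iota_mult ac_simps)
      finally show ?thesis using True assms(3) by (simp add: mult.commute)
    next
      case False
      with that nm have "i - (n - m) > m" by auto
      then have "Polynomial.coeff P (i - (n - m)) = 0" using assms(1) by (auto simp: hpoly_def)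
      then have "Polynomial.coeff (t * P) i = 0" unfolding t_def coeff_monom_mult by simp
      then show ?thesis using Suc.prems(2)[of i] that False by (simp add: mult.commute)
    qed
    from Suc.IH[OF hpoly_diff[OF Suc.prems(1) Pt] this] obtain Q R where
      "hpoly zs (d - m) Q" "\<forall>i\<ge>m. Polynomial.coeff R i = 0" "p - P * t = P * Q + R" by blast
    then show ?thesis using t
      by (intro exI[of _ "Q + t"] exI[of _ R]) (auto simp: algebra_simps intro: hpoly_add)
  qed
qed

text \<open>A nonzero scalar \<open>a\<close> is coprime to a polynomial \<open>P\<close> that is
  monic up to a constant: after division of \<open>p\<close> by \<open>P\<close>, \<open>a\<close>
  times the remainder is a multiple of \<open>P\<close> of smaller degree and hence zero.\<close>

lemma hpoly_cancel:
  assumes "hpoly zs m P" "Polynomial.coeff P m = \<iota> l" "l \<noteq> 0" "hpoly zs d p" "a \<noteq> 0"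
    "Polynomial.smult a p = w * P"
  shows "\<exists>Q. hpoly zs (d - m) Q \<and> p = P * Q"
proof -
  have "\<And>i. i \<ge> Suc d \<Longrightarrow> Polynomial.coeff p i = 0" using assms(4) by (auto simp: hpoly_def)
  from hpoly_division[OF assms(1-4) this] obtain Q R where QR: "hpoly zs (d - m) Q" "\<forall>i\<ge>m. Polynomial.coeff R i = 0"
    "p = P * Q + R" by blast
  define D where "D = w - Polynomial.smult a Q"
  have PD: "P * D = Polynomial.smult a R"
    using assms(6) by (simp add: D_def QR(3) algebra_simps smult_add_right)
  have Pm: "Polynomial.coeff P m \<noteq> 0" using assms by simp
  have "Polynomial.degree P = m" using Pm assms(1) by (intro antisym degree_le le_degree) (auto simp: hpoly_def)
  have "D = 0"
  proof (rule ccontr)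
    assume "D \<noteq> 0"
    moreover have "P \<noteq> 0" using Pm by auto
    ultimately have "P * D \<noteq> 0" "Polynomial.degree (P * D) = m + Polynomial.degree D" using \<open>Polynomial.degree P = m\<close> by (auto simp: degree_mult_eq)
    then have "Polynomial.coeff (P * D) (m + Polynomial.degree D) \<noteq> 0" by (metis leading_coeff_neq_0)
    then show False unfolding PD using QR(2) by simp
  qed
  with PD assms(5) have "R = 0" by simp
  with QR show ?thesis by auto
qed

end

text \<open>If the sequence more than doubled over every step of length \<open>s\<close> from
  \<open>L0\<close> on, it would be at least \<open>2 ^ j\<close> at \<open>L0 + j * s\<close>,
  beyond any polynomial bound. This allows a shift \<open>s\<close> fixed beforehand to be absorbed
  into a factor 2.\<close>

lemma subexponential_doubling:
  fixes a :: "nat \<Rightarrow> nat"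
  assumes "\<And>l. a l \<le> (l + 1) ^ r" "\<And>l. a l \<ge> 1"
  shows "\<exists>L\<ge>L0. a (L + s) \<le> 2 * a L"
proof (rule ccontr)
  assume *: "\<not> ?thesis"
  have g: "2 ^ j \<le> a (L0 + j * s)" for j
  proof (induction j)
    case 0 then show ?case using assms(2)[of L0] by simp
  next
    case (Suc j)
    have "a (L0 + j * s + s) > 2 * a (L0 + j * s)" using * by (metis le_add1 not_less)
    with Suc show ?case by (simp add: algebra_simps)
  qed
  have "((\<lambda>j. real ((L0 + j * s + 1) ^ r) / 2 ^ j) \<longlongrightarrow> 0) at_top" 
  proof -
    have "((\<lambda>j. real (j + 1) ^ r / 2 ^ j) \<longlongrightarrow> 0) at_top"
      by real_asymp
    then have "((\<lambda>j. real (L0 + s + 1) ^ r * (real (j + 1) ^ r / 2 ^ j)) \<longlongrightarrow> 0) at_top"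
      by (rule tendsto_mult_right_zero)
    moreover have le: "real ((L0 + j * s + 1) ^ r) / 2 ^ j \<le> real (L0 + s + 1) ^ r * (real (j + 1) ^ r / 2 ^ j)" for j
    proof -
      have "L0 + j * s + 1 \<le> (L0 + s + 1) * (j + 1)" by (simp add: algebra_simps)
      then have "(L0 + j * s + 1) ^ r \<le> ((L0 + s + 1) * (j + 1)) ^ r" by (rule power_mono) simp
      then have "real ((L0 + j * s + 1) ^ r) \<le> real (((L0 + s + 1) * (j + 1)) ^ r)" by (rule of_nat_mono)
      also have "\<dots> = real (L0 + s + 1) ^ r * real (j + 1) ^ r" by (simp only: of_nat_power of_nat_mult power_mult_distrib)
      finally have "real ((L0 + j * s + 1) ^ r) \<le> real (L0 + s + 1) ^ r * real (j + 1) ^ r" .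
      then show ?thesis by (simp add: divide_right_mono)
    qed
    ultimately show ?thesis
      by (intro tendsto_sandwich[OF always_eventually[OF allI] always_eventually[OF allI[OF le]] tendsto_const])
        (rule divide_nonneg_nonneg, simp_all only: of_nat_0_le_iff zero_le_power zero_le_numeral)
  qed
  then have "eventually (\<lambda>j. real ((L0 + j * s + 1) ^ r) / 2 ^ j < 1) at_top"
    by (rule order_tendstoD) simp
  then obtain j where "real ((L0 + j * s + 1) ^ r) / 2 ^ j < 1" by (auto simp: eventually_at_top_linorder)
  then have "real ((L0 + j * s + 1) ^ r) < real (2 ^ j)" by (simp add: field_simps)
  then have "(L0 + j * s + 1) ^ r < 2 ^ j" by (simp only: of_nat_less_iff)
  with g[of j] assms(1)[of "L0 + j * s"] show False by linarith
qed

text \<open>Shifting a sum of a monotone sequence by \<open>m\<close> exchanges at most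
  \<open>m\<close> terms at the ends, each of them at most \<open>h (L + s)\<close>.\<close>

lemma telescope_bound:
  fixes h :: "nat \<Rightarrow> nat"
  assumes "\<And>i. h i \<le> h (Suc i)"
  shows "m \<le> s \<Longrightarrow> (\<Sum>l\<le>L. h (l + s)) \<le> (\<Sum>l\<le>L. h (l + s - m)) + m * h (L + s)"
proof (induction m)
  case (Suc m)
  have mono: "h i \<le> h j" if "i \<le> j" for i j using assms that by (rule lift_Suc_mono_le)
  define t where "t = s - Suc m"
  have t: "l + s - m = l + t + 1" "l + s - Suc m = l + t" for l using Suc.prems by (auto simp: t_def)
  have "(\<Sum>l\<le>L. h (l + t + 1)) \<le> (\<Sum>l\<le>L. h (l + t)) + h (L + t + 1)" by (induction L) auto
  also have "h (L + t + 1) \<le> h (L + s)" using Suc.prems by (intro mono) (auto simp: t_def)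
  finally have "(\<Sum>l\<le>L. h (l + t + 1)) \<le> (\<Sum>l\<le>L. h (l + t)) + h (L + s)" by simp
  with Suc show ?case by (simp add: t)
qed auto

section \<open>Comparison of Hilbert functions\<close>

context embedded_complex
begin

lemma dim_hom_ge:
  assumes "finite I" "\<And>i. i \<in> I \<Longrightarrow> g i \<in> hom ys d"
    "\<And>l. (\<Sum>i\<in>I. \<iota> (l i) * g i) = 0 \<Longrightarrow> \<forall>i\<in>I. l i = 0"
  shows "card I \<le> kv.dim (hom ys d)"
proof (rule ccontr)
  assume *: "\<not> ?thesis"
  obtain B where B: "finite B" "hom ys d \<subseteq> kv.span B" "card B = kv.dim (hom ys d)" by (rule hom_basis[of ys d])
  have "card B < card I" "\<And>i. i \<in> I \<Longrightarrow> g i \<in> kv.span B" using * B assms(2) by auto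
  from family_dependent[OF assms(1) B(1) this] have "\<exists>l. (\<exists>i\<in>I. l i \<noteq> 0) \<and> (\<Sum>i\<in>I. \<iota> (l i) * g i) = 0" .
  with assms(3) show False by blast
qed

lemma indep_sum_zero:
  assumes "kv.independent B" "finite B" "(\<Sum>b\<in>B. \<iota> (l b) * b) = 0" "b \<in> B" shows "l b = 0"
  using assms kv.dependent_finite[OF assms(2)] by auto

text \<open>Multiplication by a nonzero \<open>w\<close> is injective in a field.\<close>

lemma dim_hom_mono:
  assumes "w \<in> hom ys e" "w \<noteq> 0" shows "kv.dim (hom ys d) \<le> kv.dim (hom ys (d + e))"
proof -
  obtain B where B: "B \<subseteq> hom ys d" "finite B" "kv.independent B" "card B = kv.dim (hom ys d)" by (rule hom_basis[of ys d])
  have "card B \<le> kv.dim (hom ys (d + e))"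
  proof (rule dim_hom_ge[of B "\<lambda>b. b * w"])
    fix l assume "(\<Sum>b\<in>B. \<iota> (l b) * (b * w)) = 0"
    then have "(\<Sum>b\<in>B. \<iota> (l b) * b) * w = 0" by (simp add: sum_distrib_right mult.assoc)
    then show "\<forall>b\<in>B. l b = 0" using assms(2) indep_sum_zero[OF B(3,2)] by auto
  qed (use B assms(1) hom_mult in auto)
  with B show ?thesis by simp
qed

lemma indep_last_nonzero: "indep (zs @ [u]) \<Longrightarrow> u \<noteq> 0"
proof
  assume *: "indep (zs @ [u])" "u = 0"
  have "hf (zs @ [u]) 1 u (\<lambda>x. x ! length zs)" using hf_var[of "length zs" "zs @ [u]"] by (simp add: nth_append)
  with * have "(replicate (length zs) 0 @ [1]) ! length zs = (0::complex)"
    unfolding indep_def by (metis length_append_singleton length_replicate)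
  then show False by (simp add: nth_append)
qed

lemma indep_nonzero:
  assumes "indep ys" "y \<in> set ys" shows "y \<noteq> 0"
proof
  assume "y = 0"
  from assms obtain i where i: "i < length ys" "y = ys ! i" by (auto simp: in_set_conv_nth)
  with hf_var[of i ys] \<open>y = 0\<close> have "hf ys 1 0 (\<lambda>x. x ! i)" by simp
  then have "replicate (length ys) 1 ! i = (0::complex)" using assms(1) unfolding indep_def by fastforce
  with i show False by simp
qed

text \<open>By the expansion in powers of \<open>u\<close>, a further variable at most sums up the
  Hilbert function.\<close>

lemma dim_snoc_le: "kv.dim (hom (zs @ [u]) L) \<le> (\<Sum>l\<le>L. kv.dim (hom zs l))"
proof -
  have "\<exists>B. finite B \<and> hom zs l \<subseteq> kv.span B \<and> card B = kv.dim (hom zs l)" for l using hom_basis by metis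
  then obtain B where B: "\<And>l. finite (B l)" "\<And>l. hom zs l \<subseteq> kv.span (B l)" "\<And>l. card (B l) = kv.dim (hom zs l)"
    by metis
  let ?T = "\<Union>l\<le>L. (\<lambda>t. t * u ^ (L - l)) ` B l"
  have "hom (zs @ [u]) L \<subseteq> kv.span ?T"
  proof
    fix g assume "g \<in> hom (zs @ [u]) L"
    then obtain f where "hf (zs @ [u]) L g f" by (auto simp: hom_def)
    from hf_snocD[OF this] obtain G F where *: "\<forall>i\<le>L. hf zs (L - i) (G i) (F i)" "g = (\<Sum>i\<le>L. G i * u ^ i)"
      by blast
    have "G i * u ^ i \<in> kv.span ?T" if "i \<le> L" for i
    proof -
      have "G i \<in> kv.span (B (L - i))" using * that homI B(2) by blast
      from span_mult_right[OF this] have "G i * u ^ i \<in> kv.span ((\<lambda>t. t * u ^ (L - (L - i))) ` B (L - i))" using that by simp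
      moreover have "kv.span ((\<lambda>t. t * u ^ (L - (L - i))) ` B (L - i)) \<subseteq> kv.span ?T"
        by (rule kv.span_mono) (rule UN_upper, simp)
      ultimately show ?thesis by (rule subsetD[rotated])
    qed
    then show "g \<in> kv.span ?T" unfolding *(2) by (intro kv.span_sum) auto
  qed
  then have "kv.dim (hom (zs @ [u]) L) \<le> card ?T" using B(1) by (intro kv.dim_le_card) auto
  also have "\<dots> \<le> (\<Sum>l\<le>L. card ((\<lambda>t. t * u ^ (L - l)) ` B l))" by (rule card_UN_le) auto
  also have "\<dots> \<le> (\<Sum>l\<le>L. kv.dim (hom zs l))" by (rule sum_mono) (use B card_image_le in metis)
  finally show ?thesis .
qed

text \<open>Starting from degree \<open>q\<close>, all elements are combinations of
  \<open>hom V q\<close> with coefficients that are forms in \<open>ys\<close>. The factor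
  \<open>dim (hom V q)\<close> is the source of the constant in the Bezout inequality.\<close>

lemma dim_red_le:
  assumes "reduces V q ys"
  shows "kv.dim (hom V (q + d)) \<le> kv.dim (hom V q) * kv.dim (hom ys d)"
proof -
  obtain B where B: "finite B" "hom V q \<subseteq> kv.span B" "card B = kv.dim (hom V q)" by (rule hom_basis[of V q])
  obtain A where A: "finite A" "hom ys d \<subseteq> kv.span A" "card A = kv.dim (hom ys d)" by (rule hom_basis[of ys d])
  let ?U = "\<lambda>d. {a * b | a b. a \<in> hom ys d \<and> b \<in> hom V q}"
  have "hom V (q + d) \<subseteq> kv.span (?U d)" for d
  proof (induction d)
    case 0
    have "1 * g \<in> kv.span (?U 0)" if "g \<in> hom V q" for g
      by (rule kv.span_base) (use that hom_one in blast)
    then show ?case by auto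
  next
    case (Suc d)
    have "lincomb (set ys) (hom V (q + d)) \<subseteq> kv.span (?U (Suc d))"
    proof (rule lincomb_subset)
      fix y h assume y: "y \<in> set ys" and "h \<in> hom V (q + d)"
      with Suc have "h \<in> kv.span (?U d)" by blast
      from span_mult_right[OF this] have "h * y \<in> kv.span ((\<lambda>t. t * y) ` ?U d)" .
      moreover have "(\<lambda>t. t * y) ` ?U d \<subseteq> ?U (Suc d)"
      proof
        fix w assume "w \<in> (\<lambda>t. t * y) ` ?U d"
        then obtain a b where "w = a * b * y" "a \<in> hom ys d" "b \<in> hom V q" by blast
        then have "w = (y * a) * b" "a \<in> hom ys d" "b \<in> hom V q" by (auto simp: ac_simps)
        moreover have "y \<in> hom ys 1" using y hom_var by (metis in_set_conv_nth)
        ultimately have "y * a \<in> hom ys (Suc d)" using hom_mult[of y ys 1 a d] by simp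
        with \<open>w = (y * a) * b\<close> \<open>b \<in> hom V q\<close> show "w \<in> ?U (Suc d)"
          by (intro CollectI exI[of _ "y * a"] exI[of _ b]) simp
      qed
      ultimately have "h * y \<in> kv.span (?U (Suc d))" by (rule subsetD[OF kv.span_mono, rotated])
      then show "y * h \<in> kv.span (?U (Suc d))" by (simp only: mult.commute)
    qed (rule kv.subspace_span)
    then show ?case using reduces_up[OF assms, of d] by auto
  qed
  moreover have "?U d \<subseteq> kv.span ((\<lambda>(a, b). a * b) ` (A \<times> B))"
  proof clarify
    fix a b assume "a \<in> hom ys d" and b: "b \<in> hom V q"
    then have "a \<in> kv.span A" using A by blast
    from span_mult_right[OF this] have "a * b \<in> kv.span ((\<lambda>t. t * b) ` A)" .
    moreover have "t * b \<in> kv.span ((\<lambda>(a, b). a * b) ` (A \<times> B))" if "t \<in> A" for t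
    proof -
      have "b \<in> kv.span B" using b B by blast
      from span_mult_right[OF this, of t] have "b * t \<in> kv.span ((\<lambda>s. s * t) ` B)" .
      moreover have "(\<lambda>s. s * t) ` B \<subseteq> (\<lambda>(a, b). a * b) ` (A \<times> B)"
      proof clarify
        fix s assume "s \<in> B"
        with that show "s * t \<in> (\<lambda>(a, b). a * b) ` (A \<times> B)"
          by (intro image_eqI[of _ _ "(t, s)"]) (auto simp: mult.commute)
      qed
      ultimately have "b * t \<in> kv.span ((\<lambda>(a, b). a * b) ` (A \<times> B))" by (rule subsetD[OF kv.span_mono, rotated])
      then show ?thesis by (simp only: mult.commute)
    qed
    ultimately show "a * b \<in> kv.span ((\<lambda>(a, b). a * b) ` (A \<times> B))"
      using kv.span_minimal[of "(\<lambda>t. t * b) ` A", OF _ kv.subspace_span] by blast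
  qed
  ultimately have "hom V (q + d) \<subseteq> kv.span ((\<lambda>(a, b). a * b) ` (A \<times> B))"
    using kv.span_minimal[OF _ kv.subspace_span] by (meson order_trans)
  then have "kv.dim (hom V (q + d)) \<le> card ((\<lambda>(a, b). a * b) ` (A \<times> B))" using A B by (intro kv.dim_le_card) auto
  also have "\<dots> \<le> card (A \<times> B)" using A B by (intro card_image_le) auto
  finally show ?thesis using A B by (simp add: card_cartesian_product mult.commute)
qed

text \<open>Up to one denominator \<delta>, the module over the forms in \<open>ys\<close> is free.
  \<open>B\<close> is a maximal independent part of a basis \<open>T\<close> of
  \<open>hom V q\<close>; maximality makes each element of \<open>T\<close> dependent on
  \<open>B\<close> after multiplication by a nonzero form, and \<delta> is the product of these
  forms. It is essential that \<delta> does not depend on the degree \<open>d\<close>.\<close>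

lemma reduces_module_basis:
  assumes "reduces V q ys"
  obtains B D \<delta> where "finite B" "B \<subseteq> hom V q" "\<delta> \<in> hom ys D" "\<delta> \<noteq> 0"
    "\<And>d h. \<forall>b\<in>B. h b \<in> hom ys d \<Longrightarrow> (\<Sum>b\<in>B. h b * b) = 0 \<Longrightarrow> \<forall>b\<in>B. h b = 0"
    "\<And>d s. s \<in> hom V (q + d) \<Longrightarrow> \<exists>h. (\<forall>b\<in>B. h b \<in> hom ys (D + d)) \<and> \<delta> * s = (\<Sum>b\<in>B. h b * b)"
proof -
  obtain T where T: "T \<subseteq> hom V q" "finite T" "hom V q \<subseteq> kv.span T" by (rule hom_basis[of V q])
  \<comment> \<open>All coefficients have one degree because the elements of \<open>T\<close> all
    have degree \<open>q\<close>; only homogeneous relations are considered.\<close>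
  let ?ind = "\<lambda>B. \<forall>d h. (\<forall>b\<in>B. h b \<in> hom ys d) \<longrightarrow> (\<Sum>b\<in>B. h b * b) = 0 \<longrightarrow> (\<forall>b\<in>B. h b = 0)"
  define BB where "BB = {B. B \<subseteq> T \<and> ?ind B}"
  have "finite BB" using T(2) by (auto simp: BB_def)
  moreover have "{} \<in> BB" by (auto simp: BB_def)
  ultimately obtain B where Bmax: "B \<in> BB" "\<And>B'. B' \<in> BB \<Longrightarrow> B \<subseteq> B' \<Longrightarrow> B' = B"
    using finite_has_maximal[of BB] by blast
  have B: "B \<subseteq> T" "?ind B" using Bmax(1) by (simp_all add: BB_def)
  have Bm: "B' = B" if "B' \<subseteq> T" "?ind B'" "B \<subseteq> B'" for B' using Bmax(2)[of B'] that unfolding BB_def by blast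
  have fB: "finite B" using B(1) T(2) finite_subset by blast
  define M where "M d = {\<Sum>b\<in>B. h b * b | h. \<forall>b\<in>B. h b \<in> hom ys d}" for d
  have M0: "0 \<in> M d" for d unfolding M_def by (auto intro!: exI[of _ "\<lambda>_. 0"])
  have Madd: "x + y \<in> M d" if xy: "x \<in> M d" "y \<in> M d" for x y d
  proof -
    obtain h h' where "x = (\<Sum>b\<in>B. h b * b)" "\<forall>b\<in>B. h b \<in> hom ys d" "y = (\<Sum>b\<in>B. h' b * b)" "\<forall>b\<in>B. h' b \<in> hom ys d"
      using xy unfolding M_def by blast
    then show ?thesis unfolding M_def
      by (auto intro!: exI[of _ "\<lambda>b. h b + h' b"] hom_add simp: algebra_simps sum.distrib)
  qed
  have Mmult: "a * x \<in> M (e + d)" if xy: "x \<in> M d" "a \<in> hom ys e" for x a d e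
  proof -
    obtain h where "x = (\<Sum>b\<in>B. h b * b)" "\<forall>b\<in>B. h b \<in> hom ys d"
      using xy unfolding M_def by blast
    then show ?thesis using xy(2) unfolding M_def
      by (auto intro!: exI[of _ "\<lambda>b. a * h b"] hom_mult simp: mult.assoc sum_distrib_left)
  qed
  have Msub: "kv.subspace (M d)" for d
    unfolding kv.subspace_def using M0 Madd Mmult[OF _ hom_const] by fastforce
  have "\<exists>d \<delta>. \<delta> \<in> hom ys d \<and> \<delta> \<noteq> 0 \<and> \<delta> * e \<in> M d" if e: "e \<in> T" for e
  proof (cases "e \<in> B")
    case True
    have "(\<Sum>b\<in>B. (if b = e then 1 else 0) * b) = (\<Sum>b\<in>B. if b = e then b else 0)" by (intro sum.cong) auto
    then have "1 * e = (\<Sum>b\<in>B. (if b = e then 1 else 0) * b)" using True fB by simp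
    then have "1 * e \<in> M 0" unfolding M_def using hom_one by fastforce
    then show ?thesis using hom_one by (intro exI[of _ 0] exI[of _ 1]) auto
  next
    case False
    have sub: "insert e B \<subseteq> T" using B(1) e by blast
    have "\<not> ?ind (insert e B)"
    proof
      assume i: "?ind (insert e B)"
      from Bm[OF sub i subset_insertI] have "e \<in> B" by (rule subst) (rule insertI1)
      with False show False by (rule notE)
    qed
    then obtain d h where h: "\<forall>b\<in>insert e B. h b \<in> hom ys d" "(\<Sum>b\<in>insert e B. h b * b) = 0"
      "\<exists>b\<in>insert e B. h b \<noteq> 0" by (auto simp only: not_all not_imp ball_simps)
    from h(2) False fB have s: "h e * e + (\<Sum>b\<in>B. h b * b) = 0" by simp
    have "h e \<noteq> 0"
    proof
      assume "h e = 0"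
      with s B(2) h(1) have "\<forall>b\<in>B. h b = 0" by auto
      with \<open>h e = 0\<close> h(3) show False by auto
    qed
    moreover have "h e * e = (\<Sum>b\<in>B. (- h b) * b)" using s by (simp add: sum_negf eq_neg_iff_add_eq_0)
    then have "h e * e \<in> M d" unfolding M_def using h(1) by (auto intro!: exI[of _ "\<lambda>b. - h b"] hom_uminus)
    ultimately show ?thesis using h(1) by auto
  qed
  then obtain dd \<delta>\<delta> where dd: "\<And>e. e \<in> T \<Longrightarrow> \<delta>\<delta> e \<in> hom ys (dd e)" "\<And>e. e \<in> T \<Longrightarrow> \<delta>\<delta> e \<noteq> 0"
    "\<And>e. e \<in> T \<Longrightarrow> \<delta>\<delta> e * e \<in> M (dd e)" by metis
  \<comment> \<open>The common denominator for all elements of \<open>T\<close>.\<close>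
  define \<delta> where "\<delta> = (\<Prod>e\<in>T. \<delta>\<delta> e)"
  define D where "D = (\<Sum>e\<in>T. dd e)"
  have hom_prod: "(\<Prod>e\<in>U. \<delta>\<delta> e) \<in> hom ys (\<Sum>e\<in>U. dd e)" if "U \<subseteq> T" for U
    using finite_subset[OF that T(2)] that
    by (induction U rule: finite_induct) (auto simp: hom_one intro!: hom_mult dd(1))
  have \<delta>: "\<delta> \<in> hom ys D" "\<delta> \<noteq> 0" unfolding \<delta>_def D_def using hom_prod[of T] dd(2) T(2) by auto
  have \<delta>T: "\<delta> * e \<in> M D" if "e \<in> T" for e
  proof -
    have "\<delta> * e = (\<Prod>e\<in>T - {e}. \<delta>\<delta> e) * (\<delta>\<delta> e * e)" "D = (\<Sum>e\<in>T - {e}. dd e) + dd e"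
      using that T(2) by (simp_all add: \<delta>_def D_def prod.remove[of T e] sum.remove[of T e])
    then show ?thesis using Mmult[OF dd(3)[OF that] hom_prod[of "T - {e}"]] by (simp only: Diff_subset)
  qed
  have "\<delta> * s \<in> M (D + d)" if "s \<in> hom V (q + d)" for s d
    using that
  proof (induction d arbitrary: s)
    case 0
    then have "s \<in> kv.span T" using T(3) by auto
    from span_mult_right[OF this] have "s * \<delta> \<in> kv.span ((\<lambda>t. t * \<delta>) ` T)" .
    moreover have "(\<lambda>t. t * \<delta>) ` T \<subseteq> M D" using \<delta>T by (auto simp: mult.commute)
    ultimately have "s * \<delta> \<in> M D" using kv.span_minimal[OF _ Msub] by blast
    then show ?case by (simp add: mult.commute[of s \<delta>])
  next
    case (Suc d)
    have "lincomb (set ys) (hom V (q + d)) \<subseteq> {s. \<delta> * s \<in> M (D + Suc d)}"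
    proof (rule lincomb_subset)
      fix y h assume y: "y \<in> set ys" and "h \<in> hom V (q + d)"
      with Suc.IH have "\<delta> * h \<in> M (D + d)" by blast
      moreover have "y \<in> hom ys 1" using y hom_var by (metis in_set_conv_nth)
      ultimately have "y * (\<delta> * h) \<in> M (1 + (D + d))" by (rule Mmult)
      then show "y * h \<in> {s. \<delta> * s \<in> M (D + Suc d)}" by (simp add: ac_simps)
    next
      have "kv.subspace (M (D + Suc d))" by (rule Msub)
      then show "kv.subspace {s. \<delta> * s \<in> M (D + Suc d)}"
        unfolding kv.subspace_def by (simp add: distrib_left mult.left_commute[of \<delta>])
    qed
    then show ?case using reduces_up[OF assms, of d] Suc.prems by auto
  qed
  then have "\<exists>h. (\<forall>b\<in>B. h b \<in> hom ys (D + d)) \<and> \<delta> * s = (\<Sum>b\<in>B. h b * b)" if "s \<in> hom V (q + d)" for s d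
    using that unfolding M_def by blast
  moreover have "\<forall>b\<in>B. h b = 0" if "\<forall>b\<in>B. h b \<in> hom ys d" "(\<Sum>b\<in>B. h b * b) = 0" for d h
    using B(2)[rule_format, of h d] that by (intro ballI) (auto simp only:)
  ultimately show thesis by (intro that[OF fB order_trans[OF B(1) T(1)] \<delta>])
qed

end

section \<open>A Bezout inequality\<close>

text \<open>What the Bezout inequality uses of a normal variety: \<open>YY\<close> are the prime
  divisors, \<open>v\<close> their valuations, \<open>xx Y\<close> a coordinate not vanishing
  identically on \<open>Y\<close>. Thus \<open>int d * v Y (xx Y)\<close> is the valuation of a form
  of degree \<open>d\<close> that does not vanish on \<open>Y\<close>. In \<open>v_frac\<close> the
  denominator is such a form, and \<open>v_sep\<close> provides a form that vanishes on
  \<open>Y'\<close> but not on \<open>Y\<close>.\<close>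

locale valued_forms = embedded_complex \<iota> for \<iota> :: "complex \<Rightarrow> 'k::field" +
  fixes V :: "'k list" and YY :: "'y set" and v :: "'y \<Rightarrow> 'k \<Rightarrow> int" and xx :: "'y \<Rightarrow> 'k"
  assumes v_mult: "Y \<in> YY \<Longrightarrow> f \<noteq> 0 \<Longrightarrow> g \<noteq> 0 \<Longrightarrow> v Y (f * g) = v Y f + v Y g"
    and v_add: "Y \<in> YY \<Longrightarrow> f \<noteq> 0 \<Longrightarrow> g \<noteq> 0 \<Longrightarrow> f + g \<noteq> 0 \<Longrightarrow> min (v Y f) (v Y g) \<le> v Y (f + g)"
    and xx_hom: "Y \<in> YY \<Longrightarrow> xx Y \<in> hom V 1"
    and xx_nz: "Y \<in> YY \<Longrightarrow> xx Y \<noteq> 0"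
    and v_hom: "Y \<in> YY \<Longrightarrow> F \<in> hom V d \<Longrightarrow> F \<noteq> 0 \<Longrightarrow> int d * v Y (xx Y) \<le> v Y F"
    and v_frac: "Y \<in> YY \<Longrightarrow> f \<noteq> 0 \<Longrightarrow> 0 \<le> v Y f \<Longrightarrow>
      \<exists>d. \<exists>F\<in>hom V d. \<exists>G\<in>hom V d. F \<noteq> 0 \<and> G \<noteq> 0 \<and> f = F / G \<and> v Y G = int d * v Y (xx Y)"
    and v_unif: "Y \<in> YY \<Longrightarrow> \<exists>f. f \<noteq> 0 \<and> v Y f = 1"
    and v_sep: "Y \<in> YY \<Longrightarrow> Y' \<in> YY \<Longrightarrow> Y \<noteq> Y' \<Longrightarrow>
      \<exists>d. \<exists>H\<in>hom V d. H \<noteq> 0 \<and> int d * v Y' (xx Y') < v Y' H \<and> v Y H = int d * v Y (xx Y)"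
    and V_nz: "\<exists>x\<in>set V. x \<noteq> 0"
begin

text \<open>The order of vanishing of a form along \<open>Y\<close>. The coordinates of
  \<open>V\<close> are only determined up to a common factor, and subtracting the value of
  \<open>xx Y\<close> makes the order independent of it.\<close>

definition od :: "'y \<Rightarrow> nat \<Rightarrow> 'k \<Rightarrow> int" where
  "od Y d F = v Y F - int d * v Y (xx Y)"

lemma v_one: "Y \<in> YY \<Longrightarrow> v Y 1 = 0"
  using v_mult[of Y 1 1] by simp

lemma v_power: "Y \<in> YY \<Longrightarrow> f \<noteq> 0 \<Longrightarrow> v Y (f ^ n) = int n * v Y f"
  by (induction n) (auto simp: v_one v_mult algebra_simps)

lemma od_nonneg: "Y \<in> YY \<Longrightarrow> F \<in> hom V d \<Longrightarrow> F \<noteq> 0 \<Longrightarrow> 0 \<le> od Y d F"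
  using v_hom by (simp add: od_def)

lemma od_mult: "Y \<in> YY \<Longrightarrow> F \<noteq> 0 \<Longrightarrow> G \<noteq> 0 \<Longrightarrow> od Y (d + e) (F * G) = od Y d F + od Y e G"
  by (simp add: od_def v_mult algebra_simps)

lemma od_power: "Y \<in> YY \<Longrightarrow> F \<noteq> 0 \<Longrightarrow> od Y (d * n) (F ^ n) = int n * od Y d F"
  by (simp add: od_def v_power algebra_simps)

lemma od_one: "Y \<in> YY \<Longrightarrow> od Y 0 1 = 0"
  by (simp add: od_def v_one)

lemma od_xx: "Y \<in> YY \<Longrightarrow> od Y n (xx Y ^ n) = 0"
  by (simp add: od_def v_power xx_nz)

definition oge :: "'y \<Rightarrow> nat \<Rightarrow> int \<Rightarrow> 'k \<Rightarrow> bool" where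
  "oge Y d n F \<longleftrightarrow> F = 0 \<or> n \<le> od Y d F"

lemma oge_add: "Y \<in> YY \<Longrightarrow> oge Y d n F \<Longrightarrow> oge Y d n G \<Longrightarrow> oge Y d n (F + G)"
  using v_add[of Y F G] by (cases "F = 0"; cases "G = 0"; cases "F + G = 0") (auto simp: oge_def od_def)

lemma v_minus: "Y \<in> YY \<Longrightarrow> f \<noteq> 0 \<Longrightarrow> v Y (- f) = v Y f"
proof -
  assume *: "Y \<in> YY" "f \<noteq> 0"
  have "v Y (- 1) + v Y (- 1) = v Y ((- 1) * (- 1))" using *(1) by (subst v_mult) auto
  then have "v Y (- 1) = 0" using v_one[OF *(1)] by simp
  then show ?thesis using v_mult[OF *(1), of "-1" f] * by simp
qed

lemma oge_diff: "Y \<in> YY \<Longrightarrow> oge Y d n F \<Longrightarrow> oge Y d n G \<Longrightarrow> oge Y d n (F - G)"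
  using oge_add[of Y d n F "- G"] v_minus[of Y G] by (cases "G = 0") (auto simp: oge_def od_def)

lemma oge_mult: "Y \<in> YY \<Longrightarrow> F \<in> hom V d \<Longrightarrow> oge Y e n G \<Longrightarrow> oge Y (d + e) n (F * G)"
  using od_nonneg[of Y F d] od_mult[of Y F G d e] by (force simp: oge_def)

text \<open>Constants are forms of degree 0, so both \<open>c\<close> and its inverse have
  nonnegative valuation.\<close>

lemma v_const: "Y \<in> YY \<Longrightarrow> c \<noteq> 0 \<Longrightarrow> v Y (\<iota> c) = 0"
proof -
  assume *: "Y \<in> YY" "c \<noteq> 0"
  have "0 \<le> v Y (\<iota> c)" "0 \<le> v Y (\<iota> (1 / c))" using v_hom[OF *(1) hom_const] * by force+
  moreover have "v Y (\<iota> c) + v Y (\<iota> (1 / c)) = 0"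
    using v_mult[OF *(1), of "\<iota> c" "\<iota> (1 / c)"] * v_one by (simp flip: iota_mult)
  ultimately show ?thesis by linarith
qed

lemma coeff_power_top:
  assumes "hpoly zs m P" "Polynomial.coeff P m \<noteq> 0"
  shows "Polynomial.coeff (P ^ n) (m * n) = Polynomial.coeff P m ^ n"
proof -
  have "Polynomial.degree P = m"
    using assms by (intro antisym degree_le le_degree) (auto simp: hpoly_def)
  moreover from this assms have "P \<noteq> 0" by auto
  then have "Polynomial.degree (P ^ n) = n * m" using calculation by (simp add: degree_power_eq)
  ultimately show ?thesis using lead_coeff_power[of P n] by (simp add: mult.commute)
qed

text \<open>If \<open>a\<close> and \<open>c\<close> vanished along the same divisor, some \<open>a\<^sup>\<beta> / c\<^sup>\<alpha>\<close> would be a unit \<open>s' / s\<close> there;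
  then \<open>c\<^sup>\<alpha>\<^sup>n\<close> divides \<open>\<delta> s\<^sup>n\<close> for all \<open>n\<close>, with a fixed denominator \<open>\<delta>\<close>, because \<open>a\<close> and the monic \<open>c\<close>
  are coprime.\<close>

lemma transversal:
  assumes Y: "Y \<in> YY" and reduces: "reduces V q (zs @ [u])" and ind: "indep (zs @ [u])"
    and P: "hpoly zs m P" "Polynomial.coeff P m = \<iota> l" "l \<noteq> 0"
    and c: "c = poly P u" "od Y m c > 0"
    and a: "a \<in> hom zs p" "a \<noteq> 0"
  shows "od Y p a = 0"
proof (rule ccontr)
  assume "od Y p a \<noteq> 0"
  have ysV: "set (zs @ [u]) \<subseteq> hom V 1" using reduces by (auto simp: reduces_def)
  then have sub: "hom (zs @ [u]) d \<subseteq> hom V d" "hom zs d \<subseteq> hom V d" for d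
    using hom_subset[OF ysV, of d] hom_subset[of zs V d] by simp_all
  have "P \<noteq> 0" using P by auto
  then have c0: "c \<noteq> 0" using hpoly_inj[OF ind P(1)] c by auto
  have cV: "c \<in> hom V m" using hpoly_poly[OF P(1)] c sub by blast
  have aV: "a \<in> hom V p" using a sub by blast
  have apos: "od Y p a > 0" using od_nonneg[OF Y aV a(2)] \<open>od Y p a \<noteq> 0\<close> by linarith
  \<comment> \<open>Exchanging the two orders as exponents gives \<open>a\<close> to the \<beta> and
    \<open>c\<close> to the \<alpha> the same order of vanishing.\<close>
  define \<alpha> where "\<alpha> = nat (od Y p a)"
  define \<beta> where "\<beta> = nat (od Y m c)"
  define A where "A = a ^ \<beta>"
  define C where "C = c ^ \<alpha>"
  have nz: "A \<noteq> 0" "C \<noteq> 0" "xx Y \<noteq> 0" using a c0 xx_nz[OF Y] by (auto simp: A_def C_def)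
  have odA: "od Y (p * \<beta>) A = od Y (m * \<alpha>) C"
    using od_power[OF Y a(2)] od_power[OF Y c0] apos c(2) by (simp add: A_def C_def \<alpha>_def \<beta>_def)
  have odC: "od Y (m * \<alpha>) C \<ge> 1"
    using od_power[OF Y c0, of m \<alpha>] apos c(2) mult_mono[of 1 "od Y p a" 1 "od Y m c"] by (simp add: C_def \<alpha>_def)
  define f where "f = (C * xx Y ^ (p * \<beta>)) / (A * xx Y ^ (m * \<alpha>))"
  have f: "f * (A * xx Y ^ (m * \<alpha>)) = C * xx Y ^ (p * \<beta>)" "f \<noteq> 0" using nz by (auto simp: f_def)
  have "v Y f + v Y (A * xx Y ^ (m * \<alpha>)) = v Y (C * xx Y ^ (p * \<beta>))"
    using v_mult[OF Y f(2), of "A * xx Y ^ (m * \<alpha>)"] f(1) nz by simp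
  then have vf: "v Y f = 0" using odA nz by (simp add: v_mult[OF Y] v_power[OF Y] od_def)
  obtain e F G where FG: "F \<in> hom V e" "G \<in> hom V e" "F \<noteq> 0" "G \<noteq> 0" "f = F / G" "od Y e G = 0"
    using v_frac[OF Y f(2)] vf unfolding od_def by force
  have "v Y (F / G) + v Y G = v Y F" using v_mult[OF Y, of "F / G" G] FG by simp
  then have odF: "od Y e F = 0" using FG vf by (simp add: od_def)
  \<comment> \<open>Neither factor of \<open>s\<close> vanishes on \<open>Y\<close>. The additional
    \<open>xx Y ^ q\<close> moves the powers of \<open>s\<close> and \<open>s'\<close> into degrees
    at least \<open>q\<close>, where the module basis can be applied.\<close>
  define s where "s = F * xx Y ^ (m * \<alpha>) * xx Y ^ q"
  define s' where "s' = G * xx Y ^ (p * \<beta>) * xx Y ^ q"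
  define \<sigma> where "\<sigma> = e + m * \<alpha> + q"
  define \<sigma>' where "\<sigma>' = e + p * \<beta> + q"
  have xp: "xx Y ^ n \<in> hom V n" for n using hom_power[OF xx_hom[OF Y], of n] by simp
  have sV: "s \<in> hom V \<sigma>" "s' \<in> hom V \<sigma>'" unfolding s_def s'_def \<sigma>_def \<sigma>'_def by (intro hom_mult FG xp)+
  have s0: "s \<noteq> 0" using FG nz by (simp add: s_def)
  have ods: "od Y \<sigma> s = 0" unfolding s_def \<sigma>_def using FG nz odF by (simp add: od_mult[OF Y] od_xx[OF Y])
  have sA: "s * A = s' * C"
  proof -
    have "F * (A * xx Y ^ (m * \<alpha>)) = G * (C * xx Y ^ (p * \<beta>))" using f(1) FG by (simp add: field_simps)
    then show ?thesis unfolding s_def s'_def by (simp add: algebra_simps)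
  qed
  obtain B D \<delta> where B: "finite B" "B \<subseteq> hom V q" "\<delta> \<in> hom (zs @ [u]) D" "\<delta> \<noteq> 0"
    "\<And>d h. \<forall>b\<in>B. h b \<in> hom (zs @ [u]) d \<Longrightarrow> (\<Sum>b\<in>B. h b * b) = 0 \<Longrightarrow> \<forall>b\<in>B. h b = 0"
    "\<And>d s. s \<in> hom V (q + d) \<Longrightarrow> \<exists>h. (\<forall>b\<in>B. h b \<in> hom (zs @ [u]) (D + d)) \<and> \<delta> * s = (\<Sum>b\<in>B. h b * b)"
    by (rule reduces_module_basis[OF reduces]) blast
  \<comment> \<open>The order of the fixed form \<delta> would be at least \<open>n\<close> for
    every \<open>n\<close>.\<close>
  have key: "int n \<le> od Y D \<delta>" if n: "n \<ge> 1" for n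
  proof -
    define d d' where "d = \<sigma> * n - q" and "d' = \<sigma>' * n - q"
    have ge: "\<sigma> * n \<ge> m * \<alpha> * n + q" "\<sigma>' * n \<ge> p * \<beta> * n + q"
      using mult_le_mono[OF n order_refl[of q]] by (simp_all add: \<sigma>_def \<sigma>'_def algebra_simps trans_le_add2)
    then have dq: "q + d = \<sigma> * n" "q + d' = \<sigma>' * n" by (auto simp: d_def d'_def)
    have dd: "d + p * \<beta> * n = d' + m * \<alpha> * n" using dq ge unfolding \<sigma>_def \<sigma>'_def by (simp add: algebra_simps)
    obtain h where h: "\<forall>b\<in>B. h b \<in> hom (zs @ [u]) (D + d)" "\<delta> * s ^ n = (\<Sum>b\<in>B. h b * b)"
      using B(6)[of "s ^ n" d] hom_power[OF sV(1), of n] dq by auto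
    obtain h' where h': "\<forall>b\<in>B. h' b \<in> hom (zs @ [u]) (D + d')" "\<delta> * s' ^ n = (\<Sum>b\<in>B. h' b * b)"
      using B(6)[of "s' ^ n" d'] hom_power[OF sV(2), of n] dq by auto
    have An: "A ^ n \<in> hom zs (p * \<beta> * n)" unfolding A_def by (intro hom_power a)
    have An': "A ^ n \<in> hom (zs @ [u]) (p * \<beta> * n)" using An hf_append unfolding hom_def by blast
    have Cn: "C ^ n = poly (P ^ (\<alpha> * n)) u" by (simp add: C_def c(1) poly_power power_mult)
    have Pn: "hpoly zs (m * \<alpha> * n) (P ^ (\<alpha> * n))" using hpoly_power[OF P(1), of "\<alpha> * n"] by (simp add: mult.assoc)
    have Cn': "C ^ n \<in> hom (zs @ [u]) (m * \<alpha> * n)" unfolding Cn using hpoly_poly[OF Pn] .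
    have "(\<Sum>b\<in>B. (A ^ n * h b - C ^ n * h' b) * b) = A ^ n * (\<delta> * s ^ n) - C ^ n * (\<delta> * s' ^ n)"
      unfolding h(2) h'(2) by (simp add: algebra_simps sum_subtractf sum_distrib_left)
    also have "\<dots> = \<delta> * ((s * A) ^ n - (s' * C) ^ n)" by (simp add: algebra_simps power_mult_distrib)
    also have "\<dots> = 0" by (simp add: sA)
    finally have z: "(\<Sum>b\<in>B. (A ^ n * h b - C ^ n * h' b) * b) = 0" .
    have "\<forall>b\<in>B. A ^ n * h b - C ^ n * h' b \<in> hom (zs @ [u]) (p * \<beta> * n + (D + d))"
    proof
      fix b assume b: "b \<in> B"
      have "A ^ n * h b \<in> hom (zs @ [u]) (p * \<beta> * n + (D + d))" using An' h(1) b by (intro hom_mult) auto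
      moreover have "C ^ n * h' b \<in> hom (zs @ [u]) (m * \<alpha> * n + (D + d'))" using Cn' h'(1) b by (intro hom_mult) auto
      moreover have "m * \<alpha> * n + (D + d') = p * \<beta> * n + (D + d)" using dd by simp
      ultimately show "A ^ n * h b - C ^ n * h' b \<in> hom (zs @ [u]) (p * \<beta> * n + (D + d))" by (auto intro: hom_diff)
    qed
    \<comment> \<open>Comparing coefficients over the module basis turns
      \<open>(s * A) ^ n = (s' * C) ^ n\<close> into identities between forms in \<open>zs\<close>
      and \<open>u\<close>, where division by the monic polynomial of \<open>C ^ n\<close> is
      possible.\<close>
    from B(5)[OF this z] have eq: "A ^ n * h b = C ^ n * h' b" if "b \<in> B" for b using that by simp
    have "\<exists>w. w \<in> hom (zs @ [u]) (D + d - m * \<alpha> * n) \<and> h b = C ^ n * w" if b: "b \<in> B" for b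
    proof -
      obtain pv where pv: "hpoly zs (D + d) pv" "poly pv u = h b" using hom_snocE h(1) b by metis
      obtain pw where pw: "hpoly zs (D + d') pw" "poly pw u = h' b" using hom_snocE h'(1) b by metis
      have "hpoly zs (p * \<beta> * n + (D + d)) (Polynomial.smult (A ^ n) pv)" by (rule hpoly_smult[OF An pv(1)])
      moreover have "hpoly zs (p * \<beta> * n + (D + d)) (pw * P ^ (\<alpha> * n))"
        using hpoly_mult[OF pw(1) Pn] dd by (simp add: ac_simps)
      ultimately have "hpoly zs (p * \<beta> * n + (D + d)) (Polynomial.smult (A ^ n) pv - pw * P ^ (\<alpha> * n))" by (rule hpoly_diff)
      moreover have "poly (Polynomial.smult (A ^ n) pv - pw * P ^ (\<alpha> * n)) u = 0"
        using eq[OF b] by (simp add: pv pw Cn[symmetric] del: poly_power)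
      ultimately have "Polynomial.smult (A ^ n) pv = pw * P ^ (\<alpha> * n)" using hpoly_inj[OF ind] by fastforce
      moreover have "Polynomial.coeff (P ^ (\<alpha> * n)) (m * \<alpha> * n) = \<iota> (l ^ (\<alpha> * n))"
        using coeff_power_top[OF P(1), of "\<alpha> * n"] P(2,3) by (simp add: iota_power mult.assoc)
      ultimately obtain Q where Q: "hpoly zs (D + d - m * \<alpha> * n) Q" "pv = P ^ (\<alpha> * n) * Q"
        using hpoly_cancel[OF Pn _ _ pv(1), of "l ^ (\<alpha> * n)" "A ^ n" pw] P(3) nz by auto
      have "h b = C ^ n * poly Q u" using pv(2) by (simp add: Q(2) Cn)
      with hpoly_poly[OF Q(1)] show ?thesis by blast
    qed
    then obtain w where w: "\<And>b. b \<in> B \<Longrightarrow> w b \<in> hom (zs @ [u]) (D + d - m * \<alpha> * n)" "\<And>b. b \<in> B \<Longrightarrow> h b = C ^ n * w b"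
      by metis
    define W where "W = (\<Sum>b\<in>B. w b * b)"
    have dW: "\<delta> * s ^ n = C ^ n * W" unfolding h(2) W_def using w(2) by (simp add: sum_distrib_left mult.assoc)
    have WV: "W \<in> hom V (D + d - m * \<alpha> * n + q)" unfolding W_def
      using w(1) sub B(2) by (intro hom_sum hom_mult) auto
    have W0: "W \<noteq> 0" using dW B(4) s0 by auto
    have "od Y (D + \<sigma> * n) (\<delta> * s ^ n) = od Y D \<delta>"
      using B(4) s0 ods by (simp add: od_mult[OF Y] od_power[OF Y])
    moreover have "D + \<sigma> * n = m * \<alpha> * n + (D + d - m * \<alpha> * n + q)" using dq ge by auto
    then have "od Y (D + \<sigma> * n) (\<delta> * s ^ n) = int n * od Y (m * \<alpha>) C + od Y (D + d - m * \<alpha> * n + q) W"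
      unfolding dW using W0 nz od_mult[OF Y, of "C ^ n" W] od_power[OF Y nz(2), of "m * \<alpha>" n] by simp
    ultimately show ?thesis
      using od_nonneg[OF Y WV W0] odC mult_left_mono[OF odC, of "int n"] by simp
  qed
  from key[of "nat (od Y D \<delta>) + 1"] show False by (simp split: if_splits)
qed

text \<open>A weak approximation statement. A uniformizer at \<open>Y0\<close>, written as a
  fraction of forms, yields a form with order exactly 1 there; products of separating forms vanish
  as much as required on the other divisors and not at all on \<open>Y0\<close>.\<close>

lemma form_with_orders:
  assumes "Y0 \<in> T" "T \<subseteq> YY" "finite T"
  shows "\<exists>d. \<exists>g\<in>hom V d. g \<noteq> 0 \<and> (\<forall>Y\<in>T. int (E Y) \<le> od Y d g) \<and> od Y0 d g = int (E Y0)"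
proof -
  have Y0: "Y0 \<in> YY" using assms by auto
  obtain f where f: "f \<noteq> 0" "v Y0 f = 1" using v_unif[OF Y0] by blast
  then obtain e F G where FG: "F \<in> hom V e" "G \<in> hom V e" "F \<noteq> 0" "G \<noteq> 0" "f = F / G" "od Y0 e G = 0"
    using v_frac[OF Y0 f(1)] unfolding od_def by force
  have "v Y0 (F / G) + v Y0 G = v Y0 F" using v_mult[OF Y0, of "F / G" G] FG by simp
  then have odF: "od Y0 e F = 1" using FG f by (simp add: od_def)
  have "\<exists>d. \<exists>H\<in>hom V d. H \<noteq> 0 \<and> od Y0 d H = 0 \<and> (\<forall>Y\<in>T'. int (E Y) \<le> od Y d H)" if "T' \<subseteq> T - {Y0}" for T'
  proof -
    have "finite T'" by (rule finite_subset[OF that]) (use assms(3) in simp)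
    then show ?thesis using that
  proof (induction T' rule: finite_induct)
    case empty
    show ?case using hom_one od_one[OF Y0] by (intro exI[of _ 0] bexI[of _ 1]) auto
  next
    case (insert Y1 T')
    then obtain d H where H: "H \<in> hom V d" "H \<noteq> 0" "od Y0 d H = 0" "\<forall>Y\<in>T'. int (E Y) \<le> od Y d H" by auto
    have Y1: "Y1 \<in> YY" "Y1 \<noteq> Y0" using insert assms by auto
    obtain d1 H1 where H1: "H1 \<in> hom V d1" "H1 \<noteq> 0" "od Y1 d1 H1 > 0" "od Y0 d1 H1 = 0"
      using v_sep[OF Y0 Y1(1)] Y1(2) unfolding od_def by force
    show ?case
    proof (intro exI bexI conjI ballI)
      show "H * H1 ^ E Y1 \<in> hom V (d + d1 * E Y1)" by (intro hom_mult hom_power H H1)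
      show "H * H1 ^ E Y1 \<noteq> 0" using H H1 by simp
      show "od Y0 (d + d1 * E Y1) (H * H1 ^ E Y1) = 0" using H H1 by (simp add: od_mult[OF Y0] od_power[OF Y0])
      fix Y assume Y: "Y \<in> insert Y1 T'"
      have YY: "Y \<in> YY" using Y insert.prems assms by auto
      have s: "od Y (d + d1 * E Y1) (H * H1 ^ E Y1) = od Y d H + int (E Y1) * od Y d1 H1"
        using H H1 by (simp add: od_mult[OF YY] od_power[OF YY])
      show "int (E Y) \<le> od Y (d + d1 * E Y1) (H * H1 ^ E Y1)"
      proof (cases "Y = Y1")
        case True
        have "int (E Y1) * 1 \<le> int (E Y1) * od Y1 d1 H1" using H1 by (intro mult_left_mono) auto
        then show ?thesis using od_nonneg[OF YY H(1,2)] unfolding s by (simp add: True)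
      next
        case False
        have "0 \<le> int (E Y1) * od Y d1 H1" using od_nonneg[OF YY H1(1,2)] by simp
        with False Y H(4) show ?thesis unfolding s by auto
      qed
    qed
  qed
  qed
  from this[of "T - {Y0}"] obtain d H where H: "H \<in> hom V d" "H \<noteq> 0" "od Y0 d H = 0" "\<forall>Y\<in>T - {Y0}. int (E Y) \<le> od Y d H"
    by auto
  show ?thesis
  proof (intro exI bexI conjI ballI)
    show "H * F ^ E Y0 \<in> hom V (d + e * E Y0)" by (intro hom_mult hom_power H FG)
    show "H * F ^ E Y0 \<noteq> 0" using H FG by simp
    show *: "od Y0 (d + e * E Y0) (H * F ^ E Y0) = int (E Y0)"
      using H FG odF by (simp add: od_mult[OF Y0] od_power[OF Y0])
    fix Y assume Y: "Y \<in> T"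
    have YY: "Y \<in> YY" using Y assms by auto
    have s: "od Y (d + e * E Y0) (H * F ^ E Y0) = od Y d H + int (E Y0) * od Y e F"
        using H FG by (simp add: od_mult[OF YY] od_power[OF YY])
    show "int (E Y) \<le> od Y (d + e * E Y0) (H * F ^ E Y0)"
    proof (cases "Y = Y0")
      case True then show ?thesis using * by simp
    next
      case False
      have "0 \<le> int (E Y0) * od Y e F" using od_nonneg[OF YY FG(1,3)] by simp
      with False Y H(4) show ?thesis unfolding s by force
    qed
  qed
qed

text \<open>Modulo the forms with orders at least \<open>E\<close>, the coordinate ring has rank at
  least the sum of the \<open>E Y\<close> over the forms in \<open>zs\<close>. The hypothesis that
  nonzero forms in \<open>zs\<close> vanish on none of the divisors keeps coefficients from
  contributing to the orders. The bound \<open>m\<close> on the degree \<open>s\<close> serves the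
  later subtraction \<open>l + s - m\<close>.\<close>

lemma independent_chain:
  assumes T: "T \<subseteq> YY" "finite T" and zsV: "set zs \<subseteq> hom V 1"
    and zs: "\<And>Y p a. Y \<in> T \<Longrightarrow> a \<in> hom zs p \<Longrightarrow> a \<noteq> 0 \<Longrightarrow> od Y p a = 0"
    and z: "z \<in> hom zs 1" "z \<noteq> 0"
  shows "(\<Sum>Y\<in>T. E Y) = N \<Longrightarrow> \<exists>s\<ge>m. \<exists>G. (\<forall>j<N. G j \<in> hom V s) \<and>
     (\<forall>l a. (\<forall>j<N. a j \<in> hom zs l) \<longrightarrow> (\<forall>Y\<in>T. oge Y (l + s) (int (E Y)) (\<Sum>j<N. a j * G j)) \<longrightarrow> (\<forall>j<N. a j = 0))"
proof (induction N arbitrary: E)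
  case 0
  then show ?case by auto
next
  case (Suc N)
  have hV: "hom zs d \<subseteq> hom V d" for d using hom_subset[OF zsV] .
  have "\<exists>Y0\<in>T. E Y0 \<noteq> 0"
  proof (rule ccontr)
    assume "\<not> ?thesis"
    then have "(\<Sum>Y\<in>T. E Y) = 0" by simp
    with Suc.prems show False by simp
  qed
  then obtain Y0 where Y0: "Y0 \<in> T" "E Y0 \<noteq> 0" by blast
  \<comment> \<open>One order is given up at \<open>Y0\<close>. A form \<open>g\<close> with orders
    at least \<open>E'\<close>, and exactly \<open>E' Y0\<close> at \<open>Y0\<close>, becomes the
    new member of the chain.\<close>
  define E' where "E' = E(Y0 := E Y0 - 1)"
  have "(\<Sum>Y\<in>T. E' Y) = N"
    using Suc.prems Y0 T(2) by (simp add: E'_def sum.remove[of T Y0])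
  from Suc.IH[OF this] obtain s1 G1 where G1: "s1 \<ge> m" "\<And>j. j < N \<Longrightarrow> G1 j \<in> hom V s1"
    "\<And>l a. (\<forall>j<N. a j \<in> hom zs l) \<Longrightarrow> (\<forall>Y\<in>T. oge Y (l + s1) (int (E' Y)) (\<Sum>j<N. a j * G1 j)) \<Longrightarrow> (\<forall>j<N. a j = 0)"
    by blast
  obtain s2 g where g: "g \<in> hom V s2" "g \<noteq> 0" "\<forall>Y\<in>T. int (E' Y) \<le> od Y s2 g" "od Y0 s2 g = int (E' Y0)"
    using form_with_orders[OF Y0(1) T, of E'] by blast
  \<comment> \<open>Powers of \<open>z\<close>, a form in \<open>zs\<close>, bring all members to
    the common degree \<open>s1 + s2\<close>.\<close>
  define G where "G j = (if j < N then G1 j * z ^ s2 else g * z ^ s1)" for j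
  have zp: "z ^ n \<in> hom zs n" for n using hom_power[OF z(1), of n] by simp
  show ?case
  proof (rule exI[of _ "s1 + s2"], intro conjI, use G1(1) in simp, rule exI[of _ G], intro conjI allI impI)
    fix j assume "j < Suc N"
    have "G1 j * z ^ s2 \<in> hom V (s1 + s2)" if "j < N" using zp hV that G1 by (intro hom_mult) auto
    moreover have "g * z ^ s1 \<in> hom V (s2 + s1)" using zp hV g by (intro hom_mult) auto
    ultimately show "G j \<in> hom V (s1 + s2)" by (simp add: G_def add.commute)
  next
    fix l a j
    assume a: "\<forall>j<Suc N. a j \<in> hom zs l" and ord: "\<forall>Y\<in>T. oge Y (l + (s1 + s2)) (int (E Y)) (\<Sum>j<Suc N. a j * G j)"
      and j: "j < Suc N"
    let ?tot = "\<Sum>j<Suc N. a j * G j"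
    have tot: "?tot = (\<Sum>j<N. (a j * z ^ s2) * G1 j) + (a N * z ^ s1) * g" by (simp add: G_def algebra_simps)
    have "\<forall>j<N. a j * z ^ s2 = 0"
    proof (rule G1(3)[of _ "l + s2"])
      show "\<forall>j<N. a j * z ^ s2 \<in> hom zs (l + s2)" using a zp by (intro allI impI hom_mult) auto
      show "\<forall>Y\<in>T. oge Y (l + s2 + s1) (int (E' Y)) (\<Sum>j<N. a j * z ^ s2 * G1 j)"
      proof
        fix Y assume Y: "Y \<in> T"
        then have YY: "Y \<in> YY" using T by auto
        have "a N * z ^ s1 \<in> hom V (l + s1)" using a zp hV by (intro hom_mult) auto
        then have "oge Y (l + s1 + s2) (int (E' Y)) ((a N * z ^ s1) * g)"
          using g Y by (intro oge_mult YY) (auto simp: oge_def)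
        moreover have "oge Y (l + s1 + s2) (int (E' Y)) ?tot"
          using ord Y by (auto simp: oge_def E'_def add.assoc split: if_splits)
        ultimately have "oge Y (l + s1 + s2) (int (E' Y)) (?tot - (a N * z ^ s1) * g)" by (intro oge_diff YY)
        then show "oge Y (l + s2 + s1) (int (E' Y)) (\<Sum>j<N. a j * z ^ s2 * G1 j)"
          unfolding tot by (simp add: ac_simps)
      qed
    qed
    then have aN: "\<forall>j<N. a j = 0" using z by simp
    \<comment> \<open>What remains is the multiple of \<open>g\<close>, whose order at
      \<open>Y0\<close> is exactly \<open>E Y0 - 1\<close> and hence too small.\<close>
    have "a N = 0"
    proof (rule ccontr)
      assume n0: "a N \<noteq> 0"
      have Y0Y: "Y0 \<in> YY" using Y0 T by auto
      have "a N * z ^ s1 \<in> hom zs (l + s1)" using a zp by (intro hom_mult) auto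
      then have "od Y0 (l + s1) (a N * z ^ s1) = 0" using zs[OF Y0(1)] n0 z by simp
      then have "od Y0 (l + s1 + s2) ((a N * z ^ s1) * g) = int (E' Y0)"
        using n0 z g by (simp add: od_mult[OF Y0Y, of "a N * z ^ s1"])
      moreover have "?tot = (a N * z ^ s1) * g" unfolding tot using aN by simp
      moreover have "oge Y0 (l + s1 + s2) (int (E Y0)) ?tot" using ord Y0 by (simp add: add.assoc)
      ultimately show False using n0 z g Y0(2) by (auto simp: oge_def E'_def)
    qed
    with aN j show "a j = 0" by (auto simp: less_Suc_eq)
  qed
qed

section \<open>Counting dimensions\<close>

lemma dim_pos: "w \<in> hom ys d \<Longrightarrow> w \<noteq> 0 \<Longrightarrow> 1 \<le> kv.dim (hom ys d)"
  using dim_hom_ge[of "{()}" "\<lambda>_. w" ys d] by auto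

lemma hf_point_nonzero:
  assumes "hf ys (Suc d) g f" "f p \<noteq> 0" "length p = length ys" shows "\<exists>k<length ys. p ! k \<noteq> 0"
proof (rule ccontr)
  assume "\<not> ?thesis"
  then have "map ((*) 0) p = p" using assms(3) by (intro nth_equalityI) auto
  with hf_homogeneous[OF assms(1,3), of 0] assms(2) show False by simp
qed

text \<open>By \<open>inj\<close>, the combinations of the \<open>G j\<close> meet the multiples of
  \<open>F\<close> only in zero, and multiplication by \<open>F\<close> is injective. So
  \<open>N\<close> copies of \<open>hom ys l\<close> and one of \<open>hom V (l + s - m)\<close> fit
  side by side into \<open>hom V (l + s)\<close>.\<close>

lemma pair_dim:
  assumes F: "F \<in> hom V m" "F \<noteq> 0"
    and ys: "set ys \<subseteq> hom V 1" and g: "\<And>j. j < N \<Longrightarrow> G j \<in> hom V s" and "m \<le> l + s"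
    and inj: "\<And>a b. \<lbrakk>\<And>j. j < N \<Longrightarrow> a j \<in> hom ys l; b \<in> hom V (l + s - m); (\<Sum>j<N. a j * G j) = F * b\<rbrakk> \<Longrightarrow> (\<forall>j<N. a j = 0)"
  shows "N * kv.dim (hom ys l) + kv.dim (hom V (l + s - m)) \<le> kv.dim (hom V (l + s))"
proof -
  obtain B where B: "B \<subseteq> hom ys l" "finite B" "kv.independent B" "card B = kv.dim (hom ys l)"
    by (rule hom_basis[of ys l])
  obtain B' where B': "B' \<subseteq> hom V (l + s - m)" "finite B'" "kv.independent B'" "card B' = kv.dim (hom V (l + s - m))"
    by (rule hom_basis[of V "l + s - m"])
  define gg :: "((nat \<times> 'k) + 'k) \<Rightarrow> 'k" where "gg i = (case i of Inl (j, b) \<Rightarrow> b * G j | Inr b \<Rightarrow> F * b)" for i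
  have hV: "hom ys d \<subseteq> hom V d" for d using hom_subset[OF ys] .
  have "card (({..<N} \<times> B) <+> B') \<le> kv.dim (hom V (l + s))"
  proof (rule dim_hom_ge[of _ gg])
    fix i assume i: "i \<in> ({..<N} \<times> B) <+> B'"
    have "F * b \<in> hom V (l + s)" if "b \<in> B'" for b
      using hom_mult[OF F(1), of b "l + s - m"] B'(1) that assms(5) by auto
    moreover have "b * G j \<in> hom V (l + s)" if "b \<in> B" "j < N" for b j
      using that B(1) hV g by (intro hom_mult) auto
    ultimately show "gg i \<in> hom V (l + s)" using i by (auto simp: gg_def)
  next
    fix k assume "(\<Sum>i\<in>({..<N} \<times> B) <+> B'. \<iota> (k i) * gg i) = 0"
    then have "(\<Sum>i\<in>{..<N} \<times> B. \<iota> (k (Inl i)) * gg (Inl i)) + (\<Sum>b\<in>B'. \<iota> (k (Inr b)) * gg (Inr b)) = 0"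
      using B(2) B'(2) by (simp add: sum.Plus)
    moreover have "(\<Sum>i\<in>{..<N} \<times> B. \<iota> (k (Inl i)) * gg (Inl i)) = (\<Sum>j<N. \<Sum>b\<in>B. \<iota> (k (Inl (j, b))) * (b * G j))"
      unfolding sum.cartesian_product by (intro sum.cong) (auto simp: gg_def)
    moreover have "(\<Sum>b\<in>B'. \<iota> (k (Inr b)) * gg (Inr b)) = (\<Sum>b\<in>B'. \<iota> (k (Inr b)) * (F * b))" by (simp add: gg_def)
    ultimately have e: "(\<Sum>j<N. (\<Sum>b\<in>B. \<iota> (k (Inl (j, b))) * b) * G j) + F * (\<Sum>b\<in>B'. \<iota> (k (Inr b)) * b) = 0"
      by (simp add: sum_distrib_left sum_distrib_right ac_simps)
    have 1: "\<forall>j<N. (\<Sum>b\<in>B. \<iota> (k (Inl (j, b))) * b) = 0"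
    proof (rule inj)
      show "(\<Sum>b\<in>B. \<iota> (k (Inl (j, b))) * b) \<in> hom ys l" if "j < N" for j
        using B(1) by (intro hom_sum hom_scale) auto
      show "- (\<Sum>b\<in>B'. \<iota> (k (Inr b)) * b) \<in> hom V (l + s - m)"
        using B'(1) by (intro hom_uminus hom_sum hom_scale) auto
      show "(\<Sum>j<N. (\<Sum>b\<in>B. \<iota> (k (Inl (j, b))) * b) * G j) = F * - (\<Sum>b\<in>B'. \<iota> (k (Inr b)) * b)"
        using e by (simp add: eq_neg_iff_add_eq_0)
    qed
    with e F(2) have 2: "(\<Sum>b\<in>B'. \<iota> (k (Inr b)) * b) = 0" by simp
    have "k (Inl (j, b)) = 0" if "j < N" "b \<in> B" for j b
      using indep_sum_zero[OF B(3,2), of "\<lambda>b. k (Inl (j, b))"] 1 that by simp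
    moreover have "k (Inr b) = 0" if "b \<in> B'" for b
      using indep_sum_zero[OF B'(3,2), of "\<lambda>b. k (Inr b)"] 2 that by simp
    ultimately show "\<forall>i\<in>({..<N} \<times> B) <+> B'. k i = 0" by auto
  qed (use B B' in auto)
  then show ?thesis using B B' by (simp add: card_Plus card_cartesian_product)
qed


lemma indep_red: "reduces V q ys \<Longrightarrow> length ys = noether_number V \<Longrightarrow> indep ys"
  unfolding indep_def using reduces_indep by blast

text \<open>A multiple of the \<open>zs\<close> contributes no pure power of \<open>u\<close>, so
  adding it to such a power leaves the polynomial monic up to a constant.\<close>

lemma monic_remainder:
  assumes "r \<in> lincomb (set zs) (hom (zs @ [u]) d)"
  shows "\<exists>p. hpoly zs (Suc d) p \<and> Polynomial.coeff p (Suc d) = 0 \<and> poly p u = r"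
proof -
  let ?U = "{r. \<exists>p. hpoly zs (Suc d) p \<and> Polynomial.coeff p (Suc d) = 0 \<and> poly p u = r}"
  have "lincomb (set zs) (hom (zs @ [u]) d) \<subseteq> ?U"
  proof (rule lincomb_subset)
    fix x h assume x: "x \<in> set zs" and "h \<in> hom (zs @ [u]) d"
    then obtain p where p: "hpoly zs d p" "poly p u = h" using hom_snocE by metis
    have "x \<in> hom zs 1" using x hom_var by (metis in_set_conv_nth)
    from hpoly_smult[OF this p(1)] p show "x * h \<in> ?U"
      by (intro CollectI exI[of _ "Polynomial.smult x p"]) (auto simp: hpoly_def)
  next
    have "hpoly zs (Suc d) (Polynomial.smult (\<iota> c) p)" if "hpoly zs (Suc d) p" for c p
      using hpoly_smult[OF hom_const that, of c] by simp
    then show "kv.subspace ?U" unfolding kv.subspace_def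
    proof (intro conjI ballI allI, goal_cases)
      case 1 show ?case by (intro CollectI exI[of _ 0]) auto
    next
      case (2 x y)
      then obtain p p' where "hpoly zs (Suc d) p" "Polynomial.coeff p (Suc d) = 0" "poly p u = x"
        "hpoly zs (Suc d) p'" "Polynomial.coeff p' (Suc d) = 0" "poly p' u = y" by blast
      then show ?case by (intro CollectI exI[of _ "p + p'"]) (auto intro: hpoly_add)
    next
      case (3 c x)
      then obtain p where "hpoly zs (Suc d) p" "Polynomial.coeff p (Suc d) = 0" "poly p u = x" by blast
      with 3(1)[of p c] show ?case by (intro CollectI exI[of _ "Polynomial.smult (\<iota> c) p"]) auto
    qed
  qed
  with assms show ?thesis by blast
qed

text \<open>Otherwise a power of a nonzero coordinate would lie in the zero ideal.\<close>

lemma reduces_nonempty: "reduces V q ys \<Longrightarrow> ys \<noteq> []"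
proof
  assume *: "reduces V q ys" "ys = []"
  obtain x where x: "x \<in> set V" "x \<noteq> 0" using V_nz by blast
  then have "x \<in> hom V 1" using hom_var by (metis in_set_conv_nth)
  from hom_power[OF this, of "Suc q"] have "x ^ Suc q \<in> lincomb {} (hom V q)" using * by (auto simp: reduces_def)
  with x show False by (simp add: lincomb_def)
qed

text \<open>Replaces the norm of \<open>F\<close>. If no nonzero form in \<open>ys\<close> were a
  multiple of \<open>F\<close>, then \<open>hom ys (l + m)\<close> and \<open>F * hom V l\<close>
  would be independent in \<open>hom V (l + m)\<close>. Summed over \<open>l\<close>, this makes the
  Hilbert function of \<open>V\<close> grow faster than generation over the forms in
  \<open>ys\<close> permits.\<close>

lemma multiple_in_subring:
  assumes reduces: "reduces V q ys" and len: "length ys = noether_number V" and F: "F \<in> hom V m" "F \<noteq> 0"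
  shows "\<exists>\<gamma>\<ge>m. \<exists>c\<in>hom ys \<gamma>. c \<noteq> 0 \<and> (\<exists>g\<in>hom V (\<gamma> - m). c = F * g)"
proof (rule ccontr)
  assume no: "\<not> ?thesis"
  have ind: "indep ys" using reduces len by (rule indep_red)
  have ysV: "set ys \<subseteq> hom V 1" using reduces by (simp add: reduces_def)
  obtain y where y: "y \<in> set ys" using reduces_nonempty[OF reduces] by (cases ys) auto
  have y0: "y \<noteq> 0" using ind y by (rule indep_nonzero)
  have y1: "y \<in> hom ys 1" using y hom_var by (metis in_set_conv_nth)
  have yp: "y ^ n \<in> hom ys n" "y ^ n \<in> hom V n" for n
    using hom_power[OF y1, of n] hom_power[OF subsetD[OF ysV y], of n] by simp_all
  define a where "a l = kv.dim (hom ys l)" for l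
  define h where "h l = kv.dim (hom V l)" for l
  have amono: "a d \<le> a (d + e)" for d e unfolding a_def by (rule dim_hom_mono[OF yp(1)]) (use y0 in simp)
  have hmono: "h d \<le> h (d + e)" for d e unfolding h_def by (rule dim_hom_mono[OF yp(2)]) (use y0 in simp)
  have a1: "1 \<le> a l" for l unfolding a_def by (rule dim_pos[OF yp(1)]) (use y0 in simp)
  have step: "a (l + m) + h l \<le> h (l + m)" for l
  proof -
    have "1 * kv.dim (hom ys (l + m)) + kv.dim (hom V (l + m + 0 - m)) \<le> kv.dim (hom V (l + m + 0))"
    proof (rule pair_dim[OF F ysV, where G = "\<lambda>_. 1"])
      show "1 \<in> hom V 0" by (rule hom_one)
    next
      fix a :: "nat \<Rightarrow> 'k" and b assume *: "\<And>j. j < 1 \<Longrightarrow> a j \<in> hom ys (l + m)" "b \<in> hom V (l + m + 0 - m)" "(\<Sum>j<1. a j * 1) = F * b"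
      have "a 0 \<in> hom ys (l + m)" using *(1) by simp
      moreover have "a 0 = F * b" "b \<in> hom V (l + m - m)" using * by auto
      ultimately have "a 0 = 0" using no by (metis le_add2)
      then show "\<forall>j<1. a j = (0::'k)" by simp
    qed simp
    then show ?thesis by (simp add: a_def h_def)
  qed
  \<comment> \<open>The factor \<open>m\<close> counts the boundary terms of the telescoping sum,
    \<open>h q\<close> comes from \<open>dim_red_le\<close> and 2 from the doubling lemma.\<close>
  define K where "K = 2 * m * h q"
  obtain L0 where L0: "L0 \<ge> q + m" "a (L0 + K) \<le> 2 * a L0"
    using subexponential_doubling[of a "length ys" "q + m" K] dim_hom_le a1 unfolding a_def by auto
  define L where "L = L0 - m + K"
  have Lm: "L + m = L0 + K" using L0 by (simp add: L_def)
  have "(\<Sum>l\<le>L. a (l + m)) + (\<Sum>l\<le>L. h l) \<le> (\<Sum>l\<le>L. h (l + m))"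
    unfolding sum.distrib[symmetric] by (intro sum_mono step)
  also have "\<dots> \<le> (\<Sum>l\<le>L. h (l + m - m)) + m * h (L + m)" using hmono[of _ 1] by (intro telescope_bound) auto
  finally have "(\<Sum>l\<le>L. a (l + m)) \<le> m * h (L + m)" by simp
  also have "h (L + m) \<le> h q * a (L0 + K - q)"
    using dim_red_le[OF reduces, of "L0 + K - q"] L0 unfolding Lm h_def a_def by simp
  also have "a (L0 + K - q) \<le> a (L0 + K)" using amono[of "L0 + K - q" q] L0 by simp
  also have "\<dots> \<le> 2 * a L0" by (rule L0)
  finally have 1: "(\<Sum>l\<le>L. a (l + m)) \<le> K * a L0" by (simp add: K_def ac_simps)
  \<comment> \<open>The sum contains \<open>K + 1\<close> terms that are at least
    \<open>a L0\<close>, one more than the upper bound allows.\<close>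
  have "(\<Sum>l\<in>{L0 - m..L0 - m + K}. a L0) \<le> (\<Sum>l\<in>{L0 - m..L0 - m + K}. a (l + m))"
  proof (rule sum_mono)
    fix l assume "l \<in> {L0 - m..L0 - m + K}"
    then have "L0 + (l + m - L0) = l + m" by auto
    then show "a L0 \<le> a (l + m)" using amono[of L0 "l + m - L0"] by simp
  qed
  also have "\<dots> \<le> (\<Sum>l\<le>L. a (l + m))" by (rule sum_mono2) (auto simp: L_def)
  finally have "(K + 1) * a L0 \<le> K * a L0" using 1 by simp
  with a1[of L0] show False by simp
qed

text \<open>A multiple of \<open>F\<close> that is a form in the Noether normalization is made monic
  in \<open>u\<close>. By transversality, forms in the remaining \<open>zs\<close> vanish on none of
  the zero divisors of \<open>F\<close>, so the chain has one member for each unit of total order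
  \<open>N\<close>. Then \<open>N\<close> copies of the Hilbert function of \<open>zs\<close> fit
  into the Hilbert function of \<open>V\<close> modulo \<open>F\<close>; summation over the degree
  bounds \<open>N\<close> by a multiple of \<open>m\<close>.\<close>

theorem bezout:
  "\<exists>C::nat. \<forall>m F T. F \<in> hom V m \<longrightarrow> F \<noteq> 0 \<longrightarrow> finite T \<longrightarrow> T \<subseteq> YY \<longrightarrow> (\<Sum>Y\<in>T. od Y m F) \<le> int C * int m"
proof -
  obtain q ys where ys: "length ys = noether_number V" "reduces V q ys" using reduces_noether_number by blast
  define h where "h l = kv.dim (hom V l)" for l
  have "(\<Sum>Y\<in>T. od Y m F) \<le> int (2 * h q) * int m" if F: "F \<in> hom V m" "F \<noteq> 0" and T: "finite T" "T \<subseteq> YY" for m F T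
  proof -
    \<comment> \<open>Only divisors with positive order contribute, and transversality needs this
      positivity.\<close>
    define T' where "T' = {Y\<in>T. od Y m F > 0}"
    have T': "T' \<subseteq> YY" "finite T'" using T by (auto simp: T'_def)
    define E where "E Y = nat (od Y m F)" for Y
    define N where "N = (\<Sum>Y\<in>T'. E Y)"
    have "(\<Sum>Y\<in>T. od Y m F) = (\<Sum>Y\<in>T'. od Y m F)"
      using T od_nonneg[OF _ F] by (intro sum.mono_neutral_right) (force simp: T'_def)+
    also have "\<dots> = int N" unfolding N_def of_nat_sum by (intro sum.cong) (auto simp: E_def T'_def)
    finally have sN: "(\<Sum>Y\<in>T. od Y m F) = int N" .
    have "N \<le> 2 * h q * m"
    proof (cases "T' = {}")
      case True then show ?thesis by (simp add: N_def)
    next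
      case False
      then obtain Y1 where Y1: "Y1 \<in> T'" by blast
      have m1: "m \<noteq> 0"
      proof
        assume m: "m = 0"
        then obtain e where "F = \<iota> e" using hom_0D F by blast
        with F v_const[of Y1 e] Y1 T' m show False by (auto simp: T'_def od_def)
      qed
      obtain \<gamma> c g where c: "\<gamma> \<ge> m" "c \<in> hom ys \<gamma>" "c \<noteq> 0" "g \<in> hom V (\<gamma> - m)" "c = F * g"
        using multiple_in_subring[OF ys(2,1) F] by blast
      have odc: "od Y \<gamma> c > 0" if "Y \<in> T'" for Y
      proof -
        have YY: "Y \<in> YY" using that T' by blast
        have "g \<noteq> 0" using c by auto
        then have "od Y (m + (\<gamma> - m)) c = od Y m F + od Y (\<gamma> - m) g" unfolding c(5) by (intro od_mult YY F)
        moreover have "od Y (\<gamma> - m) g \<ge> 0" using \<open>g \<noteq> 0\<close> c(4) by (intro od_nonneg[OF YY])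
        ultimately show ?thesis using that c(1) by (simp add: T'_def)
      qed
      obtain \<gamma>' where \<gamma>': "\<gamma> = Suc \<gamma>'" using c(1) m1 by (cases \<gamma>) auto
      obtain f where f: "hf ys (Suc \<gamma>') c f" using c(2) unfolding \<gamma>' hom_def by blast
      obtain p where p: "length p = length ys" "f p \<noteq> 0" using hf_vanish[OF f] c(3) by blast
      obtain k where k: "k < length ys" "p ! k \<noteq> 0" using hf_point_nonzero[OF f p(2,1)] by blast
      obtain zs u where zu: "Suc (length zs) = length ys" "set (zs @ [u]) \<subseteq> hom ys 1" "set ys \<subseteq> hom (zs @ [u]) 1"
        "\<And>d g f. hf ys (Suc d) g f \<Longrightarrow> g - \<iota> (f p) * u ^ Suc d \<in> lincomb (set zs) (hom ys d)"
        "\<And>A. kv.subspace A \<Longrightarrow> lincomb (set ys) A \<subseteq> lincomb (set (zs @ [u])) A"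
        by (rule coordinate_change[OF p(1) k]) blast
      have ysV: "set ys \<subseteq> hom V 1" using ys(2) by (simp add: reduces_def)
      have reduces: "reduces V q (zs @ [u])" unfolding reduces_def
        using zu(2) hom_subset[OF ysV, of 1] zu(5)[OF subspace_hom, of V q] ys(2) by (auto simp: reduces_def)
      have zsV: "set zs \<subseteq> hom V 1" using reduces by (simp add: reduces_def)
      have ind: "indep (zs @ [u])" using reduces zu(1) ys(1) by (intro indep_red[of q]) auto
      \<comment> \<open>The coordinates are adapted to a point where \<open>c\<close> does not
        vanish, so the power of \<open>u\<close> has a nonzero constant coefficient.\<close>
      have "c - \<iota> (f p) * u ^ Suc \<gamma>' \<in> lincomb (set zs) (hom (zs @ [u]) \<gamma>')"
        using zu(4)[OF f] lincomb_mono[OF order_refl hom_subset[OF zu(3)]] by blast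
      from monic_remainder[OF this] obtain r where r: "hpoly zs \<gamma> r" "Polynomial.coeff r \<gamma> = 0"
        "poly r u = c - \<iota> (f p) * u ^ \<gamma>" unfolding \<gamma>' by blast
      define P where "P = Polynomial.monom (\<iota> (f p)) \<gamma> + r"
      have P: "hpoly zs \<gamma> P" "Polynomial.coeff P \<gamma> = \<iota> (f p)" "c = poly P u"
        unfolding P_def using r hom_const by (auto intro!: hpoly_add hpoly_monom simp: poly_monom)
      \<comment> \<open>With no further variable, \<open>c\<close> would be a multiple of a power of
        \<open>u\<close>, so \<open>u\<close> would vanish on \<open>Y1\<close>. But then every form
        of degree \<open>q + 1\<close> is a multiple of \<open>u\<close> and vanishes there,
        including the power of \<open>xx Y1\<close>. Geometrically, the variety is a point and has
        no prime divisors.\<close>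
      have "zs \<noteq> []"
      proof
        assume zs: "zs = []"
        have Y1Y: "Y1 \<in> YY" using Y1 T' by blast
        have "P = Polynomial.monom (\<iota> (f p)) \<gamma>"
        proof -
          have "Polynomial.coeff r i = 0" for i
          proof (cases "i < \<gamma>")
            case True
            then have "Polynomial.coeff r i \<in> hom [] (Suc (\<gamma> - i - 1))" using hpoly_coeff[OF r(1), of i] zs by (simp add: Suc_diff_Suc)
            from hom_SucD[OF this] show ?thesis by simp
          next
            case False with r show ?thesis by (cases "i = \<gamma>") (auto simp: hpoly_def)
          qed
          then have "r = 0" by (intro poly_eqI) simp
          then show ?thesis by (simp add: P_def)
        qed
        then have cu: "c = \<iota> (f p) * u ^ \<gamma>" using P(3) by (simp add: poly_monom)
        have u0: "u \<noteq> 0" using indep_last_nonzero[OF ind] .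
        have "od Y1 (0 + 1 * \<gamma>) c = int \<gamma> * od Y1 1 u"
          unfolding cu using p(2) u0 v_const[OF Y1Y p(2)] by (simp add: od_def v_mult[OF Y1Y] v_power[OF Y1Y] algebra_simps)
        then have ou: "od Y1 1 u \<ge> 1" using odc[OF Y1] zero_less_mult_iff[of "int \<gamma>" "od Y1 1 u"] by simp
        have xp: "xx Y1 ^ n \<in> hom V n" for n using hom_power[OF xx_hom[OF Y1Y], of n] by simp
        have "xx Y1 ^ Suc q \<in> lincomb (insert u {}) (hom V q)" using xp[of "Suc q"] reduces zs by (auto simp: reduces_def)
        from lincomb_insert[OF subspace_hom this] obtain b where b: "b \<in> hom V q" "xx Y1 ^ Suc q = u * b"
          by (auto simp: lincomb_def)
        have "b \<noteq> 0" using b xx_nz[OF Y1Y] by auto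
        then have "od Y1 (1 + q) (u * b) = od Y1 1 u + od Y1 q b" by (intro od_mult Y1Y u0)
        then have "od Y1 (1 + q) (xx Y1 ^ Suc q) \<ge> 1"
          unfolding b(2) using ou od_nonneg[OF Y1Y b(1) \<open>b \<noteq> 0\<close>] by linarith
        with od_xx[OF Y1Y, of "Suc q"] show False by simp
      qed
      then obtain z where z: "z \<in> set zs" by (cases zs) auto
      have z0: "z \<noteq> 0" using ind by (rule indep_nonzero) (use z in simp)
      have z1: "z \<in> hom zs 1" using z hom_var by (metis in_set_conv_nth)
      have tr: "od Y l a = 0" if "Y \<in> T'" "a \<in> hom zs l" "a \<noteq> 0" for Y l a
        using transversal[OF _ reduces ind P(1,2) p(2) P(3) odc[OF that(1)] that(2,3)] that(1) T' by blast
      have "(\<Sum>Y\<in>T'. E Y) = N" by (simp add: N_def)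
      from independent_chain[OF T' zsV tr z1 z0 this, of m] obtain s G where G: "s \<ge> m" "\<forall>j<N. G j \<in> hom V s"
        "\<And>l a. (\<forall>j<N. a j \<in> hom zs l) \<Longrightarrow> (\<forall>Y\<in>T'. oge Y (l + s) (int (E Y)) (\<Sum>j<N. a j * G j)) \<Longrightarrow> (\<forall>j<N. a j = 0)"
        by blast
      define a' where "a' l = kv.dim (hom zs l)" for l
      define a where "a l = kv.dim (hom (zs @ [u]) l)" for l
      have step: "N * a' l + h (l + s - m) \<le> h (l + s)" for l
        unfolding a'_def h_def
      proof (rule pair_dim[OF F zsV])
        fix x b assume *: "\<And>j. j < N \<Longrightarrow> x j \<in> hom zs l" "b \<in> hom V (l + s - m)" "(\<Sum>j<N. x j * G j) = F * b"
        show "\<forall>j<N. x j = 0"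
        proof (rule G(3))
          show "\<forall>Y\<in>T'. oge Y (l + s) (int (E Y)) (\<Sum>j<N. x j * G j)"
          proof
            fix Y assume Y: "Y \<in> T'"
            have YY: "Y \<in> YY" using Y T' by blast
            have "od Y (m + (l + s - m)) (F * b) \<ge> od Y m F" if "b \<noteq> 0"
              using that F od_nonneg[OF YY *(2)] by (simp add: od_mult[OF YY])
            then show "oge Y (l + s) (int (E Y)) (\<Sum>j<N. x j * G j)"
              unfolding *(3) oge_def using G(1) Y by (auto simp: E_def T'_def)
          qed
        qed (use * in blast)
      qed (use G in auto)
      have u0: "u \<noteq> 0" using indep_last_nonzero[OF ind] .
      have u1: "u \<in> hom (zs @ [u]) 1" using hom_var[of "length zs" "zs @ [u]"] by (simp add: nth_append)
      have up: "u ^ n \<in> hom (zs @ [u]) n" "u ^ n \<in> hom V n" for n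
        using hom_power[OF u1, of n] hom_power[of u V 1 n] reduces by (auto simp: reduces_def)
      have amono: "a d \<le> a (d + e)" for d e unfolding a_def by (rule dim_hom_mono[OF up(1)]) (use u0 in simp)
      have hmono: "h d \<le> h (d + e)" for d e unfolding h_def by (rule dim_hom_mono[OF up(2)]) (use u0 in simp)
      have a1: "1 \<le> a l" for l unfolding a_def by (rule dim_pos[OF up(1)]) (use u0 in simp)
      obtain L where L: "L \<ge> q" "a (L + s) \<le> 2 * a L"
        using subexponential_doubling[of a "length (zs @ [u])" q s] dim_hom_le[of "zs @ [u]"] a1 unfolding a_def by blast
      have "N * (\<Sum>l\<le>L. a' l) + (\<Sum>l\<le>L. h (l + s - m)) \<le> (\<Sum>l\<le>L. h (l + s))"
        unfolding sum_distrib_left sum.distrib[symmetric] by (intro sum_mono step)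
      also have "\<dots> \<le> (\<Sum>l\<le>L. h (l + s - m)) + m * h (L + s)"
        using hmono[of _ 1] G(1) by (intro telescope_bound) auto
      finally have "N * (\<Sum>l\<le>L. a' l) \<le> m * h (L + s)" by simp
      \<comment> \<open>Summing the Hilbert function of \<open>zs\<close> yields at least that of
        \<open>zs @ [u]\<close>, which also bounds the Hilbert function of \<open>V\<close>; the
        common factor \<open>a L\<close> cancels in the end.\<close>
      moreover have "N * a L \<le> N * (\<Sum>l\<le>L. a' l)" unfolding a_def a'_def by (intro mult_le_mono dim_snoc_le order_refl)
      moreover have "h (L + s) \<le> h q * (2 * a L)"
      proof -
        have "h (L + s) \<le> h q * a (L + s - q)"
          using dim_red_le[OF reduces, of "L + s - q"] L(1) unfolding h_def a_def by simp
        also have "a (L + s - q) \<le> a (L + s)" using amono[of "L + s - q" q] L(1) by simp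
        also have "\<dots> \<le> 2 * a L" by (rule L)
        finally show ?thesis by simp
      qed
      then have "m * h (L + s) \<le> (2 * h q * m) * a L" using mult_le_mono2[of "h (L + s)" _ m] by (simp add: ac_simps)
      ultimately have "N * a L \<le> (2 * h q * m) * a L" by linarith
      then show ?thesis using a1[of L] by simp
    qed
    then have "int N \<le> int (2 * h q * m)" by (rule of_nat_mono)
    with sN show ?thesis by (simp only: of_nat_mult)
  qed
  then show ?thesis by blast
qed

end

section \<open>Noetherian subrings of a field\<close>

text \<open>Subrings are sets rather than types, because the charts and the local rings along
  different divisors are all subsets of one field and are compared there.\<close>

definition subrng :: "'a::comm_ring_1 set \<Rightarrow> bool" where
  "subrng B \<longleftrightarrow> 1 \<in> B \<and> (\<forall>x\<in>B. \<forall>y\<in>B. x - y \<in> B \<and> x * y \<in> B)"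

definition sideal :: "'a::comm_ring_1 set \<Rightarrow> 'a set \<Rightarrow> bool" where
  "sideal B I \<longleftrightarrow> I \<subseteq> B \<and> 0 \<in> I \<and> (\<forall>x\<in>I. \<forall>y\<in>I. x + y \<in> I) \<and> (\<forall>b\<in>B. \<forall>x\<in>I. b * x \<in> I)"

definition sprime :: "'a::comm_ring_1 set \<Rightarrow> 'a set \<Rightarrow> bool" where
  "sprime B P \<longleftrightarrow> sideal B P \<and> 1 \<notin> P \<and> (\<forall>x\<in>B. \<forall>y\<in>B. x * y \<in> P \<longrightarrow> x \<in> P \<or> y \<in> P)"

definition noetherian :: "'a::comm_ring_1 set \<Rightarrow> bool" where
  "noetherian B \<longleftrightarrow> (\<forall>I. sideal B I \<longrightarrow> (\<exists>M. finite M \<and> M \<subseteq> I \<and> (\<forall>J. sideal B J \<longrightarrow> M \<subseteq> J \<longrightarrow> I \<subseteq> J)))"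

lemma subrng_1: "subrng B \<Longrightarrow> 1 \<in> B" by (simp add: subrng_def)
lemma subrng_diff: "subrng B \<Longrightarrow> x \<in> B \<Longrightarrow> y \<in> B \<Longrightarrow> x - y \<in> B" by (simp add: subrng_def)
lemma subrng_mult: "subrng B \<Longrightarrow> x \<in> B \<Longrightarrow> y \<in> B \<Longrightarrow> x * y \<in> B" by (simp add: subrng_def)
lemma subrng_0: "subrng B \<Longrightarrow> 0 \<in> B" by (metis subrng_1 subrng_diff diff_self)
lemma subrng_neg: "subrng B \<Longrightarrow> x \<in> B \<Longrightarrow> - x \<in> B" by (metis subrng_0 subrng_diff diff_0)
lemma subrng_add: "subrng B \<Longrightarrow> x \<in> B \<Longrightarrow> y \<in> B \<Longrightarrow> x + y \<in> B" by (metis subrng_neg subrng_diff diff_minus_eq_add)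
lemma subrng_power: "subrng B \<Longrightarrow> x \<in> B \<Longrightarrow> x ^ n \<in> B" by (induction n) (auto intro: subrng_1 subrng_mult)
lemma subrng_sum: "subrng B \<Longrightarrow> (\<And>i. i \<in> A \<Longrightarrow> f i \<in> B) \<Longrightarrow> (\<Sum>i\<in>A. f i) \<in> B"
  by (induction A rule: infinite_finite_induct) (auto intro: subrng_0 subrng_add)

lemmas subrng_simps = subrng_1 subrng_diff subrng_mult subrng_0 subrng_neg subrng_add subrng_power

lemma sideal_subset: "sideal B I \<Longrightarrow> x \<in> I \<Longrightarrow> x \<in> B" by (auto simp: sideal_def)
lemma sideal_0: "sideal B I \<Longrightarrow> 0 \<in> I" by (auto simp: sideal_def)
lemma sideal_add: "sideal B I \<Longrightarrow> x \<in> I \<Longrightarrow> y \<in> I \<Longrightarrow> x + y \<in> I" by (auto simp: sideal_def)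
lemma sideal_mult: "sideal B I \<Longrightarrow> b \<in> B \<Longrightarrow> x \<in> I \<Longrightarrow> b * x \<in> I" by (auto simp: sideal_def)
lemma sideal_neg: "subrng B \<Longrightarrow> sideal B I \<Longrightarrow> x \<in> I \<Longrightarrow> - x \<in> I"
  by (metis mult_minus1 sideal_mult subrng_1 subrng_neg)
lemma sideal_diff: "subrng B \<Longrightarrow> sideal B I \<Longrightarrow> x \<in> I \<Longrightarrow> y \<in> I \<Longrightarrow> x - y \<in> I"
  by (metis sideal_add sideal_neg diff_conv_add_uminus)
lemma sideal_sum: "sideal B I \<Longrightarrow> (\<And>i. i \<in> A \<Longrightarrow> f i \<in> I) \<Longrightarrow> (\<Sum>i\<in>A. f i) \<in> I"
  by (induction A rule: infinite_finite_induct) (auto intro: sideal_0 sideal_add)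

lemma sprime_ideal: "sprime B P \<Longrightarrow> sideal B P" by (simp add: sprime_def)
lemma sprime_mult: "sprime B P \<Longrightarrow> x \<in> B \<Longrightarrow> y \<in> B \<Longrightarrow> x * y \<in> P \<Longrightarrow> x \<in> P \<or> y \<in> P" by (simp add: sprime_def)
lemma sprime_power: "subrng B \<Longrightarrow> sprime B P \<Longrightarrow> x \<in> B \<Longrightarrow> x ^ n \<in> P \<Longrightarrow> x \<in> P"
proof (induction n)
  case (Suc n)
  from sprime_mult[of B P x "x ^ n"] Suc subrng_power[of B x n] show ?case by auto
qed (simp add: sprime_def)

lemma sideal_Union_chain:
  assumes "C \<noteq> {}" "\<And>I. I \<in> C \<Longrightarrow> sideal B I" "\<And>I J. I \<in> C \<Longrightarrow> J \<in> C \<Longrightarrow> I \<subseteq> J \<or> J \<subseteq> I"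
  shows "sideal B (\<Union>C)"
  unfolding sideal_def
proof (intro conjI ballI)
  fix x y assume "x \<in> \<Union>C" "y \<in> \<Union>C"
  then obtain I J where "I \<in> C" "J \<in> C" "x \<in> I" "y \<in> J" by blast
  with assms(3)[of I J] have "\<exists>K\<in>C. x \<in> K \<and> y \<in> K" by blast
  then show "x + y \<in> \<Union>C" using assms(2) sideal_add by blast
next
  show "0 \<in> \<Union>C" using assms(1,2) sideal_0 by blast
next
  fix b x assume "b \<in> B" "x \<in> \<Union>C"
  then show "b * x \<in> \<Union>C" using assms(2) sideal_mult by blast
next
  show "\<Union>C \<subseteq> B"
  proof (rule Union_least)
    fix I assume "I \<in> C" from assms(2)[OF this] show "I \<subseteq> B" by (simp add: sideal_def)
  qed
qed

lemma finite_subset_chain: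
  assumes "finite M" "M \<subseteq> \<Union>C" "C \<noteq> {}" "\<And>I J. I \<in> C \<Longrightarrow> J \<in> C \<Longrightarrow> I \<subseteq> J \<or> J \<subseteq> I"
  shows "\<exists>I\<in>C. M \<subseteq> I"
  using assms(1,2)
proof (induction M rule: finite_induct)
  case empty then show ?case using assms(3) by blast
next
  case (insert x M)
  from insert.prems obtain J where J: "J \<in> C" "x \<in> J" by blast
  from insert obtain I where I: "I \<in> C" "M \<subseteq> I" by auto
  from assms(4)[OF I(1) J(1)] show ?case
  proof
    assume "I \<subseteq> J" with I J show ?thesis by (intro bexI[of _ J]) auto
  next
    assume "J \<subseteq> I" with I J show ?thesis by (intro bexI[of _ I]) auto
  qed
qed

lemma noethE:
  assumes "noetherian B" "sideal B I"
  obtains M where "finite M" "M \<subseteq> I" "\<And>J. sideal B J \<Longrightarrow> M \<subseteq> J \<Longrightarrow> I \<subseteq> J"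
proof -
  from assms(1)[unfolded noetherian_def, rule_format, OF assms(2)]
  obtain M where "finite M \<and> M \<subseteq> I \<and> (\<forall>J. sideal B J \<longrightarrow> M \<subseteq> J \<longrightarrow> I \<subseteq> J)" by (rule exE)
  then show thesis by (intro that[of M]) auto
qed

lemma noetherian_chain:
  assumes "noetherian B" "C \<noteq> {}" "\<And>I. I \<in> C \<Longrightarrow> sideal B I" "\<And>I J. I \<in> C \<Longrightarrow> J \<in> C \<Longrightarrow> I \<subseteq> J \<or> J \<subseteq> I"
  shows "\<exists>I\<in>C. \<Union>C \<subseteq> I"
proof -
  have "sideal B (\<Union>C)" by (rule sideal_Union_chain) (use assms in auto)
  then obtain M where M: "finite M" "M \<subseteq> \<Union>C" "\<And>J. sideal B J \<Longrightarrow> M \<subseteq> J \<Longrightarrow> \<Union>C \<subseteq> J"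
    using noethE[OF assms(1)] by metis
  from finite_subset_chain[OF M(1,2) assms(2,4)] obtain I where "I \<in> C" "M \<subseteq> I" by auto
  with M(3) assms(3) show ?thesis by blast
qed

lemma noetherian_max:
  assumes "noetherian B" "F \<noteq> {}" "\<And>I. I \<in> F \<Longrightarrow> sideal B I"
  shows "\<exists>I\<in>F. \<forall>J\<in>F. I \<subseteq> J \<longrightarrow> J = I"
proof (rule subset_Zorn_nonempty)
  fix C assume C: "C \<noteq> {}" "subset.chain F C"
  then have CF: "C \<subseteq> F" and ch: "\<And>I J. I \<in> C \<Longrightarrow> J \<in> C \<Longrightarrow> I \<subseteq> J \<or> J \<subseteq> I"
    by (auto simp: subset_chain_def)
  obtain I where "I \<in> C" "\<Union>C \<subseteq> I" using noetherian_chain[OF assms(1) C(1) _ ch] CF assms(3) by blast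
  then have "\<Union>C = I" by blast
  with \<open>I \<in> C\<close> CF show "\<Union>C \<in> F" by auto
qed (rule assms(2))

lemma noetherian_sequence:
  assumes "noetherian B" "\<And>n. sideal B (I n)" "\<And>n. I n \<subseteq> I (Suc n)"
  shows "\<exists>N. \<forall>n. I n \<subseteq> I N"
proof -
  have "I m \<subseteq> I n \<or> I n \<subseteq> I m" for m n using lift_Suc_mono_le[of I, OF assms(3)] by (meson nat_le_linear)
  then have "\<exists>J\<in>range I. \<Union>(range I) \<subseteq> J" by (intro noetherian_chain[OF assms(1)]) (auto simp: assms(2))
  then obtain N where "\<Union>(range I) \<subseteq> I N" by auto
  then show ?thesis by (intro exI[of _ N]) auto
qed

text \<open>An ideal maximal among those that contain \<open>I\<close> and miss the powers of
  \<open>g\<close> is prime. Maximality also gives the last property: modulo \<open>P\<close>,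
  inverting \<open>g\<close> inverts every nonzero element. The Nullstellensatz rests on it.\<close>

lemma noetherian_prime_avoiding:
  assumes B: "subrng B" "noetherian B" and I: "sideal B I" and g: "g \<in> B" "\<And>n::nat. g ^ n \<notin> I"
  obtains P where "sprime B P" "I \<subseteq> P" "\<And>n. g ^ n \<notin> P"
    "\<And>f. f \<in> B \<Longrightarrow> f \<notin> P \<Longrightarrow> \<exists>n. \<exists>b\<in>B. g ^ n - b * f \<in> P"
proof -
  let ?F = "{J. sideal B J \<and> I \<subseteq> J \<and> (\<forall>n. g ^ n \<notin> J)}"
  have "\<exists>P\<in>?F. \<forall>J\<in>?F. P \<subseteq> J \<longrightarrow> J = P" by (rule noetherian_max[OF B(2)]) (use I g(2) in auto)
  then obtain P where P: "P \<in> ?F" and mx0: "\<forall>J\<in>?F. P \<subseteq> J \<longrightarrow> J = P" by (rule bexE)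
  have mx: "J = P" if "J \<in> ?F" "P \<subseteq> J" for J using mx0[rule_format, OF that] .
  have Pi: "sideal B P" using P by simp
  have ex: "\<exists>n. \<exists>b\<in>B. g ^ n - b * f \<in> P" if f: "f \<in> B" "f \<notin> P" for f
  proof -
    let ?J = "{x + b * f | x b. x \<in> P \<and> b \<in> B}"
    have "sideal B ?J" unfolding sideal_def
    proof (intro conjI ballI)
      show "?J \<subseteq> B" using f(1) sideal_subset[OF Pi] by (auto intro!: subrng_add[OF B(1)] subrng_mult[OF B(1)])
      show "0 \<in> ?J" using sideal_0[OF Pi] subrng_0[OF B(1)] by force
    next
      fix x y assume "x \<in> ?J" "y \<in> ?J"
      then obtain p b p' b' where *: "x = p + b * f" "p \<in> P" "b \<in> B" "y = p' + b' * f" "p' \<in> P" "b' \<in> B" by blast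
      then have "x + y = (p + p') + (b + b') * f" by (simp add: algebra_simps)
      moreover have "p + p' \<in> P" "b + b' \<in> B" using * sideal_add[OF Pi] subrng_add[OF B(1)] by auto
      ultimately show "x + y \<in> ?J" by blast
    next
      fix c x assume "c \<in> B" "x \<in> ?J"
      then obtain p b where *: "x = p + b * f" "p \<in> P" "b \<in> B" by blast
      then have "c * x = c * p + (c * b) * f" by (simp add: algebra_simps)
      moreover have "c * p \<in> P" "c * b \<in> B" using * \<open>c \<in> B\<close> sideal_mult[OF Pi] subrng_mult[OF B(1)] by auto
      ultimately show "c * x \<in> ?J" by blast
    qed
    moreover have "P \<subseteq> ?J"
    proof
      fix x assume "x \<in> P" then show "x \<in> ?J" using subrng_0[OF B(1)] by (intro CollectI exI[of _ x] exI[of _ 0]) auto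
    qed
    moreover have "f \<in> ?J" using sideal_0[OF Pi] subrng_1[OF B(1)] by (intro CollectI exI[of _ 0] exI[of _ 1]) auto
    ultimately have "\<not> (\<forall>n. g ^ n \<notin> ?J)" using mx[of ?J] P f(2) by blast
    then obtain n x b where "g ^ n = x + b * f" "x \<in> P" "b \<in> B" by blast
    then show ?thesis by (intro exI[of _ n] bexI[of _ b]) auto
  qed
  have "1 \<notin> P" using P by (metis (mono_tags, lifting) mem_Collect_eq power_0)
  moreover have "x \<in> P \<or> y \<in> P" if xy: "x \<in> B" "y \<in> B" "x * y \<in> P" for x y
  proof (rule ccontr)
    assume "\<not> ?thesis"
    then obtain n b n' b' where *: "b \<in> B" "g ^ n - b * x \<in> P" "b' \<in> B" "g ^ n' - b' * y \<in> P"
      using ex[of x] ex[of y] xy by blast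
    have "g ^ (n + n') = g ^ n' * (g ^ n - b * x) + (b * x) * (g ^ n' - b' * y) + (b * b') * (x * y)"
      by (simp add: algebra_simps power_add)
    also have "\<dots> \<in> P"
    proof (intro sideal_add[OF Pi])
      show "g ^ n' * (g ^ n - b * x) \<in> P" by (rule sideal_mult[OF Pi subrng_power[OF B(1) g(1)] *(2)])
      show "b * x * (g ^ n' - b' * y) \<in> P" by (rule sideal_mult[OF Pi subrng_mult[OF B(1) *(1) xy(1)] *(4)])
      show "b * b' * (x * y) \<in> P" by (rule sideal_mult[OF Pi subrng_mult[OF B(1) *(1,3)] xy(3)])
    qed
    finally show False using P by blast
  qed
  ultimately have "sprime B P" using Pi by (simp add: sprime_def)
  with that P ex show thesis by blast
qed

section \<open>Hilbert's basis theorem\<close>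

definition adjoin :: "'a::comm_ring_1 set \<Rightarrow> 'a \<Rightarrow> 'a set" where
  "adjoin B z = {poly p z | p. \<forall>i. Polynomial.coeff p i \<in> B}"

lemma subrng_adjoin:
  assumes "subrng B" shows "subrng (adjoin B z)"
  unfolding subrng_def
proof (intro conjI ballI)
  have "\<forall>i. Polynomial.coeff 1 i \<in> B" using assms by (auto simp: subrng_0 subrng_1)
  then show "1 \<in> adjoin B z" unfolding adjoin_def by (intro CollectI exI[of _ 1]) auto
next
  fix x y assume "x \<in> adjoin B z" "y \<in> adjoin B z"
  then obtain p q where *: "x = poly p z" "y = poly q z" "\<forall>i. Polynomial.coeff p i \<in> B" "\<forall>i. Polynomial.coeff q i \<in> B"
    by (auto simp: adjoin_def)
  show "x - y \<in> adjoin B z" unfolding adjoin_def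
    using * assms by (intro CollectI exI[of _ "p - q"]) (auto simp: subrng_diff)
  show "x * y \<in> adjoin B z" unfolding adjoin_def
    using * assms by (intro CollectI exI[of _ "p * q"]) (auto simp: coeff_mult intro!: subrng_sum subrng_mult)
qed

lemma adjoin_superset: "subrng B \<Longrightarrow> B \<subseteq> adjoin B z"
  unfolding adjoin_def
proof
  fix b assume "subrng B" "b \<in> B"
  then show "b \<in> {poly p z | p. \<forall>i. Polynomial.coeff p i \<in> B}"
    by (intro CollectI exI[of _ "[:b:]"]) (auto simp: coeff_pCons subrng_0 split: nat.split)
qed

lemma adjoin_elem: "subrng B \<Longrightarrow> z \<in> adjoin B z"
  unfolding adjoin_def
  by (intro CollectI exI[of _ "[:0, 1:]"]) (auto simp: coeff_pCons subrng_0 subrng_1 split: nat.split)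

text \<open>The classical argument with ideals \<open>L I n\<close> of leading coefficients. As
  \<open>z\<close> may be algebraic over \<open>B\<close>, an element has several representing
  polynomials; the argument therefore runs over polynomials with value in the ideal, and
  \<open>n\<close> only bounds the degree.\<close>

theorem noetherian_adjoin:
  assumes B: "subrng B" "noetherian B"
  shows "noetherian (adjoin B z)"
  unfolding noetherian_def
proof (intro allI impI)
  fix I assume I: "sideal (adjoin B z) I"
  define PP where "PP J n = {p. (\<forall>i. Polynomial.coeff p i \<in> B) \<and> (\<forall>i>n. Polynomial.coeff p i = 0) \<and> poly p z \<in> J}" for J and n :: nat
  define L where "L J n = (\<lambda>p. Polynomial.coeff p n) ` PP J n" for J n
  have ad: "poly p z \<in> adjoin B z" if "\<forall>i. Polynomial.coeff p i \<in> B" for p using that by (auto simp: adjoin_def)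
  have Lideal: "sideal B (L J n)" if J: "sideal (adjoin B z) J" for J n
    unfolding sideal_def
  proof (intro conjI ballI)
    show "L J n \<subseteq> B" by (auto simp: L_def PP_def)
    have "0 \<in> PP J n" using sideal_0[OF J] subrng_0[OF B(1)] by (simp add: PP_def)
    then show "0 \<in> L J n" unfolding L_def by force
  next
    fix x y assume "x \<in> L J n" "y \<in> L J n"
    then obtain p q where "p \<in> PP J n" "q \<in> PP J n" "x = Polynomial.coeff p n" "y = Polynomial.coeff q n"
      by (auto simp: L_def)
    moreover from this have "p + q \<in> PP J n" using sideal_add[OF J] subrng_add[OF B(1)] by (simp add: PP_def)
    ultimately show "x + y \<in> L J n" unfolding L_def by (intro image_eqI[of _ _ "p + q"]) auto
  next
    fix b x assume b: "b \<in> B" and "x \<in> L J n"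
    then obtain p where p: "p \<in> PP J n" "x = Polynomial.coeff p n" by (auto simp: L_def)
    have "b \<in> adjoin B z" using b adjoin_superset[OF B(1)] by blast
    with p b have "Polynomial.smult b p \<in> PP J n"
      using sideal_mult[OF J] subrng_mult[OF B(1)] by (simp add: PP_def)
    with p show "b * x \<in> L J n" unfolding L_def by (intro image_eqI[of _ _ "Polynomial.smult b p"]) auto
  qed
  have shift: "Polynomial.monom 1 k * p \<in> PP J (n + k)" if "p \<in> PP J n" "sideal (adjoin B z) J" for p J n k
  proof -
    have "z ^ k \<in> adjoin B z" using adjoin_elem[OF B(1)] subrng_adjoin[OF B(1)] subrng_power by blast
    then show ?thesis using that sideal_mult[OF that(2)]
      by (auto simp: PP_def coeff_monom_mult poly_monom subrng_0[OF B(1)])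
  qed
  have Lmono: "L J n \<subseteq> L J (n + k)" if "sideal (adjoin B z) J" for J n k
  proof
    fix x assume "x \<in> L J n"
    then obtain p where p: "p \<in> PP J n" "x = Polynomial.coeff p n" by (auto simp: L_def)
    from shift[OF p(1) that, of k] show "x \<in> L J (n + k)" unfolding L_def
      by (intro image_eqI[of _ _ "Polynomial.monom 1 k * p"]) (auto simp: coeff_monom_mult p)
  qed
  obtain N where N: "\<And>n. L I n \<subseteq> L I N"
    using noetherian_sequence[OF B(2), of "L I"] Lideal[OF I] Lmono[OF I, of _ 1] by auto
  have "\<forall>n. \<exists>M. finite M \<and> M \<subseteq> L I n \<and> (\<forall>J. sideal B J \<longrightarrow> M \<subseteq> J \<longrightarrow> L I n \<subseteq> J)"
    using B(2)[unfolded noetherian_def, rule_format, OF Lideal[OF I]] by (rule allI)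
  from choice[OF this] obtain M where
    M0: "\<forall>n. finite (M n) \<and> M n \<subseteq> L I n \<and> (\<forall>J. sideal B J \<longrightarrow> M n \<subseteq> J \<longrightarrow> L I n \<subseteq> J)" by (rule exE)
  have M: "finite (M n)" "M n \<subseteq> L I n" "sideal B J \<Longrightarrow> M n \<subseteq> J \<Longrightarrow> L I n \<subseteq> J" for n J
    using M0[rule_format, of n] by simp_all
  have "\<exists>p. p \<in> PP I n \<and> a = Polynomial.coeff p n" if "a \<in> M n" for n a
  proof -
    have "a \<in> (\<lambda>p. Polynomial.coeff p n) ` PP I n" using M(2)[of n] that unfolding L_def by (rule subsetD)
    then show ?thesis by (elim imageE) (intro exI conjI)
  qed
  note ex_pp = this
  define pp where "pp n a = (SOME p. p \<in> PP I n \<and> a = Polynomial.coeff p n)" for n a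
  have pp: "pp n a \<in> PP I n" "Polynomial.coeff (pp n a) n = a" if "a \<in> M n" for n a
    using someI_ex[OF ex_pp[OF that]] unfolding pp_def[symmetric] by simp_all
  define G where "G = (\<Union>n\<le>N. (\<lambda>a. poly (pp n a) z) ` M n)"
  show "\<exists>M. finite M \<and> M \<subseteq> I \<and> (\<forall>J. sideal (adjoin B z) J \<longrightarrow> M \<subseteq> J \<longrightarrow> I \<subseteq> J)"
  proof (intro exI[of _ G] conjI allI impI)
    show "finite G" unfolding G_def using M(1) by auto
    show "G \<subseteq> I" unfolding G_def using pp(1) by (auto simp: PP_def)
  next
    fix J assume J: "sideal (adjoin B z) J" "G \<subseteq> J"
    \<comment> \<open>With the intersection, a polynomial matching a leading coefficient has its
      value in \<open>J\<close> and also in \<open>I\<close>, so the difference stays in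
      \<open>I\<close> and the induction continues.\<close>
    define J' where "J' = I \<inter> J"
    have J': "sideal (adjoin B z) J'" using I J(1) by (auto simp: J'_def sideal_def)
    have LJ: "L I n \<subseteq> L J' n" for n
    proof (cases "n \<le> N")
      case True
      have "M n \<subseteq> L J' n"
      proof
        fix a assume a: "a \<in> M n"
        then have "poly (pp n a) z \<in> J" using J(2) True by (auto simp: G_def)
        with pp[OF a] show "a \<in> L J' n" unfolding L_def
          by (intro image_eqI[of _ _ "pp n a"]) (auto simp: PP_def J'_def)
      qed
      with M(3)[OF Lideal[OF J']] show ?thesis by blast
    next
      case False
      have "M N \<subseteq> L J' N"
      proof
        fix a assume a: "a \<in> M N"
        then have "poly (pp N a) z \<in> J" using J(2) by (auto simp: G_def)
        with pp[OF a] show "a \<in> L J' N" unfolding L_def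
          by (intro image_eqI[of _ _ "pp N a"]) (auto simp: PP_def J'_def)
      qed
      with M(3)[OF Lideal[OF J']] have "L I N \<subseteq> L J' N" by blast
      with N[of n] Lmono[OF J', of N "n - N"] False show ?thesis by auto
    qed
    have "p \<in> PP I n \<Longrightarrow> poly p z \<in> J" for p n
    proof (induction n arbitrary: p)
      case 0
      then have "Polynomial.coeff p 0 \<in> L J' 0" using LJ[of 0] by (auto simp: L_def)
      then obtain q where q: "q \<in> PP J' 0" "Polynomial.coeff q 0 = Polynomial.coeff p 0" by (auto simp: L_def)
      have "p = q" using 0 q by (intro poly_eqI) (auto simp: PP_def neq0_conv[symmetric] simp del: neq0_conv, metis neq0_conv)
      with q show ?case by (simp add: PP_def J'_def)
    next
      case (Suc n)
      then have "Polynomial.coeff p (Suc n) \<in> L J' (Suc n)" using LJ[of "Suc n"] by (auto simp: L_def)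
      then obtain q where q: "q \<in> PP J' (Suc n)" "Polynomial.coeff q (Suc n) = Polynomial.coeff p (Suc n)" by (auto simp: L_def)
      have qI: "q \<in> PP I (Suc n)" "poly q z \<in> J" using q by (auto simp: PP_def J'_def)
      have "poly p z - poly q z \<in> I"
        using Suc.prems qI(1) by (intro sideal_diff[OF subrng_adjoin[OF B(1)] I]) (auto simp: PP_def)
      moreover have "Polynomial.coeff (p - q) i = 0" if "i > n" for i
        using that Suc.prems qI(1) q(2) by (cases "i = Suc n") (auto simp: PP_def)
      ultimately have "p - q \<in> PP I n"
        using Suc.prems qI(1) subrng_diff[OF B(1)] by (simp add: PP_def)
      from Suc.IH[OF this] have "poly p z - poly q z \<in> J" by simp
      from sideal_add[OF J(1) this qI(2)] show ?case by simp
    qed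
    moreover have "\<exists>p n. p \<in> PP I n \<and> x = poly p z" if x: "x \<in> I" for x
    proof -
      from sideal_subset[OF I x] obtain p where p: "x = poly p z" "\<forall>i. Polynomial.coeff p i \<in> B" by (auto simp: adjoin_def)
      then have "p \<in> PP I (Polynomial.degree p)" using x by (auto simp: PP_def coeff_eq_0)
      with p show ?thesis by blast
    qed
    ultimately show "I \<subseteq> J" by blast
  qed
qed

text \<open>An ideal of the localization is recovered from its intersection with \<open>B\<close> by
  clearing denominators.\<close>

lemma noetherian_localization:
  fixes A :: "'a::field set"
  assumes B: "subrng B" "noetherian B" "B \<subseteq> A"
    and frac: "\<And>f. f \<in> A \<Longrightarrow> \<exists>u\<in>B. u \<noteq> 0 \<and> u * f \<in> B \<and> inverse u \<in> A"
  shows "noetherian A"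
  unfolding noetherian_def
proof (intro allI impI)
  fix I assume I: "sideal A I"
  have restrict: "sideal B (J \<inter> B)" if "sideal A J" for J
    using that B(1,3) unfolding sideal_def by (auto simp: subrng_simps)
  then obtain M where M: "finite M" "M \<subseteq> I \<inter> B" "\<And>J. sideal B J \<Longrightarrow> M \<subseteq> J \<Longrightarrow> I \<inter> B \<subseteq> J"
    using noethE[OF B(2) restrict[OF I]] by metis
  show "\<exists>M. finite M \<and> M \<subseteq> I \<and> (\<forall>J. sideal A J \<longrightarrow> M \<subseteq> J \<longrightarrow> I \<subseteq> J)"
  proof (intro exI[of _ M] conjI allI impI subsetI)
    fix J f assume J: "sideal A J" "M \<subseteq> J" and f: "f \<in> I"
    obtain u where u: "u \<in> B" "u \<noteq> 0" "u * f \<in> B" "inverse u \<in> A" using frac sideal_subset[OF I f] by blast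
    have "u * f \<in> I" using I f u B(3) sideal_mult by blast
    with u(3) M(3)[OF restrict[OF J(1)]] J(2) M(2) have "u * f \<in> J" by blast
    from sideal_mult[OF J(1) u(4) this] show "f \<in> J" using u(2) by (simp add: mult.assoc[symmetric])
  qed (use M in auto)
qed

section \<open>Discrete valuation rings\<close>

definition integrally_closed :: "'a::field set \<Rightarrow> bool" where
  "integrally_closed A \<longleftrightarrow> (\<forall>f. (\<exists>p. Polynomial.lead_coeff p = 1 \<and> (\<forall>i. Polynomial.coeff p i \<in> A) \<and> poly p f = 0) \<longrightarrow> f \<in> A)"

text \<open>The ideals generated by \<open>d * th ^ i\<close> for \<open>i < n\<close> become
  stationary, so some \<open>d * th ^ N\<close> is a combination of lower ones; cancelling
  \<open>d\<close> leaves an integral equation.\<close>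

lemma bounded_powers_integral:
  fixes A :: "'a::field set"
  assumes A: "subrng A" "noetherian A" and d: "d \<noteq> 0" "\<And>i. d * th ^ i \<in> A"
  shows "\<exists>p. Polynomial.lead_coeff p = 1 \<and> (\<forall>i. Polynomial.coeff p i \<in> A) \<and> poly p th = 0"
proof -
  define I where "I n = {\<Sum>i<n. c i * (d * th ^ i) | c. \<forall>i<n. c i \<in> A}" for n
  have I: "sideal A (I n)" for n
    unfolding sideal_def
  proof (intro conjI ballI)
    show "I n \<subseteq> A" unfolding I_def using d(2) by (auto intro!: subrng_sum[OF A(1)] subrng_mult[OF A(1) _ d(2)])
    show "0 \<in> I n" unfolding I_def using subrng_0[OF A(1)] by (intro CollectI exI[of _ "\<lambda>_. 0"]) auto
  next
    fix x y assume "x \<in> I n" "y \<in> I n"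
    then obtain c c' where "x = (\<Sum>i<n. c i * (d * th ^ i))" "\<forall>i<n. c i \<in> A"
      "y = (\<Sum>i<n. c' i * (d * th ^ i))" "\<forall>i<n. c' i \<in> A" unfolding I_def by blast
    then show "x + y \<in> I n" unfolding I_def
      using subrng_add[OF A(1)] by (intro CollectI exI[of _ "\<lambda>i. c i + c' i"]) (auto simp: algebra_simps sum.distrib)
  next
    fix b x assume "b \<in> A" "x \<in> I n"
    then obtain c where "x = (\<Sum>i<n. c i * (d * th ^ i))" "\<forall>i<n. c i \<in> A" unfolding I_def by blast
    then show "b * x \<in> I n" unfolding I_def
      using subrng_mult[OF A(1)] \<open>b \<in> A\<close> by (intro CollectI exI[of _ "\<lambda>i. b * c i"]) (auto simp: algebra_simps sum_distrib_left)
  qed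
  have "I n \<subseteq> I (Suc n)" for n
  proof
    fix x assume "x \<in> I n"
    then obtain c where "x = (\<Sum>i<n. c i * (d * th ^ i))" "\<forall>i<n. c i \<in> A" unfolding I_def by blast
    then show "x \<in> I (Suc n)" unfolding I_def
      using subrng_0[OF A(1)] by (intro CollectI exI[of _ "\<lambda>i. if i < n then c i else 0"]) auto
  qed
  then obtain N where N: "\<And>n. I n \<subseteq> I N" using noetherian_sequence[OF A(2), of I] I by blast
  have "d * th ^ N \<in> I (Suc N)" unfolding I_def
    using subrng_0[OF A(1)] subrng_1[OF A(1)]
    by (intro CollectI exI[of _ "\<lambda>i. if i < N then 0 else 1"]) auto
  with N obtain c where c: "d * th ^ N = (\<Sum>i<N. c i * (d * th ^ i))" "\<forall>i<N. c i \<in> A" unfolding I_def by blast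
  have "d * th ^ N = d * (\<Sum>i<N. c i * th ^ i)" using c(1) by (simp add: sum_distrib_left algebra_simps)
  with d(1) have e: "th ^ N = (\<Sum>i<N. c i * th ^ i)" by simp
  define p where "p = Polynomial.monom 1 N - (\<Sum>i<N. Polynomial.monom (c i) i)"
  have cf: "Polynomial.coeff p i = (if i < N then - c i else if i = N then 1 else 0)" for i
    unfolding p_def by (auto simp: coeff_sum)
  have "Polynomial.degree p = N" by (intro antisym degree_le le_degree) (auto simp: cf)
  then have "Polynomial.lead_coeff p = 1" by (simp add: cf)
  moreover have "\<forall>i. Polynomial.coeff p i \<in> A" using c(2) by (auto simp: cf subrng_simps[OF A(1)])
  moreover have "poly p th = 0" by (simp add: p_def poly_sum poly_monom e)
  ultimately show ?thesis by blast
qed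

lemma normal_bounded_powers:
  assumes "subrng A" "noetherian A" "integrally_closed A" "d \<noteq> 0" "\<And>i. d * th ^ i \<in> A"
  shows "th \<in> A"
  using bounded_powers_integral[OF assms(1,2,4,5)] assms(3) unfolding integrally_closed_def by blast

text \<open>If multiplication by \<open>th\<close> preserved \<open>P\<close>, all
  \<open>d * th ^ i\<close> would lie in \<open>P\<close>, and \<open>th\<close> would be integral.
  This takes the place of the determinant trick.\<close>

lemma ideal_not_stable:
  assumes A: "subrng A" "noetherian A" "integrally_closed A" and P: "sideal A P" "d \<in> P" "d \<noteq> 0" and th: "th \<notin> A"
  shows "\<exists>m\<in>P. th * m \<notin> P"
proof (rule ccontr)
  assume *: "\<not> ?thesis"
  have "d * th ^ i \<in> P" for i
  proof (induction i)
    case (Suc i)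
    with * have "th * (d * th ^ i) \<in> P" by blast
    then show ?case by (simp add: algebra_simps)
  qed (use P in simp)
  then have "d * th ^ i \<in> A" for i using sideal_subset[OF P(1)] by blast
  from normal_bounded_powers[OF A P(3) this] th show False by blast
qed

lemma colon_ideal:
  assumes "subrng A" shows "sideal A {r \<in> A. r * c \<in> (\<lambda>x. p * x) ` A}"
  unfolding sideal_def
proof (intro conjI ballI)
  show "0 \<in> {r \<in> A. r * c \<in> (\<lambda>x. p * x) ` A}" using subrng_0[OF assms] by force
next
  fix x y assume "x \<in> {r \<in> A. r * c \<in> (\<lambda>x. p * x) ` A}" "y \<in> {r \<in> A. r * c \<in> (\<lambda>x. p * x) ` A}"
  then obtain x' y' where "x \<in> A" "y \<in> A" "x' \<in> A" "y' \<in> A" "x * c = p * x'" "y * c = p * y'" by auto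
  then show "x + y \<in> {r \<in> A. r * c \<in> (\<lambda>x. p * x) ` A}"
    using subrng_add[OF assms] by (auto intro!: image_eqI[of _ _ "x' + y'"] simp: algebra_simps)
next
  fix b x assume "b \<in> A" "x \<in> {r \<in> A. r * c \<in> (\<lambda>x. p * x) ` A}"
  then obtain x' where "x \<in> A" "x' \<in> A" "x * c = p * x'" by auto
  with \<open>b \<in> A\<close> show "b * x \<in> {r \<in> A. r * c \<in> (\<lambda>x. p * x) ` A}"
    using subrng_mult[OF assms] by (auto intro!: image_eqI[of _ _ "b * x'"] simp: algebra_simps)
qed auto

lemma local_units_inverse: "u \<in> local_units A \<Longrightarrow> inverse u \<in> local_units A"
  by (auto simp: local_units_def)

lemma local_units_mult: "subrng A \<Longrightarrow> u \<in> local_units A \<Longrightarrow> w \<in> local_units A \<Longrightarrow> u * w \<in> local_units A"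
  by (auto simp: local_units_def subrng_mult)

lemma local_units_powi: "subrng A \<Longrightarrow> u \<in> local_units A \<Longrightarrow> u powi k \<in> local_units A"
  by (cases k rule: int_cases4)
    (auto simp: local_units_def subrng_power power_int_minus power_inverse[symmetric] subrng_1)

lemma local_units_1: "subrng A \<Longrightarrow> 1 \<in> local_units A"
  by (auto simp: local_units_def subrng_1)

text \<open>The hypothesis \<open>rad\<close> says that the maximal ideal is the only prime
  containing a nonzero nonunit \<open>p\<close>. Hence it consists of elements that multiply a
  suitable \<open>c\<close> into \<open>p * A\<close>, and \<open>c / p\<close> carries it into
  \<open>A\<close> without preserving it; an element carried to a unit is the uniformizer.\<close>

theorem discrete_valuation_ring:
  fixes A :: "'a::field set"
  assumes A: "subrng A" "noetherian A" "integrally_closed A"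
    and M: "sideal A (A - local_units A)" "\<exists>p\<in>A - local_units A. p \<noteq> 0"
    and rad: "\<And>p g. p \<in> A - local_units A \<Longrightarrow> p \<noteq> 0 \<Longrightarrow> g \<in> A - local_units A \<Longrightarrow> \<exists>n. g ^ n \<in> (\<lambda>x. p * x) ` A"
    and frac: "\<And>f. \<exists>a\<in>A. \<exists>b\<in>A. b \<noteq> 0 \<and> f = a / b"
  shows "\<exists>t. uniformizer A t"
proof -
  let ?M = "A - local_units A"
  obtain p where p: "p \<in> ?M" "p \<noteq> 0" using M(2) by blast
  let ?pA = "(\<lambda>x. p * x) ` A"
  let ?Q = "\<lambda>c. {r \<in> A. r * c \<in> ?pA}"
  have "1 \<notin> ?pA"
  proof
    assume "1 \<in> ?pA"
    then obtain x where "x \<in> A" "p * x = 1" by auto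
    with p inverse_unique[of p x] show False by (auto simp: local_units_def)
  qed
  then have ne: "?Q ` {c \<in> A. c \<notin> ?pA} \<noteq> {}" using subrng_1[OF A(1)] by blast
  \<comment> \<open>Maximal among the annihilators of nonzero classes modulo \<open>p * A\<close>;
    such an annihilator is an associated prime.\<close>
  have "\<exists>I\<in>?Q ` {c \<in> A. c \<notin> ?pA}. \<forall>J\<in>?Q ` {c \<in> A. c \<notin> ?pA}. I \<subseteq> J \<longrightarrow> J = I"
    by (rule noetherian_max[OF A(2) ne]) (use colon_ideal[OF A(1)] in blast)
  then obtain I where I: "I \<in> ?Q ` {c \<in> A. c \<notin> ?pA}" and Imax: "\<forall>J\<in>?Q ` {c \<in> A. c \<notin> ?pA}. I \<subseteq> J \<longrightarrow> J = I"
    by (rule bexE)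
  from I obtain c where c': "c \<in> {c \<in> A. c \<notin> ?pA}" and Ic: "I = ?Q c" by (rule imageE)
  have c: "c \<in> A" "c \<notin> ?pA" using c' by simp_all
  have mx: "?Q c' = ?Q c" if "c' \<in> A" "c' \<notin> ?pA" "?Q c \<subseteq> ?Q c'" for c'
  proof -
    have "?Q c' \<in> ?Q ` {c \<in> A. c \<notin> ?pA}" using that(1,2) by (intro imageI) simp
    from Imax[rule_format, OF this] that(3) show ?thesis unfolding Ic .
  qed
  have pr: "y \<in> ?Q c" if xy: "x \<in> A" "y \<in> A" "x * y \<in> ?Q c" "x \<notin> ?Q c" for x y
  proof -
    have "x * c \<in> A" "x * c \<notin> ?pA" using xy c subrng_mult[OF A(1)] by auto
    moreover have "?Q c \<subseteq> ?Q (x * c)"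
    proof
      fix r assume "r \<in> ?Q c"
      then obtain w where w: "r \<in> A" "w \<in> A" "r * c = p * w" by auto
      then have "r * (x * c) = p * (x * w)" by (simp add: algebra_simps)
      moreover have "x * w \<in> A" using w xy(1) subrng_mult[OF A(1)] by blast
      ultimately have "r * (x * c) \<in> ?pA" by (rule image_eqI)
      with w show "r \<in> ?Q (x * c)" by simp
    qed
    ultimately have "?Q (x * c) = ?Q c" by (rule mx)
    moreover have "y \<in> ?Q (x * c)" using xy by (auto simp: ac_simps)
    ultimately show ?thesis by blast
  qed
  have "?M \<subseteq> ?Q c"
  proof
    fix g assume g: "g \<in> ?M"
    then obtain n where n: "g ^ n \<in> ?pA" using rad[OF p] by blast
    have "1 \<notin> ?Q c" using c by simp
    have "g ^ n \<in> ?Q c"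
    proof -
      from n obtain x where x: "x \<in> A" "g ^ n = p * x" by blast
      then have e: "g ^ n * c = p * (x * c)" by simp
      have "x * c \<in> A" using x(1) c(1) by (rule subrng_mult[OF A(1)])
      with e have "g ^ n * c \<in> ?pA" by (rule image_eqI)
      moreover have "g ^ n \<in> A" using g by (intro subrng_power[OF A(1)]) simp
      ultimately show ?thesis by simp
    qed
    then show "g \<in> ?Q c"
    proof (induction n)
      case 0 with \<open>1 \<notin> ?Q c\<close> show ?case by simp
    next
      case (Suc n)
      show ?case
      proof (rule ccontr)
        assume "g \<notin> ?Q c"
        with pr[of g "g ^ n"] Suc.prems g subrng_power[OF A(1)] have "g ^ n \<in> ?Q c" by auto
        with Suc.IH \<open>g \<notin> ?Q c\<close> show False by blast
      qed
    qed
  qed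
  define th where "th = c / p"
  have thM: "th * m \<in> A" if m: "m \<in> ?M" for m
  proof -
    obtain x where "x \<in> A" "m * c = p * x" using m \<open>?M \<subseteq> ?Q c\<close> by blast
    then have "th * m = x" using p by (simp add: th_def field_simps)
    with \<open>x \<in> A\<close> show ?thesis by simp
  qed
  have "th \<notin> A"
  proof
    assume "th \<in> A"
    then have "c \<in> ?pA" using p by (intro image_eqI[of _ _ th]) (auto simp: th_def)
    with c show False by blast
  qed
  then obtain t where t: "t \<in> ?M" "th * t \<notin> ?M" using ideal_not_stable[OF A M(1) p] by blast
  then have un: "th * t \<in> local_units A" using thM by blast
  then have t0: "t \<noteq> 0" by (auto simp: local_units_def)
  have div: "g / t \<in> A" if "g \<in> ?M" for g
  proof -
    have "th * g * inverse (th * t) \<in> A"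
      using thM[OF that] un subrng_mult[OF A(1)] by (auto simp: local_units_def)
    moreover have "th \<noteq> 0" using un by (auto simp: local_units_def)
    ultimately show ?thesis using t0 by (simp add: field_simps)
  qed
  have rep: "\<exists>n. \<exists>u\<in>local_units A. f = u * t ^ n" if f: "f \<in> A" "f \<noteq> 0" for f
  proof (rule ccontr)
    assume no: "\<not> ?thesis"
    \<comment> \<open>If no quotient were ever a unit, \<open>f\<close> would be divisible by all
      powers of \<open>t\<close>, and by normality \<open>inverse t\<close> would lie in
      \<open>A\<close>.\<close>
    have "f / t ^ n \<in> A" for n
    proof (induction n)
      case (Suc n)
      have "f / t ^ n \<notin> local_units A"
      proof
        assume "f / t ^ n \<in> local_units A"
        moreover have "f = (f / t ^ n) * t ^ n" using t0 by simp
        ultimately show False using no by blast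
      qed
      with Suc div[of "f / t ^ n"] show ?case by (simp add: field_simps)
    qed (use f in simp)
    then have "f * (inverse t) ^ i \<in> A" for i by (simp add: field_simps power_inverse)
    from normal_bounded_powers[OF A f(2) this] have "inverse t \<in> A" .
    with t t0 show False by (auto simp: local_units_def)
  qed
  have "uniformizer A t"
    unfolding uniformizer_def
  proof (intro conjI allI impI)
    fix f :: 'a assume "f \<noteq> 0"
    obtain a b where ab: "a \<in> A" "b \<in> A" "b \<noteq> 0" "f = a / b" using frac by blast
    with \<open>f \<noteq> 0\<close> have "a \<noteq> 0" by auto
    obtain n u m w where nu: "u \<in> local_units A" "a = u * t ^ n" "w \<in> local_units A" "b = w * t ^ m"
      using rep[OF ab(1) \<open>a \<noteq> 0\<close>] rep[OF ab(2,3)] by blast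
    have "f = (u * inverse w) * t powi (int n - int m)"
      using t0 by (simp add: ab(4) nu power_int_diff field_simps)
    moreover have "u * inverse w \<in> local_units A" using nu local_units_inverse local_units_mult[OF A(1)] by blast
    ultimately show "\<exists>k. \<exists>u\<in>local_units A. f = u * t powi k" by blast
  qed (use t t0 in auto)
  then show ?thesis by blast
qed

section \<open>The normalized valuation\<close>

lemma uniformizer_powi_unit:
  assumes A: "subrng A" and t: "uniformizer A t" and "t powi k \<in> local_units A" shows "k = 0"
proof (rule ccontr)
  assume "k \<noteq> 0"
  have t0: "t \<noteq> 0" "t \<in> A" "t \<notin> local_units A" using t by (auto simp: uniformizer_def)
  have *: "t powi (- k) \<in> local_units A" using local_units_inverse[OF assms(3)] by (simp add: power_int_minus)
  define n where "n = nat \<bar>k\<bar>"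
  have "t ^ n \<in> local_units A"
    using * assms(3) by (cases "k \<ge> 0") (auto simp: n_def power_int_def split: if_splits)
  moreover obtain m where "n = Suc m" using \<open>k \<noteq> 0\<close> by (cases n) (auto simp: n_def)
  ultimately have "inverse (t * t ^ m) \<in> A" by (simp add: local_units_def)
  then have "inverse (t * t ^ m) * t ^ m \<in> A" using subrng_simps[OF A] t0 by auto
  then have "inverse t \<in> A" using t0 by (simp add: field_simps)
  with t0 show False by (auto simp: local_units_def)
qed

lemma powi_eq_units:
  assumes A: "subrng A" and t: "uniformizer A t" and "u \<in> local_units A" "w \<in> local_units A"
    "u * t powi k = w * t powi l"
  shows "k = l"
proof -
  have t0: "t \<noteq> 0" using t by (auto simp: uniformizer_def)
  have "u \<noteq> 0" using assms(3) by (auto simp: local_units_def)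
  then have "t powi (k - l) = w * inverse u" using assms(5) t0 by (simp add: power_int_diff field_simps)
  moreover have "w * inverse u \<in> local_units A"
    using assms(3,4) local_units_mult[OF A] local_units_inverse by blast
  ultimately have "k - l = 0" using uniformizer_powi_unit[OF A t] by metis
  then show ?thesis by simp
qed

lemma uniformizer_unique:
  assumes A: "subrng A" and t: "uniformizer A t" and s: "uniformizer A s"
  shows "\<exists>w\<in>local_units A. s = w * t"
proof -
  have t0: "t \<noteq> 0" "t \<in> A" "t \<notin> local_units A" using t by (auto simp: uniformizer_def)
  have s0: "s \<noteq> 0" "s \<in> A" "s \<notin> local_units A" using s by (auto simp: uniformizer_def)
  obtain k u where u: "u \<in> local_units A" "s = u * t powi k" using t s0(1) by (auto simp: uniformizer_def)
  obtain l w where w: "w \<in> local_units A" "t = w * s powi l" using s t0(1) by (auto simp: uniformizer_def)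
  have "t = (w * u powi l) * t powi (k * l)"
    using w(2) unfolding u(2) by (simp add: power_int_mult_distrib power_int_mult mult.assoc)
  then have "1 * t powi 1 = (w * u powi l) * t powi (k * l)" by simp
  moreover have "w * u powi l \<in> local_units A" using w u local_units_mult[OF A] local_units_powi[OF A] by blast
  ultimately have "1 = k * l" using powi_eq_units[OF A t local_units_1[OF A]] by blast
  then have "k = 1 \<or> k = -1" by (metis zmult_eq_1_iff)
  moreover have "k \<noteq> -1"
  proof
    assume "k = -1"
    then have "inverse t = inverse u * s" using u by (auto simp: power_int_minus local_units_def)
    moreover have "inverse u * s \<in> A" using u s0 subrng_mult[OF A] by (auto simp: local_units_def)
    ultimately show False using t0 by (auto simp: local_units_def)
  qed
  ultimately show ?thesis using u by auto
qed

text \<open>The description in \<open>valuation\<close> ranges over all uniformizers; any two of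
  them differ by a unit, so the exponent is well defined.\<close>

lemma valuation_eqI:
  assumes A: "subrng A" and t: "uniformizer A t" and u: "u \<in> local_units A"
  shows "valuation A (u * t powi k) = k"
  unfolding valuation_def
proof (rule the_equality)
  show "\<exists>t' u'. uniformizer A t' \<and> u' \<in> local_units A \<and> u * t powi k = u' * t' powi k" using t u by blast
next
  fix l assume "\<exists>t' u'. uniformizer A t' \<and> u' \<in> local_units A \<and> u * t powi k = u' * t' powi l"
  then obtain s u' where s: "uniformizer A s" "u' \<in> local_units A" "u * t powi k = u' * s powi l" by blast
  obtain w where w: "w \<in> local_units A" "s = w * t" using uniformizer_unique[OF A t s(1)] by blast
  have "u * t powi k = (u' * w powi l) * t powi l" using s(3) unfolding w(2) by (simp add: power_int_mult_distrib)
  moreover have "u' * w powi l \<in> local_units A" using s w local_units_mult[OF A] local_units_powi[OF A] by blast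
  ultimately show "l = k" using powi_eq_units[OF A t u] by metis
qed

lemma uniformizer_rep:
  assumes A: "subrng A" and t: "uniformizer A t" and "f \<noteq> 0"
  obtains u where "u \<in> local_units A" "f = u * t powi valuation A f"
proof -
  obtain k u where "u \<in> local_units A" "f = u * t powi k" using t assms(3) by (auto simp: uniformizer_def)
  with valuation_eqI[OF A t this(1)] that show thesis by auto
qed

lemma valuation_mult:
  assumes A: "subrng A" and t: "uniformizer A t" and "f \<noteq> 0" "g \<noteq> 0"
  shows "valuation A (f * g) = valuation A f + valuation A g"
proof -
  obtain u w where "u \<in> local_units A" "f = u * t powi valuation A f" "w \<in> local_units A" "g = w * t powi valuation A g"
    using uniformizer_rep[OF A t] assms(3,4) by metis
  moreover have "t \<noteq> 0" using t by (auto simp: uniformizer_def)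
  ultimately have "f * g = (u * w) * t powi (valuation A f + valuation A g)" "u * w \<in> local_units A"
    using local_units_mult[OF A] by (auto simp: power_int_add) (metis mult.assoc mult.left_commute)
  then show ?thesis using valuation_eqI[OF A t] by metis
qed

lemma valuation_nonneg_iff:
  assumes A: "subrng A" and t: "uniformizer A t" and "f \<noteq> 0"
  shows "0 \<le> valuation A f \<longleftrightarrow> f \<in> A"
proof -
  obtain u where u: "u \<in> local_units A" "f = u * t powi valuation A f" using uniformizer_rep[OF assms] .
  have t0: "t \<noteq> 0" "t \<in> A" "t \<notin> local_units A" using t by (auto simp: uniformizer_def)
  show ?thesis
  proof
    assume "0 \<le> valuation A f"
    then have "t powi valuation A f \<in> A" using subrng_power[OF A t0(2)] by (simp add: power_int_def)
    moreover have "u \<in> A" using u(1) by (simp add: local_units_def)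
    ultimately have "u * t powi valuation A f \<in> A" by (intro subrng_mult[OF A])
    then show "f \<in> A" using u(2) by simp
  next
    assume f: "f \<in> A"
    show "0 \<le> valuation A f"
    proof (rule ccontr)
      assume neg: "\<not> ?thesis"
      define n where "n = nat (- valuation A f)"
      have "t powi valuation A f = inverse (t ^ n)" using neg by (simp add: n_def power_int_def power_inverse)
      moreover have "inverse u * f \<in> A" using u(1) f subrng_mult[OF A] by (auto simp: local_units_def)
      moreover have "inverse u * f = t powi valuation A f"
      proof -
        have "u \<noteq> 0" using u(1) by (simp add: local_units_def)
        then show ?thesis by (subst u(2)) simp
      qed
      ultimately have "t powi valuation A f \<in> local_units A"
        using t0 subrng_power[OF A t0(2)] by (auto simp: local_units_def)
      from uniformizer_powi_unit[OF A t this] neg show False by simp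
    qed
  qed
qed

lemma valuation_uniformizer: "subrng A \<Longrightarrow> uniformizer A t \<Longrightarrow> valuation A t = 1"
  using valuation_eqI[of A t 1 1] local_units_1 by auto

lemma valuation_add:
  assumes A: "subrng A" and t: "uniformizer A t" and "f \<noteq> 0" "g \<noteq> 0" "f + g \<noteq> 0"
  shows "min (valuation A f) (valuation A g) \<le> valuation A (f + g)"
proof -
  have *: "valuation A f \<le> valuation A (f + g)" if "f \<noteq> 0" "g \<noteq> 0" "f + g \<noteq> 0" "valuation A f \<le> valuation A g" for f g
  proof -
    have "valuation A (g / f) + valuation A f = valuation A g"
      using valuation_mult[OF A t, of "g / f" f] that by simp
    then have "g / f \<in> A" using valuation_nonneg_iff[OF A t, of "g / f"] that by simp
    then have "1 + g / f \<in> A" using subrng_simps[OF A] by auto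
    moreover have e: "f + g = f * (1 + g / f)" using that by (simp add: field_simps)
    with that have "1 + g / f \<noteq> 0" by auto
    ultimately have "0 \<le> valuation A (1 + g / f)" using valuation_nonneg_iff[OF A t] by blast
    then show ?thesis unfolding e using valuation_mult[OF A t that(1) \<open>1 + g / f \<noteq> 0\<close>] by simp
  qed
  show ?thesis
    using *[of f g] *[of g f] assms(3-5) by (cases "valuation A f \<le> valuation A g") (auto simp: add.commute)
qed

section \<open>Projective varieties\<close>

lemma noetherian_foldl_adjoin:
  assumes "subrng B" "noetherian B"
  shows "subrng (foldl adjoin B zs) \<and> noetherian (foldl adjoin B zs) \<and> B \<subseteq> foldl adjoin B zs \<and> set zs \<subseteq> foldl adjoin B zs"
  using assms
proof (induction zs arbitrary: B)
  case (Cons z zs)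
  from Cons.IH[OF subrng_adjoin[OF Cons.prems(1)] noetherian_adjoin[OF Cons.prems], of z]
    adjoin_superset[OF Cons.prems(1), of z] adjoin_elem[OF Cons.prems(1), of z]
  show ?case by auto
qed auto

lemma adjoin_subset:
  assumes "subrng A" "B \<subseteq> A" "z \<in> A" shows "adjoin B z \<subseteq> A"
proof
  fix x assume "x \<in> adjoin B z"
  then obtain p where p: "x = poly p z" "\<forall>i. Polynomial.coeff p i \<in> B" by (auto simp: adjoin_def)
  have "x = (\<Sum>i\<le>Polynomial.degree p. Polynomial.coeff p i * z ^ i)" by (simp add: p(1) poly_altdef)
  also have "\<dots> \<in> A" using p(2) assms by (intro subrng_sum subrng_mult subrng_power) auto
  finally show "x \<in> A" .
qed

lemma foldl_adjoin_subset:
  assumes "subrng A" "B \<subseteq> A" "set zs \<subseteq> A" shows "foldl adjoin B zs \<subseteq> A"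
  using assms
proof (induction zs arbitrary: B)
  case (Cons z zs)
  then have "adjoin B z \<subseteq> A" by (intro adjoin_subset) auto
  with Cons show ?case by simp
qed simp

text \<open>With a common denominator \<open>u\<close> of the coefficients, \<open>u * f\<close> is
  a root of the monic polynomial with coefficients \<open>u ^ (n - i)\<close> times the old ones,
  which lie in \<open>A\<close>.\<close>

lemma integrally_closed_localization:
  fixes A :: "'a::field set"
  assumes A: "subrng A" "integrally_closed A" and A': "subrng A'" "A \<subseteq> A'"
    and frac: "\<And>f. f \<in> A' \<Longrightarrow> \<exists>u\<in>A. u \<noteq> 0 \<and> u * f \<in> A \<and> inverse u \<in> A'"
  shows "integrally_closed A'"
  unfolding integrally_closed_def
proof (intro allI impI, elim exE conjE)
  fix f p assume p: "Polynomial.lead_coeff p = 1" "\<forall>i. Polynomial.coeff p i \<in> A'" "poly p f = 0"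
  let ?n = "Polynomial.degree p"
  have "\<exists>u\<in>A. u \<noteq> 0 \<and> inverse u \<in> A' \<and> (\<forall>i<n. u * Polynomial.coeff p i \<in> A)" for n
  proof (induction n)
    case 0 show ?case using subrng_1[OF A(1)] subrng_1[OF A'(1)] by (intro bexI[of _ 1]) auto
  next
    case (Suc n)
    then obtain u where u: "u \<in> A" "u \<noteq> 0" "inverse u \<in> A'" "\<forall>i<n. u * Polynomial.coeff p i \<in> A" by blast
    obtain w where w: "w \<in> A" "w \<noteq> 0" "w * Polynomial.coeff p n \<in> A" "inverse w \<in> A'" using frac p(2) by blast
    have "u * w * Polynomial.coeff p i \<in> A" if "i < Suc n" for i
    proof (cases "i = n")
      case True then show ?thesis using subrng_mult[OF A(1) u(1) w(3)] by (simp add: mult.assoc)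
    next
      case False
      with that u(4) have "w * (u * Polynomial.coeff p i) \<in> A" by (intro subrng_mult[OF A(1) w(1)]) auto
      then show ?thesis by (simp add: ac_simps)
    qed
    then show ?case using u w subrng_mult[OF A(1)] subrng_mult[OF A'(1)] by (intro bexI[of _ "u * w"]) auto
  qed
  then obtain u where u: "u \<in> A" "u \<noteq> 0" "inverse u \<in> A'" "\<And>i. i < ?n \<Longrightarrow> u * Polynomial.coeff p i \<in> A" by blast
  define c where "c i = (if i = ?n then 1 else u ^ (?n - i) * Polynomial.coeff p i)" for i
  define q where "q = (\<Sum>i\<le>?n. Polynomial.monom (c i) i)"
  have cq: "Polynomial.coeff q i = (if i \<le> ?n then c i else 0)" for i by (simp add: q_def coeff_sum)
  have "Polynomial.degree q = ?n" by (intro antisym degree_le le_degree) (auto simp: cq c_def)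
  then have "Polynomial.lead_coeff q = 1" by (simp add: cq c_def)
  moreover have "Polynomial.coeff q i \<in> A" for i
  proof (cases "i < ?n")
    case True
    have "u ^ (?n - i - 1) * (u * Polynomial.coeff p i) \<in> A" by (rule subrng_mult[OF A(1) subrng_power[OF A(1) u(1)] u(4)[OF True]])
    moreover have "u ^ (?n - i - 1) * (u * Polynomial.coeff p i) = u ^ Suc (?n - i - 1) * Polynomial.coeff p i"
      by (simp add: ac_simps)
    moreover have "Suc (?n - i - 1) = ?n - i" using True by simp
    ultimately have "u ^ (?n - i) * Polynomial.coeff p i \<in> A" by (simp only:)
    then show ?thesis using True by (simp add: cq c_def)
  qed (auto simp: cq c_def subrng_0[OF A(1)] subrng_1[OF A(1)])
  moreover have "poly q (u * f) = 0"
  proof -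
    have "poly q (u * f) = (\<Sum>i\<le>?n. c i * (u * f) ^ i)" by (simp add: q_def poly_sum poly_monom)
    also have "\<dots> = (\<Sum>i\<le>?n. u ^ ?n * (Polynomial.coeff p i * f ^ i))"
    proof (rule sum.cong)
      fix i assume i: "i \<in> {..?n}"
      then have "u ^ ?n = u ^ (?n - i) * u ^ i" by (simp flip: power_add)
      then show "c i * (u * f) ^ i = u ^ ?n * (Polynomial.coeff p i * f ^ i)"
        using p(1) by (auto simp: c_def power_mult_distrib)
    qed simp
    also have "\<dots> = u ^ ?n * poly p f" by (simp add: poly_altdef sum_distrib_left)
    finally show ?thesis using p(3) by simp
  qed
  ultimately have "u * f \<in> A" using A(2) unfolding integrally_closed_def by blast
  then have "inverse u * (u * f) \<in> A'" using subrng_mult[OF A'(1) u(3)] A'(2) by blast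
  with u(2) show "f \<in> A'" by (simp add: mult.assoc[symmetric])
qed

section \<open>Affine charts and residues modulo a prime\<close>

context embedded_complex
begin

definition ev :: "'k \<Rightarrow> complex poly \<Rightarrow> 'k" where
  "ev z p = poly (map_poly \<iota> p) z"

lemma ev_0 [simp]: "ev z 0 = 0" by (simp add: ev_def)
lemma ev_pCons: "ev z (pCons a p) = \<iota> a + z * ev z p"
  by (cases "a = 0 \<and> p = 0") (auto simp: ev_def map_poly_pCons)
lemma ev_add: "ev z (p + q) = ev z p + ev z q"
  by (induction p q rule: poly_induct2) (auto simp: ev_pCons iota_add algebra_simps)
lemma ev_smult: "ev z (Polynomial.smult c p) = \<iota> c * ev z p"
  by (induction p) (auto simp: ev_pCons iota_mult algebra_simps)
lemma ev_mult: "ev z (p * q) = ev z p * ev z q"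
  by (induction p) (auto simp: ev_pCons ev_add ev_smult algebra_simps)
lemma ev_sum: "ev z (\<Sum>i\<in>A. p i) = (\<Sum>i\<in>A. ev z (p i))"
  by (induction A rule: infinite_finite_induct) (auto simp: ev_add)
lemma ev_1 [simp]: "ev z 1 = 1" using ev_pCons[of z 1 0] by (simp add: one_pCons)
lemma ev_prod: "ev z (\<Prod>i\<in>A. p i) = (\<Prod>i\<in>A. ev z (p i))"
  by (induction A rule: infinite_finite_induct) (auto simp: ev_mult)

lemma ev_in: "subrng R \<Longrightarrow> range \<iota> \<subseteq> R \<Longrightarrow> z \<in> R \<Longrightarrow> ev z p \<in> R"
  by (induction p) (auto simp: ev_pCons intro!: subrng_add subrng_mult subrng_0)

text \<open>By the fundamental theorem of algebra \<open>p\<close> splits into linear factors, and a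
  prime containing the product contains a factor; a nonzero constant is never in
  \<open>P\<close>.\<close>

lemma ev_root:
  assumes R: "subrng R" "range \<iota> \<subseteq> R" "z \<in> R" and P: "sprime R P"
  shows "p \<noteq> 0 \<Longrightarrow> ev z p \<in> P \<Longrightarrow> \<exists>c. z - \<iota> c \<in> P"
proof (induction "Polynomial.degree p" arbitrary: p)
  case 0
  then obtain a where a: "p = [:a:]" "a \<noteq> 0" by (metis degree_eq_zeroE pCons_0_0)
  with 0 have "\<iota> a \<in> P" by (simp add: ev_pCons)
  then have "\<iota> (1 / a) * \<iota> a \<in> P" using R P by (intro sideal_mult[OF sprime_ideal[OF P]]) auto
  with a(2) P show ?case by (simp add: sprime_def flip: iota_mult)
next
  case (Suc n)
  then have "\<not> constant (poly p)" by (simp add: constant_degree)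
  then obtain c where "poly p c = 0" using fundamental_theorem_of_algebra by blast
  from poly_eq_0_iff_dvd[THEN iffD1, OF this] obtain q where q: "p = [:- c, 1:] * q" by (rule dvdE)
  have e: "ev z p = (z - \<iota> c) * ev z q" unfolding q ev_mult by (simp add: ev_pCons iota_uminus)
  have "z - \<iota> c \<in> R" using R by (intro subrng_diff) auto
  with e Suc.prems sprime_mult[OF P _ ev_in[OF R, of q]] have "z - \<iota> c \<in> P \<or> ev z q \<in> P" by metis
  then show ?case
  proof
    assume "ev z q \<in> P"
    have "q \<noteq> 0" using q Suc.prems by auto
    with q have "Polynomial.degree p = Suc (Polynomial.degree q)" by (subst q, subst degree_mult_eq) auto
    with Suc.hyps(2) have "n = Polynomial.degree q" by simp
    from Suc.hyps(1)[OF this \<open>q \<noteq> 0\<close> \<open>ev z q \<in> P\<close>] show ?thesis .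
  qed blast
qed

lemma algebraic_is_const:
  assumes "p \<noteq> 0" "ev z p = 0" shows "\<exists>c. z = \<iota> c"
proof -
  have "sprime UNIV {0::'k}" by (auto simp: sprime_def sideal_def)
  moreover have "subrng (UNIV :: 'k set)" by (simp add: subrng_def)
  ultimately have "\<exists>c. z - \<iota> c \<in> {0}" using ev_root[of UNIV z "{0}" p] assms by auto
  then show ?thesis by auto
qed

text \<open>The coordinate ring of the affine open part where the \<open>j\<close>-th coordinate is
  nonzero.\<close>

definition chart :: "'k list \<Rightarrow> nat \<Rightarrow> 'k set" where
  "chart V j = {g / (V ! j) ^ d | d g. g \<in> hom V d}"

lemma subrng_chart:
  assumes "j < length V" "V ! j \<noteq> 0" shows "subrng (chart V j)"
  unfolding subrng_def
proof (intro conjI ballI)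
  show "1 \<in> chart V j" unfolding chart_def using hom_one by (intro CollectI exI[of _ 0] exI[of _ 1]) auto
next
  fix x y assume "x \<in> chart V j" "y \<in> chart V j"
  then obtain d g e h where *: "x = g / (V ! j) ^ d" "g \<in> hom V d" "y = h / (V ! j) ^ e" "h \<in> hom V e"
    unfolding chart_def by blast
  have xp: "(V ! j) ^ n \<in> hom V n" for n using hom_power[OF hom_var[OF assms(1)], of n] by simp
  have "x - y = (g * (V ! j) ^ e - (V ! j) ^ d * h) / (V ! j) ^ (d + e)"
    using assms(2) by (simp add: * field_simps power_add)
  moreover have "g * (V ! j) ^ e - (V ! j) ^ d * h \<in> hom V (d + e)"
    using * xp by (intro hom_diff hom_mult) auto
  ultimately show "x - y \<in> chart V j" unfolding chart_def by blast
  have "x * y = (g * h) / (V ! j) ^ (d + e)" by (simp add: * power_add)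
  moreover have "g * h \<in> hom V (d + e)" using * by (intro hom_mult) auto
  ultimately show "x * y \<in> chart V j" unfolding chart_def by blast
qed

lemma const_chart: "\<iota> c \<in> chart V j"
  unfolding chart_def using hom_const by (intro CollectI exI[of _ 0] exI[of _ "\<iota> c"]) auto

lemma coord_chart: "i < length V \<Longrightarrow> V ! i / V ! j \<in> chart V j"
  unfolding chart_def using hom_var by (intro CollectI exI[of _ 1] exI[of _ "V ! i"]) auto

lemma chartI: "g \<in> hom V d \<Longrightarrow> g / (V ! j) ^ d \<in> chart V j"
  unfolding chart_def by blast

lemma subrng_const: "subrng (range \<iota>)"
  unfolding subrng_def
proof (intro conjI ballI)
  show "1 \<in> range \<iota>" by (metis iota_1 rangeI)
qed (auto simp flip: iota_diff iota_mult)

lemma noetherian_const: "noetherian (range \<iota>)"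
  unfolding noetherian_def
proof (intro allI impI)
  fix I assume I: "sideal (range \<iota>) I"
  show "\<exists>M. finite M \<and> M \<subseteq> I \<and> (\<forall>J. sideal (range \<iota>) J \<longrightarrow> M \<subseteq> J \<longrightarrow> I \<subseteq> J)"
  proof (cases "I = {0}")
    case True then show ?thesis by (intro exI[of _ "{0}"]) auto
  next
    case False
    then obtain x where x: "x \<in> I" "x \<noteq> 0" using sideal_0[OF I] by blast
    then obtain c where "x = \<iota> c" using sideal_subset[OF I] by blast
    with x have c: "\<iota> c \<in> I" "c \<noteq> 0" by auto
    show ?thesis
    proof (intro exI[of _ "{\<iota> c}"] conjI allI impI subsetI)
      fix J x assume J: "sideal (range \<iota>) J" "{\<iota> c} \<subseteq> J" and "x \<in> I"
      then obtain e where e: "x = \<iota> e" using I by (auto simp: sideal_def)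
      have "\<iota> (e / c) * \<iota> c \<in> J" using J by (intro sideal_mult[OF J(1)]) auto
      then show "x \<in> J" using c(2) by (simp add: e flip: iota_mult)
    qed (use c in auto)
  qed
qed

lemma noetherian_chart:
  assumes "j < length V" "V ! j \<noteq> 0" shows "noetherian (chart V j)"
proof -
  let ?zs = "map (\<lambda>v. v / V ! j) V"
  let ?A = "foldl adjoin (range \<iota>) ?zs"
  have A: "subrng ?A" "noetherian ?A" "range \<iota> \<subseteq> ?A" "set ?zs \<subseteq> ?A"
    using noetherian_foldl_adjoin[OF subrng_const noetherian_const, of ?zs] by blast+
  have "hf V d g f \<Longrightarrow> g / (V ! j) ^ d \<in> ?A" for d g f
  proof (induction rule: hf.induct)
    case (hf_mul i d g f)
    have "V ! i / V ! j \<in> set ?zs" using imageI[OF nth_mem[OF hf_mul.hyps(1)]] by simp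
    then have "(V ! i / V ! j) * (g / (V ! j) ^ d) \<in> ?A" using A hf_mul.IH by (intro subrng_mult) blast+
    then show ?case by simp
  next
    case (hf_add d g f g' f')
    then have "g / (V ! j) ^ d + g' / (V ! j) ^ d \<in> ?A" using A by (intro subrng_add) auto
    then show ?case by (simp add: add_divide_distrib)
  qed (use A subrng_0 in auto)
  then have "chart V j \<subseteq> ?A" by (auto simp: chart_def hom_def)
  moreover have "?A \<subseteq> chart V j"
    using coord_chart by (intro foldl_adjoin_subset subrng_chart assms) (auto simp: const_chart in_set_conv_nth)
  ultimately show ?thesis using A(2) by simp
qed

text \<open>If no \<open>z - \<iota> c\<close> were in \<open>P\<close>, then \<open>G\<^sup>n \<equiv> b\<^sub>c (z - \<iota> c)\<close> modulo \<open>P\<close> for every \<open>c\<close>; since \<open>\<complex>\<close> is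
  uncountable, infinitely many \<open>b\<^sub>c\<close> lie in one space of finite dimension and have the same \<open>n\<close>,
  and a linear relation between them gives a polynomial relation for \<open>z\<close> modulo \<open>P\<close>.\<close>

lemma residue_in_const:
  assumes j: "j < length V" "V ! j \<noteq> 0" and P: "sprime (chart V j) P" and G: "G \<in> chart V j" "\<And>n. G ^ n \<notin> P"
    and ex: "\<And>f. f \<in> chart V j \<Longrightarrow> f \<notin> P \<Longrightarrow> \<exists>n. \<exists>b\<in>chart V j. G ^ n - b * f \<in> P"
    and z: "z \<in> chart V j"
  shows "\<exists>c. z - \<iota> c \<in> P"
proof (rule ccontr)
  let ?R = "chart V j"
  note R = subrng_chart[OF j]
  note Pi = sprime_ideal[OF P]
  assume no: "\<not> ?thesis"
  have "\<exists>n e. \<exists>h\<in>hom V e. G ^ n - (h / (V ! j) ^ e) * (z - \<iota> c) \<in> P" for c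
  proof -
    have "z - \<iota> c \<in> ?R" using z const_chart by (intro subrng_diff R)
    then obtain n b where "b \<in> ?R" "G ^ n - b * (z - \<iota> c) \<in> P" using ex no by blast
    then show ?thesis unfolding chart_def by blast
  qed
  then obtain nf ef hf' where h: "\<And>c. hf' c \<in> hom V (ef c)" "\<And>c. G ^ (nf c) - (hf' c / (V ! j) ^ (ef c)) * (z - \<iota> c) \<in> P"
    by metis
  have "\<exists>q. infinite {c. (nf c, ef c) = q}"
  proof (rule ccontr)
    assume "\<not> ?thesis"
    then have "finite {c. (nf c, ef c) = q}" for q by blast
    then have "countable {c. (nf c, ef c) = q}" for q by (rule countable_finite)
    then have "countable (\<Union>q. {c. (nf c, ef c) = q})" by (intro countable_UN) auto
    moreover have "(\<Union>q. {c. (nf c, ef c) = q}) = (UNIV :: complex set)" by auto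
    ultimately show False using uncountable_UNIV_complex by simp
  qed
  then obtain n e where inf: "infinite {c. nf c = n \<and> ef c = e}" by auto
  obtain T where T: "finite T" "hom V e \<subseteq> kv.span T" using hom_span_bound by blast
  let ?T = "(\<lambda>t. t * inverse ((V ! j) ^ e)) ` T"
  obtain I where I: "I \<subseteq> {c. nf c = n \<and> ef c = e}" "finite I" "card I = Suc (card ?T)"
    using infinite_arbitrarily_large[OF inf] by blast
  define b where "b c = hf' c / (V ! j) ^ e" for c
  have b: "b c \<in> kv.span ?T" "G ^ n - b c * (z - \<iota> c) \<in> P" if "c \<in> I" for c
  proof -
    have c: "nf c = n" "ef c = e" using that I by auto
    then have "hf' c \<in> kv.span T" using h(1)[of c] T by auto
    from span_mult_right[OF this] show "b c \<in> kv.span ?T" by (simp add: b_def divide_inverse)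
    show "G ^ n - b c * (z - \<iota> c) \<in> P" using h(2)[of c] c by (simp add: b_def)
  qed
  obtain l where l: "\<exists>c\<in>I. l c \<noteq> 0" "(\<Sum>c\<in>I. \<iota> (l c) * b c) = 0"
    using family_dependent[OF I(2) finite_imageI[OF T(1)], of "\<lambda>t. t * inverse ((V ! j) ^ e)" b] I(3) b(1) by auto
  define N where "N c = (\<Prod>c'\<in>I - {c}. z - \<iota> c')" for c
  \<comment> \<open>Multiplying the relation between the \<open>b c\<close> by all
    \<open>z - \<iota> c'\<close> leaves \<open>G ^ n * ev z p\<close> modulo \<open>P\<close>. At a
    \<open>c\<close> with \<open>l c \<noteq> 0\<close> only one summand of \<open>p\<close>
    survives, so \<open>p\<close> is not zero.\<close>
  define p where "p = (\<Sum>c\<in>I. Polynomial.smult (l c) (\<Prod>c'\<in>I - {c}. [:- c', 1:]))"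
  have evp: "ev z p = (\<Sum>c\<in>I. \<iota> (l c) * N c)"
    by (simp add: p_def ev_sum ev_smult ev_prod N_def ev_pCons iota_uminus)
  have "p \<noteq> 0"
  proof -
    obtain c where c: "c \<in> I" "l c \<noteq> 0" using l(1) by blast
    have "poly p c = (\<Sum>c'\<in>I. l c' * (\<Prod>c''\<in>I - {c'}. c - c''))" by (simp add: p_def poly_sum poly_prod)
    also have "\<dots> = (\<Sum>c'\<in>I. if c' = c then l c * (\<Prod>c''\<in>I - {c}. c - c'') else 0)"
    proof (rule sum.cong)
      fix c' assume "c' \<in> I"
      show "l c' * (\<Prod>c''\<in>I - {c'}. c - c'') = (if c' = c then l c * (\<Prod>c''\<in>I - {c}. c - c'') else 0)"
      proof (cases "c' = c")
        case False
        then have "(\<Prod>c''\<in>I - {c'}. c - c'') = 0" using c(1) I(2) by (intro prod_zero) auto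
        with False show ?thesis by simp
      qed simp
    qed simp
    also have "\<dots> = l c * (\<Prod>c''\<in>I - {c}. c - c'')" using c(1) I(2) by simp
    also have "\<dots> \<noteq> 0" using c(2) I(2) by auto
    finally show ?thesis by auto
  qed
  have NR: "N c \<in> ?R" for c
  proof -
    have "N c = ev z (\<Prod>c'\<in>I - {c}. [:- c', 1:])" by (simp add: N_def ev_prod ev_pCons iota_uminus)
    then show ?thesis using ev_in[OF R _ z] const_chart by auto
  qed
  have ND: "N c * (z - \<iota> c) = (\<Prod>c'\<in>I. z - \<iota> c')" if "c \<in> I" for c
    using that I(2) by (simp add: N_def prod.remove[of I c] mult.commute)
  have "(\<Sum>c\<in>I. (\<iota> (l c) * N c) * (G ^ n - b c * (z - \<iota> c))) \<in> P"
    using b(2) NR const_chart by (intro sideal_sum[OF Pi] sideal_mult[OF Pi] subrng_mult[OF R]) auto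
  also have "(\<Sum>c\<in>I. (\<iota> (l c) * N c) * (G ^ n - b c * (z - \<iota> c)))
     = G ^ n * ev z p - (\<Sum>c\<in>I. (\<iota> (l c) * b c) * (N c * (z - \<iota> c)))"
    unfolding evp by (simp add: algebra_simps sum_subtractf sum.distrib sum_distrib_left)
  also have "(\<Sum>c\<in>I. (\<iota> (l c) * b c) * (N c * (z - \<iota> c))) = (\<Sum>c\<in>I. \<iota> (l c) * b c) * (\<Prod>c'\<in>I. z - \<iota> c')"
    by (simp add: ND sum_distrib_right)
  also have "\<dots> = 0" by (simp add: l(2))
  finally have "G ^ n * ev z p \<in> P" by simp
  moreover have "ev z p \<in> ?R" "G ^ n \<in> ?R" using ev_in[OF R _ z] const_chart G(1) subrng_power[OF R] by auto
  ultimately have "ev z p \<in> P" using sprime_mult[OF P] G(2) by blast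
  from ev_root[OF R _ z P \<open>p \<noteq> 0\<close> this] no const_chart show False by blast
qed

end

section \<open>Local rings along irreducible sets\<close>

locale variety = embedded_complex \<iota> for \<iota> :: "complex \<Rightarrow> 'k::field" +
  fixes V :: "'k list"
  assumes pv: "projective_variety \<iota> V" and nv: "normal_variety \<iota> V"
begin

abbreviation "pts \<equiv> points \<iota> V"
abbreviation "LR \<equiv> local_ring \<iota> V"

definition vanishes_on :: "complex list set \<Rightarrow> (complex list \<Rightarrow> complex) \<Rightarrow> bool" where
  "vanishes_on Y f \<longleftrightarrow> (\<forall>a\<in>Y. f a = 0)"

lemma pts_iff: "a \<in> pts \<longleftrightarrow> length a = length V \<and> (\<exists>c\<in>set a. c \<noteq> 0) \<and> (\<forall>d f. hf V d 0 f \<longrightarrow> f a = 0)"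
proof -
  have "(\<forall>d. \<forall>F\<in>forms (length V) d. eval_mpoly \<iota> F V = 0 \<longrightarrow> eval_mpoly id F a = 0) \<longleftrightarrow>
    (\<forall>d f. hf V d 0 f \<longrightarrow> f a = 0)"
  proof (intro iffI allI impI ballI)
    fix d f assume *: "\<forall>d. \<forall>F\<in>forms (length V) d. eval_mpoly \<iota> F V = 0 \<longrightarrow> eval_mpoly id F a = 0" "hf V d 0 f"
    then show "f a = 0" using hf_imp_form by blast
  next
    fix d F assume *: "\<forall>d f. hf V d 0 f \<longrightarrow> f a = 0" "F \<in> forms (length V) d" "eval_mpoly \<iota> F V = 0"
    then show "eval_mpoly id F a = 0" using hf_eval_mpoly[OF *(2)] by auto
  qed
  then show ?thesis unfolding points_def by blast
qed

lemma pts_eval_eq: "a \<in> pts \<Longrightarrow> hf V d g f \<Longrightarrow> hf V d g f' \<Longrightarrow> f a = f' a"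
proof -
  assume a: "a \<in> pts" and h: "hf V d g f" "hf V d g f'"
  have "hf V d 0 (\<lambda>x. f x - f' x)" using hf_diff[OF h] by simp
  with a have "f a - f' a = 0" unfolding pts_iff by fast
  then show "f a = f' a" by simp
qed

lemma pts_zero: "a \<in> pts \<Longrightarrow> hf V d g f \<Longrightarrow> f a \<noteq> 0 \<Longrightarrow> g \<noteq> 0"
  by (auto simp: pts_iff)

lemma zariski_closed_iff:
  "zariski_closed \<iota> V Y \<longleftrightarrow> (\<exists>T. (\<forall>f\<in>T. \<exists>d g. hf V d g f) \<and> Y = {a\<in>pts. \<forall>f\<in>T. f a = 0})"
proof
  assume "zariski_closed \<iota> V Y"
  then obtain T where T: "T \<subseteq> (\<Union>d. forms (length V) d)" "Y = {a \<in> pts. \<forall>F\<in>T. eval_mpoly id F a = 0}"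
    unfolding zariski_closed_def by blast
  show "\<exists>T. (\<forall>f\<in>T. \<exists>d g. hf V d g f) \<and> Y = {a\<in>pts. \<forall>f\<in>T. f a = 0}"
  proof (intro exI[of _ "eval_mpoly id ` T"] conjI ballI)
    fix f assume "f \<in> eval_mpoly id ` T"
    then obtain F d where "f = eval_mpoly id F" "F \<in> forms (length V) d" using T(1) by blast
    then show "\<exists>d g. hf V d g f" using hf_eval_mpoly by blast
  qed (use T(2) in auto)
next
  assume "\<exists>T. (\<forall>f\<in>T. \<exists>d g. hf V d g f) \<and> Y = {a\<in>pts. \<forall>f\<in>T. f a = 0}"
  then obtain T where T: "\<forall>f\<in>T. \<exists>d g. hf V d g f" "Y = {a\<in>pts. \<forall>f\<in>T. f a = 0}" by blast
  show "zariski_closed \<iota> V Y" unfolding zariski_closed_def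
  proof (intro exI[of _ "{F. eval_mpoly id F \<in> T \<and> (\<exists>d. F \<in> forms (length V) d)}"] conjI)
    have "\<exists>F. eval_mpoly id F = f \<and> (\<exists>d. F \<in> forms (length V) d)" if "f \<in> T" for f
      using T(1) that hf_imp_form by blast
    then show "Y = {a \<in> pts. \<forall>F\<in>{F. eval_mpoly id F \<in> T \<and> (\<exists>d. F \<in> forms (length V) d)}. eval_mpoly id F a = 0}"
      unfolding T(2) by (auto; metis)
  qed auto
qed

lemma local_ring_iff:
  "x \<in> LR Y \<longleftrightarrow> (\<exists>d g f g' f'. hf V d g f \<and> hf V d g' f' \<and> \<not> vanishes_on Y f' \<and> x = g / g')"
proof
  assume "x \<in> LR Y"
  then obtain d F G where "F \<in> forms (length V) d" "G \<in> forms (length V) d" "\<exists>a\<in>Y. eval_mpoly id G a \<noteq> 0"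
    "x = eval_mpoly \<iota> F V / eval_mpoly \<iota> G V" unfolding local_ring_def by blast
  then show "\<exists>d g f g' f'. hf V d g f \<and> hf V d g' f' \<and> \<not> vanishes_on Y f' \<and> x = g / g'"
    unfolding vanishes_on_def using hf_eval_mpoly by blast
next
  assume "\<exists>d g f g' f'. hf V d g f \<and> hf V d g' f' \<and> \<not> vanishes_on Y f' \<and> x = g / g'"
  then obtain d g f g' f' where *: "hf V d g f" "hf V d g' f'" "\<not> vanishes_on Y f'" "x = g / g'" by blast
  obtain F where F: "F\<in>forms (length V) d" "eval_mpoly \<iota> F V = g" using hf_imp_form[OF *(1)] by blast
  obtain G where G: "G\<in>forms (length V) d" "eval_mpoly \<iota> G V = g'" "eval_mpoly id G = f'" using hf_imp_form[OF *(2)] by blast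
  show "x \<in> LR Y" unfolding local_ring_def using * F G by (auto simp: vanishes_on_def)
qed

text \<open>The forms vanishing on \<open>Y\<close> generate a prime ideal. This covers irreducible
  closed sets and also a single coordinate vector, which is not closed in this encoding, so that
  local rings at points and along divisors are treated alike.\<close>

definition primeset :: "complex list set \<Rightarrow> bool" where
  "primeset Y \<longleftrightarrow> Y \<subseteq> pts \<and> Y \<noteq> {} \<and>
     (\<forall>d g f d' g' f'. hf V d g f \<longrightarrow> hf V d' g' f' \<longrightarrow> vanishes_on Y (\<lambda>a. f a * f' a) \<longrightarrow> vanishes_on Y f \<or> vanishes_on Y f')"

lemma primeset_mult:
  "primeset Y \<Longrightarrow> hf V d g f \<Longrightarrow> hf V d' g' f' \<Longrightarrow> \<not> vanishes_on Y f \<Longrightarrow> \<not> vanishes_on Y f' \<Longrightarrow> \<not> vanishes_on Y (\<lambda>a. f a * f' a)"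
  unfolding primeset_def by blast

lemma primeset_nonzero: "primeset Y \<Longrightarrow> hf V d g f \<Longrightarrow> \<not> vanishes_on Y f \<Longrightarrow> g \<noteq> 0"
  unfolding primeset_def vanishes_on_def using pts_zero by blast

lemma primeset_van_eq: "primeset Y \<Longrightarrow> hf V d g f \<Longrightarrow> hf V d g f' \<Longrightarrow> vanishes_on Y f \<longleftrightarrow> vanishes_on Y f'"
  unfolding primeset_def vanishes_on_def using pts_eval_eq by (metis subsetD)

lemma singleton_primeset: "a \<in> pts \<Longrightarrow> primeset {a}"
  by (auto simp: primeset_def vanishes_on_def)

lemma irreducible_primeset:
  assumes "irreducible_closed \<iota> V Y" shows "primeset Y"
  unfolding primeset_def
proof (intro conjI allI impI)
  from assms have Y: "zariski_closed \<iota> V Y" "Y \<noteq> {}"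
    and irr: "\<And>Y1 Y2. zariski_closed \<iota> V Y1 \<Longrightarrow> zariski_closed \<iota> V Y2 \<Longrightarrow> Y = Y1 \<union> Y2 \<Longrightarrow> Y = Y1 \<or> Y = Y2"
    by (auto simp: irreducible_closed_def)
  from Y(1) obtain T where T: "\<forall>f\<in>T. \<exists>d g. hf V d g f" "Y = {a\<in>pts. \<forall>f\<in>T. f a = 0}"
    unfolding zariski_closed_iff by blast
  show "Y \<subseteq> pts" "Y \<noteq> {}" using T Y(2) by auto
  fix d g f d' g' f' assume h: "hf V d g f" "hf V d' g' f'" "vanishes_on Y (\<lambda>a. f a * f' a)"
  let ?Z = "\<lambda>f. {a\<in>pts. \<forall>h\<in>insert f T. h a = 0}"
  have c: "zariski_closed \<iota> V (?Z f)" if "hf V d g f" for d g f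
    unfolding zariski_closed_iff by (rule exI[of _ "insert f T"]) (use T(1) that in auto)
  have "Y = ?Z f \<union> ?Z f'" using h(3) T(2) by (auto simp: vanishes_on_def)
  from irr[OF c[OF h(1)] c[OF h(2)] this] show "vanishes_on Y f \<or> vanishes_on Y f'" by (auto simp: vanishes_on_def)
qed

lemma primeset_irreducible:
  assumes "zariski_closed \<iota> V Y" "primeset Y" shows "irreducible_closed \<iota> V Y"
  unfolding irreducible_closed_def
proof (intro conjI allI impI)
  show "Y \<noteq> {}" using assms(2) by (simp add: primeset_def)
  fix Y1 Y2 assume *: "zariski_closed \<iota> V Y1 \<and> zariski_closed \<iota> V Y2 \<and> Y = Y1 \<union> Y2"
  have ex: "\<exists>d g f. hf V d g f \<and> vanishes_on Y' f \<and> \<not> vanishes_on Y f" if Y': "zariski_closed \<iota> V Y'" "Y' \<subseteq> Y" "Y' \<noteq> Y" for Y'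
  proof -
    obtain T where T: "\<forall>f\<in>T. \<exists>d g. hf V d g f" "Y' = {a\<in>pts. \<forall>f\<in>T. f a = 0}"
      using Y'(1) unfolding zariski_closed_iff by blast
    obtain a where a: "a \<in> Y" "a \<notin> Y'" using Y'(2,3) by blast
    then have "a \<in> pts" using assms(2) by (auto simp: primeset_def)
    with a(2) T(2) obtain f where "f \<in> T" "f a \<noteq> 0" by blast
    then show ?thesis using T a(1) unfolding vanishes_on_def by blast
  qed
  show "Y = Y1 \<or> Y = Y2"
  proof (rule ccontr)
    assume no: "\<not> ?thesis"
    obtain d g f where f: "hf V d g f" "vanishes_on Y1 f" "\<not> vanishes_on Y f" using ex[of Y1] * no by blast
    obtain d' g' f' where f': "hf V d' g' f'" "vanishes_on Y2 f'" "\<not> vanishes_on Y f'" using ex[of Y2] * no by blast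
    have "vanishes_on Y (\<lambda>a. f a * f' a)" using * f(2) f'(2) by (auto simp: vanishes_on_def)
    with primeset_mult[OF assms(2) f(1) f'(1) f(3) f'(3)] show False by blast
  qed
qed (rule assms(1))

lemma primeset_coord:
  assumes "primeset Y"
  shows "\<exists>j<length V. \<not> vanishes_on Y (\<lambda>a. a ! j)"
proof -
  obtain a where a: "a \<in> Y" "a \<in> pts" using assms by (auto simp: primeset_def)
  then obtain j where "j < length V" "a ! j \<noteq> 0" unfolding pts_iff by (metis in_set_conv_nth)
  with a(1) show ?thesis by (auto simp: vanishes_on_def)
qed

lemma coord_nonzero: "primeset Y \<Longrightarrow> j < length V \<Longrightarrow> \<not> vanishes_on Y (\<lambda>a. a ! j) \<Longrightarrow> V ! j \<noteq> 0"
  using primeset_nonzero[OF _ hf_var] by blast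

lemma coord_power: "j < length V \<Longrightarrow> hf V d ((V ! j) ^ d) (\<lambda>a. (a ! j) ^ d)"
  using hf_power[OF hf_var, of j V d] by simp

lemma vanishes_on_power: "vanishes_on Y (\<lambda>a. (a ! j) ^ d) \<Longrightarrow> vanishes_on Y (\<lambda>a. a ! j)"
  by (auto simp: vanishes_on_def)

lemma subrng_LR:
  assumes Y: "primeset Y" shows "subrng (LR Y)"
  unfolding subrng_def
proof (intro conjI ballI)
  have "\<not> vanishes_on Y (\<lambda>_. 1)" using Y by (auto simp: vanishes_on_def primeset_def)
  then show "1 \<in> LR Y" unfolding local_ring_iff using hf_one by (intro exI[of _ 0] exI[of _ 1] exI[of _ "\<lambda>_. 1"]) auto
next
  fix x y assume "x \<in> LR Y" "y \<in> LR Y"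
  then obtain d g f g' f' e h k h' k' where *: "hf V d g f" "hf V d g' f'" "\<not> vanishes_on Y f'" "x = g / g'"
    "hf V e h k" "hf V e h' k'" "\<not> vanishes_on Y k'" "y = h / h'" unfolding local_ring_iff by blast
  have nz: "g' \<noteq> 0" "h' \<noteq> 0" using primeset_nonzero[OF Y] * by blast+
  have nv: "\<not> vanishes_on Y (\<lambda>a. f' a * k' a)" using primeset_mult[OF Y] * by blast
  have den: "hf V (d + e) (g' * h') (\<lambda>a. f' a * k' a)" using * by (intro hf_mult)
  have "x - y = (g * h' - g' * h) / (g' * h')" using nz by (simp add: * field_simps)
  moreover have "hf V (d + e) (g * h' - g' * h) (\<lambda>a. f a * k' a - f' a * k a)" using * by (intro hf_diff hf_mult)
  ultimately show "x - y \<in> LR Y" unfolding local_ring_iff using den nv by blast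
  have "x * y = (g * h) / (g' * h')" by (simp add: *)
  moreover have "hf V (d + e) (g * h) (\<lambda>a. f a * k a)" using * by (intro hf_mult)
  ultimately show "x * y \<in> LR Y" unfolding local_ring_iff using den nv by blast
qed

lemma LR_unit:
  assumes Y: "primeset Y" and "hf V d g f" "hf V d g' f'" "\<not> vanishes_on Y f" "\<not> vanishes_on Y f'"
  shows "g / g' \<in> local_units (LR Y)"
proof -
  have "g / g' \<in> LR Y" "g' / g \<in> LR Y" unfolding local_ring_iff using assms by blast+
  moreover have "g \<noteq> 0" "g' \<noteq> 0" using primeset_nonzero[OF Y] assms by blast+
  ultimately show ?thesis by (simp add: local_units_def)
qed

definition max_ideal :: "complex list set \<Rightarrow> 'k set" where
  "max_ideal Y = {g / g' | d g f g' f'. hf V d g f \<and> hf V d g' f' \<and> vanishes_on Y f \<and> \<not> vanishes_on Y f'}"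

lemma max_ideal_van:
  assumes Y: "primeset Y" and "g / g' \<in> max_ideal Y" "hf V d g f" "hf V d g' f'" "\<not> vanishes_on Y f'"
  shows "vanishes_on Y f"
proof -
  obtain e h k h' k' where *: "hf V e h k" "hf V e h' k'" "vanishes_on Y k" "\<not> vanishes_on Y k'" "g / g' = h / h'"
    using assms(2) unfolding max_ideal_def by blast
  have nz: "g' \<noteq> 0" "h' \<noteq> 0" using primeset_nonzero[OF Y] * assms by blast+
  have "g * h' = h * g'" using *(5) nz by (simp add: field_simps)
  moreover have "hf V (d + e) (g * h') (\<lambda>a. f a * k' a)" "hf V (e + d) (h * g') (\<lambda>a. k a * f' a)"
    using assms * by (intro hf_mult; blast)+
  moreover have "vanishes_on Y (\<lambda>a. k a * f' a)" using *(3) by (simp add: vanishes_on_def)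
  ultimately have "vanishes_on Y (\<lambda>a. f a * k' a)" using primeset_van_eq[OF Y] by (metis add.commute)
  then show ?thesis using primeset_mult[OF Y assms(3) *(2)] *(4) by blast
qed

lemma nonunits_LR:
  assumes Y: "primeset Y" shows "LR Y - local_units (LR Y) = max_ideal Y"
proof
  show "LR Y - local_units (LR Y) \<subseteq> max_ideal Y"
  proof
    fix x assume x: "x \<in> LR Y - local_units (LR Y)"
    then have "x \<in> LR Y" by blast
    then obtain d g f g' f' where *: "hf V d g f" "hf V d g' f'" "\<not> vanishes_on Y f'" "x = g / g'"
      unfolding local_ring_iff by blast
    have "vanishes_on Y f" using LR_unit[OF Y *(1,2) _ *(3)] x *(4) by blast
    with * show "x \<in> max_ideal Y" unfolding max_ideal_def by blast
  qed
  show "max_ideal Y \<subseteq> LR Y - local_units (LR Y)"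
  proof
    fix x assume x: "x \<in> max_ideal Y"
    then obtain d g f g' f' where *: "hf V d g f" "hf V d g' f'" "vanishes_on Y f" "\<not> vanishes_on Y f'" "x = g / g'"
      unfolding max_ideal_def by blast
    then have "x \<in> LR Y" unfolding local_ring_iff by blast
    moreover have "x \<notin> local_units (LR Y)"
    proof
      assume "x \<in> local_units (LR Y)"
      then have "x \<noteq> 0" "inverse x \<in> LR Y" by (auto simp: local_units_def)
      then obtain e h k h' k' where h: "hf V e h k" "hf V e h' k'" "\<not> vanishes_on Y k'" "inverse x = h / h'"
        unfolding local_ring_iff by blast
      have nz: "g' \<noteq> 0" "h' \<noteq> 0" "g \<noteq> 0" using primeset_nonzero[OF Y] * h \<open>x \<noteq> 0\<close> by auto
      have "h * g = g' * h'" using h(4) *(5) nz by (simp add: field_simps)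
      moreover have "hf V (e + d) (h * g) (\<lambda>a. k a * f a)" "hf V (d + e) (g' * h') (\<lambda>a. f' a * k' a)"
        using h * by (intro hf_mult; blast)+
      moreover have "vanishes_on Y (\<lambda>a. k a * f a)" using *(3) by (simp add: vanishes_on_def)
      ultimately have "vanishes_on Y (\<lambda>a. f' a * k' a)" using primeset_van_eq[OF Y] by (metis add.commute)
      with primeset_mult[OF Y *(2) h(2) *(4) h(3)] show False by blast
    qed
    ultimately show "x \<in> LR Y - local_units (LR Y)" by blast
  qed
qed

lemma max_ideal_subset: "primeset Y \<Longrightarrow> max_ideal Y \<subseteq> LR Y"
  using nonunits_LR by blast

lemma max_ideal_prime:
  assumes Y: "primeset Y" shows "sprime (LR Y) (max_ideal Y)"
  unfolding sprime_def sideal_def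
proof (intro conjI ballI impI)
  show "max_ideal Y \<subseteq> LR Y" by (rule max_ideal_subset[OF Y])
  have 1: "\<not> vanishes_on Y (\<lambda>_. 1)" "vanishes_on Y (\<lambda>_. 0)" using Y by (auto simp: vanishes_on_def primeset_def)
  show "0 \<in> max_ideal Y" unfolding max_ideal_def using 1 hf_one hf_zero
    by (intro CollectI exI[of _ 0] exI[of _ 0] exI[of _ "\<lambda>_. 0"] exI[of _ 1] exI[of _ "\<lambda>_. 1"]) auto
  have "1 \<in> local_units (LR Y)" by (rule local_units_1[OF subrng_LR[OF Y]])
  then show "1 \<notin> max_ideal Y" using nonunits_LR[OF Y] by blast
next
  fix x y assume "x \<in> max_ideal Y" "y \<in> max_ideal Y"
  then obtain d g f g' f' e h k h' k' where *: "hf V d g f" "hf V d g' f'" "vanishes_on Y f" "\<not> vanishes_on Y f'" "x = g / g'"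
    "hf V e h k" "hf V e h' k'" "vanishes_on Y k" "\<not> vanishes_on Y k'" "y = h / h'" unfolding max_ideal_def by blast
  have nz: "g' \<noteq> 0" "h' \<noteq> 0" using primeset_nonzero[OF Y] * by blast+
  have nv: "\<not> vanishes_on Y (\<lambda>a. f' a * k' a)" using primeset_mult[OF Y] * by blast
  have den: "hf V (d + e) (g' * h') (\<lambda>a. f' a * k' a)" using * by (intro hf_mult)
  have "x + y = (g * h' + g' * h) / (g' * h')" using nz by (simp add: * field_simps)
  moreover have "hf V (d + e) (g * h' + g' * h) (\<lambda>a. f a * k' a + f' a * k a)" using * by (intro hf_add hf_mult)
  moreover have "vanishes_on Y (\<lambda>a. f a * k' a + f' a * k a)" using * by (simp add: vanishes_on_def)
  ultimately show "x + y \<in> max_ideal Y" unfolding max_ideal_def using den nv by blast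
next
  fix x y assume "x \<in> LR Y" "y \<in> max_ideal Y"
  then obtain d g f g' f' e h k h' k' where *: "hf V d g f" "hf V d g' f'" "\<not> vanishes_on Y f'" "x = g / g'"
    "hf V e h k" "hf V e h' k'" "vanishes_on Y k" "\<not> vanishes_on Y k'" "y = h / h'" unfolding max_ideal_def local_ring_iff by blast
  have nv: "\<not> vanishes_on Y (\<lambda>a. f' a * k' a)" using primeset_mult[OF Y] * by blast
  have "x * y = (g * h) / (g' * h')" by (simp add: *)
  moreover have "hf V (d + e) (g * h) (\<lambda>a. f a * k a)" "hf V (d + e) (g' * h') (\<lambda>a. f' a * k' a)"
    using * by (intro hf_mult; blast)+
  moreover have "vanishes_on Y (\<lambda>a. f a * k a)" using * by (simp add: vanishes_on_def)
  ultimately show "x * y \<in> max_ideal Y" unfolding max_ideal_def using nv by blast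
next
  fix x y assume xy: "x \<in> LR Y" "y \<in> LR Y" "x * y \<in> max_ideal Y"
  show "x \<in> max_ideal Y \<or> y \<in> max_ideal Y"
  proof (rule ccontr)
    assume "\<not> ?thesis"
    then have "x \<in> local_units (LR Y)" "y \<in> local_units (LR Y)" using xy nonunits_LR[OF Y] by blast+
    then have "x * y \<in> local_units (LR Y)" by (rule local_units_mult[OF subrng_LR[OF Y]])
    with xy(3) nonunits_LR[OF Y] show False by blast
  qed
qed

lemma chart_LR:
  assumes "primeset Y" "j < length V" "\<not> vanishes_on Y (\<lambda>a. a ! j)" shows "chart V j \<subseteq> LR Y"
proof
  fix x assume "x \<in> chart V j"
  then obtain d g f where *: "x = g / (V ! j) ^ d" "hf V d g f" by (auto simp: chart_def hom_def)
  then show "x \<in> LR Y" unfolding local_ring_iff using coord_power[OF assms(2)] vanishes_on_power assms(3) by blast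
qed

text \<open>The local ring is a localization of any chart that meets \<open>Y\<close>, in the form
  required by the two localization lemmas.\<close>

lemma LR_denominator:
  assumes Y: "primeset Y" and j: "j < length V" "\<not> vanishes_on Y (\<lambda>a. a ! j)" and "f \<in> LR Y"
  shows "\<exists>u\<in>chart V j. u \<noteq> 0 \<and> u * f \<in> chart V j \<and> inverse u \<in> LR Y"
proof -
  obtain d g k g' k' where *: "hf V d g k" "hf V d g' k'" "\<not> vanishes_on Y k'" "f = g / g'"
    using assms(4) unfolding local_ring_iff by blast
  have nz: "g' \<noteq> 0" "V ! j \<noteq> 0" using primeset_nonzero[OF Y *(2,3)] coord_nonzero[OF Y j] by auto
  let ?u = "g' / (V ! j) ^ d"
  have "?u \<in> chart V j" "?u * f = g / (V ! j) ^ d" using * homI chartI nz by auto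
  moreover have "g / (V ! j) ^ d \<in> chart V j" using * homI chartI by auto
  moreover have "inverse ?u = (V ! j) ^ d / g'" by simp
  moreover have "(V ! j) ^ d / g' \<in> LR Y" unfolding local_ring_iff using * coord_power[OF j(1)] by blast
  ultimately show ?thesis using nz by (intro bexI[of _ ?u]) auto
qed

lemma noetherian_LR:
  assumes Y: "primeset Y" shows "noetherian (LR Y)"
proof -
  obtain j where j: "j < length V" "\<not> vanishes_on Y (\<lambda>a. a ! j)" using primeset_coord[OF Y] by blast
  note nz = coord_nonzero[OF Y j]
  show ?thesis
    by (rule noetherian_localization[OF subrng_chart[OF j(1) nz] noetherian_chart[OF j(1) nz] chart_LR[OF Y j]])
      (rule LR_denominator[OF Y j])
qed

text \<open>Normality is assumed at points; the local ring along \<open>Y\<close> is a localization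
  of the local ring at any \<open>a\<close> in \<open>Y\<close>.\<close>

lemma integrally_closed_LR:
  assumes Y: "primeset Y" shows "integrally_closed (LR Y)"
proof -
  obtain a where a: "a \<in> Y" "a \<in> pts" using Y by (auto simp: primeset_def)
  note A = singleton_primeset[OF a(2)]
  obtain j where j: "j < length V" "\<not> vanishes_on {a} (\<lambda>a. a ! j)" using primeset_coord[OF A] by blast
  have jY: "\<not> vanishes_on Y (\<lambda>a. a ! j)" using j a by (auto simp: vanishes_on_def)
  have sub: "LR {a} \<subseteq> LR Y"
  proof
    fix x assume "x \<in> LR {a}"
    then obtain d g f g' f' where *: "hf V d g f" "hf V d g' f'" "\<not> vanishes_on {a} f'" "x = g / g'"
      unfolding local_ring_iff by blast
    moreover have "\<not> vanishes_on Y f'" using *(3) a(1) by (auto simp: vanishes_on_def)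
    ultimately show "x \<in> LR Y" unfolding local_ring_iff by blast
  qed
  have "integrally_closed (LR {a})" using nv a(2) unfolding normal_variety_def integrally_closed_def by blast
  then show ?thesis
  proof (rule integrally_closed_localization[OF subrng_LR[OF A] _ subrng_LR[OF Y] sub])
    fix f assume "f \<in> LR Y"
    from LR_denominator[OF Y j(1) jY this] chart_LR[OF A j]
    show "\<exists>u\<in>LR {a}. u \<noteq> 0 \<and> u * f \<in> LR {a} \<and> inverse u \<in> LR Y" by blast
  qed
qed

lemma LR_frac:
  assumes Y: "primeset Y" shows "\<exists>a\<in>LR Y. \<exists>b\<in>LR Y. b \<noteq> 0 \<and> f = a / b"
proof -
  obtain j where j: "j < length V" "\<not> vanishes_on Y (\<lambda>a. a ! j)" using primeset_coord[OF Y] by blast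
  note nz = coord_nonzero[OF Y j]
  obtain d F G where FG: "F \<in> forms (length V) d" "G \<in> forms (length V) d" "eval_mpoly \<iota> G V \<noteq> 0"
    "f = eval_mpoly \<iota> F V / eval_mpoly \<iota> G V" using pv unfolding projective_variety_def by blast
  have "eval_mpoly \<iota> F V / (V ! j) ^ d \<in> LR Y" "eval_mpoly \<iota> G V / (V ! j) ^ d \<in> LR Y"
    using chart_LR[OF Y j] chartI hf_eval_mpoly homI FG by blast+
  with FG nz show ?thesis
    by (intro bexI[of _ "eval_mpoly \<iota> F V / (V ! j) ^ d"] bexI[of _ "eval_mpoly \<iota> G V / (V ! j) ^ d"]) auto
qed

text \<open>A prime containing \<open>J\<close> but no power of the given element has residues in
  \<open>\<complex>\<close> by \<open>residue_in_const\<close>. The residues of the coordinate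
  quotients are the coordinates of the desired point, normalized to 1 in place
  \<open>j\<close>.\<close>

theorem nullstellensatz:
  assumes j: "j < length V" "V ! j \<noteq> 0" and J: "sideal (chart V j) J"
    and g: "hf V d g f" "\<And>n. (g / (V ! j) ^ d) ^ n \<notin> J"
  shows "\<exists>a\<in>pts. a ! j = 1 \<and> f a \<noteq> 0 \<and> (\<forall>d g f. hf V d g f \<longrightarrow> g / (V ! j) ^ d \<in> J \<longrightarrow> f a = 0)"
proof -
  note R = subrng_chart[OF j]
  let ?x = "V ! j"
  have gR: "g / ?x ^ d \<in> chart V j" using g(1) homI chartI by blast
  obtain P where P: "sprime (chart V j) P" "J \<subseteq> P" "\<And>n. (g / ?x ^ d) ^ n \<notin> P"
    "\<And>f. f \<in> chart V j \<Longrightarrow> f \<notin> P \<Longrightarrow> \<exists>n. \<exists>b\<in>chart V j. (g / ?x ^ d) ^ n - b * f \<in> P"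
    using noetherian_prime_avoiding[OF R noetherian_chart[OF j] J gR g(2)] by metis
  note Pi = sprime_ideal[OF P(1)]
  have "\<forall>i. \<exists>c. i < length V \<longrightarrow> V ! i / ?x - \<iota> c \<in> P"
    using residue_in_const[OF j P(1) gR P(3,4) coord_chart] by blast
  then obtain c where c: "\<And>i. i < length V \<Longrightarrow> V ! i / ?x - \<iota> (c i) \<in> P" by metis
  define a where "a = map c [0..<length V]"
  have a: "length a = length V" "\<And>i. i < length V \<Longrightarrow> a ! i = c i" by (auto simp: a_def)
  have const: "\<iota> e \<in> P \<longleftrightarrow> e = 0" for e
  proof
    assume "\<iota> e \<in> P"
    show "e = 0"
    proof (rule ccontr)
      assume "e \<noteq> 0"
      have "\<iota> (1 / e) * \<iota> e \<in> P" using sideal_mult[OF Pi const_chart \<open>\<iota> e \<in> P\<close>] .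
      with \<open>e \<noteq> 0\<close> P(1) show False by (simp add: sprime_def flip: iota_mult)
    qed
  qed (use sideal_0[OF Pi] in simp)
  have ev: "h / ?x ^ e - \<iota> (k a) \<in> P" if "hf V e h k" for e h k
    using that
  proof (induction rule: hf.induct)
    case (hf_add d g f g' f')
    from sideal_add[OF Pi hf_add.IH] show ?case by (simp add: iota_add add_divide_distrib algebra_simps)
  next
    case (hf_mul i d g f)
    have "g / ?x ^ d \<in> chart V j" using hf_mul.hyps homI chartI by blast
    then have "(g / ?x ^ d) * (V ! i / ?x - \<iota> (c i)) + \<iota> (c i) * (g / ?x ^ d - \<iota> (f a)) \<in> P"
      using c[OF hf_mul.hyps(1)] hf_mul.IH const_chart by (intro sideal_add[OF Pi] sideal_mult[OF Pi])
    then show ?case using a(2)[OF hf_mul.hyps(1)] by (simp add: iota_mult algebra_simps)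
  qed (use sideal_0[OF Pi] in auto)
  have iff: "h / ?x ^ e \<in> P \<longleftrightarrow> k a = 0" if "hf V e h k" for e h k
  proof
    assume "h / ?x ^ e \<in> P"
    from sideal_diff[OF R Pi this ev[OF that]] show "k a = 0" using const by simp
  next
    assume "k a = 0" with ev[OF that] show "h / ?x ^ e \<in> P" by simp
  qed
  have "\<iota> (1 - c j) \<in> P" using c[OF j(1)] j(2) by (simp add: iota_diff)
  then have aj: "a ! j = 1" using const a(2)[OF j(1)] by simp
  have "a \<in> pts" unfolding pts_iff
  proof (intro conjI allI impI)
    show "\<exists>c\<in>set a. c \<noteq> 0" using aj nth_mem[of j a] a(1) j(1) by (intro bexI[of _ "a ! j"]) auto
    fix e k assume "hf V e 0 k"
    from iff[OF this] sideal_0[OF Pi] show "k a = 0" by simp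
  qed (rule a(1))
  moreover have "f a \<noteq> 0" using iff[OF g(1)] P(3)[of 1] by simp
  ultimately show ?thesis using aj iff P(2) by (intro bexI[of _ a]) blast+
qed

section \<open>Zero sets of primes of a chart\<close>

lemma coord_exists: "\<exists>j<length V. V ! j \<noteq> 0"
  using pv unfolding projective_variety_def by (metis in_set_conv_nth)

lemma vanishes_on_pts_imp_zero:
  assumes "hf V d g f" "vanishes_on pts f" shows "g = 0"
proof (rule ccontr)
  assume "g \<noteq> 0"
  obtain j where j: "j < length V" "V ! j \<noteq> 0" using coord_exists by blast
  have "sideal (chart V j) {0}" using subrng_0[OF subrng_chart[OF j]] by (auto simp: sideal_def)
  moreover have "(g / (V ! j) ^ d) ^ n \<notin> {0}" for n using \<open>g \<noteq> 0\<close> j by simp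
  ultimately obtain a where "a \<in> pts" "f a \<noteq> 0" using nullstellensatz[OF j _ assms(1), of "{0}"] by blast
  with assms(2) show False by (auto simp: vanishes_on_def)
qed

text \<open>The closure, inside the projective variety, of the zero set of \<open>Q\<close> in the
  chart: all forms whose dehomogenization lies in \<open>Q\<close> are imposed, so points outside
  the chart may belong to it.\<close>

definition zero_set :: "nat \<Rightarrow> 'k set \<Rightarrow> complex list set" where
  "zero_set j Q = {a\<in>pts. \<forall>d g f. hf V d g f \<longrightarrow> g / (V ! j) ^ d \<in> Q \<longrightarrow> f a = 0}"

lemma
  assumes j: "j < length V" "V ! j \<noteq> 0" and Q: "sprime (chart V j) Q"
  shows vanishes_on_Zs: "\<And>d g f. hf V d g f \<Longrightarrow> vanishes_on (zero_set j Q) f \<longleftrightarrow> g / (V ! j) ^ d \<in> Q"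
    and primeset_Zs: "primeset (zero_set j Q)"
    and irreducible_Zs: "irreducible_closed \<iota> V (zero_set j Q)"
    and zero_set_coord: "\<not> vanishes_on (zero_set j Q) (\<lambda>a. a ! j)"
    and zero_set_proper: "Q \<noteq> {0} \<Longrightarrow> zero_set j Q \<noteq> pts"
proof -
  note R = subrng_chart[OF j]
  show vZ: "vanishes_on (zero_set j Q) f \<longleftrightarrow> g / (V ! j) ^ d \<in> Q" if h: "hf V d g f" for d g f
  proof
    assume v: "vanishes_on (zero_set j Q) f"
    show "g / (V ! j) ^ d \<in> Q"
    proof (rule ccontr)
      assume n: "g / (V ! j) ^ d \<notin> Q"
      have "g / (V ! j) ^ d \<in> chart V j" using h homI chartI by blast
      then have "(g / (V ! j) ^ d) ^ n \<notin> Q" for n using sprime_power[OF R Q] n by blast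
      from nullstellensatz[OF j sprime_ideal[OF Q] h this] v show False by (auto simp: zero_set_def vanishes_on_def)
    qed
  qed (use h in \<open>auto simp: zero_set_def vanishes_on_def\<close>)
  have 1: "1 \<notin> Q" using Q by (simp add: sprime_def)
  have ne: "zero_set j Q \<noteq> {}" using vZ[OF hf_one] 1 by (auto simp: vanishes_on_def)
  show pZ: "primeset (zero_set j Q)" unfolding primeset_def
  proof (intro conjI allI impI)
    show "zero_set j Q \<subseteq> pts" by (auto simp: zero_set_def)
    fix d g f d' g' f' assume h: "hf V d g f" "hf V d' g' f'" "vanishes_on (zero_set j Q) (\<lambda>a. f a * f' a)"
    then have "(g / (V ! j) ^ d) * (g' / (V ! j) ^ d') \<in> Q" using vZ[OF hf_mult[OF h(1,2)]] by (simp add: power_add)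
    moreover have "g / (V ! j) ^ d \<in> chart V j" "g' / (V ! j) ^ d' \<in> chart V j" using h homI chartI by blast+
    ultimately show "vanishes_on (zero_set j Q) f \<or> vanishes_on (zero_set j Q) f'" using vZ h sprime_mult[OF Q] by blast
  qed (rule ne)
  have "zariski_closed \<iota> V (zero_set j Q)" unfolding zariski_closed_iff
    by (rule exI[of _ "{f. \<exists>d g. hf V d g f \<and> g / (V ! j) ^ d \<in> Q}"]) (auto simp: zero_set_def)
  then show "irreducible_closed \<iota> V (zero_set j Q)" using pZ by (rule primeset_irreducible)
  show "\<not> vanishes_on (zero_set j Q) (\<lambda>a. a ! j)" using vZ[OF hf_var[OF j(1)]] 1 j(2) by simp
  show "zero_set j Q \<noteq> pts" if Q0: "Q \<noteq> {0}"
  proof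
    assume e: "zero_set j Q = pts"
    obtain q where q: "q \<in> Q" "q \<noteq> 0" using Q0 sideal_0[OF sprime_ideal[OF Q]] by blast
    then have "q \<in> chart V j" using sideal_subset[OF sprime_ideal[OF Q]] by blast
    then obtain d g f where g: "q = g / (V ! j) ^ d" "hf V d g f" by (auto simp: chart_def hom_def)
    then have "vanishes_on pts f" using vZ[OF g(2)] q(1) e by simp
    with vanishes_on_pts_imp_zero[OF g(2)] g(1) q(2) show False by simp
  qed
qed

lemma sprime_restrict:
  fixes A :: "'k set"
  assumes B: "B \<subseteq> A" "subrng B" and Q: "sprime A Q"
  shows "sprime B (Q \<inter> B)"
  unfolding sprime_def
proof (intro conjI ballI impI)
  show "sideal B (Q \<inter> B)" using sprime_ideal[OF Q] B unfolding sideal_def by (auto simp: subrng_simps)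
  show "1 \<notin> Q \<inter> B" using Q by (simp add: sprime_def)
  fix x y assume "x \<in> B" "y \<in> B" "x * y \<in> Q \<inter> B"
  then show "x \<in> Q \<inter> B \<or> y \<in> Q \<inter> B" using sprime_mult[OF Q, of x y] B(1) by blast
qed

end

section \<open>Prime divisors of a normal variety\<close>

context variety
begin

abbreviation "PD \<equiv> prime_divisors \<iota> V"

lemma PD_irreducible: "Y \<in> PD \<Longrightarrow> irreducible_closed \<iota> V Y"
  and PD_proper: "Y \<in> PD \<Longrightarrow> Y \<noteq> pts"
  and PD_maximal: "Y \<in> PD \<Longrightarrow> irreducible_closed \<iota> V Z \<Longrightarrow> Y \<subset> Z \<Longrightarrow> Z \<subset> pts \<Longrightarrow> False"
  unfolding prime_divisors_def by blast+

lemma PD_primeset: "Y \<in> PD \<Longrightarrow> primeset Y"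
  using PD_irreducible irreducible_primeset by blast

lemma irreducible_subset_pts: "irreducible_closed \<iota> V Y \<Longrightarrow> Y \<subseteq> pts"
  using irreducible_primeset by (auto simp: primeset_def)

lemma closed_subsetI:
  assumes "irreducible_closed \<iota> V Y" "Z \<subseteq> pts" "\<And>d g f. hf V d g f \<Longrightarrow> vanishes_on Y f \<Longrightarrow> vanishes_on Z f"
  shows "Z \<subseteq> Y"
proof
  fix a assume a: "a \<in> Z"
  obtain T where T: "\<forall>f\<in>T. \<exists>d g. hf V d g f" "Y = {a\<in>pts. \<forall>f\<in>T. f a = 0}"
    using assms(1) unfolding irreducible_closed_def zariski_closed_iff by blast
  have "f a = 0" if f: "f \<in> T" for f
  proof -
    obtain d g where "hf V d g f" using T(1) f by blast
    moreover have "vanishes_on Y f" using T(2) f by (auto simp: vanishes_on_def)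
    ultimately have "vanishes_on Z f" by (rule assms(3))
    then show ?thesis using a by (auto simp: vanishes_on_def)
  qed
  then show "a \<in> Y" using a T(2) assms(2) by blast
qed

lemma exists_vanishing_form:
  assumes "irreducible_closed \<iota> V Y" "Y \<noteq> pts"
  obtains d g f where "hf V d g f" "vanishes_on Y f" "g \<noteq> 0"
proof -
  have "\<not> pts \<subseteq> Y" using assms irreducible_subset_pts by blast
  then obtain d g f where f: "hf V d g f" "vanishes_on Y f" "\<not> vanishes_on pts f" using closed_subsetI[OF assms(1) order_refl] by blast
  have "g \<noteq> 0"
  proof
    assume "g = 0"
    then have "vanishes_on pts f" using f(1) by (auto simp: pts_iff vanishes_on_def)
    with f(3) show False by blast
  qed
  with f that show thesis by blast
qed

text \<open>Codimension one yields the radical condition of \<open>discrete_valuation_ring\<close>: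
  a prime of the local ring that contains \<open>p\<close> but not \<open>g\<close> would define an
  irreducible closed set strictly between \<open>Y\<close> and the whole variety.\<close>

theorem PD_uniformizer:
  assumes YD: "Y \<in> PD" shows "\<exists>t. uniformizer (LR Y) t"
proof -
  note irr = PD_irreducible[OF YD] and Y = PD_primeset[OF YD]
  note A = subrng_LR[OF Y] noetherian_LR[OF Y] integrally_closed_LR[OF Y]
  obtain j where j: "j < length V" "\<not> vanishes_on Y (\<lambda>a. a ! j)" using primeset_coord[OF Y] by blast
  note nz = coord_nonzero[OF Y j]
  note cp = coord_power[OF j(1)]
  show ?thesis
  proof (rule discrete_valuation_ring[OF A]; (unfold nonunits_LR[OF Y])?)
    show "sideal (LR Y) (max_ideal Y)" by (rule sprime_ideal[OF max_ideal_prime[OF Y]])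
    obtain d g f where f: "hf V d g f" "vanishes_on Y f" "g \<noteq> 0" using exists_vanishing_form[OF irr PD_proper[OF YD]] .
    have "g / (V ! j) ^ d \<in> max_ideal Y" unfolding max_ideal_def using f(1,2) cp vanishes_on_power j(2) by blast
    then show "\<exists>p\<in>max_ideal Y. p \<noteq> 0" using f(3) nz by (intro bexI) auto
    show "\<exists>a\<in>LR Y. \<exists>b\<in>LR Y. b \<noteq> 0 \<and> f = a / b" for f by (rule LR_frac[OF Y])
  next
    fix p g assume p: "p \<in> max_ideal Y" "p \<noteq> 0" and g: "g \<in> max_ideal Y"
    show "\<exists>n. g ^ n \<in> (\<lambda>x. p * x) ` LR Y"
    proof (rule ccontr)
      assume no: "\<not> ?thesis"
      have pL: "p \<in> LR Y" "g \<in> LR Y" using p g max_ideal_subset[OF Y] by auto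
      \<comment> \<open>This is the ideal \<open>p * LR Y\<close>, written in the shape of
        \<open>colon_ideal\<close> so that it is known to be an ideal.\<close>
      define I0 where "I0 = {r \<in> LR Y. r * 1 \<in> (\<lambda>x. p * x) ` LR Y}"
      have i0: "sideal (LR Y) I0" unfolding I0_def by (rule colon_ideal[OF A(1)])
      have n0: "g ^ n \<notin> I0" for n using no by (simp add: I0_def)
      obtain P where P: "sprime (LR Y) P" "I0 \<subseteq> P" "\<And>n. g ^ n \<notin> P"
        by (rule noetherian_prime_avoiding[OF A(1,2) i0 pL(2) n0], rule that, assumption+)
      have "p \<in> I0" unfolding I0_def
        using pL subrng_1[OF A(1)] by (auto intro: image_eqI[of _ _ 1])
      then have pP: "p \<in> P" using P(2) by blast
      note R = subrng_chart[OF j(1) nz] and sub = chart_LR[OF Y j]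
      have PM: "P \<subseteq> max_ideal Y"
      proof
        fix x assume x: "x \<in> P"
        show "x \<in> max_ideal Y"
        proof (rule ccontr)
          assume "x \<notin> max_ideal Y"
          then have "x \<in> local_units (LR Y)" using nonunits_LR[OF Y] sideal_subset[OF sprime_ideal[OF P(1)] x] by blast
          then have un: "inverse x \<in> LR Y" "x \<noteq> 0" by (auto simp: local_units_def)
          have "inverse x * x \<in> P" by (rule sideal_mult[OF sprime_ideal[OF P(1)] un(1) x])
          with P(1) un(2) show False by (simp add: sprime_def)
        qed
      qed
      define Q where "Q = P \<inter> chart V j"
      have Q: "sprime (chart V j) Q" unfolding Q_def by (rule sprime_restrict[OF sub R P(1)])
      let ?Z = "zero_set j Q"
      have clear: "\<exists>u\<in>chart V j. u \<noteq> 0 \<and> u * x \<in> chart V j \<and> inverse u \<in> LR Y" if "x \<in> LR Y" for x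
        using LR_denominator[OF Y j that] .
      have "Q \<noteq> {0}"
      proof -
        obtain u where u: "u \<in> chart V j" "u \<noteq> 0" "u * p \<in> chart V j" using clear[OF pL(1)] by blast
        have "u * p \<in> P" using sideal_mult[OF sprime_ideal[OF P(1)] _ pP] u(1) sub by blast
        then have "u * p \<in> Q" "u * p \<noteq> 0" using u p(2) by (auto simp: Q_def)
        then show ?thesis by blast
      qed
      then have Zp: "?Z \<noteq> pts" by (rule zero_set_proper[OF j(1) nz Q])
      have Zirr: "irreducible_closed \<iota> V ?Z" by (rule irreducible_Zs[OF j(1) nz Q])
      have YZ: "Y \<subseteq> ?Z"
      proof (rule closed_subsetI[OF Zirr irreducible_subset_pts[OF irr]])
        fix d h k assume h: "hf V d h k" "vanishes_on ?Z k"
        then have "h / (V ! j) ^ d \<in> max_ideal Y" using vanishes_on_Zs[OF j(1) nz Q h(1)] PM unfolding Q_def by blast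
        then show "vanishes_on Y k" using max_ideal_van[OF Y _ h(1) cp] vanishes_on_power j(2) by blast
      qed
      \<comment> \<open>The element \<open>g\<close> vanishes on \<open>Y\<close>; if
        \<open>Y\<close> were the zero set of \<open>Q\<close>, its numerator, and hence
        \<open>g\<close>, would lie in \<open>P\<close>.\<close>
      have "Y \<noteq> ?Z"
      proof
        assume e: "Y = ?Z"
        obtain d h k h' k' where gh: "hf V d h k" "hf V d h' k'" "vanishes_on Y k" "\<not> vanishes_on Y k'" "g = h / h'"
          using g unfolding max_ideal_def by blast
        have h'0: "h' \<noteq> 0" using primeset_nonzero[OF Y gh(2,4)] .
        have "h / (V ! j) ^ d \<in> P" using vanishes_on_Zs[OF j(1) nz Q gh(1)] gh(3) e unfolding Q_def by blast
        moreover have "(V ! j) ^ d / h' \<in> LR Y" unfolding local_ring_iff using cp gh(2,4) by blast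
        ultimately have "(V ! j) ^ d / h' * (h / (V ! j) ^ d) \<in> P" using sideal_mult[OF sprime_ideal[OF P(1)]] by blast
        then have "g \<in> P" using nz by (simp add: gh(5))
        with P(3)[of 1] show False by simp
      qed
      with YZ Zp irreducible_subset_pts[OF Zirr] PD_maximal[OF YD Zirr] show False by blast
    qed
  qed
qed

text \<open>The algebraic form of Hartogs' principle for normal varieties. If \<open>f\<close> is
  not regular at \<open>a\<close>, a maximal denominator ideal \<open>P\<close> of a multiple
  \<open>g = c * f\<close> is prime; normality forces its zero set to have codimension one, and
  \<open>f\<close> cannot be regular along that divisor.\<close>

theorem regular_extension:
  assumes a: "a \<in> pts" and reg: "\<And>Y. Y \<in> PD \<Longrightarrow> a \<in> Y \<Longrightarrow> f \<in> LR Y"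
  shows "f \<in> LR {a}"
proof (rule ccontr)
  assume nf: "f \<notin> LR {a}"
  let ?A = "LR {a}"
  note pa = singleton_primeset[OF a]
  note A = subrng_LR[OF pa] noetherian_LR[OF pa] integrally_closed_LR[OF pa]
  obtain j where j: "j < length V" "\<not> vanishes_on {a} (\<lambda>a. a ! j)" using primeset_coord[OF pa] by blast
  note nz = coord_nonzero[OF pa j]
  note cp = coord_power[OF j(1)]
  note R = subrng_chart[OF j(1) nz] and sub = chart_LR[OF pa j]
  \<comment> \<open>The denominators of \<open>c * f\<close>. A maximal one among the proper ideals
    of this kind is prime.\<close>
  define col where "col c = {r \<in> ?A. r * (c * f) \<in> ?A}" for c
  have col: "sideal ?A (col c)" for c
    unfolding sideal_def col_def
    by (auto simp: distrib_right mult.assoc subrng_simps[OF A(1)])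
  have "col ` {c \<in> ?A. c * f \<notin> ?A} \<noteq> {}" using nf subrng_1[OF A(1)] by force
  then have "\<exists>I\<in>col ` {c \<in> ?A. c * f \<notin> ?A}. \<forall>J\<in>col ` {c \<in> ?A. c * f \<notin> ?A}. I \<subseteq> J \<longrightarrow> J = I"
    by (rule noetherian_max[OF A(2)]) (use col in blast)
  then obtain I where I: "I \<in> col ` {c \<in> ?A. c * f \<notin> ?A}" "\<forall>J\<in>col ` {c \<in> ?A. c * f \<notin> ?A}. I \<subseteq> J \<longrightarrow> J = I" by (rule bexE)
  from I(1) obtain c where Ic: "I = col c" and c': "c \<in> {c \<in> ?A. c * f \<notin> ?A}" by (rule imageE)
  have c: "c \<in> ?A" "c * f \<notin> ?A" using c' by simp_all
  have mx: "col c' = col c" if "c' \<in> ?A" "c' * f \<notin> ?A" "col c \<subseteq> col c'" for c'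
  proof -
    have "col c' \<in> col ` {c \<in> ?A. c * f \<notin> ?A}" using that(1,2) by (intro imageI) simp
    from I(2)[rule_format, OF this] that(3) show ?thesis unfolding Ic .
  qed
  define g where "g = c * f"
  define P where "P = col c"
  have P_iff: "r \<in> P \<longleftrightarrow> r \<in> ?A \<and> r * g \<in> ?A" for r by (simp add: P_def col_def g_def)
  have P: "sprime ?A P" unfolding sprime_def
  proof (intro conjI ballI impI)
    show "sideal ?A P" unfolding P_def by (rule col)
    show "1 \<notin> P" using c by (simp add: P_iff g_def)
    fix x y assume xy: "x \<in> ?A" "y \<in> ?A" "x * y \<in> P"
    show "x \<in> P \<or> y \<in> P"
    proof (rule disjCI)
      assume "y \<notin> P"
      then have yc: "y * c \<in> ?A" "y * c * f \<notin> ?A" using xy c subrng_mult[OF A(1)] by (auto simp: P_iff g_def mult.assoc)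
      have "col c \<subseteq> col (y * c)"
      proof
        fix r assume "r \<in> col c"
        then have "r \<in> ?A" "y * (r * (c * f)) \<in> ?A" using xy subrng_mult[OF A(1)] by (auto simp: col_def)
        then show "r \<in> col (y * c)" by (simp add: col_def ac_simps)
      qed
      from mx[OF yc this] have "col (y * c) = P" by (simp add: P_def)
      moreover have "x \<in> col (y * c)" using xy by (simp add: col_def P_iff g_def ac_simps)
      ultimately show "x \<in> P" by simp
    qed
  qed
  note Pi = sprime_ideal[OF P]
  have PM: "P \<subseteq> max_ideal {a}"
  proof
    fix x assume x: "x \<in> P"
    show "x \<in> max_ideal {a}"
    proof (rule ccontr)
      assume "x \<notin> max_ideal {a}"
      then have "x \<in> local_units ?A" using nonunits_LR[OF pa] sideal_subset[OF Pi x] by blast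
      then have un: "inverse x \<in> ?A" "x \<noteq> 0" by (auto simp: local_units_def)
      have "inverse x * x \<in> P" by (rule sideal_mult[OF Pi un(1) x])
      with P un(2) show False by (simp add: sprime_def)
    qed
  qed
  obtain e where e: "e \<in> P" "e \<noteq> 0"
  proof -
    obtain x y where xy: "x \<in> ?A" "y \<in> ?A" "y \<noteq> 0" "f = x / y" using LR_frac[OF pa] by blast
    have "y * g = c * x" using xy by (simp add: g_def)
    then have "y \<in> P" using xy c subrng_mult[OF A(1)] by (simp add: P_iff)
    with xy that show thesis by blast
  qed
  have gA: "g \<notin> ?A" using c by (simp add: g_def)
  obtain p0 where p0: "p0 \<in> P" "g * p0 \<notin> P" using ideal_not_stable[OF A Pi e gA] by blast
  define u where "u = g * p0"
  have uA: "u \<in> ?A" using p0(1) by (simp add: P_iff u_def mult.commute)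
  define Q where "Q = P \<inter> chart V j"
  have Q: "sprime (chart V j) Q" unfolding Q_def by (rule sprime_restrict[OF sub R P])
  let ?Y = "zero_set j Q"
  note pY = primeset_Zs[OF j(1) nz Q] and irr = irreducible_Zs[OF j(1) nz Q]
    and vY = vanishes_on_Zs[OF j(1) nz Q] and jY = zero_set_coord[OF j(1) nz Q]
  have clear: "\<exists>w\<in>chart V j. w \<noteq> 0 \<and> w * x \<in> chart V j \<and> inverse w \<in> ?A" if "x \<in> ?A" for x
    using LR_denominator[OF pa j that] .
  have "Q \<noteq> {0}"
  proof -
    obtain w where w: "w \<in> chart V j" "w \<noteq> 0" "w * e \<in> chart V j" using clear sideal_subset[OF Pi e(1)] by blast
    have "w * e \<in> P" using sideal_mult[OF Pi _ e(1)] w(1) sub by blast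
    then have "w * e \<in> Q" "w * e \<noteq> 0" using w e(2) by (auto simp: Q_def)
    then show ?thesis by blast
  qed
  then have Yp: "?Y \<noteq> pts" by (rule zero_set_proper[OF j(1) nz Q])
  have aY: "a \<in> ?Y"
  proof -
    have "{a} \<subseteq> ?Y"
    proof (rule closed_subsetI[OF irr])
      fix d h k assume h: "hf V d h k" "vanishes_on ?Y k"
      then have "h / (V ! j) ^ d \<in> max_ideal {a}" using vY[OF h(1)] PM unfolding Q_def by blast
      then show "vanishes_on {a} k" using max_ideal_van[OF pa _ h(1) cp] vanishes_on_power j(2) by blast
    qed (use a in simp)
    then show ?thesis by simp
  qed
  \<comment> \<open>A set \<open>Z\<close> strictly between would give a nonzero prime strictly
    inside \<open>P\<close>. That prime is preserved by multiplication with \<open>g\<close>,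
    because \<open>p0 * (x * g) = u * x\<close> and \<open>p0\<close> lies outside it; so
    \<open>g\<close> would be integral.\<close>
  have "?Y \<in> PD" unfolding prime_divisors_def
  proof (intro CollectI conjI notI, rule irr)
    show "?Y = pts \<Longrightarrow> False" using Yp by blast
    assume "\<exists>Z. irreducible_closed \<iota> V Z \<and> ?Y \<subset> Z \<and> Z \<subset> pts"
    then obtain Z where Z: "irreducible_closed \<iota> V Z" "?Y \<subset> Z" "Z \<subset> pts" by blast
    note pZ = irreducible_primeset[OF Z(1)]
    note MZ = max_ideal_prime[OF pZ] and AZ = subrng_LR[OF pZ]
    have aZ: "a \<in> Z" using aY Z(2) by blast
    have AsubZ: "?A \<subseteq> LR Z"
    proof
      fix x assume "x \<in> ?A"
      then obtain d g f g' f' where *: "hf V d g f" "hf V d g' f'" "\<not> vanishes_on {a} f'" "x = g / g'"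
        unfolding local_ring_iff by blast
      moreover have "\<not> vanishes_on Z f'" using *(3) aZ by (auto simp: vanishes_on_def)
      ultimately show "x \<in> LR Z" unfolding local_ring_iff by blast
    qed
    have jZ: "\<not> vanishes_on Z (\<lambda>a. a ! j)" using j aZ by (auto simp: vanishes_on_def)
    have MZiff: "h / (V ! j) ^ d \<in> max_ideal Z \<longleftrightarrow> vanishes_on Z k" if "hf V d h k" for d h k
    proof
      assume "h / (V ! j) ^ d \<in> max_ideal Z" then show "vanishes_on Z k" using max_ideal_van[OF pZ _ that cp] vanishes_on_power jZ by blast
    next
      assume "vanishes_on Z k" then show "h / (V ! j) ^ d \<in> max_ideal Z" unfolding max_ideal_def using that cp vanishes_on_power jZ by blast
    qed
    have MZP: "x \<in> P" if x: "x \<in> max_ideal Z" "x \<in> ?A" for x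
    proof -
      obtain d h k h' k' where h: "hf V d h k" "hf V d h' k'" "\<not> vanishes_on {a} k'" "x = h / h'"
        using x(2) unfolding local_ring_iff by blast
      have "\<not> vanishes_on Z k'" using h(3) aZ by (auto simp: vanishes_on_def)
      then have "vanishes_on Z k" using max_ideal_van[OF pZ _ h(1,2)] x(1) h(4) by blast
      then have "vanishes_on ?Y k" using Z(2) by (auto simp: vanishes_on_def)
      then have "h / (V ! j) ^ d \<in> P" using vY[OF h(1)] unfolding Q_def by blast
      moreover have "(V ! j) ^ d / h' \<in> ?A" unfolding local_ring_iff using cp h(2,3) by blast
      ultimately have "(V ! j) ^ d / h' * (h / (V ! j) ^ d) \<in> P" using sideal_mult[OF Pi] by blast
      then show ?thesis using nz by (simp add: h(4))
    qed
    have "\<exists>w\<in>P. w \<notin> max_ideal Z"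
    proof (rule ccontr)
      assume no: "\<not> ?thesis"
      have "Z \<subseteq> ?Y"
      proof (rule closed_subsetI[OF irr])
        fix d h k assume h: "hf V d h k" "vanishes_on ?Y k"
        then have "h / (V ! j) ^ d \<in> P" using vY[OF h(1)] unfolding Q_def by blast
        then show "vanishes_on Z k" using no MZiff[OF h(1)] by blast
      qed (use Z(3) in blast)
      with Z(2) show False by blast
    qed
    then obtain w where w: "w \<in> P" "w \<notin> max_ideal Z" by blast
    have up: "u * x = (x * g) * p0" for x by (simp add: u_def ac_simps)
    \<comment> \<open>With \<open>w\<close> in \<open>P\<close> but outside the smaller prime: if
      \<open>p0\<close> were in that prime, so would be \<open>u * w = (w * g) * p0\<close> and
      hence \<open>u\<close>, although \<open>u\<close> is not in \<open>P\<close>.\<close>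
    have p0Z: "p0 \<notin> max_ideal Z"
    proof
      assume p: "p0 \<in> max_ideal Z"
      have "w * g \<in> LR Z" using w(1) AsubZ by (auto simp: P_iff)
      then have "u * w \<in> max_ideal Z" unfolding up using sideal_mult[OF sprime_ideal[OF MZ] _ p] by blast
      moreover have "u \<in> LR Z" "w \<in> LR Z" using uA AsubZ sideal_subset[OF Pi w(1)] by auto
      ultimately have "u \<in> max_ideal Z" using sprime_mult[OF MZ] w(2) by blast
      then have "u \<in> P" using MZP uA by blast
      with p0(2) show False by (simp add: u_def)
    qed
    have Zn: "Z \<noteq> pts" using Z(3) by blast
    obtain d h k where h: "hf V d h k" "vanishes_on Z k" "h \<noteq> 0" by (rule exists_vanishing_form[OF Z(1) Zn])
    define q where "q = h / (V ! j) ^ d"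
    have q: "q \<in> max_ideal Z" "q \<in> ?A" "q \<noteq> 0" unfolding q_def using MZiff[OF h(1)] h homI chartI sub nz by auto
    have "q * g ^ i \<in> max_ideal Z \<inter> ?A" for i
    proof (induction i)
      case (Suc i)
      then have r: "q * g ^ i \<in> P" using MZP by blast
      then have rg: "q * g ^ i * g \<in> ?A" by (simp add: P_iff)
      have "p0 * (q * g ^ i * g) = u * (q * g ^ i)" by (simp add: u_def ac_simps)
      also have "\<dots> \<in> max_ideal Z" using sideal_mult[OF sprime_ideal[OF MZ]] Suc uA AsubZ by blast
      finally have "q * g ^ i * g \<in> max_ideal Z"
        using sprime_mult[OF MZ] p0Z rg AsubZ sideal_subset[OF Pi p0(1)] by blast
      with rg show ?case by (simp add: ac_simps)
    qed (use q in simp)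
    then have "q * g ^ i \<in> ?A" for i by blast
    from normal_bounded_powers[OF A q(3) this] gA show False by blast
  qed
  \<comment> \<open>A denominator of \<open>f\<close> along this divisor is a denominator of
    \<open>g\<close>, hence lies in \<open>P\<close> and vanishes on the divisor, contrary to its
    choice.\<close>
  from reg[OF this aY] obtain d h k h' k' where h: "hf V d h k" "hf V d h' k'" "\<not> vanishes_on ?Y k'" "f = h / h'"
    unfolding local_ring_iff by blast
  let ?w = "h' / (V ! j) ^ d"
  have h'0: "h' \<noteq> 0" using primeset_nonzero[OF pY h(2,3)] .
  have "?w \<in> chart V j" "h / (V ! j) ^ d \<in> chart V j" using h homI chartI by blast+
  then have "?w \<in> ?A" "h / (V ! j) ^ d \<in> ?A" using sub by auto
  moreover have "?w * g = c * (h / (V ! j) ^ d)" using h'0 nz by (simp add: g_def h(4))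
  moreover have "c * (h / (V ! j) ^ d) \<in> ?A" using calculation(2) by (rule subrng_mult[OF A(1) c(1)])
  ultimately have "?w \<in> P" unfolding P_iff by (simp only:)
  then have "?w \<in> Q" using \<open>?w \<in> chart V j\<close> by (simp add: Q_def)
  with vY[OF h(2)] h(3) show False by blast
qed

section \<open>Orders along prime divisors\<close>

definition xi :: "complex list set \<Rightarrow> 'k" where
  "xi Y = V ! (SOME j. j < length V \<and> \<not> vanishes_on Y (\<lambda>a. a ! j))"

lemma xi: "primeset Y \<Longrightarrow> \<exists>j<length V. \<not> vanishes_on Y (\<lambda>a. a ! j) \<and> xi Y = V ! j"
  unfolding xi_def by (rule exI[of _ "SOME j. j < length V \<and> \<not> vanishes_on Y (\<lambda>a. a ! j)"])
    (use someI_ex[OF primeset_coord[unfolded Bex_def]] primeset_coord someI_ex[of "\<lambda>j. j < length V \<and> \<not> vanishes_on Y (\<lambda>a. a ! j)"] in blast)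

abbreviation "vv \<equiv> ord_along \<iota> V"

lemma hom_LR:
  assumes "primeset Y" "hf V d g f" shows "g / xi Y ^ d \<in> LR Y"
proof -
  obtain j where j: "j < length V" "\<not> vanishes_on Y (\<lambda>a. a ! j)" "xi Y = V ! j" using xi[OF assms(1)] by blast
  then show ?thesis using chart_LR[OF assms(1) j(1,2)] homI[OF assms(2)] chartI by auto
qed

lemma vv_mult: "Y \<in> PD \<Longrightarrow> f \<noteq> 0 \<Longrightarrow> g \<noteq> 0 \<Longrightarrow> vv Y (f * g) = vv Y f + vv Y g"
  using PD_uniformizer PD_primeset subrng_LR valuation_mult unfolding ord_along_def by blast

lemma vv_nonneg_iff: "Y \<in> PD \<Longrightarrow> f \<noteq> 0 \<Longrightarrow> 0 \<le> vv Y f \<longleftrightarrow> f \<in> LR Y"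
  using PD_uniformizer PD_primeset subrng_LR valuation_nonneg_iff unfolding ord_along_def by blast

lemma vv_add: "Y \<in> PD \<Longrightarrow> f \<noteq> 0 \<Longrightarrow> g \<noteq> 0 \<Longrightarrow> f + g \<noteq> 0 \<Longrightarrow> min (vv Y f) (vv Y g) \<le> vv Y (f + g)"
  using PD_uniformizer PD_primeset subrng_LR valuation_add unfolding ord_along_def by blast

lemma vv_one: "Y \<in> PD \<Longrightarrow> vv Y 1 = 0"
  using vv_mult[of Y 1 1] by simp

lemma vv_power: "Y \<in> PD \<Longrightarrow> f \<noteq> 0 \<Longrightarrow> vv Y (f ^ n) = int n * vv Y f"
  by (induction n) (auto simp: vv_one vv_mult algebra_simps)

lemma vv_divide: "Y \<in> PD \<Longrightarrow> f \<noteq> 0 \<Longrightarrow> g \<noteq> 0 \<Longrightarrow> vv Y (f / g) = vv Y f - vv Y g"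
  using vv_mult[of Y "f / g" g] by simp

lemma xi_nonzero: "primeset Y \<Longrightarrow> xi Y \<noteq> 0"
  using xi coord_nonzero by metis

text \<open>Dividing by a power of \<open>xi Y\<close> gives an element of the local ring, which is
  a unit exactly when the form does not vanish on \<open>Y\<close>.\<close>

lemma vv_form:
  assumes Y: "Y \<in> PD" and h: "hf V d g f" "g \<noteq> 0"
  shows "int d * vv Y (xi Y) \<le> vv Y g" and "vv Y g = int d * vv Y (xi Y) \<longleftrightarrow> \<not> vanishes_on Y f"
proof -
  note pY = PD_primeset[OF Y]
  obtain j where j: "j < length V" "\<not> vanishes_on Y (\<lambda>a. a ! j)" "xi Y = V ! j" using xi[OF pY] by blast
  have x: "xi Y \<noteq> 0" by (rule xi_nonzero[OF pY])
  have e: "vv Y (g / xi Y ^ d) = vv Y g - int d * vv Y (xi Y)" "vv Y (xi Y ^ d / g) = int d * vv Y (xi Y) - vv Y g"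
    using h x Y by (simp_all add: vv_divide vv_power)
  have "0 \<le> vv Y (g / xi Y ^ d)" using vv_nonneg_iff[OF Y] hom_LR[OF pY h(1)] h x by simp
  then show le: "int d * vv Y (xi Y) \<le> vv Y g" using e by simp
  have "vv Y g = int d * vv Y (xi Y) \<longleftrightarrow> 0 \<le> vv Y (xi Y ^ d / g)" using le e by auto
  also have "\<dots> \<longleftrightarrow> xi Y ^ d / g \<in> LR Y" using vv_nonneg_iff[OF Y] h x by simp
  also have "\<dots> \<longleftrightarrow> \<not> vanishes_on Y f"
  proof
    assume "\<not> vanishes_on Y f"
    then show "xi Y ^ d / g \<in> LR Y" unfolding local_ring_iff j(3) using coord_power[OF j(1)] h(1) by blast
  next
    assume l: "xi Y ^ d / g \<in> LR Y"
    show "\<not> vanishes_on Y f"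
    proof
      assume "vanishes_on Y f"
      then have "g / xi Y ^ d \<in> max_ideal Y" unfolding max_ideal_def j(3) using h(1) coord_power[OF j(1)] vanishes_on_power j(2) by blast
      then have "xi Y ^ d / g * (g / xi Y ^ d) \<in> max_ideal Y" using sideal_mult[OF sprime_ideal[OF max_ideal_prime[OF pY]] l] by blast
      with h x max_ideal_prime[OF pY] show False by (simp add: sprime_def)
    qed
  qed
  finally show "vv Y g = int d * vv Y (xi Y) \<longleftrightarrow> \<not> vanishes_on Y f" .
qed

sublocale valued_forms \<iota> V PD vv xi
proof (unfold_locales, goal_cases)
  case (1 Y f g) then show ?case by (rule vv_mult)
next
  case (2 Y f g) then show ?case by (rule vv_add)
next
  case (3 Y) then show ?case using xi[OF PD_primeset] hom_var by metis
next
  case (4 Y) then show ?case using xi_nonzero PD_primeset by blast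
next
  case (5 Y F d) then show ?case using vv_form(1) unfolding hom_def by blast
next
  case (6 Y f)
  note pY = PD_primeset[OF 6(1)]
  have "f \<in> LR Y" using 6 vv_nonneg_iff by blast
  then obtain d g k g' k' where h: "hf V d g k" "hf V d g' k'" "\<not> vanishes_on Y k'" "f = g / g'" unfolding local_ring_iff by blast
  have "g' \<noteq> 0" "g \<noteq> 0" using primeset_nonzero[OF pY h(2,3)] h(4) 6(2) by auto
  then show ?case using h vv_form(2)[OF 6(1) h(2)] homI by blast
next
  case (7 Y)
  then obtain t where t: "uniformizer (LR Y) t" using PD_uniformizer by blast
  then show ?case using valuation_uniformizer[OF subrng_LR[OF PD_primeset[OF 7]] t]
    unfolding ord_along_def by (auto simp: uniformizer_def)
next
  case (8 Y Y')
  \<comment> \<open>Otherwise \<open>Y\<close> would be contained in \<open>Y'\<close>, which is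
    impossible for two different prime divisors.\<close>
  have "\<exists>d g f. hf V d g f \<and> vanishes_on Y' f \<and> \<not> vanishes_on Y f"
  proof (rule ccontr)
    assume "\<not> ?thesis"
    then have "Y \<subseteq> Y'"
      using closed_subsetI[OF PD_irreducible[OF 8(2)] irreducible_subset_pts[OF PD_irreducible[OF 8(1)]]] by blast
    with 8 PD_maximal[OF 8(1) PD_irreducible[OF 8(2)]] PD_proper[OF 8(2)]
      irreducible_subset_pts[OF PD_irreducible[OF 8(2)]] show False by blast
  qed
  then obtain d g f where h: "hf V d g f" "vanishes_on Y' f" "\<not> vanishes_on Y f" by blast
  have g0: "g \<noteq> 0" using primeset_nonzero[OF PD_primeset[OF 8(1)] h(1,3)] .
  have "vv Y' g \<noteq> int d * vv Y' (xi Y')" using vv_form(2)[OF 8(2) h(1) g0] h(2) by blast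
  with vv_form(1)[OF 8(2) h(1) g0] have "int d * vv Y' (xi Y') < vv Y' g" by linarith
  moreover have "vv Y g = int d * vv Y (xi Y)" using vv_form(2)[OF 8(1) h(1) g0] h(3) by blast
  ultimately show ?case using homI[OF h(1)] g0 by blast
next
  case 9 show ?case using coord_exists by (metis nth_mem)
qed

end

section \<open>Additive minorants of subadditive functions\<close>

lemma sum_const_add: "(\<Sum>i<n. x + y) = (\<Sum>i<n. x) + (\<Sum>i<n. (y::'g::ab_group_add))"
  by (rule sum.distrib)

text \<open>Zorn's lemma gives a minimal subadditive function below \<open>q\<close>; it is additive.\<close>

theorem additive_minorant:
  fixes q :: "'g::ab_group_add \<Rightarrow> real"
  assumes q: "\<And>x y. q (x + y) \<le> q x + q y"
  shows "\<exists>p. (\<forall>x y. p (x + y) = p x + p y) \<and> (\<forall>x. p x \<le> q x)"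
proof -
  define A where "A = {s::'g \<Rightarrow> real. (\<forall>x y. s (x + y) \<le> s x + s y) \<and> (\<forall>x. s x \<le> q x)}"
  define P where "P s t \<longleftrightarrow> (\<forall>x. t x \<le> s x)" for s t :: "'g \<Rightarrow> real"
  have sub: "s (x + y) \<le> s x + s y" if "s \<in> A" for s x y using that by (simp add: A_def)
  \<comment> \<open>A lower bound common to all members of \<open>A\<close>; it makes the infimum
    along a chain finite.\<close>
  have low: "- q (- x) \<le> s x" if "s \<in> A" for s x
  proof -
    have "0 \<le> s 0" using sub[OF that, of 0 0] by simp
    moreover have "s 0 \<le> s x + s (- x)" using sub[OF that, of x "-x"] by simp
    moreover have "s (- x) \<le> q (- x)" using that by (simp add: A_def)
    ultimately show ?thesis by linarith
  qed
  have "\<exists>m\<in>A. \<forall>a\<in>A. P m a \<longrightarrow> a = m"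
  proof (rule predicate_Zorn)
    show "partial_order_on A (relation_of P A)"
      by (rule partial_order_on_relation_ofI) (auto simp: P_def fun_eq_iff intro: order_trans antisym)
    fix C assume C: "C \<in> Chains (relation_of P A)"
    have CA: "C \<subseteq> A" and ch: "\<And>s t. s \<in> C \<Longrightarrow> t \<in> C \<Longrightarrow> P s t \<or> P t s"
      using C by (auto simp: Chains_def relation_of_def)
    show "\<exists>u\<in>A. \<forall>a\<in>C. P a u"
    proof (cases "C = {}")
      case True
      then show ?thesis using q by (intro bexI[of _ q]) (auto simp: A_def)
    next
      case False
      define u where "u x = (INF s\<in>C. s x)" for x
      have bdd: "bdd_below ((\<lambda>s. s x) ` C)" for x using low CA by (intro bdd_belowI[of _ "- q (- x)"]) auto
      have ul: "u x \<le> s x" if "s \<in> C" for s x unfolding u_def using that bdd by (intro cINF_lower)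
      have st: "u (x + y) \<le> s x + t y" if tt: "s \<in> C" "t \<in> C" for s t x y
      proof -
        obtain r where r: "r \<in> C" "\<And>x. r x \<le> s x" "\<And>x. r x \<le> t x"
          using ch[OF tt] tt unfolding P_def by blast
        have "u (x + y) \<le> r (x + y)" by (rule ul[OF r(1)])
        also have "\<dots> \<le> r x + r y" using sub r(1) CA by blast
        also have "\<dots> \<le> s x + t y" by (intro add_mono r)
        finally show ?thesis .
      qed
      have "u (x + y) \<le> u x + u y" for x y
      proof -
        have "u (x + y) - t y \<le> u x" if "t \<in> C" for t
          unfolding u_def[of x] using False st[OF _ that, of _ x y] by (intro cINF_greatest) (auto simp: algebra_simps)
        then have "u (x + y) - u x \<le> u y"
          unfolding u_def[of y] using False by (intro cINF_greatest) (auto simp: algebra_simps)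
        then show ?thesis by linarith
      qed
      moreover have "u x \<le> q x" for x
      proof -
        obtain s where "s \<in> C" using False by blast
        with ul[of s x] CA show ?thesis unfolding A_def by (force intro: order_trans)
      qed
      ultimately have "u \<in> A" by (simp add: A_def)
      with ul show ?thesis by (auto simp: P_def)
    qed
  qed
  then obtain m where m: "m \<in> A" "\<forall>a\<in>A. P m a \<longrightarrow> a = m" by blast
  have min: "s = m" if "\<And>x y. s (x + y) \<le> s x + s y" "\<And>x. s x \<le> m x" for s
  proof -
    have "s \<in> A" using that m(1) unfolding A_def by (force intro: order_trans)
    with m(2) that(2) show ?thesis by (auto simp: P_def)
  qed
  have mult_le: "m (\<Sum>i<Suc n. x) \<le> real (Suc n) * m x" for n x
  proof (induction n)
    case (Suc n)
    have "m (\<Sum>i<Suc (Suc n). x) \<le> m (\<Sum>i<Suc n. x) + m x" unfolding sum.lessThan_Suc[of _ "Suc n"] by (rule sub[OF m(1)])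
    with Suc show ?case by (simp add: algebra_simps)
  qed simp
  \<comment> \<open>Multiples are written as sums because the group carries no scalars. Dividing
    \<open>m\<close> of the \<open>n\<close>-fold multiple by \<open>n\<close> gives a subadditive
    function below \<open>m\<close>, which by minimality is \<open>m\<close> itself.\<close>
  have hom: "m (\<Sum>i<Suc n. x) = real (Suc n) * m x" for n x
  proof -
    have "(\<lambda>x. m (\<Sum>i<Suc n. x) / real (Suc n)) = m"
    proof (rule min)
      fix x y
      have "m (\<Sum>i<Suc n. x + y) \<le> m (\<Sum>i<Suc n. x) + m (\<Sum>i<Suc n. y)"
        unfolding sum_const_add by (rule sub[OF m(1)])
      then show "m (\<Sum>i<Suc n. x + y) / real (Suc n) \<le> m (\<Sum>i<Suc n. x) / real (Suc n) + m (\<Sum>i<Suc n. y) / real (Suc n)"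
        unfolding add_divide_distrib[symmetric] by (rule divide_right_mono) simp
    next
      fix x show "m (\<Sum>i<Suc n. x) / real (Suc n) \<le> m x" using mult_le[where n = n and x = x]
        by (subst pos_divide_le_eq) (auto simp: mult.commute)
    qed
    from fun_cong[OF this, of x] show ?thesis by (simp only: divide_eq_eq mult.commute split: if_splits)
  qed
  have hom': "m (\<Sum>i<n. x) \<ge> real n * m x" for n x
  proof (cases n)
    case 0 then show ?thesis using sub[OF m(1), of 0 0] by simp
  qed (use hom in simp)
  have "m x + m z \<le> m (x + z)" for x z
  proof -
    \<comment> \<open>Again subadditive and below \<open>m\<close> (take \<open>n = 0\<close>),
      hence equal to \<open>m\<close>; the term for \<open>n = 1\<close> then gives the missing
      inequality.\<close>
    define s where "s x = (INF n. m (x + (\<Sum>i<n. z)) - real n * m z)" for x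
    have lb: "- m (- x) \<le> m (x + (\<Sum>i<n. z)) - real n * m z" for x n
      using sub[OF m(1), of "x + (\<Sum>i<n. z)" "- x"] hom'[where n = n and x = z] by simp
    have bdd: "bdd_below (range (\<lambda>n. m (x + (\<Sum>i<n. z)) - real n * m z))" for x
      using lb[of x] by (intro bdd_belowI[of _ "- m (- x)"]) auto
    have sl: "s x \<le> m (x + (\<Sum>i<n. z)) - real n * m z" for x n unfolding s_def by (rule cINF_lower[OF bdd]) simp
    have "s = m"
    proof (rule min)
      fix x y
      have st: "s (x + y) \<le> (m (x + (\<Sum>i<k. z)) - real k * m z) + (m (y + (\<Sum>i<n. z)) - real n * m z)" for k n
      proof -
        have "(\<Sum>i<k + n. z) = (\<Sum>i<k. z) + (\<Sum>i<n. z)" by (induction n) (simp_all add: add.assoc)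
        then have "m (x + y + (\<Sum>i<k + n. z)) \<le> m (x + (\<Sum>i<k. z)) + m (y + (\<Sum>i<n. z))"
          using sub[OF m(1), of "x + (\<Sum>i<k. z)" "y + (\<Sum>i<n. z)"] by (simp add: ac_simps)
        with sl[of "x + y" "k + n"] show ?thesis by (simp add: algebra_simps)
      qed
      have "s (x + y) - (m (y + (\<Sum>i<n. z)) - real n * m z) \<le> s x" for n
        unfolding s_def[of x] using st[of _ n] by (intro cINF_greatest) (auto simp: algebra_simps)
      then have "s (x + y) - s x \<le> s y"
        unfolding s_def[of y] by (intro cINF_greatest) (auto simp: algebra_simps)
      then show "s (x + y) \<le> s x + s y" by linarith
    next
      fix x show "s x \<le> m x" using sl[of x 0] by simp
    qed
    then show ?thesis using sl[of x 1] by simp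
  qed
  with sub[OF m(1)] have "m (x + z) = m x + m z" for x z by (simp add: antisym)
  moreover have "m x \<le> q x" for x using m(1) by (simp add: A_def)
  ultimately show ?thesis by blast
qed

section \<open>Global sections and the degree\<close>

context embedded_complex
begin

text \<open>A monomial whose degree exceeds \<open>N\<close> times the number of variables is
  divisible by the \<open>N\<close>-th power of one of them.\<close>

lemma hom_pigeonhole:
  "d > length ys * N \<Longrightarrow> hom ys d \<subseteq> kv.span {ys ! i ^ N * h | i h. i < length ys \<and> h \<in> hom ys (d - N)}"
proof (induction ys arbitrary: d rule: rev_induct)
  case Nil
  then obtain d' where "d = Suc d'" by (cases d) auto
  have "g = 0" if "g \<in> hom [] d" for g using hom_SucD[of g "[]" d'] that \<open>d = Suc d'\<close> by simp
  then show ?case using kv.span_zero by blast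
next
  case (snoc z ys)
  let ?U = "{(ys @ [z]) ! i ^ N * h | i h. i < length (ys @ [z]) \<and> h \<in> hom (ys @ [z]) (d - N)}"
  have lift: "hom ys e \<subseteq> hom (ys @ [z]) e" for e using hf_append unfolding hom_def by blast
  have zp: "z ^ n \<in> hom (ys @ [z]) n" for n
    using hom_power[OF hom_var[of "length ys" "ys @ [z]"], of n] by (simp add: nth_append)
  show ?case
  proof
    fix g assume "g \<in> hom (ys @ [z]) d"
    then obtain f where "hf (ys @ [z]) d g f" by (auto simp: hom_def)
    from hf_snocD[OF this] obtain G F where *: "\<forall>i\<le>d. hf ys (d - i) (G i) (F i)" "g = (\<Sum>i\<le>d. G i * z ^ i)" by blast
    have "G i * z ^ i \<in> kv.span ?U" if i: "i \<le> d" for i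
    proof (cases "i < N")
      case True
      have Gi: "G i \<in> hom ys (d - i)" using * i homI by blast
      have "length ys * N < d - i" using snoc.prems True by simp
      from snoc.IH[OF this] Gi have "G i \<in> kv.span {ys ! j ^ N * h | j h. j < length ys \<and> h \<in> hom ys (d - i - N)}" by blast
      from span_mult_right[OF this]
      have "G i * z ^ i \<in> kv.span ((\<lambda>t. t * z ^ i) ` {ys ! j ^ N * h | j h. j < length ys \<and> h \<in> hom ys (d - i - N)})" .
      moreover have "(\<lambda>t. t * z ^ i) ` {ys ! j ^ N * h | j h. j < length ys \<and> h \<in> hom ys (d - i - N)} \<subseteq> kv.span ?U"
      proof clarify
        fix j h assume jh: "j < length ys" "h \<in> hom ys (d - i - N)"
        show "ys ! j ^ N * h * z ^ i \<in> kv.span ?U"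
        proof (cases "d - i \<ge> N")
          case True
          have "h * z ^ i \<in> hom (ys @ [z]) (d - i - N + i)" using jh lift zp by (intro hom_mult) auto
          moreover have "d - i - N + i = d - N" using True i by simp
          ultimately have "(ys @ [z]) ! j ^ N * (h * z ^ i) \<in> ?U"
            using jh(1) by (intro CollectI exI[of _ j] exI[of _ "h * z ^ i"]) auto
          then show ?thesis using kv.span_base jh(1) by (simp add: nth_append mult.assoc)
        next
          case False
          have "N \<le> length ys * N" using jh(1) by (cases "length ys") auto
          with False \<open>length ys * N < d - i\<close> show ?thesis by simp
        qed
      qed
      ultimately show ?thesis using kv.span_minimal[OF _ kv.subspace_span] by blast
    next
      case False
      have "G i * z ^ (i - N) \<in> hom (ys @ [z]) (d - i + (i - N))" using * i lift zp homI by (intro hom_mult) blast+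
      moreover have "d - i + (i - N) = d - N" using i False by simp
      ultimately have "(ys @ [z]) ! length ys ^ N * (G i * z ^ (i - N)) \<in> ?U"
        by (intro CollectI exI[of _ "length ys"] exI[of _ "G i * z ^ (i - N)"]) auto
      moreover have "(ys @ [z]) ! length ys ^ N * (G i * z ^ (i - N)) = G i * z ^ i"
        using False by (simp add: nth_append mult.left_commute flip: power_add)
      ultimately have "G i * z ^ i \<in> ?U" by (simp only:)
      then show ?thesis by (rule kv.span_base)
    qed
    then show "g \<in> kv.span ?U" unfolding *(2) by (intro kv.span_sum) auto
  qed
qed

end

section \<open>Sections of the twists by hyperplanes\<close>

context variety
begin

text \<open>The condition on the valuations makes \<open>f\<close> a section of the
  \<open>m\<close>-th twist. Dividing by a coordinate that is nonzero at \<open>a\<close> leaves a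
  function without poles near \<open>a\<close>.\<close>

lemma section_local:
  assumes f: "f \<noteq> 0" "\<And>Y. Y \<in> PD \<Longrightarrow> int m * vv Y (xi Y) \<le> vv Y f"
    and a: "a \<in> pts" and i: "i < length V" "a ! i \<noteq> 0"
  shows "f / (V ! i) ^ m \<in> LR {a}"
proof (rule regular_extension[OF a])
  fix Y assume Y: "Y \<in> PD" "a \<in> Y"
  have nv: "\<not> vanishes_on Y (\<lambda>a. a ! i)" using Y(2) i(2) by (auto simp: vanishes_on_def)
  note nz = coord_nonzero[OF PD_primeset[OF Y(1)] i(1) nv]
  have "vv Y (V ! i) = int 1 * vv Y (xi Y)" using vv_form(2)[OF Y(1) hf_var[OF i(1)] nz] nv by blast
  then have "0 \<le> vv Y (f / (V ! i) ^ m)" using f Y(1) nz by (simp add: vv_divide vv_power)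
  then show "f / (V ! i) ^ m \<in> LR Y" using vv_nonneg_iff[OF Y(1)] f(1) nz by simp
qed

lemma sideal_colon: "subrng R \<Longrightarrow> sideal R {r \<in> R. r * h \<in> R}" for h :: 'k
  unfolding sideal_def by (auto simp: distrib_right mult.assoc subrng_simps)

text \<open>From local to global on an affine chart: if the ideal of denominators were proper, the
  Nullstellensatz would give a common zero of it, while regularity at that point provides a
  denominator that is nonzero there.\<close>

lemma section_chart:
  assumes f: "f \<noteq> 0" "\<And>Y. Y \<in> PD \<Longrightarrow> int m * vv Y (xi Y) \<le> vv Y f"
    and i: "i < length V" "V ! i \<noteq> 0"
  shows "f / (V ! i) ^ m \<in> chart V i"
proof (rule ccontr)
  assume no: "f / (V ! i) ^ m \<notin> chart V i"
  let ?h = "f / (V ! i) ^ m"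
  note R = subrng_chart[OF i]
  define J where "J = {r \<in> chart V i. r * ?h \<in> chart V i}"
  have J: "sideal (chart V i) J"
    unfolding J_def by (rule sideal_colon[OF R])
  have "(1 / (V ! i) ^ 0) ^ n \<notin> J" for n using no by (simp add: J_def)
  from nullstellensatz[OF i J hf_one this] obtain a where a: "a \<in> pts" "a ! i = 1"
    "\<And>d g k. hf V d g k \<Longrightarrow> g / (V ! i) ^ d \<in> J \<Longrightarrow> k a = 0" by blast
  have "?h \<in> LR {a}" using section_local[OF f a(1) i(1)] a(2) by simp
  then obtain d g k g' k' where h: "hf V d g k" "hf V d g' k'" "\<not> vanishes_on {a} k'" "?h = g / g'"
    unfolding local_ring_iff by blast
  have g'0: "g' \<noteq> 0" using primeset_nonzero[OF singleton_primeset[OF a(1)] h(2,3)] .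
  have "g' / (V ! i) ^ d \<in> chart V i" "g / (V ! i) ^ d \<in> chart V i" using h homI chartI by blast+
  moreover have "g' / (V ! i) ^ d * ?h = g / (V ! i) ^ d" unfolding h(4) using g'0 by simp
  ultimately have "g' / (V ! i) ^ d \<in> J" unfolding J_def by simp
  from a(3)[OF h(2) this] h(3) show False by (simp add: vanishes_on_def)
qed

text \<open>A section need not be a form, since \<open>V\<close> need not be projectively normal. A
  power of each coordinate turns it into one, and in large degrees every form is a combination of
  multiples of such powers.\<close>

theorem section_multiplier:
  assumes f: "f \<noteq> 0" "\<And>Y. Y \<in> PD \<Longrightarrow> int m * vv Y (xi Y) \<le> vv Y f"
  shows "\<exists>M. \<forall>d\<ge>M. \<forall>g\<in>hom V d. f * g \<in> hom V (d + m)"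
proof -
  \<comment> \<open>The exponent is kept positive so that a coordinate equal to 0 makes the product
    zero.\<close>
  have "\<exists>n. f * (V ! i) ^ Suc n \<in> hom V (Suc n + m)" if i: "i < length V" for i
  proof (cases "V ! i = 0")
    case True then show ?thesis by simp
  next
    case False
    from section_chart[OF f i False] obtain d g where g: "f / (V ! i) ^ m = g / (V ! i) ^ d" "g \<in> hom V d"
      by (auto simp: chart_def)
    have xp: "(V ! i) ^ n \<in> hom V n" for n using hom_power[OF hom_var[OF i], of n] by simp
    have "f * (V ! i) ^ d = g * (V ! i) ^ m" using g(1) False by (simp add: field_simps)
    then have "f * (V ! i) ^ Suc d = g * (V ! i) ^ Suc m" by (simp add: ac_simps)
    moreover have "g * (V ! i) ^ Suc m \<in> hom V (d + Suc m)" using g(2) xp by (intro hom_mult)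
    ultimately have "f * (V ! i) ^ Suc d \<in> hom V (d + Suc m)" by (simp only:)
    moreover have "d + Suc m = Suc d + m" by simp
    ultimately show ?thesis by (intro exI[of _ d]) (simp only:)
  qed
  then obtain nf where nf: "\<And>i. i < length V \<Longrightarrow> f * (V ! i) ^ Suc (nf i) \<in> hom V (Suc (nf i) + m)" by metis
  define N where "N = Max (insert 0 ((\<lambda>i. Suc (nf i)) ` {..<length V}))"
  have N: "f * (V ! i) ^ N \<in> hom V (N + m)" if i: "i < length V" for i
  proof -
    have le: "Suc (nf i) \<le> N" unfolding N_def using i by (intro Max_ge) auto
    have "(V ! i) ^ (N - Suc (nf i)) \<in> hom V (N - Suc (nf i))" using hom_power[OF hom_var[OF i]] by simp
    from hom_mult[OF nf[OF i] this]
    have "f * (V ! i) ^ Suc (nf i) * (V ! i) ^ (N - Suc (nf i)) \<in> hom V (Suc (nf i) + m + (N - Suc (nf i)))" .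
    moreover have "f * (V ! i) ^ Suc (nf i) * (V ! i) ^ (N - Suc (nf i)) = f * (V ! i) ^ N"
      using le by (simp only: mult.assoc flip: power_add) simp
    moreover have "Suc (nf i) + m + (N - Suc (nf i)) = N + m" using le by simp
    ultimately show ?thesis by (simp only:)
  qed
  show ?thesis
  proof (intro exI[of _ "Suc (length V * N)"] allI impI ballI)
    fix d g assume d: "d \<ge> Suc (length V * N)" and g: "g \<in> hom V d"
    obtain j where j: "j < length V" using coord_exists by blast
    have "N \<le> length V * N" using j by (cases "length V") auto
    then have dN: "N \<le> d" using d by linarith
    have "g \<in> kv.span {V ! i ^ N * h | i h. i < length V \<and> h \<in> hom V (d - N)}" using hom_pigeonhole[of V N d] d g by auto
    from span_mult_right[OF this]
    have "g * f \<in> kv.span ((\<lambda>t. t * f) ` {V ! i ^ N * h | i h. i < length V \<and> h \<in> hom V (d - N)})" .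
    moreover have "(\<lambda>t. t * f) ` {V ! i ^ N * h | i h. i < length V \<and> h \<in> hom V (d - N)} \<subseteq> hom V (d + m)"
    proof clarify
      fix i h assume "i < length V" "h \<in> hom V (d - N)"
      from hom_mult[OF N[OF this(1)] this(2)] have "f * V ! i ^ N * h \<in> hom V (N + m + (d - N))" .
      then show "V ! i ^ N * h * f \<in> hom V (d + m)" using dN by (simp add: ac_simps)
    qed
    ultimately have "g * f \<in> hom V (d + m)" using kv.span_minimal[OF _ subspace_hom] by blast
    then show "f * g \<in> hom V (d + m)" by (simp add: mult.commute)
  qed
qed

text \<open>After one multiplication by \<open>s\<close> the degrees stay above the bound of
  \<open>section_multiplier\<close>, so \<open>f\<close> can be applied any number of times with the
  same \<open>s\<close>.\<close>

lemma section_powers: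
  assumes f: "f \<noteq> 0" "\<And>Y. Y \<in> PD \<Longrightarrow> int m * vv Y (xi Y) \<le> vv Y f"
  obtains M s where "s \<in> hom V M" "s \<noteq> 0" "\<And>k. f ^ k * s \<in> hom V (M + m * k)"
proof -
  obtain M where M: "\<And>d g. d \<ge> M \<Longrightarrow> g \<in> hom V d \<Longrightarrow> f * g \<in> hom V (d + m)" using section_multiplier[OF f] by blast
  obtain j where j: "j < length V" "V ! j \<noteq> 0" using coord_exists by blast
  let ?s = "(V ! j) ^ M"
  have s: "?s \<in> hom V M" using hom_power[OF hom_var[OF j(1)], of M] by simp
  have "f ^ k * ?s \<in> hom V (M + m * k)" for k
  proof (induction k)
    case (Suc k)
    have "f * (f ^ k * ?s) \<in> hom V (M + m * k + m)" using M[OF _ Suc] by simp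
    then show ?case by (simp add: ac_simps)
  qed (use s in simp)
  with that[OF s] j show thesis by simp
qed

text \<open>For \<open>m = 0\<close> the products \<open>f ^ k * s\<close> remain in one space of
  finite dimension. A linear relation between them makes \<open>f\<close> algebraic over
  \<open>\<complex>\<close>.\<close>

theorem regular_function_const:
  assumes "\<And>Y. Y \<in> PD \<Longrightarrow> 0 \<le> vv Y f" shows "\<exists>c. f = \<iota> c"
proof (cases "f = 0")
  case True then show ?thesis by (metis iota_0)
next
  case False
  have f0: "int 0 * vv Y (xi Y) \<le> vv Y f" if "Y \<in> PD" for Y using assms[OF that] by simp
  obtain M s where s: "s \<in> hom V M" "s \<noteq> 0" "\<And>k. f ^ k * s \<in> hom V (M + 0 * k)"
    by (rule section_powers[OF False f0], assumption, rule that, assumption+)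
  obtain T where T: "finite T" "hom V M \<subseteq> kv.span T" using hom_span_bound by blast
  have "\<exists>l. (\<exists>i\<in>{..card T}. l i \<noteq> 0) \<and> (\<Sum>i\<in>{..card T}. \<iota> (l i) * (f ^ i * s)) = 0"
    using s(3) T by (intro family_dependent[OF _ T(1)]) auto
  then obtain l where l: "\<exists>i\<le>card T. l i \<noteq> 0" "(\<Sum>i\<le>card T. \<iota> (l i) * (f ^ i * s)) = 0" by auto
  define p where "p = (\<Sum>i\<le>card T. Polynomial.monom (l i) i)"
  have evm: "ev f (Polynomial.monom c n) = \<iota> c * f ^ n" for c n
    by (induction n) (auto simp: monom_0 monom_Suc ev_pCons algebra_simps)
  have "ev f p * s = 0" using l(2) by (simp add: p_def ev_sum evm sum_distrib_right mult.assoc)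
  then have "ev f p = 0" using s(2) by simp
  moreover have "p \<noteq> 0"
  proof -
    obtain i where "i \<le> card T" "l i \<noteq> 0" using l(1) by blast
    then have "Polynomial.coeff p i \<noteq> 0" by (simp add: p_def coeff_sum)
    then show ?thesis by auto
  qed
  ultimately show ?thesis using algebraic_is_const by blast
qed

text \<open>The Bezout inequality for the forms \<open>f ^ k * s\<close>: the contribution of
  \<open>s\<close> is bounded while that of \<open>f\<close> grows with \<open>k\<close>, so the
  same constant works for \<open>f\<close>.\<close>

theorem section_bezout:
  "\<exists>C::nat. \<forall>m f T. f \<noteq> 0 \<longrightarrow> (\<forall>Y\<in>PD. 0 \<le> od Y m f) \<longrightarrow> finite T \<longrightarrow> T \<subseteq> PD \<longrightarrow> (\<Sum>Y\<in>T. od Y m f) \<le> int C * int m"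
proof -
  obtain C :: nat where C: "\<And>m F T. F \<in> hom V m \<Longrightarrow> F \<noteq> 0 \<Longrightarrow> finite T \<Longrightarrow> T \<subseteq> PD \<Longrightarrow> (\<Sum>Y\<in>T. od Y m F) \<le> int C * int m"
    using bezout by blast
  have "(\<Sum>Y\<in>T. od Y m f) \<le> int C * int m"
    if f: "f \<noteq> 0" "\<forall>Y\<in>PD. 0 \<le> od Y m f" and T: "finite T" "T \<subseteq> PD" for m f T
  proof (rule ccontr)
    assume "\<not> ?thesis"
    then have gt: "int C * int m + 1 \<le> (\<Sum>Y\<in>T. od Y m f)" by linarith
    have f': "int m * vv Y (xi Y) \<le> vv Y f" if "Y \<in> PD" for Y using f(2) that by (simp add: od_def)
    obtain M s where s: "s \<in> hom V M" "s \<noteq> 0" "\<And>k. f ^ k * s \<in> hom V (M + m * k)"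
      by (rule section_powers[OF f(1) f'], assumption, rule that, assumption+)
    \<comment> \<open>Integrality turns a violation into an excess of at least 1 for each factor
      \<open>f\<close>; an excess of \<open>k\<close> contradicts the slack
      \<open>C * M\<close>.\<close>
    define k where "k = C * M + 1"
    have "int k * (\<Sum>Y\<in>T. od Y m f) \<le> (\<Sum>Y\<in>T. od Y (M + m * k) (f ^ k * s))"
      unfolding sum_distrib_left
    proof (rule sum_mono)
      fix Y assume "Y \<in> T"
      then have Y: "Y \<in> PD" using T by blast
      have "od Y (m * k + M) (f ^ k * s) = int k * od Y m f + od Y M s" using f s by (simp add: od_mult[OF Y] od_power[OF Y])
      then show "int k * od Y m f \<le> od Y (M + m * k) (f ^ k * s)" using od_nonneg[OF Y s(1,2)] by (simp add: add.commute)
    qed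
    also have "\<dots> \<le> int C * int (M + m * k)" using s f T by (intro C) auto
    finally have "int k * (int C * int m + 1) \<le> int C * int (M + m * k)"
      using mult_left_mono[OF gt, of "int k"] by simp
    then show False by (simp add: k_def algebra_simps)
  qed
  then show ?thesis by blast
qed

text \<open>Each divisor in the support contributes at least 1 to a sum bounded by
  \<open>C * d\<close>.\<close>

lemma finite_form_support:
  assumes "F \<in> hom V d" "F \<noteq> 0" shows "finite {Y\<in>PD. od Y d F \<noteq> 0}"
proof (rule ccontr)
  assume inf: "infinite {Y\<in>PD. od Y d F \<noteq> 0}"
  obtain C :: nat where C: "\<And>m F T. F \<in> hom V m \<Longrightarrow> F \<noteq> 0 \<Longrightarrow> finite T \<Longrightarrow> T \<subseteq> PD \<Longrightarrow> (\<Sum>Y\<in>T. od Y m F) \<le> int C * int m"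
    using bezout by blast
  obtain T where T: "T \<subseteq> {Y\<in>PD. od Y d F \<noteq> 0}" "finite T" "card T = C * d + 1"
    using infinite_arbitrarily_large[OF inf] by blast
  have "int (card T) = (\<Sum>Y\<in>T. 1)" by simp
  also have "\<dots> \<le> (\<Sum>Y\<in>T. od Y d F)"
    using T(1) od_nonneg[OF _ assms] by (intro sum_mono) force
  also have "\<dots> \<le> int C * int d" using T assms by (intro C) auto
  finally show False using T(3) by simp
qed

lemma finite_support:
  assumes "f \<noteq> 0" shows "finite {Y\<in>PD. vv Y f \<noteq> 0}"
proof -
  obtain d F G where FG: "F \<in> forms (length V) d" "G \<in> forms (length V) d" "eval_mpoly \<iota> G V \<noteq> 0"
    "f = eval_mpoly \<iota> F V / eval_mpoly \<iota> G V" using pv unfolding projective_variety_def by blast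
  define g h where "g = eval_mpoly \<iota> F V" and "h = eval_mpoly \<iota> G V"
  have gh: "g \<in> hom V d" "h \<in> hom V d" "h \<noteq> 0" "f = g / h" "g \<noteq> 0"
    using homI[OF hf_eval_mpoly[OF FG(1)]] homI[OF hf_eval_mpoly[OF FG(2)]] FG assms by (auto simp: g_def h_def)
  have "{Y\<in>PD. vv Y f \<noteq> 0} \<subseteq> {Y\<in>PD. od Y d g \<noteq> 0} \<union> {Y\<in>PD. od Y d h \<noteq> 0}"
    using gh by (auto simp: od_def vv_divide)
  then show ?thesis using finite_form_support gh finite_subset by blast
qed

section \<open>The additive degree on divisors\<close>

definition divisor :: "(complex list set \<Rightarrow> int) \<Rightarrow> weil_divisor" where
  "divisor h = Abs_poly_mapping (\<lambda>Y. if Y \<in> PD then h Y else 0)"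

lemma lookup_divisor:
  assumes "finite {Y\<in>PD. h Y \<noteq> 0}"
  shows "Poly_Mapping.lookup (divisor h) Y = (if Y \<in> PD then h Y else 0)"
  unfolding divisor_def
proof (subst Abs_poly_mapping_inverse)
  have "{Y. (if Y \<in> PD then h Y else 0) \<noteq> 0} = {Y\<in>PD. h Y \<noteq> 0}" by auto
  with assms show "(\<lambda>Y. if Y \<in> PD then h Y else 0) \<in> {f. finite {x. f x \<noteq> 0}}" by simp
qed simp

text \<open>The type \<open>weil_divisor\<close> also contains functions supported outside the prime
  divisors. As in \<open>prin\<close> and \<open>mult_sum\<close>, these coefficients are ignored,
  so that the degree can be defined on the whole type, a group to which
  \<open>additive_minorant\<close> applies.\<close>

definition effective :: "weil_divisor \<Rightarrow> bool" where
  "effective E \<longleftrightarrow> (\<forall>Y\<in>PD. 0 \<le> Poly_Mapping.lookup E Y)"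

definition prin :: "weil_divisor \<Rightarrow> bool" where
  "prin D \<longleftrightarrow> (\<exists>f. f \<noteq> 0 \<and> (\<forall>Y\<in>PD. Poly_Mapping.lookup D Y = vv Y f))"

definition mult_sum :: "weil_divisor \<Rightarrow> int" where
  "mult_sum E = (\<Sum>Y\<in>Poly_Mapping.keys E \<inter> PD. Poly_Mapping.lookup E Y)"

lemma mult_sum_superset:
  assumes "finite T" "Poly_Mapping.keys E \<inter> PD \<subseteq> T" "T \<subseteq> PD"
  shows "mult_sum E = (\<Sum>Y\<in>T. Poly_Mapping.lookup E Y)"
  unfolding mult_sum_def using assms by (intro sum.mono_neutral_left) (auto simp: in_keys_iff)

lemma mult_sum_add: "mult_sum (D + E) = mult_sum D + mult_sum E"
proof -
  let ?T = "(Poly_Mapping.keys D \<union> Poly_Mapping.keys E) \<inter> PD"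
  have "Poly_Mapping.keys (D + E) \<subseteq> Poly_Mapping.keys D \<union> Poly_Mapping.keys E" by (rule Poly_Mapping.keys_add)
  then show ?thesis
    by (subst (1 2 3) mult_sum_superset[of ?T]) (auto simp: lookup_add sum.distrib)
qed

text \<open>A principal divisor and its negative both have \<open>q\<close> at most 0, which makes
  \<open>w\<close> vanish there; for effective \<open>E\<close> the lower bound on
  \<open>w E\<close> comes from an upper bound on \<open>w (- E)\<close>.\<close>

theorem degree_exists:
  "\<exists>w::weil_divisor \<Rightarrow> real. (\<forall>D E. w (D + E) = w D + w E) \<and> (\<forall>D. prin D \<longrightarrow> w D = 0) \<and>
     (\<forall>E. effective E \<longrightarrow> real_of_int (mult_sum E) \<le> w E)"
proof -
  obtain C :: nat where C0: "\<forall>m f T. f \<noteq> 0 \<longrightarrow> (\<forall>Y\<in>PD. 0 \<le> od Y m f) \<longrightarrow> finite T \<longrightarrow> T \<subseteq> PD \<longrightarrow> (\<Sum>Y\<in>T. od Y m f) \<le> int C * int m"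
    using section_bezout by (rule exE)
  have C: "(\<Sum>Y\<in>T. od Y m f) \<le> int C * int m"
    if "f \<noteq> 0" "\<And>Y. Y \<in> PD \<Longrightarrow> 0 \<le> od Y m f" "finite T" "T \<subseteq> PD" for m f T
    using C0[rule_format, OF that(1) _ that(3,4)] that(2) by simp
  obtain j where j: "j < length V" "V ! j \<noteq> 0" using coord_exists by blast
  define x where "x = V ! j"
  have x: "x \<in> hom V 1" "x \<noteq> 0" using j hom_var by (auto simp: x_def)
  \<comment> \<open>Linear equivalence to \<open>r\<close> times the divisor of the coordinate
    \<open>x\<close>, whose multiplicity along \<open>Y\<close> is \<open>od Y 1 x\<close>.\<close>
  define rel where "rel D r \<longleftrightarrow> (\<exists>f. f \<noteq> 0 \<and> (\<forall>Y\<in>PD. Poly_Mapping.lookup D Y - int r * od Y 1 x = vv Y f))" for D r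
  have rel_add: "rel (D + D') (r + r')" if rr: "rel D r" "rel D' r'" for D D' r r'
  proof -
    obtain f f' where "f \<noteq> 0" "\<forall>Y\<in>PD. Poly_Mapping.lookup D Y - int r * od Y 1 x = vv Y f"
      "f' \<noteq> 0" "\<forall>Y\<in>PD. Poly_Mapping.lookup D' Y - int r' * od Y 1 x = vv Y f'" using rr unfolding rel_def by blast
    then show ?thesis unfolding rel_def
      by (intro exI[of _ "f * f'"]) (auto simp: lookup_add vv_mult algebra_simps)
  qed
  have bound: "mult_sum E \<le> int C * int r" if E: "effective E" "rel E r" for E r
  proof -
    obtain f where f: "f \<noteq> 0" "\<And>Y. Y \<in> PD \<Longrightarrow> Poly_Mapping.lookup E Y - int r * od Y 1 x = vv Y f" using E unfolding rel_def by blast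
    \<comment> \<open>Adding the hyperplane sections back turns the rational function into a section
      of degree \<open>r\<close> whose orders are the multiplicities of \<open>E\<close>.\<close>
    have o: "od Y r (f * x ^ r) = Poly_Mapping.lookup E Y" if Y: "Y \<in> PD" for Y
      using f(2)[OF Y] f(1) x(2) Y by (simp add: od_def vv_mult vv_power algebra_simps)
    have "(\<Sum>Y\<in>Poly_Mapping.keys E \<inter> PD. od Y r (f * x ^ r)) \<le> int C * int r"
      using f(1) x(2) E(1) o by (intro C) (auto simp: effective_def)
    moreover have "(\<Sum>Y\<in>Poly_Mapping.keys E \<inter> PD. od Y r (f * x ^ r)) = mult_sum E"
      unfolding mult_sum_def by (intro sum.cong) (auto simp: o)
    ultimately show ?thesis by simp
  qed
  \<comment> \<open>A form vanishing to orders at least those of \<open>D\<close> exists in some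
    degree \<open>r\<close>; its excess over \<open>D\<close> is the effective complement.\<close>
  have exE: "\<exists>r E. effective E \<and> rel (D + E) r" for D
  proof -
    define T where "T = Poly_Mapping.keys D \<inter> PD"
    have "\<exists>r. \<exists>g\<in>hom V r. g \<noteq> 0 \<and> (\<forall>Y\<in>T. int (nat (Poly_Mapping.lookup D Y)) \<le> od Y r g)"
    proof (cases "T = {}")
      case True then show ?thesis using hom_one by (intro exI[of _ 0] bexI[of _ 1]) auto
    next
      case False
      then obtain Y0 where "Y0 \<in> T" by blast
      moreover have "T \<subseteq> PD" "finite T" by (auto simp: T_def)
      ultimately have "\<exists>r. \<exists>g\<in>hom V r. g \<noteq> 0 \<and> (\<forall>Y\<in>T. int (nat (Poly_Mapping.lookup D Y)) \<le> od Y r g) \<and>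
        od Y0 r g = int (nat (Poly_Mapping.lookup D Y0))" by (rule form_with_orders)
      then obtain r g where "g \<in> hom V r" "g \<noteq> 0" "\<forall>Y\<in>T. int (nat (Poly_Mapping.lookup D Y)) \<le> od Y r g"
        by (elim exE bexE conjE) (rule that)
      then show ?thesis by (intro exI[of _ r] bexI[of _ g] conjI)
    qed
    then obtain r g where g: "g \<in> hom V r" "g \<noteq> 0" and g3: "\<forall>Y\<in>T. int (nat (Poly_Mapping.lookup D Y)) \<le> od Y r g"
      by (elim exE bexE conjE) (rule that)
    note g = g bspec[OF g3]
    define h where "h Y = od Y r g - Poly_Mapping.lookup D Y" for Y
    have "{Y\<in>PD. h Y \<noteq> 0} \<subseteq> {Y\<in>PD. od Y r g \<noteq> 0} \<union> Poly_Mapping.keys D" by (auto simp: h_def in_keys_iff)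
    then have fin: "finite {Y\<in>PD. h Y \<noteq> 0}" by (rule finite_subset) (simp add: finite_form_support[OF g(1,2)])
    have "0 \<le> h Y" if "Y \<in> PD" for Y
    proof (cases "Y \<in> T")
      case True then show ?thesis using g(3)[of Y] unfolding h_def by linarith
    next
      case False
      with that have "Poly_Mapping.lookup D Y = 0" by (auto simp: T_def in_keys_iff)
      then show ?thesis using od_nonneg[OF that g(1,2)] by (simp add: h_def)
    qed
    then have "effective (divisor h)" using lookup_divisor[OF fin] by (simp add: effective_def)
    moreover have "Poly_Mapping.lookup (divisor h) Y = od Y r g - Poly_Mapping.lookup D Y" if "Y \<in> PD" for Y
      using lookup_divisor[OF fin, of Y] that h_def[of Y] by simp
    then have "rel (D + divisor h) r" unfolding rel_def
      using g(2) x(2)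
      by (intro exI[of _ "g / x ^ r"]) (auto simp: lookup_add od_def vv_divide vv_power algebra_simps)
    ultimately show ?thesis by blast
  qed
  define S where "S D = {real C * real r - real_of_int (mult_sum E) | r E. effective E \<and> rel (D + E) r}" for D
  have Sne: "S D \<noteq> {}" for D using exE[of D] unfolding S_def by blast
  have Sbdd: "bdd_below (S D)" for D
  proof -
    \<comment> \<open>An effective complement of \<open>- D\<close> is fixed. Together with any
      complement \<open>E\<close> of \<open>D\<close> it is equivalent to \<open>r + r'\<close>
      hyperplane sections, so the Bezout inequality bounds \<open>mult_sum E\<close>.\<close>
    obtain r' E' where E': "effective E'" "rel (- D + E') r'" using exE by blast
    show ?thesis
    proof (rule bdd_belowI)
      fix s assume "s \<in> S D"
      then obtain r E where E: "effective E" "rel (D + E) r" "s = real C * real r - real_of_int (mult_sum E)" unfolding S_def by blast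
      have "rel (E + E') (r + r')" using rel_add[OF E(2) E'(2)] by (simp add: ac_simps)
      moreover have "effective (E + E')" using E(1) E'(1) by (simp add: effective_def lookup_add)
      ultimately have "mult_sum E + mult_sum E' \<le> int C * int (r + r')" using bound mult_sum_add by metis
      then have "real_of_int (mult_sum E + mult_sum E') \<le> real_of_int (int C * int (r + r'))" by (simp only: of_int_le_iff)
      then show "real_of_int (mult_sum E') - real C * real r' \<le> s" by (simp add: E(3) algebra_simps)
    qed
  qed
  define q where "q D = Inf (S D)" for D
  have qle: "q D \<le> s" if "s \<in> S D" for D s unfolding q_def using that Sbdd by (rule cInf_lower)
  have "q (D + D') \<le> q D + q D'" for D D'
  proof -
    have st: "q (D + D') \<le> s + t" if st: "s \<in> S D" "t \<in> S D'" for s t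
    proof -
      obtain r E where E: "effective E" "rel (D + E) r" "s = real C * real r - real_of_int (mult_sum E)" using st(1) unfolding S_def by blast
      obtain r' E' where E': "effective E'" "rel (D' + E') r'" "t = real C * real r' - real_of_int (mult_sum E')" using st(2) unfolding S_def by blast
      have "rel (D + D' + (E + E')) (r + r')" using rel_add[OF E(2) E'(2)] by (simp add: ac_simps)
      moreover have "effective (E + E')" using E(1) E'(1) by (simp add: effective_def lookup_add)
      ultimately have "real C * real (r + r') - real_of_int (mult_sum (E + E')) \<in> S (D + D')" unfolding S_def by blast
      from qle[OF this] show ?thesis by (simp add: E(3) E'(3) mult_sum_add algebra_simps)
    qed
    have "q (D + D') - t \<le> q D" if "t \<in> S D'" for t
      unfolding q_def[of D] using Sne st[OF _ that] by (intro cInf_greatest) (auto simp: algebra_simps)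
    then have "q (D + D') - q D \<le> q D'" unfolding q_def[of D'] using Sne by (intro cInf_greatest) (auto simp: algebra_simps)
    then show ?thesis by linarith
  qed
  then obtain w where w: "\<And>D E. w (D + E) = w D + w E" "\<And>D. w D \<le> q D" using additive_minorant[of q] by blast
  have w0: "w 0 = 0" using w(1)[of 0 0] by simp
  have wneg: "w (- D) = - w D" for D using w(1)[of D "-D"] w0 by simp
  have wprin: "w D \<le> 0" if "prin D" for D
  proof -
    have "effective 0" by (simp add: effective_def)
    moreover have "rel (D + 0) 0" using that by (simp add: rel_def prin_def)
    ultimately have "real C * real 0 - real_of_int (mult_sum 0) \<in> S D" unfolding S_def by blast
    from qle[OF this] w(2)[of D] show ?thesis by (simp add: mult_sum_def)
  qed
  have "w D = 0" if pD: "prin D" for D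
  proof -
    obtain f where f: "f \<noteq> 0" "\<And>Y. Y \<in> PD \<Longrightarrow> Poly_Mapping.lookup D Y = vv Y f" using pD unfolding prin_def by blast
    have "prin (- D)" unfolding prin_def
    proof (intro exI[of _ "1 / f"] conjI ballI)
      fix Y assume "Y \<in> PD"
      then show "Poly_Mapping.lookup (- D) Y = vv Y (1 / f)"
        using f by (simp add: vv_divide vv_one)
    qed (use f in simp)
    from wprin[OF this] wprin[OF pD] wneg[of D] show ?thesis by simp
  qed
  moreover have "real_of_int (mult_sum E) \<le> w E" if "effective E" for E
  proof -
    \<comment> \<open>The divisor \<open>E\<close> is itself a complement of \<open>- E\<close>,
      with no hyperplane sections at all.\<close>
    have "rel (- E + E) 0" by (auto simp: rel_def vv_one intro!: exI[of _ 1])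
    with that have "real C * real 0 - real_of_int (mult_sum E) \<in> S (- E)" unfolding S_def by blast
    from qle[OF this] w(2)[of "- E"] wneg[of E] show ?thesis by simp
  qed
  ultimately show ?thesis using w(1) by blast
qed

text \<open>A section \<open>f\<close> makes \<open>D\<close> plus the divisor of \<open>f\<close>
  effective, of the same weight as \<open>D\<close>. If this weight is 0, all multiplicities are 0,
  and \<open>D\<close> is the divisor of \<open>1 / f\<close>.\<close>

theorem degree_of_sections:
  "\<exists>w::weil_divisor \<Rightarrow> real. (\<forall>D E. w (D + E) = w D + w E) \<and>
     (\<forall>D. principal_divisor \<iota> V D \<longrightarrow> w D = 0) \<and>
     (\<forall>D\<in>weil_divisors \<iota> V. \<forall>f\<in>global_sections \<iota> V D. f \<noteq> 0 \<longrightarrow>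
        0 \<le> w D \<and> (w D = 0 \<longrightarrow> principal_divisor \<iota> V D))"
proof -
  obtain w :: "weil_divisor \<Rightarrow> real" where w: "\<And>D E. w (D + E) = w D + w E" "\<And>D. prin D \<Longrightarrow> w D = 0"
    "\<And>E. effective E \<Longrightarrow> real_of_int (mult_sum E) \<le> w E" using degree_exists by blast
  show ?thesis
  proof (intro exI[of _ w] conjI allI impI ballI)
    show "w (D + E) = w D + w E" for D E by (rule w(1))
    show "w D = 0" if "principal_divisor \<iota> V D" for D
      using that w(2) unfolding principal_divisor_def is_divisor_of_def prin_def by blast
    fix D f assume D: "D \<in> weil_divisors \<iota> V" and f: "f \<in> global_sections \<iota> V D" "f \<noteq> 0"
    note ld = lookup_divisor[OF finite_support[OF f(2)]]
    define E where "E = D + divisor (\<lambda>Y. vv Y f)"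
    have lE: "Poly_Mapping.lookup E Y = Poly_Mapping.lookup D Y + vv Y f" if "Y \<in> PD" for Y
      using that by (simp add: E_def lookup_add ld)
    have E: "effective E" using f by (auto simp: effective_def lE global_sections_def)
    have "prin (divisor (\<lambda>Y. vv Y f))" using f(2) by (auto simp: prin_def ld)
    then have wE: "w E = w D" using w(1,2) by (simp add: E_def)
    have s0: "0 \<le> mult_sum E" unfolding mult_sum_def using E by (intro sum_nonneg) (auto simp: effective_def)
    then show "0 \<le> w D" using w(3)[OF E] wE by simp
    assume "w D = 0"
    then have "mult_sum E = 0" using w(3)[OF E] wE s0 by simp
    then have "\<forall>Y\<in>Poly_Mapping.keys E \<inter> PD. Poly_Mapping.lookup E Y = 0"
      unfolding mult_sum_def using E by (subst (asm) sum_nonneg_eq_0_iff) (auto simp: effective_def)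
    then have "Poly_Mapping.lookup D Y + vv Y f = 0" if "Y \<in> PD" for Y using that lE by (auto simp: in_keys_iff)
    then have "\<forall>Y\<in>PD. Poly_Mapping.lookup D Y = vv Y (1 / f)" using f(2) by (auto simp: vv_divide vv_one eq_neg_iff_add_eq_0)
    then show "principal_divisor \<iota> V D" unfolding principal_divisor_def is_divisor_of_def
      using D f(2) by (intro exI[of _ "1 / f"]) auto
  qed
qed

end

section \<open>The contraction of the spectrum of the Cox ring\<close>

text \<open>Base points move during the contraction, which is harmless because
  \<open>simply_connected\<close> asks for free homotopies of loops. Applied to constant loops, it
  includes path connectedness.\<close>

lemma simply_connected_contraction:
  fixes S :: "'a::topological_space set" and h :: "real \<Rightarrow> 'a \<Rightarrow> 'a"
  assumes cont: "continuous_on ({0..1} \<times> S) (\<lambda>(t, x). h t x)"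
    and mem: "\<And>t x. t \<in> {0..1} \<Longrightarrow> x \<in> S \<Longrightarrow> h t x \<in> S"
    and h1: "\<And>x. x \<in> S \<Longrightarrow> h 1 x = x" and h0: "\<And>x. x \<in> S \<Longrightarrow> h 0 x = z"
  shows "simply_connected S"
proof -
  have null: "homotopic_loops S p (\<lambda>_. z)" if p: "path p" "pathfinish p = pathstart p" "path_image p \<subseteq> S" for p
    unfolding homotopic_loops
  proof (intro exI[of _ "\<lambda>y. h (1 - fst y) (p (snd y))"] conjI ballI)
    have pS: "p s \<in> S" if "s \<in> {0..1}" for s using p(3) that by (auto simp: path_image_def)
    have "continuous_on ({0..1::real} \<times> {0..1::real}) (\<lambda>y. (1 - fst y, p (snd y)))"
      using p(1) unfolding path_def
      by (intro continuous_intros continuous_on_compose2[of "{0..1}" p _ snd]) auto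
    then have "continuous_on ({0..1::real} \<times> {0..1::real}) (\<lambda>y. (case (1 - fst y, p (snd y)) of (t, x) \<Rightarrow> h t x))"
      by (rule continuous_on_compose2[OF cont]) (use pS in auto)
    then show "continuous_on ({0..1::real} \<times> {0..1::real}) (\<lambda>y. h (1 - fst y) (p (snd y)))" by simp
    show "(\<lambda>y. h (1 - fst y) (p (snd y))) \<in> {0..1} \<times> {0..1} \<rightarrow> S" using mem pS by auto
    fix s :: real assume s: "s \<in> {0..1}"
    show "h (1 - fst (0, s)) (p (snd (0, s))) = p s" using h1 pS s by simp
    show "h (1 - fst (1, s)) (p (snd (1, s))) = z" using h0 pS s by simp
    show "pathfinish ((\<lambda>y. h (1 - fst y) (p (snd y))) \<circ> Pair s) = pathstart ((\<lambda>y. h (1 - fst y) (p (snd y))) \<circ> Pair s)"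
      using p(2) by (simp add: pathfinish_def pathstart_def)
  qed
  show ?thesis unfolding simply_connected_def
    using null homotopic_loops_sym homotopic_loops_trans by metis
qed

lemma poly_mapping_sum_single: "s = (\<Sum>D\<in>Poly_Mapping.keys s. Poly_Mapping.single D (Poly_Mapping.lookup s D))"
  by (rule poly_mapping_eqI) (auto simp: lookup_sum lookup_single when_def in_keys_iff)

section \<open>The section ring and the Cox ideal\<close>

locale cox = variety \<iota> V for \<iota> :: "complex \<Rightarrow> 'k::field" and V +
  fixes W :: "weil_divisor set" and \<psi> :: "weil_divisor \<Rightarrow> 'k"
  assumes cd: "cox_data \<iota> V W \<psi>"
begin

abbreviation "SR \<equiv> section_ring \<iota> V W"
abbreviation "CI \<equiv> cox_ideal \<iota> V W \<psi>"
abbreviation "CR \<equiv> cox_ring \<iota> V W \<psi>"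
abbreviation "GS \<equiv> global_sections \<iota> V"
abbreviation "prn \<equiv> principal_divisor \<iota> V"

lemma W_weil: "D \<in> W \<Longrightarrow> D \<in> weil_divisors \<iota> V"
  and W_0: "0 \<in> W"
  and W_diff: "D \<in> W \<Longrightarrow> E \<in> W \<Longrightarrow> D - E \<in> W"
  and psi: "E \<in> W \<Longrightarrow> prn E \<Longrightarrow> is_divisor_of \<iota> V (\<psi> E) E"
  using cd unfolding cox_data_def by blast+

lemma W_neg: "D \<in> W \<Longrightarrow> - D \<in> W" using W_diff[OF W_0] by force
lemma W_add: "D \<in> W \<Longrightarrow> E \<in> W \<Longrightarrow> D + E \<in> W" using W_diff[OF _ W_neg] by force

lemma psi_nonzero: "E \<in> W \<Longrightarrow> prn E \<Longrightarrow> \<psi> E \<noteq> 0"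
  and psi_ord: "E \<in> W \<Longrightarrow> prn E \<Longrightarrow> Y \<in> PD \<Longrightarrow> vv Y (\<psi> E) = Poly_Mapping.lookup E Y"
  using psi unfolding is_divisor_of_def by force+

lemma GS_0: "0 \<in> GS D" by (simp add: global_sections_def)

lemma GS_iff: "f \<noteq> 0 \<Longrightarrow> f \<in> GS D \<longleftrightarrow> (\<forall>Y\<in>PD. 0 \<le> vv Y f + Poly_Mapping.lookup D Y)"
  by (simp add: global_sections_def)

lemma GS_add:
  assumes "f \<in> GS D" "g \<in> GS D" shows "f + g \<in> GS D"
proof (cases "f = 0 \<or> g = 0 \<or> f + g = 0")
  case True then show ?thesis using assms GS_0 by auto
next
  case False
  then have nz: "f \<noteq> 0" "g \<noteq> 0" "f + g \<noteq> 0" by auto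
  show ?thesis unfolding GS_iff[OF nz(3)]
  proof
    fix Y assume Y: "Y \<in> PD"
    from vv_add[OF Y nz] assms Y nz show "0 \<le> vv Y (f + g) + Poly_Mapping.lookup D Y"
      by (fastforce simp: GS_iff min_def split: if_splits)
  qed
qed

lemma GS_mult:
  assumes "f \<in> GS D" "g \<in> GS E" shows "f * g \<in> GS (D + E)"
proof (cases "f = 0 \<or> g = 0")
  case True then show ?thesis using GS_0 by auto
next
  case False
  then have nz: "f \<noteq> 0" "g \<noteq> 0" "f * g \<noteq> 0" by auto
  show ?thesis unfolding GS_iff[OF nz(3)]
  proof
    fix Y assume Y: "Y \<in> PD"
    have "0 \<le> vv Y f + Poly_Mapping.lookup D Y" "0 \<le> vv Y g + Poly_Mapping.lookup E Y" using assms Y nz by (auto simp: GS_iff)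
    then show "0 \<le> vv Y (f * g) + Poly_Mapping.lookup (D + E) Y" by (simp add: vv_mult[OF Y nz(1,2)] lookup_add)
  qed
qed

lemma GS_const: "\<iota> c \<in> GS 0"
  by (cases "c = 0") (auto simp: GS_0 GS_iff v_const)

lemma GS_neg: "f \<in> GS D \<Longrightarrow> - f \<in> GS D"
  using GS_mult[OF GS_const[of "-1"], of f D] by (simp add: iota_uminus)

lemma carrier_SR: "carrier SR = {s. Poly_Mapping.keys s \<subseteq> W \<and> (\<forall>D\<in>W. Poly_Mapping.lookup s D \<in> GS D)}"
  and SR_mult [simp]: "s \<otimes>\<^bsub>SR\<^esub> s' = s * s'"
  and SR_add [simp]: "s \<oplus>\<^bsub>SR\<^esub> s' = s + s'"
  and SR_one [simp]: "\<one>\<^bsub>SR\<^esub> = 1"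
  and SR_zero [simp]: "\<zero>\<^bsub>SR\<^esub> = 0"
  by (simp_all add: section_ring_def ring_of_type_algebra_def)

lemma SR_single: "D \<in> W \<Longrightarrow> f \<in> GS D \<Longrightarrow> Poly_Mapping.single D f \<in> carrier SR"
  by (auto simp: carrier_SR lookup_single when_def GS_0)

lemma SR_lookup: "s \<in> carrier SR \<Longrightarrow> D \<in> Poly_Mapping.keys s \<Longrightarrow> D \<in> W \<and> Poly_Mapping.lookup s D \<in> GS D \<and> Poly_Mapping.lookup s D \<noteq> 0"
  by (auto simp: carrier_SR in_keys_iff)

lemma SR_0: "0 \<in> carrier SR" by (auto simp: carrier_SR GS_0)

lemma SR_add_closed: "s \<in> carrier SR \<Longrightarrow> s' \<in> carrier SR \<Longrightarrow> s + s' \<in> carrier SR"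
  using Poly_Mapping.keys_add[of s s'] by (auto simp: carrier_SR lookup_add GS_add)

lemma SR_neg_closed: "s \<in> carrier SR \<Longrightarrow> - s \<in> carrier SR"
  by (auto simp: carrier_SR GS_neg in_keys_iff subset_iff)

lemma SR_sum: "(\<And>i. i \<in> A \<Longrightarrow> s i \<in> carrier SR) \<Longrightarrow> (\<Sum>i\<in>A. s i) \<in> carrier SR"
  by (induction A rule: infinite_finite_induct) (auto simp: SR_0 SR_add_closed)

lemma mult_expand: "s * s' = (\<Sum>D\<in>Poly_Mapping.keys s. \<Sum>E\<in>Poly_Mapping.keys s'.
    Poly_Mapping.single (D + E) (Poly_Mapping.lookup s D * Poly_Mapping.lookup s' E))" for s s' :: "weil_divisor \<Rightarrow>\<^sub>0 'k"
proof -
  have "s * s' = (\<Sum>D\<in>Poly_Mapping.keys s. Poly_Mapping.single D (Poly_Mapping.lookup s D)) *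
    (\<Sum>E\<in>Poly_Mapping.keys s'. Poly_Mapping.single E (Poly_Mapping.lookup s' E))"
    using poly_mapping_sum_single[of s] poly_mapping_sum_single[of s'] by simp
  then show ?thesis by (simp add: sum_product mult_single)
qed

lemma SR_mult_closed: "s \<in> carrier SR \<Longrightarrow> s' \<in> carrier SR \<Longrightarrow> s * s' \<in> carrier SR"
  unfolding mult_expand using SR_lookup by (intro SR_sum SR_single W_add GS_mult) blast+

lemma SR_one_closed: "1 \<in> carrier SR"
  using SR_single[OF W_0 GS_const[of 1]] by simp

lemma ring_SR: "ring SR"
proof (rule ringI)
  show "abelian_group SR"
    by (rule abelian_groupI) (auto simp: SR_0 SR_add_closed add.assoc add.commute intro: bexI[OF _ SR_neg_closed])
  show "Group.monoid SR"
    by (rule monoidI) (auto simp: SR_one_closed SR_mult_closed mult.assoc)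
qed (auto simp: algebra_simps)

sublocale SR: ring SR by (rule ring_SR)

definition relator :: "weil_divisor \<Rightarrow> weil_divisor \<Rightarrow>\<^sub>0 'k" where
  "relator E = 1 - Poly_Mapping.single (- E) (\<psi> E)"

lemma psi_section: "E \<in> W \<Longrightarrow> prn E \<Longrightarrow> \<psi> E \<in> GS (- E)"
  by (subst GS_iff) (auto simp: psi_nonzero psi_ord)

lemma relator_carrier: "E \<in> W \<Longrightarrow> prn E \<Longrightarrow> relator E \<in> carrier SR"
  unfolding relator_def diff_conv_add_uminus
  by (intro SR_add_closed SR_one_closed SR_neg_closed SR_single W_neg psi_section)

lemma CI_eq: "CI = genideal SR {relator E | E. E \<in> W \<and> prn E}"
  by (simp add: cox_ideal_def relator_def)

lemma relators_subset: "{relator E | E. E \<in> W \<and> prn E} \<subseteq> carrier SR"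
  using relator_carrier by blast

sublocale CI: ideal CI SR
  unfolding CI_eq by (rule SR.genideal_ideal[OF relators_subset])

lemma relator_CI: "E \<in> W \<Longrightarrow> prn E \<Longrightarrow> relator E \<in> CI"
  unfolding CI_eq using SR.genideal_self[OF relators_subset] by blast

abbreviation coset :: "(weil_divisor \<Rightarrow>\<^sub>0 'k) \<Rightarrow> (weil_divisor \<Rightarrow>\<^sub>0 'k) set" where
  "coset s \<equiv> CI +>\<^bsub>SR\<^esub> s"

section \<open>Points of the spectrum as homomorphisms on the section ring\<close>

abbreviation "CC \<equiv> (ring_of_type_algebra :: complex ring)"

lemma CC [simp]: "carrier CC = UNIV" "x \<otimes>\<^bsub>CC\<^esub> y = x * y" "x \<oplus>\<^bsub>CC\<^esub> y = x + y" "\<one>\<^bsub>CC\<^esub> = 1" "\<zero>\<^bsub>CC\<^esub> = 0"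
  by (simp_all add: ring_of_type_algebra_def)

abbreviation "Spec \<equiv> analytic_spec CR (cox_scalar \<iota> V W \<psi>)"

lemma coset_hom: "coset \<in> ring_hom SR CR"
  unfolding cox_ring_def by (rule CI.rcos_ring_hom)

lemma coset_carrier: "s \<in> carrier SR \<Longrightarrow> coset s \<in> carrier CR"
  using ring_hom_closed[OF coset_hom] .

lemma CR_carrier: "M \<in> carrier CR \<Longrightarrow> \<exists>s\<in>carrier SR. M = coset s"
  by (auto simp: cox_ring_def FactRing_def A_RCOSETS_def' )

context
  fixes \<phi> assumes phi: "\<phi> \<in> Spec"
begin

lemma phi_hom: "(\<phi> \<circ> coset) \<in> ring_hom SR CC"
  by (rule ring_hom_trans[OF coset_hom]) (use phi in \<open>simp add: analytic_spec_def\<close>)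

lemma phi_add: "s \<in> carrier SR \<Longrightarrow> s' \<in> carrier SR \<Longrightarrow> \<phi> (coset (s + s')) = \<phi> (coset s) + \<phi> (coset s')"
  using ring_hom_add[OF phi_hom, of s s'] by simp

lemma phi_mult: "s \<in> carrier SR \<Longrightarrow> s' \<in> carrier SR \<Longrightarrow> \<phi> (coset (s * s')) = \<phi> (coset s) * \<phi> (coset s')"
  using ring_hom_mult[OF phi_hom, of s s'] by simp

lemma phi_one: "\<phi> (coset 1) = 1"
  using ring_hom_one[OF phi_hom] by simp

lemma phi_zero: "\<phi> (coset 0) = 0"
  using phi_add[OF SR_0 SR_0] by simp

lemma phi_const: "\<phi> (coset (Poly_Mapping.single 0 (\<iota> c))) = c"
  using phi by (simp add: analytic_spec_def cox_scalar_def)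

lemma phi_ideal:
  assumes "s \<in> CI" shows "\<phi> (coset s) = 0"
proof -
  have "coset s = CI" using CI.a_rcos_const[OF assms] .
  moreover have "coset 0 = CI" using CI.a_rcos_const[of 0] CI.zero_closed by simp
  ultimately show ?thesis using phi_zero by simp
qed

lemma phi_sum: "(\<And>i. i \<in> A \<Longrightarrow> s i \<in> carrier SR) \<Longrightarrow> \<phi> (coset (\<Sum>i\<in>A. s i)) = (\<Sum>i\<in>A. \<phi> (coset (s i)))"
  by (induction A rule: infinite_finite_induct) (auto simp: phi_zero phi_add SR_sum)

end

lemma Spec_eqI:
  assumes "\<phi> \<in> Spec" "\<phi>' \<in> Spec" "\<And>s. s \<in> carrier SR \<Longrightarrow> \<phi> (coset s) = \<phi>' (coset s)"
  shows "\<phi> = \<phi>'"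
proof (rule extensionalityI)
  show "\<phi> \<in> extensional (carrier CR)" "\<phi>' \<in> extensional (carrier CR)" using assms(1,2) by (auto simp: analytic_spec_def)
  fix M assume "M \<in> carrier CR"
  then show "\<phi> M = \<phi>' M" using CR_carrier assms(3) by blast
qed

definition rep :: "(weil_divisor \<Rightarrow>\<^sub>0 'k) set \<Rightarrow> weil_divisor \<Rightarrow>\<^sub>0 'k" where
  "rep M = (SOME s. s \<in> carrier SR \<and> M = coset s)"

lemma rep: "M \<in> carrier CR \<Longrightarrow> rep M \<in> carrier SR \<and> M = coset (rep M)"
  unfolding rep_def by (rule someI_ex) (use CR_carrier in blast)

lemma coset_eqD:
  assumes "s \<in> carrier SR" "s' \<in> carrier SR" "coset s = coset s'"
  shows "\<exists>i\<in>CI. s = i + s'"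
proof -
  have "s \<in> coset s'" using CI.a_rcos_self[OF assms(1)] assms(3) by simp
  then show ?thesis by (auto simp: a_r_coset_def')
qed

text \<open>The universal property of the quotient, with the induced map written through
  \<open>rep\<close> because that is the form in which \<open>H\<close> is defined.\<close>

lemma induced_point:
  assumes chi: "\<theta> \<in> ring_hom SR CC" and I: "\<And>i. i \<in> CI \<Longrightarrow> \<theta> i = 0"
    and const: "\<And>c. \<theta> (Poly_Mapping.single 0 (\<iota> c)) = c"
  defines "\<phi> \<equiv> (\<lambda>M. if M \<in> carrier CR then \<theta> (rep M) else undefined)"
  shows "\<phi> \<in> Spec" and "\<And>s. s \<in> carrier SR \<Longrightarrow> \<phi> (coset s) = \<theta> s"
proof -
  have CIc: "i \<in> carrier SR" if "i \<in> CI" for i using CI.a_subset that by blast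
  show val: "\<phi> (coset s) = \<theta> s" if s: "s \<in> carrier SR" for s
  proof -
    have c: "coset s \<in> carrier CR" by (rule coset_carrier[OF s])
    obtain i where i: "i \<in> CI" "rep (coset s) = i + s" using coset_eqD rep[OF c] s by metis
    have "\<theta> (i + s) = \<theta> i + \<theta> s" using ring_hom_add[OF chi CIc[OF i(1)] s] by simp
    then show ?thesis unfolding \<phi>_def using c i I by simp
  qed
  have "\<phi> \<in> ring_hom CR CC"
  proof (rule ring_hom_memI)
    fix M N assume MN: "M \<in> carrier CR" "N \<in> carrier CR"
    obtain s where s: "s \<in> carrier SR" "M = coset s" using CR_carrier[OF MN(1)] by blast
    obtain s' where s': "s' \<in> carrier SR" "N = coset s'" using CR_carrier[OF MN(2)] by blast
    have "M \<otimes>\<^bsub>CR\<^esub> N = coset (s * s')" using ring_hom_mult[OF coset_hom s(1) s'(1)] s s' by simp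
    then show "\<phi> (M \<otimes>\<^bsub>CR\<^esub> N) = \<phi> M \<otimes>\<^bsub>CC\<^esub> \<phi> N"
      using ring_hom_mult[OF chi s(1) s'(1)] s s' by (simp add: val SR_mult_closed)
    have "M \<oplus>\<^bsub>CR\<^esub> N = coset (s + s')" using ring_hom_add[OF coset_hom s(1) s'(1)] s s' by simp
    then show "\<phi> (M \<oplus>\<^bsub>CR\<^esub> N) = \<phi> M \<oplus>\<^bsub>CC\<^esub> \<phi> N"
      using ring_hom_add[OF chi s(1) s'(1)] s s' by (simp add: val SR_add_closed)
  next
    have "\<one>\<^bsub>CR\<^esub> = coset 1" using ring_hom_one[OF coset_hom] by simp
    then show "\<phi> \<one>\<^bsub>CR\<^esub> = \<one>\<^bsub>CC\<^esub>" using val[OF SR_one_closed] ring_hom_one[OF chi] by simp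
  qed simp
  moreover have "\<phi> \<in> extensional (carrier CR)" by (auto simp: \<phi>_def extensional_def)
  moreover have "\<phi> (cox_scalar \<iota> V W \<psi> c) = c" for c
    unfolding cox_scalar_def using val[OF SR_single[OF W_0 GS_const]] const by simp
  ultimately show "\<phi> \<in> Spec" by (simp add: analytic_spec_def)
qed

section \<open>The contraction defined by a weight\<close>

context
  fixes w :: "weil_divisor \<Rightarrow> real"
  assumes w_add: "\<And>D E. w (D + E) = w D + w E"
    and w_prin: "\<And>D. prn D \<Longrightarrow> w D = 0"
    and w_sec: "\<And>D f. D \<in> W \<Longrightarrow> f \<in> GS D \<Longrightarrow> f \<noteq> 0 \<Longrightarrow> 0 \<le> w D \<and> (w D = 0 \<longrightarrow> prn D)"
begin

lemma w_0: "w 0 = 0" using w_add[of 0 0] by simp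

text \<open>\<open>t\<close> to the power \<open>w D\<close>; the case distinction is needed because of \<open>0 powr 0 = 0\<close>.\<close>

definition tau :: "real \<Rightarrow> weil_divisor \<Rightarrow> complex" where
  "tau t D = (if w D = 0 then 1 else of_real (t powr w D))"

text \<open>The sign conditions exclude opposite nonzero weights, where the left side is 1 but the
  right side is 0 at \<open>t = 0\<close>.\<close>

lemma tau_add: "0 \<le> w D \<Longrightarrow> 0 \<le> w E \<Longrightarrow> tau t (D + E) = tau t D * tau t E"
  by (auto simp: tau_def w_add powr_add simp flip: of_real_mult)

lemma tau_1: "tau 1 D = 1"
  by (simp add: tau_def)

text \<open>The scaled point before passage to the quotient, on the section ring, where the
  decomposition into components is unique.\<close>

definition chi :: "real \<Rightarrow> ((weil_divisor \<Rightarrow>\<^sub>0 'k) set \<Rightarrow> complex) \<Rightarrow> (weil_divisor \<Rightarrow>\<^sub>0 'k) \<Rightarrow> complex" where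
  "chi t \<phi> s = (\<Sum>D\<in>Poly_Mapping.keys s. tau t D * \<phi> (coset (Poly_Mapping.single D (Poly_Mapping.lookup s D))))"

lemma chi_superset:
  assumes "\<phi> \<in> Spec" "finite A" "Poly_Mapping.keys s \<subseteq> A"
  shows "chi t \<phi> s = (\<Sum>D\<in>A. tau t D * \<phi> (coset (Poly_Mapping.single D (Poly_Mapping.lookup s D))))"
  unfolding chi_def using assms by (intro sum.mono_neutral_left) (auto simp: in_keys_iff phi_zero)

lemma chi_add:
  assumes phi: "\<phi> \<in> Spec" and s: "s \<in> carrier SR" "s' \<in> carrier SR"
  shows "chi t \<phi> (s + s') = chi t \<phi> s + chi t \<phi> s'"
proof -
  let ?A = "Poly_Mapping.keys s \<union> Poly_Mapping.keys s'"
  have sub: "Poly_Mapping.keys (s + s') \<subseteq> ?A" by (rule Poly_Mapping.keys_add)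
  have "\<phi> (coset (Poly_Mapping.single D (Poly_Mapping.lookup s D + Poly_Mapping.lookup s' D)))
     = \<phi> (coset (Poly_Mapping.single D (Poly_Mapping.lookup s D))) + \<phi> (coset (Poly_Mapping.single D (Poly_Mapping.lookup s' D)))"
    if "D \<in> ?A" for D
    unfolding single_add using s that by (intro phi_add phi SR_single) (auto simp: carrier_SR)
  then show ?thesis
    using chi_superset[OF phi _ sub, of t] chi_superset[OF phi, of ?A s t] chi_superset[OF phi, of ?A s' t]
    by (simp add: lookup_add distrib_left sum.distrib)
qed

lemma chi_sum:
  assumes "\<phi> \<in> Spec" shows "(\<And>i. i \<in> A \<Longrightarrow> s i \<in> carrier SR) \<Longrightarrow> chi t \<phi> (\<Sum>i\<in>A. s i) = (\<Sum>i\<in>A. chi t \<phi> (s i))"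
  by (induction A rule: infinite_finite_induct) (auto simp: chi_add[OF assms] SR_sum, auto simp: chi_def)

lemma chi_single: "\<phi> \<in> Spec \<Longrightarrow> chi t \<phi> (Poly_Mapping.single D f) = tau t D * \<phi> (coset (Poly_Mapping.single D f))"
  by (subst chi_superset[of _ "{D}"]) auto

text \<open>On products of single components multiplicativity is that of \<open>tau\<close>; the
  components that occur are nonzero sections, so their weights are nonnegative.\<close>

lemma chi_mult:
  assumes phi: "\<phi> \<in> Spec" and s: "s \<in> carrier SR" "s' \<in> carrier SR"
  shows "chi t \<phi> (s * s') = chi t \<phi> s * chi t \<phi> s'"
proof -
  let ?f = "\<lambda>D. Poly_Mapping.lookup s D" and ?g = "\<lambda>D. Poly_Mapping.lookup s' D"
  have car: "Poly_Mapping.single (D + E) (?f D * ?g E) \<in> carrier SR"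
    if "D \<in> Poly_Mapping.keys s" "E \<in> Poly_Mapping.keys s'" for D E
    using SR_lookup[OF s(1) that(1)] SR_lookup[OF s(2) that(2)] by (intro SR_single W_add GS_mult) auto
  have "chi t \<phi> (s * s') = (\<Sum>D\<in>Poly_Mapping.keys s. \<Sum>E\<in>Poly_Mapping.keys s'. chi t \<phi> (Poly_Mapping.single (D + E) (?f D * ?g E)))"
    unfolding mult_expand using car by (simp add: chi_sum[OF phi] SR_sum)
  also have "\<dots> = (\<Sum>D\<in>Poly_Mapping.keys s. \<Sum>E\<in>Poly_Mapping.keys s'.
      (tau t D * \<phi> (coset (Poly_Mapping.single D (?f D)))) * (tau t E * \<phi> (coset (Poly_Mapping.single E (?g E)))))"
  proof (intro sum.cong refl)
    fix D E assume D: "D \<in> Poly_Mapping.keys s" and E: "E \<in> Poly_Mapping.keys s'"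
    note Df = SR_lookup[OF s(1) D] and Eg = SR_lookup[OF s(2) E]
    have "0 \<le> w D" "0 \<le> w E" using w_sec Df Eg by blast+
    then have "tau t (D + E) = tau t D * tau t E" by (rule tau_add)
    moreover have "\<phi> (coset (Poly_Mapping.single D (?f D) * Poly_Mapping.single E (?g E)))
       = \<phi> (coset (Poly_Mapping.single D (?f D))) * \<phi> (coset (Poly_Mapping.single E (?g E)))"
      using Df Eg by (intro phi_mult[OF phi] SR_single) auto
    ultimately show "chi t \<phi> (Poly_Mapping.single (D + E) (?f D * ?g E)) =
      (tau t D * \<phi> (coset (Poly_Mapping.single D (?f D)))) * (tau t E * \<phi> (coset (Poly_Mapping.single E (?g E))))"
      by (simp add: chi_single[OF phi] mult_single)
  qed
  also have "\<dots> = chi t \<phi> s * chi t \<phi> s'" by (simp add: chi_def sum_product)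
  finally show ?thesis .
qed

lemma chi_const: "\<phi> \<in> Spec \<Longrightarrow> chi t \<phi> (Poly_Mapping.single 0 (\<iota> c)) = c"
  by (simp add: chi_single phi_const tau_def w_0)

lemma chi_hom:
  assumes phi: "\<phi> \<in> Spec" shows "chi t \<phi> \<in> ring_hom SR CC"
proof (rule ring_hom_memI)
  show "chi t \<phi> \<one>\<^bsub>SR\<^esub> = \<one>\<^bsub>CC\<^esub>" using chi_const[OF phi, of t 1] by simp
qed (auto simp: chi_mult[OF phi] chi_add[OF phi])

text \<open>Both terms of a relator have weight 0, so \<open>chi t \<phi>\<close> agrees there with
  \<phi> and vanishes. The kernel is an ideal and thus contains the whole Cox ideal.\<close>

lemma chi_ideal:
  assumes phi: "\<phi> \<in> Spec" and "i \<in> CI" shows "chi t \<phi> i = 0"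
proof -
  interpret K: ring_hom_ring SR CC "chi t \<phi>"
    by (rule ring_hom_ringI2[OF ring_SR _ chi_hom[OF phi]]) (rule ring_from_type_algebra)
  have "{relator E | E. E \<in> W \<and> prn E} \<subseteq> a_kernel SR CC (chi t \<phi>)"
  proof clarify
    fix E assume E: "E \<in> W" "prn E"
    have sg: "Poly_Mapping.single (- E) (\<psi> E) \<in> carrier SR" by (intro SR_single W_neg psi_section E)
    then have sn: "- Poly_Mapping.single (- E) (\<psi> E) \<in> carrier SR" by (rule SR_neg_closed)
    have "w E + w (- E) = 0" using w_add[of E "- E"] w_0 by simp
    then have "tau t (- E) = 1" using w_prin[OF E(2)] by (simp add: tau_def)
    then have "chi t \<phi> (relator E) = \<phi> (coset (relator E))"
      unfolding relator_def diff_conv_add_uminus chi_add[OF phi SR_one_closed sn] phi_add[OF phi SR_one_closed sn]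
      using chi_single[OF phi, of t "- E" "- \<psi> E"] chi_const[OF phi, of t 1] phi_one[OF phi]
      by (simp add: single_uminus)
    then have "chi t \<phi> (relator E) = 0" using phi_ideal[OF phi relator_CI[OF E]] by simp
    with relator_carrier[OF E] show "relator E \<in> a_kernel SR CC (chi t \<phi>)"
      unfolding a_kernel_def' CC(5) by (intro CollectI conjI)
  qed
  with assms(2) have "i \<in> a_kernel SR CC (chi t \<phi>)"
    unfolding CI_eq by (rule subsetD[OF SR.genideal_minimal[OF K.kernel_is_ideal], rotated])
  then show ?thesis unfolding a_kernel_def' CC(5) by (elim CollectE conjE)
qed

definition H :: "real \<Rightarrow> ((weil_divisor \<Rightarrow>\<^sub>0 'k) set \<Rightarrow> complex) \<Rightarrow> (weil_divisor \<Rightarrow>\<^sub>0 'k) set \<Rightarrow> complex" where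
  "H t \<phi> M = (if M \<in> carrier CR then chi t \<phi> (rep M) else undefined)"

lemma
  assumes phi: "\<phi> \<in> Spec"
  shows H_Spec: "H t \<phi> \<in> Spec"
    and H_coset: "s \<in> carrier SR \<Longrightarrow> H t \<phi> (coset s) = chi t \<phi> s"
proof -
  note ip = induced_point[OF chi_hom[OF phi, of t] chi_ideal[OF phi, of _ t] chi_const[OF phi, of t], folded H_def]
  show "H t \<phi> \<in> Spec" by (rule ip(1))
  show "s \<in> carrier SR \<Longrightarrow> H t \<phi> (coset s) = chi t \<phi> s" by (rule ip(2))
qed

lemma H_1: "\<phi> \<in> Spec \<Longrightarrow> H 1 \<phi> = \<phi>"
proof (rule Spec_eqI[OF H_Spec])
  fix s assume phi: "\<phi> \<in> Spec" and s: "s \<in> carrier SR"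
  have "\<phi> (coset s) = \<phi> (coset (\<Sum>D\<in>Poly_Mapping.keys s. Poly_Mapping.single D (Poly_Mapping.lookup s D)))"
    using poly_mapping_sum_single[of s] by simp
  also have "\<dots> = (\<Sum>D\<in>Poly_Mapping.keys s. \<phi> (coset (Poly_Mapping.single D (Poly_Mapping.lookup s D))))"
    using SR_lookup[OF s] by (intro phi_sum[OF phi] SR_single) auto
  also have "\<dots> = chi 1 \<phi> s" by (simp add: chi_def tau_1)
  finally show "H 1 \<phi> (coset s) = \<phi> (coset s)" using H_coset[OF phi s] by simp
qed

text \<open>The product of \<open>f\<close> with the function chosen for \<open>D\<close> has no
  poles and is a constant \<open>c\<close>; modulo the relator, \<open>f\<close> in degree
  \<open>D\<close> is \<open>c\<close> in degree 0, on which every point takes the value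
  \<open>c\<close>.\<close>

lemma phi_principal:
  assumes D: "D \<in> W" "prn D" "f \<in> GS D"
  shows "\<exists>c. \<forall>\<phi>\<in>Spec. \<phi> (coset (Poly_Mapping.single D f)) = c"
proof -
  have "0 \<le> vv Y (f * \<psi> D)" if Y: "Y \<in> PD" "f \<noteq> 0" for Y
    using D Y psi_nonzero[OF D(1,2)] psi_ord[OF D(1,2) Y(1)] by (simp add: vv_mult GS_iff)
  then obtain c where c: "f * \<psi> D = \<iota> c"
    using regular_function_const[of "f * \<psi> D"] by (cases "f = 0") (metis iota_0 mult_zero_left, blast)
  have "\<phi> (coset (Poly_Mapping.single D f)) = c" if phi: "\<phi> \<in> Spec" for \<phi>
  proof -
    have car: "Poly_Mapping.single D f \<in> carrier SR" "Poly_Mapping.single 0 (\<iota> c) \<in> carrier SR"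
      using SR_single D W_0 GS_const by auto
    have rc: "relator D \<in> carrier SR" by (rule relator_carrier[OF D(1,2)])
    have "Poly_Mapping.single D f = Poly_Mapping.single D f * relator D + Poly_Mapping.single 0 (\<iota> c)"
      by (simp add: relator_def right_diff_distrib mult_single c)
    then have "\<phi> (coset (Poly_Mapping.single D f)) = \<phi> (coset (Poly_Mapping.single D f * relator D + Poly_Mapping.single 0 (\<iota> c)))"
      by simp
    also have "\<dots> = \<phi> (coset (Poly_Mapping.single D f)) * \<phi> (coset (relator D)) + c"
      using car rc by (simp add: phi_add[OF phi] SR_mult_closed phi_mult[OF phi] phi_const[OF phi])
    also have "\<dots> = c" using phi_ideal[OF phi relator_CI[OF D(1,2)]] by simp
    finally show ?thesis .
  qed
  then show ?thesis by blast
qed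

lemma H_0: "\<phi> \<in> Spec \<Longrightarrow> \<phi>' \<in> Spec \<Longrightarrow> H 0 \<phi> = H 0 \<phi>'"
proof (rule Spec_eqI[OF H_Spec H_Spec])
  fix s assume phi: "\<phi> \<in> Spec" "\<phi>' \<in> Spec" and s: "s \<in> carrier SR"
  have "tau 0 D * \<phi> (coset (Poly_Mapping.single D (Poly_Mapping.lookup s D))) =
    tau 0 D * \<phi>' (coset (Poly_Mapping.single D (Poly_Mapping.lookup s D)))" if D: "D \<in> Poly_Mapping.keys s" for D
  proof (cases "w D = 0")
    case True
    note l = SR_lookup[OF s D]
    then have "prn D" using w_sec True by blast
    then show ?thesis using phi_principal[of D] l phi by metis
  qed (simp add: tau_def)
  then show "H 0 \<phi> (coset s) = H 0 \<phi>' (coset s)"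
    unfolding H_coset[OF phi(1) s] H_coset[OF phi(2) s] chi_def by (rule sum.cong[OF refl])
qed

text \<open>For a fixed argument, \<open>H\<close> is a finite sum indexed by the components of one
  representative. At \<open>t = 0\<close> the powers are continuous because the nonzero weights that
  occur are positive.\<close>

lemma H_continuous: "continuous_on ({0..1} \<times> Spec) (\<lambda>(t, \<phi>). H t \<phi>)"
proof (rule continuous_on_coordinatewise_then_product)
  fix M :: "(weil_divisor \<Rightarrow>\<^sub>0 'k) set"
  have "continuous_on ({0..1} \<times> Spec) (\<lambda>y. H (fst y) (snd y) M)"
  proof (cases "M \<in> carrier CR")
    case True
    have tau: "continuous_on ({0..1} \<times> Spec) (\<lambda>y. tau (fst y) D)" if D: "D \<in> Poly_Mapping.keys (rep M)" for D
    proof (cases "w D = 0")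
      case False
      have "0 \<le> w D" using w_sec SR_lookup[of "rep M" D] rep[OF True] D by blast
      with False have "0 < w D" by simp
      then have "continuous_on ({0..1} \<times> Spec) (\<lambda>y. fst y powr w D)"
        by (intro continuous_on_powr' continuous_intros) auto
      then show ?thesis using False by (auto simp: tau_def intro!: continuous_intros)
    qed (simp add: tau_def)
    have ev: "continuous_on ({0..1} \<times> Spec) (\<lambda>y. snd y N)" for N :: "(weil_divisor \<Rightarrow>\<^sub>0 'k) set"
      by (rule continuous_on_compose2[OF continuous_on_product_coordinates continuous_on_snd[OF continuous_on_id]]) simp
    show ?thesis using True by (simp add: H_def chi_def) (intro continuous_intros tau ev)
  qed (simp add: H_def)
  then show "continuous_on ({0..1} \<times> Spec) (\<lambda>x. (case x of (t, \<phi>) \<Rightarrow> H t \<phi>) M)"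
    by (simp add: case_prod_unfold)
qed

lemma simply_connected_Spec_weight: "simply_connected Spec"
proof (cases "Spec = {}")
  case True then show ?thesis by simp
next
  case False
  then obtain \<phi>0 where phi0: "\<phi>0 \<in> Spec" by blast
  show ?thesis
    by (rule simply_connected_contraction[OF H_continuous]) (use H_Spec H_1 H_0[OF _ phi0] in auto)
qed

end

theorem simply_connected_Spec: "simply_connected Spec"
  using degree_of_sections
proof (elim exE conjE)
  fix w :: "weil_divisor \<Rightarrow> real"
  assume w: "\<forall>D E. w (D + E) = w D + w E" "\<forall>D. prn D \<longrightarrow> w D = 0"
    "\<forall>D\<in>weil_divisors \<iota> V. \<forall>f\<in>GS D. f \<noteq> 0 \<longrightarrow> 0 \<le> w D \<and> (w D = 0 \<longrightarrow> prn D)"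
  show ?thesis
    by (rule simply_connected_Spec_weight[of w]) (use w W_weil in blast)+
qed

end

theorem corollary1:
  fixes \<iota> :: "complex \<Rightarrow> 'k::field"
    and V :: "'k list"
    and W :: "weil_divisor set"
    and \<psi> :: "weil_divisor \<Rightarrow> 'k"
  assumes "fano_variety \<iota> V"
    and "cox_data \<iota> V W \<psi>"
  shows "simply_connected (analytic_spec (cox_ring \<iota> V W \<psi>) (cox_scalar \<iota> V W \<psi>))"
proof -
  have "projective_variety \<iota> V" "normal_variety \<iota> V" using assms(1) by (auto simp: fano_variety_def)
  moreover from this(1) have "complex_algebra_map \<iota>" by (simp add: projective_variety_def)
  ultimately interpret cox \<iota> V W \<psi> using assms(2) by unfold_locales
  show ?thesis by (rule simply_connected_Spec)
qed

end
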